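(* Let $\sigma>0$, $T>0$, $L>0$, let $f,\gamma_1,\dots,\gamma_q:[0,T]\times\mathbf{R}^n\to\mathbf{R}^n$ be sufficiently smooth deterministic functions, $L$-periodic in each spatial coordinate, with $\operatorname{div}\gamma_r=0$, $r=1,\dots,q$, and let $\varphi:\mathbf{R}^n\to\mathbf{R}^n$ be deterministic and $L$-periodic in each coordinate. Consider the stochastic Navier-Stokes equations with additive noise $$dv(t)=\Big[\tfrac{\sigma^2}{2}\Delta v-(v,\nabla)v-\nabla p+f(t,x)\Big]dt+\sum_{r=1}^q\gamma_r(t,x)\,dw_r(t),\quad \operatorname{div}v=0,\quad 0\le t\le T,\ x\in\mathbf{R}^n,$$ with $v(0,x)=\varphi(x)$ and $v,p$ being $L$-periodic in each spatial coordinate. Assume that this problem has a unique classical solution $v(t,x),p(t,x)$, $(t,x)\in[0,T]\times\mathbf{R}^n$, which has continuous derivatives in $x$ ($v$ up to order four, $p$ up to order three), and that the solution and these derivatives have moments of every order $m\ge2$ bounded uniformly in $(t,x)$. For $N\in\{1,2,\dots\}$ let $h=T/N$, $t_k=kh$, and define the layer method $$\bar v(0,x)=\varphi(x),\qquad \bar v(t_{k+1},x)=P\breve v(t_k,x)+Pf(t_k,x)h+\sum_{r=1}^q\gamma_r(t_k,x)\,\big(w_r(t_{k+1})-w_r(t_k)\big),\quad k=0,\dots,N-1,$$ $$\breve v(t_k,x)=2^{-n}\sum_{j=1}^{2^n}\bar v\big(t_k,\,x-\bar v(t_k,x)h+\sigma\sqrt h\,\xi_j\big),$$ together with the approximate pressure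 $\bar p(t_k,x)$, $k=1,\dots,N$, given by $$\nabla\bar p(t_k,x)=-P^{\bot}\big[(\bar v(t_k,x),\nabla)\bar v(t_k,x)\big]+P^{\bot}f(t_k,x).$$ Assume that $\bar v(t_k,x)$, $k=0,\dots,N$, have continuous first-order spatial derivatives and that $$|\bar v(t_k,x)|\le C_0(\omega),\qquad |\partial\bar v(t_k,x)/\partial x^i|\le C_0(\omega),\quad i=1,\dots,n,$$ and, in addition, that the second-order spatial derivatives satisfy $$|\partial^2\bar v(t_k,x)/\partial x^i\partial x^j|\le C_0(\omega),\quad i,j=1,\dots,n,$$ where $C_0(\omega)>0$ is an a.s. finite constant independent of $x,h,k$. Then for almost every trajectory $w(\cdot)$ and any $0<\varepsilon<1/3$ there exists a constant $C(\omega)>0$, independent of $h$ and $k$, such that $$\|\bar p(t_k,\cdot)-p(t_k,\cdot)\|\le C(\omega)h^{1/3-\varepsilon}.$$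
   Context: $(\Omega,\mathcal{F},P)$ is a probability space, $w(t)=(w_1(t),\dots,w_q(t))^\top$ is a $q$-dimensional standard Wiener process on it, and $\mathcal{F}^w_t$, $0\le t\le T$, is the filtration generated by $w$. The dynamics is understood in the Ito integral sense pointwise in $x$; $v\in\mathbf{R}^n$ is the velocity, $p$ is the scalar pressure, and $(v,p)$ is $\mathcal{F}^w_t$-adapted. Here $(v,\nabla)v=\sum_i v^i\,\partial v/\partial x^i$. "Sufficiently smooth" means continuous together with all partial derivatives in $(t,x)$ up to some sufficiently large finite order. Since the solution is classical with continuous space derivatives and the problem is periodic, $v$, $p$ and these derivatives are a.s. bounded on $[0,T]\times Q$ (a standing convention). $Q=(0,L)^n$, and $\|\cdot\|$ is the $\mathbf{L}^2(Q)$-norm in the space variable (for scalar or vector functions); $|\cdot|$ is the Euclidean length. As an operator on functions, $P$ (not to be confused with the probability measure) is the Leray projection: the orthogonal projection of $Q$-periodic vector fields onto divergence-free ones; $P^{\bot}u=u-Pu$, which is the gradient of a $Q$-periodic scalar function. If $u(x)=\sum_{\mathbf{n}\in\mathbf{Z}^n}u_{\mathbf{n}}e^{i(2\pi/L)(\mathbf{n},x)}$, then $(Pu)_{\mathbf{n}}=u_{\mathbf{n}}-\frac{u_{\mathbf{n}}^\top\mathbf{n}}{|\mathbf{n}|^2}\mathbf{n}$ for $\mathbf{n}\ne\mathbf{0}$ and $(Pu)_{\mathbf{0}}=u_{\mathbf{0}}$. $P$ and $P^{\bot}$ act in the variable $x$. $\xi_1,\dots,\xi_{2^n}$ are the $2^n$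 elements of $\{-1,1\}^n$. Both pressures $p(t,\cdot)$ and $\bar p(t_k,\cdot)$ are $Q$-periodic and normalized to have zero mean over $Q$ (zero Fourier coefficient at $\mathbf{n}=\mathbf{0}$). *)

theory Defs
  imports "HOL-Probability.Probability"
begin

text \<open>Both conditions on increments are needed: the second gives increments with covariance
  \<open>(t - s) * Id\<close>, the first independence over disjoint time intervals.\<close>

definition wiener_process :: "'w measure \<Rightarrow> (real \<Rightarrow> 'w \<Rightarrow> real ^ 'q) \<Rightarrow> bool" where
  "wiener_process M w \<longleftrightarrow>
     (\<forall>t\<ge>0. w t \<in> borel_measurable M) \<and>
     (AE \<omega> in M. w 0 \<omega> = 0) \<and>
     (AE \<omega> in M. continuous_on {0..} (\<lambda>t. w t \<omega>)) \<and>
     (\<forall>m \<tau>. 0 \<le> \<tau> 0 \<and> (\<forall>i<m. \<tau> i \<le> \<tau> (Suc i)) \<longrightarrow>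
        prob_space.indep_vars M (\<lambda>_. borel) (\<lambda>i \<omega>. w (\<tau> (Suc i)) \<omega> - w (\<tau> i) \<omega>) {..<m}) \<and>
     (\<forall>s t. 0 \<le> s \<and> s < t \<longrightarrow>
        prob_space.indep_vars M (\<lambda>_. borel) (\<lambda>r \<omega>. w t \<omega> $ r - w s \<omega> $ r) UNIV \<and>
        (\<forall>r. distributed M lborel (\<lambda>\<omega>. w t \<omega> $ r - w s \<omega> $ r)
               (\<lambda>y. ennreal (normal_density 0 (sqrt (t - s)) y))))"

definition generated_filtration ::
    "'w measure \<Rightarrow> (real \<Rightarrow> 'w \<Rightarrow> 'b::topological_space) \<Rightarrow> real \<Rightarrow> 'w measure" where
  "generated_filtration M w t =
     sigma (space M) (\<Union>s\<in>{0..t}. {w s -` A \<inter> space M | A. A \<in> sets borel})"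

text \<open>An elementary process on \<open>[0, t]\<close> is given by a partition \<open>\<tau> 0 = 0, \<dots>, \<tau> m = t\<close> and
  bounded, \<open>F (\<tau> i)\<close>-measurable coefficients \<open>\<eta> i\<close> on \<open>(\<tau> i, \<tau> (i + 1)]\<close>.\<close>

definition elementary_process ::
    "'w measure \<Rightarrow> (real \<Rightarrow> 'w measure) \<Rightarrow> real \<Rightarrow> nat \<Rightarrow> (nat \<Rightarrow> real) \<Rightarrow>
     (nat \<Rightarrow> 'w \<Rightarrow> 'a::euclidean_space) \<Rightarrow> bool" where
  "elementary_process M F t m \<tau> \<eta> \<longleftrightarrow>
     \<tau> 0 = 0 \<and> \<tau> m = t \<and> (\<forall>i<m. \<tau> i \<le> \<tau> (Suc i)) \<and>
     (\<forall>i<m. \<eta> i \<in> borel_measurable (F (\<tau> i)) \<and> (\<exists>B. \<forall>\<omega>\<in>space M. norm (\<eta> i \<omega>) \<le> B))"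

definition elementary_value ::
    "nat \<Rightarrow> (nat \<Rightarrow> real) \<Rightarrow> (nat \<Rightarrow> 'w \<Rightarrow> 'a::euclidean_space) \<Rightarrow> real \<Rightarrow> 'w \<Rightarrow> 'a" where
  "elementary_value m \<tau> \<eta> s \<omega> = (\<Sum>i<m. indicator {\<tau> i<..\<tau> (Suc i)} s *\<^sub>R \<eta> i \<omega>)"

definition elementary_integral ::
    "(real \<Rightarrow> 'w \<Rightarrow> real) \<Rightarrow> nat \<Rightarrow> (nat \<Rightarrow> real) \<Rightarrow> (nat \<Rightarrow> 'w \<Rightarrow> 'a::euclidean_space) \<Rightarrow> 'w \<Rightarrow> 'a" where
  "elementary_integral W m \<tau> \<eta> \<omega> = (\<Sum>i<m. (W (\<tau> (Suc i)) \<omega> - W (\<tau> i) \<omega>) *\<^sub>R \<eta> i \<omega>)"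

text \<open>\<open>has_ito_integral M F W t X I\<close>: the random variable \<open>I\<close> is a version of the Ito integral of
  \<open>X\<close> with respect to \<open>W\<close> over \<open>[0, t]\<close>, i.e. the mean-square limit of the integrals of elementary
  processes converging to \<open>X\<close> in mean square on \<open>[0, t] \<times> \<Omega>\<close>.\<close>

definition has_ito_integral ::
    "'w measure \<Rightarrow> (real \<Rightarrow> 'w measure) \<Rightarrow> (real \<Rightarrow> 'w \<Rightarrow> real) \<Rightarrow> real \<Rightarrow>
     (real \<Rightarrow> 'w \<Rightarrow> 'a::euclidean_space) \<Rightarrow> ('w \<Rightarrow> 'a) \<Rightarrow> bool" where
  "has_ito_integral M F W t X I \<longleftrightarrow>
     (\<lambda>(s, \<omega>). X s \<omega>) \<in> borel_measurable (restrict_space borel {0..t} \<Otimes>\<^sub>M M) \<and>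
     (\<forall>s\<in>{0..t}. X s \<in> borel_measurable (F s)) \<and>
     I \<in> borel_measurable M \<and>
     (\<exists>m \<tau> \<eta>. (\<forall>j. elementary_process M F t (m j) (\<tau> j) (\<eta> j)) \<and>
        ((\<lambda>j::nat. \<integral>\<^sup>+ \<omega>. (\<integral>\<^sup>+ s\<in>{0..t}.
             ennreal ((norm (X s \<omega> - elementary_value (m j) (\<tau> j) (\<eta> j) s \<omega>))\<^sup>2) \<partial>lborel) \<partial>M)
           \<longlonglongrightarrow> 0) \<and>
        ((\<lambda>j. \<integral>\<^sup>+ \<omega>. ennreal ((norm (I \<omega> - elementary_integral W (m j) (\<tau> j) (\<eta> j) \<omega>))\<^sup>2) \<partial>M)
           \<longlonglongrightarrow> 0))"

definition has_partial :: "'n::finite \<Rightarrow> (real ^ 'n \<Rightarrow> 'b::real_normed_vector) \<Rightarrow> real ^ 'n \<Rightarrow> bool" where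
  "has_partial i u x \<longleftrightarrow> (\<lambda>s::real. u (x + s *\<^sub>R axis i 1)) differentiable (at 0)"

definition partial_deriv ::
    "'n::finite \<Rightarrow> (real ^ 'n \<Rightarrow> 'b::real_normed_vector) \<Rightarrow> real ^ 'n \<Rightarrow> 'b" where
  "partial_deriv i u x = vector_derivative (\<lambda>s::real. u (x + s *\<^sub>R axis i 1)) (at 0)"

definition partials ::
    "'n::finite list \<Rightarrow> (real ^ 'n \<Rightarrow> 'b::real_normed_vector) \<Rightarrow> real ^ 'n \<Rightarrow> 'b" where
  "partials ds u = foldr partial_deriv ds u"

definition C1_field :: "(real ^ 'n::finite \<Rightarrow> 'b::real_normed_vector) \<Rightarrow> bool" where
  "C1_field u \<longleftrightarrow> continuous_on UNIV u \<and>
     (\<forall>i. (\<forall>x. has_partial i u x) \<and> continuous_on UNIV (partial_deriv i u))"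

text \<open>All space derivatives up to order \<open>k\<close> exist and are jointly continuous in
  \<open>(t, x) \<in> [0, T] \<times> \<real>\<^sup>n\<close>; nothing is required of time derivatives.\<close>

definition space_smooth ::
    "nat \<Rightarrow> real \<Rightarrow> (real \<Rightarrow> real ^ 'n::finite \<Rightarrow> 'b::real_normed_vector) \<Rightarrow> bool" where
  "space_smooth k T u \<longleftrightarrow>
     (\<forall>ds. length ds \<le> k \<longrightarrow> continuous_on ({0..T} \<times> UNIV) (\<lambda>(t, x). partials ds (u t) x)) \<and>
     (\<forall>ds. length ds < k \<longrightarrow> (\<forall>t\<in>{0..T}. \<forall>x i. has_partial i (partials ds (u t)) x))"

text \<open>Mixed derivatives on \<open>[0, T] \<times> \<real>\<^sup>n\<close>: \<open>None\<close> stands for the time variable (one-sided derivative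
  at the end points), \<open>Some i\<close> for the \<open>i\<close>-th space variable.\<close>

fun spacetime_partials ::
    "real \<Rightarrow> 'n::finite option list \<Rightarrow> (real \<Rightarrow> real ^ 'n \<Rightarrow> 'b::real_normed_vector) \<Rightarrow>
     real \<Rightarrow> real ^ 'n \<Rightarrow> 'b" where
  "spacetime_partials T [] u = u"
| "spacetime_partials T (None # ds) u =
     (\<lambda>t x. vector_derivative (\<lambda>s. spacetime_partials T ds u s x) (at t within {0..T}))"
| "spacetime_partials T (Some i # ds) u = (\<lambda>t x. partial_deriv i (spacetime_partials T ds u t) x)"

definition spacetime_smooth ::
    "nat \<Rightarrow> real \<Rightarrow> (real \<Rightarrow> real ^ 'n::finite \<Rightarrow> 'b::real_normed_vector) \<Rightarrow> bool" where
  "spacetime_smooth k T u \<longleftrightarrow>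
     (\<forall>ds. length ds \<le> k \<longrightarrow>
        continuous_on ({0..T} \<times> UNIV) (\<lambda>(t, x). spacetime_partials T ds u t x)) \<and>
     (\<forall>ds. length ds < k \<longrightarrow> (\<forall>t\<in>{0..T}. \<forall>x.
        (\<lambda>s. spacetime_partials T ds u s x) differentiable (at t within {0..T}) \<and>
        (\<forall>i. has_partial i (spacetime_partials T ds u t) x)))"

definition gradient :: "(real ^ 'n::finite \<Rightarrow> real) \<Rightarrow> real ^ 'n \<Rightarrow> real ^ 'n" where
  "gradient p x = (\<chi> i. partial_deriv i p x)"

definition divergence :: "(real ^ 'n::finite \<Rightarrow> real ^ 'n) \<Rightarrow> real ^ 'n \<Rightarrow> real" where
  "divergence u x = (\<Sum>i\<in>UNIV. partial_deriv i u x $ i)"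

definition laplacian :: "(real ^ 'n::finite \<Rightarrow> real ^ 'n) \<Rightarrow> real ^ 'n \<Rightarrow> real ^ 'n" where
  "laplacian u x = (\<Sum>i\<in>UNIV. partials [i, i] u x)"

definition advection ::
    "(real ^ 'n::finite \<Rightarrow> real ^ 'n) \<Rightarrow> (real ^ 'n \<Rightarrow> real ^ 'n) \<Rightarrow> real ^ 'n \<Rightarrow> real ^ 'n" where
  "advection v u x = (\<Sum>i\<in>UNIV. (v x $ i) *\<^sub>R partial_deriv i u x)"

definition periodic :: "real \<Rightarrow> (real ^ 'n::finite \<Rightarrow> 'b) \<Rightarrow> bool" where
  "periodic L u \<longleftrightarrow> (\<forall>x i. u (x + L *\<^sub>R axis i 1) = u x)"

definition cell :: "real \<Rightarrow> (real ^ 'n::finite) set" where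
  "cell L = {x. \<forall>i. 0 < x $ i \<and> x $ i < L}"

definition L2_cell_norm :: "real \<Rightarrow> (real ^ 'n::finite \<Rightarrow> 'b::euclidean_space) \<Rightarrow> real" where
  "L2_cell_norm L u = sqrt (LINT x:cell L|lborel. (norm (u x))\<^sup>2)"

definition zero_mean :: "real \<Rightarrow> (real ^ 'n::finite \<Rightarrow> real) \<Rightarrow> bool" where
  "zero_mean L p \<longleftrightarrow> (LINT x:cell L|lborel. p x) = 0"

definition L2_periodic :: "real \<Rightarrow> (real ^ 'n::finite \<Rightarrow> real ^ 'n) \<Rightarrow> bool" where
  "L2_periodic L u \<longleftrightarrow> u \<in> borel_measurable borel \<and> periodic L u \<and>
     set_integrable lborel (cell L) (\<lambda>x. (norm (u x))\<^sup>2)"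

text \<open>For square integrable fields the divergence is meant in the distributional sense on the torus.\<close>

definition L2_divergence_free :: "real \<Rightarrow> (real ^ 'n::finite \<Rightarrow> real ^ 'n) \<Rightarrow> bool" where
  "L2_divergence_free L u \<longleftrightarrow> L2_periodic L u \<and>
     (\<forall>\<psi>. C1_field \<psi> \<and> periodic L \<psi> \<longrightarrow> (LINT x:cell L|lborel. u x \<bullet> gradient \<psi> x) = 0)"

text \<open>The orthogonal projection \<open>P\<close> onto the divergence-free fields lives on \<open>L\<^sup>2\<close> classes, so it is
  a relation on functions: \<open>leray_projection L u Pu\<close> says that \<open>Pu\<close> is a representative of the
  projection of \<open>u\<close>.  Which representative occurs in an equation such as \<open>v = P u\<close> is determined
  by the regularity demanded of \<open>v\<close>.\<close>

definition leray_projection ::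
    "real \<Rightarrow> (real ^ 'n::finite \<Rightarrow> real ^ 'n) \<Rightarrow> (real ^ 'n \<Rightarrow> real ^ 'n) \<Rightarrow> bool" where
  "leray_projection L u Pu \<longleftrightarrow> L2_periodic L u \<and> L2_divergence_free L Pu \<and>
     (\<forall>z. L2_divergence_free L z \<longrightarrow> (LINT x:cell L|lborel. (u x - Pu x) \<bullet> z x) = 0)"

definition leray_complement ::
    "real \<Rightarrow> (real ^ 'n::finite \<Rightarrow> real ^ 'n) \<Rightarrow> (real ^ 'n \<Rightarrow> real ^ 'n) \<Rightarrow> bool" where
  "leray_complement L u Ru \<longleftrightarrow> (\<exists>Pu. leray_projection L u Pu \<and> Ru = (\<lambda>x. u x - Pu x))"

text \<open>Classical solutions with additive noise.  The Ito equation is imposed for each \<open>(t, x)\<close>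
  almost surely; joint continuity in \<open>(t, x)\<close> is part of being classical, so the exceptional null
  sets can be chosen independent of \<open>(t, x)\<close> and \<open>v\<close>, \<open>p\<close> and their space derivatives are almost
  surely bounded.\<close>

definition snse_classical_solution ::
    "'w measure \<Rightarrow> (real \<Rightarrow> 'w \<Rightarrow> real ^ 'q) \<Rightarrow> real \<Rightarrow> real \<Rightarrow> real \<Rightarrow>
     (real \<Rightarrow> real ^ 'n::finite \<Rightarrow> real ^ 'n) \<Rightarrow> ('q::finite \<Rightarrow> real \<Rightarrow> real ^ 'n \<Rightarrow> real ^ 'n) \<Rightarrow>
     (real ^ 'n \<Rightarrow> real ^ 'n) \<Rightarrow>
     (real \<Rightarrow> real ^ 'n \<Rightarrow> 'w \<Rightarrow> real ^ 'n) \<Rightarrow> (real \<Rightarrow> real ^ 'n \<Rightarrow> 'w \<Rightarrow> real) \<Rightarrow> bool" where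
  "snse_classical_solution M w \<sigma> T L f \<gamma> \<phi> v p \<longleftrightarrow>
     (\<forall>t\<in>{0..T}. \<forall>x. v t x \<in> borel_measurable (generated_filtration M w t) \<and>
                     p t x \<in> borel_measurable (generated_filtration M w t)) \<and>
     (AE \<omega> in M. space_smooth 2 T (\<lambda>t x. v t x \<omega>) \<and> space_smooth 1 T (\<lambda>t x. p t x \<omega>)) \<and>
     (AE \<omega> in M. \<forall>t\<in>{0..T}. periodic L (\<lambda>x. v t x \<omega>) \<and>
                            periodic L (\<lambda>x. p t x \<omega>) \<and> zero_mean L (\<lambda>x. p t x \<omega>)) \<and>
     (AE \<omega> in M. \<forall>t\<in>{0..T}. \<forall>x. divergence (\<lambda>y. v t y \<omega>) x = 0) \<and>
     (AE \<omega> in M. \<forall>x. v 0 x \<omega> = \<phi> x) \<and>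
     (\<forall>x. \<forall>t\<in>{0..T}. \<exists>J.
        (\<forall>r. has_ito_integral M (generated_filtration M w) (\<lambda>s \<omega>. w s \<omega> $ r) t
               (\<lambda>s \<omega>. \<gamma> r s x) (J r)) \<and>
        (AE \<omega> in M. v t x \<omega> = \<phi> x
           + integral {0..t} (\<lambda>s. (\<sigma>\<^sup>2 / 2) *\<^sub>R laplacian (\<lambda>y. v s y \<omega>) x
                                   - advection (\<lambda>y. v s y \<omega>) (\<lambda>y. v s y \<omega>) x
                                   - gradient (\<lambda>y. p s y \<omega>) x + f s x)
           + (\<Sum>r\<in>UNIV. J r \<omega>)))"

definition snse_unique ::
    "'w measure \<Rightarrow> (real \<Rightarrow> 'w \<Rightarrow> real ^ 'q) \<Rightarrow> real \<Rightarrow> real \<Rightarrow> real \<Rightarrow>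
     (real \<Rightarrow> real ^ 'n::finite \<Rightarrow> real ^ 'n) \<Rightarrow> ('q::finite \<Rightarrow> real \<Rightarrow> real ^ 'n \<Rightarrow> real ^ 'n) \<Rightarrow>
     (real ^ 'n \<Rightarrow> real ^ 'n) \<Rightarrow>
     (real \<Rightarrow> real ^ 'n \<Rightarrow> 'w \<Rightarrow> real ^ 'n) \<Rightarrow> (real \<Rightarrow> real ^ 'n \<Rightarrow> 'w \<Rightarrow> real) \<Rightarrow> bool" where
  "snse_unique M w \<sigma> T L f \<gamma> \<phi> v p \<longleftrightarrow>
     (\<forall>v' p'. snse_classical_solution M w \<sigma> T L f \<gamma> \<phi> v' p' \<longrightarrow>
        (AE \<omega> in M. \<forall>t\<in>{0..T}. \<forall>x. v' t x \<omega> = v t x \<omega> \<and> p' t x \<omega> = p t x \<omega>))"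

text \<open>Upper bound for the \<open>m\<close>-th moments of the space derivatives up to order \<open>k\<close>.  The nonnegative
  integral is insensitive to null sets on which the derivatives fail to exist.\<close>

definition bounded_moments ::
    "'w measure \<Rightarrow> real \<Rightarrow> nat \<Rightarrow> (real \<Rightarrow> real ^ 'n::finite \<Rightarrow> 'w \<Rightarrow> 'b::real_normed_vector) \<Rightarrow> bool" where
  "bounded_moments M T k u \<longleftrightarrow> (\<forall>m\<ge>2. \<exists>K::real. \<forall>ds. length ds \<le> k \<longrightarrow> (\<forall>t\<in>{0..T}. \<forall>x.
     (\<integral>\<^sup>+ \<omega>. ennreal (norm (partials ds (\<lambda>y. u t y \<omega>) x) ^ (m::nat)) \<partial>M) \<le> ennreal K))"

definition sign_vectors :: "(real ^ 'n::finite) set" where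
  "sign_vectors = {\<xi>. \<forall>i. \<xi> $ i \<in> {-1, 1}}"

definition layer_average ::
    "real \<Rightarrow> real \<Rightarrow> (real ^ 'n::finite \<Rightarrow> real ^ 'n) \<Rightarrow> real ^ 'n \<Rightarrow> real ^ 'n" where
  "layer_average \<sigma> h V x =
     (1 / 2 ^ CARD('n)) *\<^sub>R (\<Sum>\<xi>\<in>sign_vectors. V (x - h *\<^sub>R V x + (\<sigma> * sqrt h) *\<^sub>R \<xi>))"

text \<open>Pathwise scheme with \<open>N\<close> steps of size \<open>h\<close> along the trajectory \<open>W\<close>; \<open>V k\<close> is the velocity at
  time \<open>k * h\<close>.\<close>

definition layer_method ::
    "real \<Rightarrow> real \<Rightarrow> (real \<Rightarrow> real ^ 'n::finite \<Rightarrow> real ^ 'n) \<Rightarrow>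
     ('q::finite \<Rightarrow> real \<Rightarrow> real ^ 'n \<Rightarrow> real ^ 'n) \<Rightarrow> (real ^ 'n \<Rightarrow> real ^ 'n) \<Rightarrow>
     (real \<Rightarrow> real ^ 'q) \<Rightarrow> nat \<Rightarrow> real \<Rightarrow> (nat \<Rightarrow> real ^ 'n \<Rightarrow> real ^ 'n) \<Rightarrow> bool" where
  "layer_method \<sigma> L f \<gamma> \<phi> W N h V \<longleftrightarrow>
     V 0 = \<phi> \<and>
     (\<forall>k<N. \<exists>Pv Pf.
        leray_projection L (layer_average \<sigma> h (V k)) Pv \<and>
        leray_projection L (f (real k * h)) Pf \<and>
        (\<forall>x. V (Suc k) x = Pv x + h *\<^sub>R Pf x +
           (\<Sum>r\<in>UNIV. (W (real (Suc k) * h) $ r - W (real k * h) $ r) *\<^sub>R \<gamma> r (real k * h) x)))"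

definition layer_pressure ::
    "real \<Rightarrow> (real ^ 'n::finite \<Rightarrow> real ^ 'n) \<Rightarrow> (real ^ 'n \<Rightarrow> real ^ 'n) \<Rightarrow> (real ^ 'n \<Rightarrow> real) \<Rightarrow> bool" where
  "layer_pressure L F V p \<longleftrightarrow>
     (\<forall>x. p differentiable (at x)) \<and> periodic L p \<and> zero_mean L p \<and>
     (\<exists>Ra Rf. leray_complement L (advection V V) Ra \<and> leray_complement L F Rf \<and>
        (\<forall>x. gradient p x = - Ra x + Rf x))"

definition layer_bounds :: "real \<Rightarrow> (real ^ 'n::finite \<Rightarrow> real ^ 'n) \<Rightarrow> bool" where
  "layer_bounds C V \<longleftrightarrow>
     C1_field V \<and>
     (\<forall>x. norm (V x) \<le> C) \<and>
     (\<forall>x i. norm (partial_deriv i V x) \<le> C) \<and>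
     (\<forall>x i j. has_partial j (partial_deriv i V) x \<and> norm (partials [j, i] V x) \<le> C)"

end

theory Submission
  imports Defs
begin

text \<open>The randomness is first reduced to two properties of a trajectory.  The Ito integral of a deterministic
  field \<open>\<gamma>\<close> that is smooth in time agrees almost surely with the pathwise expression
  \<open>w t *\<^sub>R \<gamma> t - integral {0..t} (\<lambda>s. w s *\<^sub>R \<gamma>' s)\<close> (\<open>wiener_integral_by_parts\<close>), so outside one null set the
  equation holds for all \<open>(t, x)\<close> at once (\<open>snse_integrated_equation\<close>); and almost every trajectory of \<open>w\<close>
  is Hoelder continuous with exponent \<open>1/3\<close> (\<open>wiener_hoelder\<close>).  From there on a single trajectory is
  fixed, and all constants may depend on it.

  For the velocity, let \<open>e\<close> and \<open>d\<close> be the errors before and after a step of length \<open>h\<close>, and let \<open>D\<close> be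
  the error after the step before anything is projected, the time integral of the pressure gradient being
  added to the exact velocity.  Since \<open>d\<close> is divergence-free, it is orthogonal to gradients and to everything the projection
  removes; pairing with \<open>d\<close> gives \<open>\<parallel>d\<parallel> \<le> \<parallel>D\<parallel>\<close>.  A Taylor expansion shows that the average over the sign
  vectors reproduces \<open>\<sigma>\<^sup>2/2 \<Delta>v - (v,\<nabla>)v\<close>, so that one step
  started from the exact velocity has an error of order \<open>h * h powr (1/3)\<close> (\<open>local_error\<close>).  Up to a
  remainder of size \<open>h (|e| + h)\<close>, the old error enters \<open>D\<close> through an average of terms
  \<open>e(y) - h (V,\<nabla>)e(y)\<close> with shifted points \<open>y\<close>.  The square of the norm of this average is at most \<open>\<parallel>e\<parallel>\<^sup>2\<close>
  up to a term of order \<open>h\<^sup>2\<close>, because the cross term is half the pairing of the divergence-free \<open>V\<close> with the gradient of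
  \<open>|e|\<^sup>2\<close> (\<open>transport_energy\<close>).  Gronwall's argument then gives \<open>\<parallel>V - v\<parallel> \<le> C h powr (1/3)\<close>
  (\<open>velocity_step\<close>, \<open>velocity_error\<close>).

  For the pressure, the difference \<open>q\<close> of the two pressures has zero mean and solves a Poisson equation
  whose right-hand side consists of second derivatives of \<open>v\<^sub>i v\<^sub>j - V\<^sub>i V\<^sub>j\<close>.  In the dual formulation both
  derivatives fall on a test function \<open>\<psi>\<close>, and \<open>\<parallel>D\<^sup>2\<psi>\<parallel> = \<parallel>\<Delta>\<psi>\<parallel>\<close> on the torus
  (\<open>hessian_eq_laplacian_L2\<close>).  As the Laplacians of trigonometric polynomials are dense among the functions
  of zero mean (\<open>trig_poly_poisson\<close>, \<open>trig_poly_dense\<close>), this bounds \<open>\<parallel>q\<parallel>\<close> by \<open>\<parallel>V - v\<parallel>\<close> times a constant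
  (\<open>L2_bound_by_duality\<close>, \<open>pressure_error\<close>): no order is lost in passing from velocity to pressure.  That
  the exact pressure satisfies its weak equation follows since the increments of the velocity, the noise
  and the Laplacian are divergence-free (\<open>exact_pressure_weak\<close>).

  Three derivatives of the data are enough for this, and the rate \<open>1/3\<close> implies the rate
  \<open>1/3 - \<epsilon>\<close> because \<open>h \<le> T\<close>.\<close>

section \<open>Integration over a period cell\<close>

lemma sum_axis_expansion: "(\<Sum>i\<in>UNIV. (c $ i) *\<^sub>R axis i 1) = (c :: real ^ 'n::finite)"
  by (simp add: vec_eq_iff axis_def if_distrib cong: if_cong)

lemma periodic_shift_int:
  assumes "periodic L u"
  shows "u (x + (real_of_int m * L) *\<^sub>R axis i 1) = u x"
proof -
  have nat: "u (y + (real k * L) *\<^sub>R axis i 1) = u y" for k y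
  proof (induction k)
    case (Suc k)
    have "y + (real (Suc k) * L) *\<^sub>R axis i 1 = (y + (real k * L) *\<^sub>R axis i 1) + L *\<^sub>R axis i 1"
      by (simp add: algebra_simps)
    then show ?case using assms Suc by (metis periodic_def)
  qed simp
  show ?thesis
  proof (cases "0 \<le> m")
    case True
    then show ?thesis using nat[of x "nat m"] by simp
  next
    case False
    have "u ((x + (real_of_int m * L) *\<^sub>R axis i 1) + (real (nat (-m)) * L) *\<^sub>R axis i 1)
        = u (x + (real_of_int m * L) *\<^sub>R axis i 1)" by (rule nat)
    then show ?thesis using False by (simp add: algebra_simps)
  qed
qed

lemma periodic_translate: "periodic L u \<Longrightarrow> periodic L (\<lambda>x. u (x + c))"
  unfolding periodic_def by (metis (no_types, lifting) add.assoc add.commute)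

lemma periodic_compose: "periodic L u \<Longrightarrow> periodic L (\<lambda>x. F (u x))"
  unfolding periodic_def by simp

lemma periodic_compose2: "periodic L u \<Longrightarrow> periodic L w \<Longrightarrow> periodic L (\<lambda>x. F (u x) (w x))"
  unfolding periodic_def by simp

lemma open_cell [simp]: "open (cell L :: (real ^ 'n::finite) set)"
proof -
  have "cell L = (\<Inter>i\<in>UNIV. {x :: real ^ 'n. 0 < x $ i} \<inter> {x. x $ i < L})"
    by (auto simp: cell_def)
  then show ?thesis
    by (auto intro!: open_INT open_Int open_Collect_less continuous_intros)
qed

lemma cell_borel [measurable, simp]: "cell L \<in> sets borel"
  by simp

lemma cell_subset_cbox: "cell L \<subseteq> cbox 0 (\<chi> i. L)"
  by (auto simp: cell_def mem_box_cart less_imp_le less_eq_real_def)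

lemma emeasure_cell_finite: "emeasure lborel (cell L :: (real ^ 'n::finite) set) < \<infinity>"
proof -
  have "emeasure lborel (cell L :: (real ^ 'n) set) \<le> emeasure lborel (cbox 0 (\<chi> i. L) :: (real ^ 'n) set)"
    by (intro emeasure_mono cell_subset_cbox) auto
  also have "\<dots> < \<infinity>" by (rule emeasure_lborel_cbox_finite)
  finally show ?thesis .
qed

lemma set_integrable_cell_bounded:
  fixes u :: "real ^ 'n::finite \<Rightarrow> real"
  assumes "u \<in> borel_measurable borel" "\<And>x. x \<in> cell L \<Longrightarrow> \<bar>u x\<bar> \<le> B"
  shows "set_integrable lborel (cell L) u"
  unfolding set_integrable_def
proof (rule integrableI_bounded_set[where A="cell L" and B=B])
  show "emeasure lborel (cell L :: (real ^ 'n) set) < \<infinity>" by (rule emeasure_cell_finite)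
qed (use assms in \<open>auto intro!: AE_I2\<close>)

lemma set_integrable_cell_continuous:
  fixes u :: "real ^ 'n::finite \<Rightarrow> real"
  assumes "continuous_on UNIV u"
  shows "set_integrable lborel (cell L) u"
proof -
  have "compact (u ` cbox 0 (\<chi> i. L))"
    by (rule compact_continuous_image) (auto intro: continuous_on_subset[OF assms])
  then obtain B where B: "\<And>x. x \<in> cbox 0 (\<chi> i. L) \<Longrightarrow> \<bar>u x\<bar> \<le> B"
    using compact_imp_bounded bounded_iff by (metis (no_types, lifting) imageI real_norm_def)
  show ?thesis
    using B cell_subset_cbox by (intro set_integrable_cell_bounded[where B=B])
      (auto intro!: borel_measurable_continuous_onI assms)
qed

lemma AE_lborel_coordinate_neq:
  fixes i :: "'n::finite"
  shows "AE x :: real ^ 'n in lborel. x $ i \<noteq> (c :: real)"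
proof (rule AE_I')
  have "negligible {x :: real ^ 'n. x \<bullet> axis i 1 = c}"
    by (rule negligible_standard_hyperplane) (auto simp: axis_in_Basis_iff)
  then have "negligible {x :: real ^ 'n. x $ i = c}" by (simp add: inner_axis)
  moreover have "{x :: real ^ 'n. x $ i = c} \<in> sets borel"
    by (intro borel_closed closed_Collect_eq continuous_intros)
  ultimately show "{x :: real ^ 'n. x $ i = c} \<in> null_sets lborel"
    by (simp add: negligible_iff_null_sets null_sets_completion_iff)
qed auto

lemma lborel_shift:
  fixes f :: "'a::euclidean_space \<Rightarrow> real"
  assumes [measurable]: "f \<in> borel_measurable borel"
  shows "integrable lborel (\<lambda>x. f (x + c)) \<longleftrightarrow> integrable lborel f"
    and "(\<integral>x. f (x + c) \<partial>lborel) = (\<integral>x. f x \<partial>lborel)"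
proof -
  have eq: "lborel = distr lborel borel (\<lambda>x :: 'a. x + c)"
    using lborel_distr_plus[of c] unfolding add.commute[of c] ..
  show "integrable lborel (\<lambda>x. f (x + c)) \<longleftrightarrow> integrable lborel f"
    by (subst (2) eq, subst integrable_distr_eq) auto
  show "(\<integral>x. f (x + c) \<partial>lborel) = (\<integral>x. f x \<partial>lborel)"
    by (subst (2) eq, subst integral_distr) auto
qed

text \<open>Quantifying over all integrands, translates included, makes this property additive in \<open>c\<close>.\<close>

definition cell_shift_invariant :: "real \<Rightarrow> real ^ 'n::finite \<Rightarrow> bool" where
  "cell_shift_invariant L c \<longleftrightarrow>
     (\<forall>u :: real ^ 'n \<Rightarrow> real. periodic L u \<longrightarrow> u \<in> borel_measurable borel \<longrightarrow>
        set_integrable lborel (cell L) u \<longrightarrow>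
        set_integrable lborel (cell L) (\<lambda>x. u (x + c)) \<and>
        (LINT x:cell L|lborel. u (x + c)) = (LINT x:cell L|lborel. u x))"

text \<open>The shifted cell differs from the cell by a slab that is a translate by one period of the
  slab it has lost, up to two hyperplanes.\<close>

lemma cell_shift_invariant_axis_small:
  fixes i :: "'n::finite"
  assumes s: "0 < s" "s < L"
  shows "cell_shift_invariant L (s *\<^sub>R axis i 1)"
  unfolding cell_shift_invariant_def
proof (intro allI impI)
  fix u :: "real ^ 'n \<Rightarrow> real"
  assume per: "periodic L u" and [measurable]: "u \<in> borel_measurable borel"
    and int: "set_integrable lborel (cell L) u"
  define e :: "real ^ 'n" where "e = s *\<^sub>R axis i 1"
  define E :: "real ^ 'n" where "E = L *\<^sub>R axis i 1"
  define S :: "(real ^ 'n) set" where "S = {x. \<forall>j. j \<noteq> i \<longrightarrow> 0 < x $ j \<and> x $ j < L}"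
  define B where "B = {x\<in>S. s < x $ i \<and> x $ i < L}"
  define A where "A = {x\<in>S. L \<le> x $ i \<and> x $ i < L + s}"
  define A0 where "A0 = {x\<in>S. 0 \<le> x $ i \<and> x $ i < s}"
  have [measurable]: "S \<in> sets borel"
  proof -
    have "S = (\<Inter>j\<in>UNIV - {i}. {x. 0 < x $ j} \<inter> {x. x $ j < L})" by (auto simp: S_def)
    then show ?thesis
      by (auto intro!: borel_open open_INT open_Int open_Collect_less continuous_intros)
  qed
  have [measurable]: "(\<lambda>x :: real ^ 'n. x $ i) \<in> borel_measurable borel"
    by (intro borel_measurable_continuous_onI continuous_intros)
  have [measurable]: "B \<in> sets borel" "A \<in> sets borel" "A0 \<in> sets borel"
    unfolding B_def A_def A0_def by measurable
  have cell_S: "x \<in> cell L \<longleftrightarrow> x \<in> S \<and> 0 < x $ i \<and> x $ i < L" for x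
    unfolding cell_def S_def by auto
  have ax: "(x + r *\<^sub>R axis i 1) $ j = (if j = i then x $ i + r else x $ j)" for x r and j
    by (auto simp: axis_def)
  have Sax: "x + r *\<^sub>R axis i 1 \<in> S \<longleftrightarrow> x \<in> S" for x r
    unfolding S_def by (auto simp: axis_def)
  have intB: "integrable lborel (\<lambda>x. indicator B x * u x)"
  proof -
    have "B \<subseteq> cell L" using s by (auto simp: B_def cell_S)
    then show ?thesis using set_integrable_subset[OF int, of B] by (simp add: set_integrable_def)
  qed
  have "integrable lborel (\<lambda>x. indicator (A0 \<inter> cell L) x * u x)"
    using set_integrable_subset[OF int, of "A0 \<inter> cell L"] by (auto simp: set_integrable_def)
  moreover have ae0: "AE x in lborel. indicator (A0 \<inter> cell L) x * u x = indicator A0 x * u x"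
    using AE_lborel_coordinate_neq[of i 0]
    by eventually_elim (use s in \<open>auto simp: indicator_def A0_def cell_S\<close>)
  ultimately have intA0: "integrable lborel (\<lambda>x. indicator A0 x * u x)"
    using integrable_cong_AE[OF _ _ ae0] by auto
  have shiftA: "indicator A (x + E) * u (x + E) = indicator A0 x * u x" for x
    using per s unfolding E_def A_def A0_def periodic_def
    by (auto simp: indicator_def ax Sax)
  have intA: "integrable lborel (\<lambda>x. indicator A x * u x)"
    using lborel_shift(1)[of "\<lambda>x. indicator A x * u x" E] intA0 unfolding shiftA by simp
  have eqA: "(\<integral>x. indicator A x * u x \<partial>lborel) = (\<integral>x. indicator A0 x * u x \<partial>lborel)"
    using lborel_shift(2)[of "\<lambda>x. indicator A x * u x" E] unfolding shiftA by simp
  define G where "G x = indicator B x * u x + indicator A x * u x" for x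
  have [measurable]: "G \<in> borel_measurable borel" unfolding G_def by measurable
  have G: "G (x + e) = indicator (cell L) x *\<^sub>R u (x + e)" for x
    using s unfolding G_def e_def B_def A_def by (auto simp: indicator_def ax Sax cell_S)
  have intG: "integrable lborel G" unfolding G_def using intA intB by simp
  have intGe: "integrable lborel (\<lambda>x. G (x + e))"
    using lborel_shift(1)[of G e] intG by simp
  have "(\<integral>x. G (x + e) \<partial>lborel) = (\<integral>x. G x \<partial>lborel)" by (rule lborel_shift(2)) simp
  also have "\<dots> = (\<integral>x. indicator B x * u x \<partial>lborel) + (\<integral>x. indicator A0 x * u x \<partial>lborel)"
    unfolding G_def using intA intB eqA by simp
  also have "\<dots> = (\<integral>x. indicator B x * u x + indicator A0 x * u x \<partial>lborel)"
    using intA0 intB by simp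
  also have "\<dots> = (\<integral>x. indicator (cell L) x *\<^sub>R u x \<partial>lborel)"
  proof (rule integral_cong_AE)
    show "AE x in lborel. indicator B x * u x + indicator A0 x * u x = indicator (cell L) x *\<^sub>R u x"
      using AE_lborel_coordinate_neq[of i 0] AE_lborel_coordinate_neq[of i s]
      by eventually_elim (use s in \<open>auto simp: indicator_def A0_def B_def cell_S\<close>)
  qed auto
  finally show "set_integrable lborel (cell L) (\<lambda>x. u (x + s *\<^sub>R axis i 1)) \<and>
      (LINT x:cell L|lborel. u (x + s *\<^sub>R axis i 1)) = (LINT x:cell L|lborel. u x)"
    using intGe unfolding G set_lebesgue_integral_def set_integrable_def e_def[symmetric] by simp
qed

lemma cell_shift_invariant_axis:
  fixes i :: "'n::finite"
  assumes L: "0 < L"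
  shows "cell_shift_invariant L (r *\<^sub>R axis i 1)"
proof -
  define m where "m = \<lfloor>r / L\<rfloor>"
  define s where "s = r - real_of_int m * L"
  have s0: "0 \<le> s" unfolding s_def m_def using L
    by (metis diff_ge_0_iff_ge floor_divide_lower)
  have s1: "s < L" unfolding s_def m_def using floor_divide_upper[OF L, of r]
    by (simp add: algebra_simps)
  have r: "u (x + r *\<^sub>R axis i 1) = u (x + s *\<^sub>R axis i 1)" if "periodic L u" for u :: "real ^ 'n \<Rightarrow> real" and x
  proof -
    have "x + r *\<^sub>R axis i 1 = (x + s *\<^sub>R axis i 1) + (real_of_int m * L) *\<^sub>R axis i 1"
      unfolding s_def by (simp add: algebra_simps)
    then show ?thesis by (simp only: periodic_shift_int[OF that])
  qed
  show ?thesis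
  proof (cases "s = 0")
    case True
    then show ?thesis unfolding cell_shift_invariant_def by (auto simp: r)
  next
    case False
    then show ?thesis
      using cell_shift_invariant_axis_small[of s L i] s0 s1
      unfolding cell_shift_invariant_def by (auto simp: r)
  qed
qed

lemma cell_shift_invariant_add:
  assumes "cell_shift_invariant L c" "cell_shift_invariant L d"
  shows "cell_shift_invariant L (c + d)"
  unfolding cell_shift_invariant_def
proof (intro allI impI)
  fix u :: "real ^ 'a \<Rightarrow> real"
  assume u: "periodic L u" "u \<in> borel_measurable borel" "set_integrable lborel (cell L) u"
  have "periodic L (\<lambda>x. u (x + d))" by (rule periodic_translate[OF u(1)])
  moreover have "(\<lambda>x. u (x + d)) \<in> borel_measurable borel" using u(2) by simp
  moreover have "set_integrable lborel (cell L) (\<lambda>x. u (x + d)) \<and>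
        (LINT x:cell L|lborel. u (x + d)) = (LINT x:cell L|lborel. u x)"
    using assms(2) u unfolding cell_shift_invariant_def by blast
  ultimately have "set_integrable lborel (cell L) (\<lambda>x. u ((x + c) + d)) \<and>
        (LINT x:cell L|lborel. u ((x + c) + d)) = (LINT x:cell L|lborel. u x)"
    using assms(1)[unfolded cell_shift_invariant_def, rule_format, of "\<lambda>x. u (x + d)"] by simp
  then show "set_integrable lborel (cell L) (\<lambda>x. u (x + (c + d))) \<and>
        (LINT x:cell L|lborel. u (x + (c + d))) = (LINT x:cell L|lborel. u x)"
    by (simp add: add.assoc)
qed

lemma cell_shift_invariant:
  fixes c :: "real ^ 'n::finite"
  assumes L: "0 < L"
  shows "cell_shift_invariant L c"
proof -
  have "cell_shift_invariant L (\<Sum>i\<in>S. (c $ i) *\<^sub>R axis i 1 :: real ^ 'n)" if "finite S" for S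
    using that
  proof (induction S)
    case empty
    show ?case unfolding cell_shift_invariant_def by simp
  next
    case (insert i S)
    then show ?case
      by (auto intro!: cell_shift_invariant_add cell_shift_invariant_axis[OF L])
  qed
  from this[of UNIV] show ?thesis by (simp add: sum_axis_expansion)
qed

lemma cell_integral_translate:
  fixes u :: "real ^ 'n::finite \<Rightarrow> real"
  assumes "0 < L" "periodic L u" "u \<in> borel_measurable borel" "set_integrable lborel (cell L) u"
  shows "set_integrable lborel (cell L) (\<lambda>x. u (x + c))"
    and "(LINT x:cell L|lborel. u (x + c)) = (LINT x:cell L|lborel. u x)"
  using cell_shift_invariant[OF assms(1), of c] assms unfolding cell_shift_invariant_def by auto


section \<open>Partial derivatives along coordinate lines\<close>

lemma has_partial_iff:
  "has_partial i u x \<longleftrightarrow>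
     ((\<lambda>s. u (x + s *\<^sub>R axis i 1)) has_vector_derivative partial_deriv i u x) (at 0)"
  unfolding has_partial_def partial_deriv_def
  by (auto simp: vector_derivative_works)

lemma has_partialI:
  assumes "((\<lambda>s. u (x + s *\<^sub>R axis i 1)) has_vector_derivative D) (at 0)"
  shows "has_partial i u x" "partial_deriv i u x = D"
  using assms unfolding has_partial_def partial_deriv_def
  by (auto simp: vector_derivative_at differentiableI_vector)

lemma has_partial_line:
  assumes "has_partial i u (x + s *\<^sub>R axis i 1)"
  shows "((\<lambda>r. u (x + r *\<^sub>R axis i 1)) has_vector_derivative partial_deriv i u (x + s *\<^sub>R axis i 1)) (at s)"
proof -
  have "((\<lambda>r. u ((x + s *\<^sub>R axis i 1) + r *\<^sub>R axis i 1)) has_vector_derivative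
      partial_deriv i u (x + s *\<^sub>R axis i 1)) (at (s - s))"
    using assms by (simp add: has_partial_iff)
  moreover have "((\<lambda>r. r - s) has_vector_derivative 1) (at s)"
    by (auto intro!: derivative_eq_intros)
  ultimately have "((\<lambda>r. u ((x + s *\<^sub>R axis i 1) + r *\<^sub>R axis i 1)) \<circ> (\<lambda>r. r - s) has_vector_derivative
      1 *\<^sub>R partial_deriv i u (x + s *\<^sub>R axis i 1)) (at s)"
    by (intro vector_diff_chain_at) auto
  then show ?thesis by (simp add: o_def algebra_simps)
qed

lemma partial_const [simp]: "has_partial i (\<lambda>_. c) x" "partial_deriv i (\<lambda>_. c) x = 0"
  using has_partialI[of "\<lambda>_. c" x i 0] by auto

lemma partial_add:
  assumes "has_partial i u x" "has_partial i w x"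
  shows "has_partial i (\<lambda>x. u x + w x) x"
    and "partial_deriv i (\<lambda>x. u x + w x) x = partial_deriv i u x + partial_deriv i w x"
  using has_partialI[of "\<lambda>x. u x + w x" x i, OF has_vector_derivative_add[OF assms[unfolded has_partial_iff]]]
  by auto

lemma partial_diff:
  assumes "has_partial i u x" "has_partial i w x"
  shows "has_partial i (\<lambda>x. u x - w x) x"
    and "partial_deriv i (\<lambda>x. u x - w x) x = partial_deriv i u x - partial_deriv i w x"
  using has_partialI[of "\<lambda>x. u x - w x" x i, OF has_vector_derivative_diff[OF assms[unfolded has_partial_iff]]]
  by auto

lemma partial_bounded_linear:
  assumes "bounded_linear F" "has_partial i u x"
  shows "has_partial i (\<lambda>x. F (u x)) x"
    and "partial_deriv i (\<lambda>x. F (u x)) x = F (partial_deriv i u x)"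
  using has_partialI[of "\<lambda>x. F (u x)" x i,
      OF bounded_linear.has_vector_derivative[OF assms(1) assms(2)[unfolded has_partial_iff]]]
  by auto

lemmas partial_cmult = partial_bounded_linear[OF bounded_linear_scaleR_right]
lemmas partial_nth = partial_bounded_linear[OF bounded_linear_vec_nth]

lemma partial_sum:
  assumes "finite S" "\<And>j. j \<in> S \<Longrightarrow> has_partial i (u j) x"
  shows "has_partial i (\<lambda>x. \<Sum>j\<in>S. u j x) x \<and>
    partial_deriv i (\<lambda>x. \<Sum>j\<in>S. u j x) x = (\<Sum>j\<in>S. partial_deriv i (u j) x)"
  using assms
proof (induction S)
  case (insert j S)
  then show ?case using partial_add[of i "u j" x "\<lambda>x. \<Sum>j\<in>S. u j x"] by simp
qed simp

lemma partial_bilinear: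
  assumes "bounded_bilinear B" "has_partial i u x" "has_partial i w x"
  shows "has_partial i (\<lambda>x. B (u x) (w x)) x"
    and "partial_deriv i (\<lambda>x. B (u x) (w x)) x = B (u x) (partial_deriv i w x) + B (partial_deriv i u x) (w x)"
  using has_partialI[of "\<lambda>x. B (u x) (w x)" x i,
      OF bounded_bilinear.has_vector_derivative[OF assms(1) assms(2,3)[unfolded has_partial_iff]]]
  by auto

lemmas partial_mult = partial_bilinear[OF bounded_bilinear_mult]
lemmas partial_inner = partial_bilinear[OF bounded_bilinear_inner]

lemma partial_translate:
  "has_partial i (\<lambda>x. u (x + c)) x \<longleftrightarrow> has_partial i u (x + c)"
  "partial_deriv i (\<lambda>x. u (x + c)) x = partial_deriv i u (x + c)"
proof -
  have "(\<lambda>s. u (x + s *\<^sub>R axis i 1 + c)) = (\<lambda>s. u (x + c + s *\<^sub>R axis i 1))"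
    by (simp add: algebra_simps)
  then show "has_partial i (\<lambda>x. u (x + c)) x \<longleftrightarrow> has_partial i u (x + c)"
    "partial_deriv i (\<lambda>x. u (x + c)) x = partial_deriv i u (x + c)"
    unfolding has_partial_def partial_deriv_def by auto
qed

lemma periodic_partial: "periodic L u \<Longrightarrow> periodic L (partial_deriv i u)"
  unfolding periodic_def
proof (intro allI)
  fix x j
  assume "\<forall>x j. u (x + L *\<^sub>R axis j 1) = u x"
  then have "(\<lambda>x. u (x + L *\<^sub>R axis j 1)) = u" by auto
  then show "partial_deriv i u (x + L *\<^sub>R axis j 1) = partial_deriv i u x"
    using partial_translate(2)[of i u "L *\<^sub>R axis j 1" x] by simp
qed

lemma partials_Nil [simp]: "partials [] u = u"
  by (simp add: partials_def)

lemma partials_Cons [simp]: "partials (i # ds) u = partial_deriv i (partials ds u)"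
  by (simp add: partials_def)

lemma periodic_partials: "periodic L u \<Longrightarrow> periodic L (partials ds u)"
  by (induction ds) (auto intro: periodic_partial)

text \<open>The flux of a periodic function through opposite faces cancels.  The derivative is merely
  integrable, as the gradient of the approximate pressure is only square integrable: the fundamental
  theorem for the gauge integral still applies on almost every line.\<close>

lemma integral_partial_deriv_cell:
  fixes g :: "real ^ 'n::finite \<Rightarrow> real"
  assumes L: "0 < L" and per: "periodic L g" and d: "\<And>x. has_partial i g x"
    and m: "partial_deriv i g \<in> borel_measurable borel"
    and int: "set_integrable lborel (cell L) (partial_deriv i g)"
  shows "(LINT x:cell L|lborel. partial_deriv i g x) = 0"
proof -
  define g' where "g' = partial_deriv i g"
  have [measurable]: "g' \<in> borel_measurable borel" unfolding g'_def by (rule m)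
  have per': "periodic L g'" unfolding g'_def by (rule periodic_partial[OF per])
  define e :: "real ^ 'n" where "e = axis i 1"
  \<comment> \<open>averaging over the shifts by \<open>\<tau> e\<close> leaves the integral over the cell unchanged and, by Fubini, exposes integrals of the derivative over full periods\<close>
  define F where "F = (\<lambda>(\<tau>::real, x). indicator {0..L} \<tau> * (indicator (cell L) x * g' (x + \<tau> *\<^sub>R e)))"
  have F[measurable]: "F \<in> borel_measurable (lborel \<Otimes>\<^sub>M lborel)"
    unfolding F_def by measurable
  have int': "integrable lborel (\<lambda>x. indicator (cell L) x * g' (x + c))"
    and eq': "(\<integral>x. indicator (cell L) x * g' (x + c) \<partial>lborel) = (LINT x:cell L|lborel. g' x)" for c
    using cell_integral_translate[OF L per', of c] int
    by (auto simp: set_integrable_def set_lebesgue_integral_def g'_def[symmetric])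
  have intabs: "set_integrable lborel (cell L) (\<lambda>x. \<bar>g' x\<bar>)"
    using set_integrable_abs[OF int] by (simp add: g'_def)
  have eqabs: "(\<integral>x. indicator (cell L) x * \<bar>g' (x + c)\<bar> \<partial>lborel) = (LINT x:cell L|lborel. \<bar>g' x\<bar>)" for c
    using cell_integral_translate(2)[OF L periodic_compose[OF per', of abs], of c] intabs
    by (auto simp: set_lebesgue_integral_def)
  have intF: "integrable (lborel \<Otimes>\<^sub>M lborel) F"
  proof (rule lborel_pair.Fubini_integrable[OF F])
    have "(\<integral>x. norm (F (\<tau>, x)) \<partial>lborel) = indicator {0..L} \<tau> * (LINT x:cell L|lborel. \<bar>g' x\<bar>)" for \<tau>
      unfolding F_def by (simp add: abs_mult eqabs)
    then show "integrable lborel (\<lambda>\<tau>. \<integral>x. norm (F (\<tau>, x)) \<partial>lborel)"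
      using emeasure_lborel_Icc[of 0 L] L by (auto simp: integrable_indicator_iff)
    show "AE \<tau> in lborel. integrable lborel (\<lambda>x. F (\<tau>, x))"
      unfolding F_def using int' by (intro AE_I2) auto
  qed
  have intF': "integrable (lborel \<Otimes>\<^sub>M lborel) (case_prod (\<lambda>\<tau> x. F (\<tau>, x)))"
    using intF by simp
  have "(\<integral>x. \<integral>\<tau>. F (\<tau>, x) \<partial>lborel \<partial>lborel) = (\<integral>\<tau>. \<integral>x. F (\<tau>, x) \<partial>lborel \<partial>lborel)"
    by (rule lborel_pair.Fubini_integral[OF intF'])
  also have "\<dots> = (\<integral>\<tau>. indicator {0..L} \<tau> * (LINT x:cell L|lborel. g' x) \<partial>lborel)"
    unfolding F_def by (simp add: eq')
  also have "\<dots> = L * (LINT x:cell L|lborel. g' x)" using L by simp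
  finally have 1: "(\<integral>x. \<integral>\<tau>. F (\<tau>, x) \<partial>lborel \<partial>lborel) = L * (LINT x:cell L|lborel. g' x)" .
  have "AE x in lborel. integrable lborel (\<lambda>\<tau>. F (\<tau>, x))"
    using lborel_pair.AE_integrable_snd[OF intF'] by simp
  then have "AE x in lborel. (\<integral>\<tau>. F (\<tau>, x) \<partial>lborel) = 0"
  proof eventually_elim
    case (elim x)
    show ?case
    proof (cases "x \<in> cell L")
      case True
      have "set_integrable lborel {0..L} (\<lambda>\<tau>. g' (x + \<tau> *\<^sub>R e))"
        using elim True by (simp add: F_def set_integrable_def)
      then have "(LINT \<tau>:{0..L}|lborel. g' (x + \<tau> *\<^sub>R e)) = integral {0..L} (\<lambda>\<tau>. g' (x + \<tau> *\<^sub>R e))"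
        by (rule set_borel_integral_eq_integral)
      also have "((\<lambda>\<tau>. g' (x + \<tau> *\<^sub>R e)) has_integral (g (x + L *\<^sub>R e) - g (x + 0 *\<^sub>R e))) {0..L}"
        unfolding e_def g'_def using L
        by (intro fundamental_theorem_of_calculus has_vector_derivative_at_within[OF has_partial_line] d) auto
      then have "integral {0..L} (\<lambda>\<tau>. g' (x + \<tau> *\<^sub>R e)) = 0"
        using per by (simp add: integral_unique periodic_def e_def)
      finally show ?thesis using True by (simp add: F_def set_lebesgue_integral_def)
    qed (simp add: F_def)
  qed
  then have "(\<integral>x. \<integral>\<tau>. F (\<tau>, x) \<partial>lborel \<partial>lborel) = 0"
    by (intro integral_eq_zero_AE)
  then show ?thesis using 1 L by (simp add: g'_def)
qed

section \<open>Taylor expansion with coordinate derivatives\<close>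

text \<open>The length of a path from \<open>0\<close> to \<open>d\<close> that follows the coordinate axes, hence the displacement that enters when only
  coordinate derivatives are controlled.\<close>

definition l1_norm :: "real ^ 'n::finite \<Rightarrow> real" where
  "l1_norm d = (\<Sum>i\<in>UNIV. \<bar>d $ i\<bar>)"

lemma l1_norm_nonneg [simp]: "0 \<le> l1_norm d"
  by (simp add: l1_norm_def sum_nonneg)

lemma l1_norm_le: "l1_norm (d :: real ^ 'n::finite) \<le> real CARD('n) * norm d"
  unfolding l1_norm_def using sum_bounded_above[of UNIV "\<lambda>i. \<bar>d $ i\<bar>" "norm d"]
  by (simp add: component_le_norm_cart)

lemma l1_norm_scaleR:
  fixes s :: real
  shows "l1_norm (s *\<^sub>R d :: real ^ 'n::finite) = \<bar>s\<bar> * l1_norm d"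
  by (simp add: l1_norm_def abs_mult sum_distrib_left)

lemma increment_bound_along_axis:
  fixes r :: real and u :: "real ^ 'n::finite \<Rightarrow> 'b::real_normed_vector"
  assumes d: "\<And>s :: real. \<bar>s\<bar> \<le> \<bar>r\<bar> \<Longrightarrow> has_partial i u (x + s *\<^sub>R axis i 1)"
    and B: "\<And>s :: real. \<bar>s\<bar> \<le> \<bar>r\<bar> \<Longrightarrow> norm (partial_deriv i u (x + s *\<^sub>R axis i 1) - D) \<le> B"
  shows "norm (u (x + r *\<^sub>R axis i 1) - u x - r *\<^sub>R D) \<le> B * \<bar>r\<bar>"
proof -
  define g where "g s = u (x + s *\<^sub>R axis i 1) - s *\<^sub>R D" for s
  have gd: "(g has_derivative (\<lambda>h. h *\<^sub>R (partial_deriv i u (x + s *\<^sub>R axis i 1) - D)))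
      (at s within cball 0 \<bar>r\<bar>)" if "s \<in> cball 0 \<bar>r\<bar>" for s :: real
  proof -
    have "(g has_vector_derivative partial_deriv i u (x + s *\<^sub>R axis i 1) - D) (at s)"
      unfolding g_def using that
      by (auto intro!: derivative_eq_intros has_partial_line d)
    then show ?thesis
      using has_derivative_at_withinI has_vector_derivative_def by blast
  qed
  have "norm (g r - g 0) \<le> B * norm (r - 0)"
  proof (rule differentiable_bound[OF _ gd])
    fix s :: real assume s: "s \<in> cball 0 \<bar>r\<bar>"
    show "onorm (\<lambda>h. h *\<^sub>R (partial_deriv i u (x + s *\<^sub>R axis i 1) - D)) \<le> B"
    proof (rule onorm_le)
      fix h
      show "norm (h *\<^sub>R (partial_deriv i u (x + s *\<^sub>R axis i 1) - D)) \<le> B * norm h"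
        using mult_left_mono[OF B[of s], of "norm h"] s by (simp add: mult.commute)
    qed
  qed auto
  then show ?thesis by (simp add: g_def algebra_simps)
qed

text \<open>Moving along one coordinate axis at a time, so that only the coordinate derivatives and
  their modulus of continuity enter.\<close>

lemma increment_bound_coordinatewise:
  fixes u :: "real ^ 'n::finite \<Rightarrow> 'b::real_normed_vector"
  assumes d: "\<And>i x. has_partial i u x"
    and B: "\<And>i y. l1_norm y \<le> l1_norm d \<Longrightarrow> norm (partial_deriv i u (x + y) - D i) \<le> B"
  shows "norm (u (x + d) - u x - (\<Sum>i\<in>UNIV. d $ i *\<^sub>R D i)) \<le> B * l1_norm d"
proof -
  define y where "y S = (\<Sum>i\<in>S. d $ i *\<^sub>R axis i 1 :: real ^ 'n)" for S
  have ynth: "y S $ j = (if j \<in> S then d $ j else 0)" if "finite S" for S j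
    using that by (simp add: y_def axis_def if_distrib cong: if_cong)
  have "norm (u (x + y S) - u x - (\<Sum>i\<in>S. d $ i *\<^sub>R D i)) \<le> B * (\<Sum>i\<in>S. \<bar>d $ i\<bar>)" if "finite S" for S
    using that
  proof (induction S)
    case (insert i S)
    have l1: "l1_norm (y S + s *\<^sub>R axis i 1) \<le> l1_norm d" if "\<bar>s\<bar> \<le> \<bar>d $ i\<bar>" for s
      unfolding l1_norm_def using that insert.hyps
      by (intro sum_mono) (auto simp: ynth axis_def)
    have "norm (u (x + y S + d $ i *\<^sub>R axis i 1) - u (x + y S) - d $ i *\<^sub>R D i) \<le> B * \<bar>d $ i\<bar>"
    proof (rule increment_bound_along_axis[OF d])
      fix s assume "\<bar>s\<bar> \<le> \<bar>d $ i\<bar>"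
      from B[OF l1[OF this], of i]
      show "norm (partial_deriv i u (x + y S + s *\<^sub>R axis i 1) - D i) \<le> B"
        by (simp add: add.assoc)
    qed
    moreover have "x + y (insert i S) = x + y S + d $ i *\<^sub>R axis i 1"
      using insert.hyps by (simp add: y_def)
    ultimately have "norm (u (x + y (insert i S)) - u (x + y S) - d $ i *\<^sub>R D i) \<le> B * \<bar>d $ i\<bar>"
      by (simp only:)
    then have "norm ((u (x + y (insert i S)) - u (x + y S) - d $ i *\<^sub>R D i)
        + (u (x + y S) - u x - (\<Sum>i\<in>S. d $ i *\<^sub>R D i))) \<le> B * \<bar>d $ i\<bar> + B * (\<Sum>i\<in>S. \<bar>d $ i\<bar>)"
      using insert.IH by (intro norm_triangle_mono)
    then show ?case using insert.hyps by (simp add: algebra_simps)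
  qed (simp add: y_def)
  from this[of UNIV] show ?thesis
    by (simp add: y_def sum_axis_expansion l1_norm_def)
qed

lemma lipschitz_of_bounded_partials:
  fixes u :: "real ^ 'n::finite \<Rightarrow> 'b::real_normed_vector"
  assumes "\<And>i x. has_partial i u x" "\<And>i x. norm (partial_deriv i u x) \<le> B"
  shows "norm (u (x + d) - u x) \<le> B * l1_norm d"
  using increment_bound_coordinatewise[of u d x "\<lambda>_. 0" B] assms by simp

lemma taylor_first_order:
  fixes u :: "real ^ 'n::finite \<Rightarrow> 'b::real_normed_vector"
  assumes "\<And>i x. has_partial i u x" and B: "0 \<le> B"
    and lip: "\<And>i x y. norm (partial_deriv i u (x + y) - partial_deriv i u x) \<le> B * l1_norm y"
  shows "norm (u (x + d) - u x - (\<Sum>i\<in>UNIV. d $ i *\<^sub>R partial_deriv i u x)) \<le> B * (l1_norm d)\<^sup>2"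
proof -
  have "norm (partial_deriv i u (x + y) - partial_deriv i u x) \<le> B * l1_norm d"
    if "l1_norm y \<le> l1_norm d" for i y
    using lip[of i x y] mult_left_mono[OF that B] by linarith
  then show ?thesis
    using increment_bound_coordinatewise[of u d x "\<lambda>i. partial_deriv i u x" "B * l1_norm d"] assms(1)
    by (simp add: power2_eq_square mult.assoc)
qed

text \<open>The first-order Taylor estimate turns coordinate derivatives into a derivative along an arbitrary line.\<close>

lemma has_vector_derivative_of_lipschitz_partials:
  fixes u :: "real ^ 'n::finite \<Rightarrow> 'b::real_normed_vector"
  assumes d: "\<And>i x. has_partial i u x" and B: "0 \<le> B"
    and lip: "\<And>i x y. norm (partial_deriv i u (x + y) - partial_deriv i u x) \<le> B * l1_norm y"
  shows "((\<lambda>s. u (x + s *\<^sub>R d)) has_vector_derivative (\<Sum>i\<in>UNIV. d $ i *\<^sub>R partial_deriv i u (x + s *\<^sub>R d))) (at s)"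
  unfolding has_vector_derivative_def has_derivative_at_alt
proof (intro conjI allI impI)
  show "bounded_linear (\<lambda>h. h *\<^sub>R (\<Sum>i\<in>UNIV. d $ i *\<^sub>R partial_deriv i u (x + s *\<^sub>R d)))"
    by (rule bounded_linear_scaleR_left)
  fix e :: real assume e: "0 < e"
  define K where "K = B * (l1_norm d)\<^sup>2 + 1"
  have K: "0 < K" unfolding K_def using B by (simp add: add_nonneg_pos)
  show "\<exists>\<delta>>0. \<forall>y. norm (y - s) < \<delta> \<longrightarrow>
      norm (u (x + y *\<^sub>R d) - u (x + s *\<^sub>R d) - (y - s) *\<^sub>R (\<Sum>i\<in>UNIV. d $ i *\<^sub>R partial_deriv i u (x + s *\<^sub>R d)))
        \<le> e * norm (y - s)"
  proof (intro exI[of _ "e / K"] conjI allI impI)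
    show "0 < e / K" using e K by simp
    fix y assume y: "norm (y - s) < e / K"
    have "norm (u (x + s *\<^sub>R d + (y - s) *\<^sub>R d) - u (x + s *\<^sub>R d)
        - (\<Sum>i\<in>UNIV. ((y - s) *\<^sub>R d) $ i *\<^sub>R partial_deriv i u (x + s *\<^sub>R d))) \<le> B * (l1_norm ((y - s) *\<^sub>R d))\<^sup>2"
      by (rule taylor_first_order[OF d B lip])
    also have "\<dots> = (B * (l1_norm d)\<^sup>2) * \<bar>y - s\<bar> * \<bar>y - s\<bar>"
      by (simp add: l1_norm_scaleR power2_eq_square)
    also have "\<dots> \<le> K * \<bar>y - s\<bar> * \<bar>y - s\<bar>"
      unfolding K_def by (intro mult_right_mono) auto
    also have "\<dots> \<le> e * \<bar>y - s\<bar>"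
      using y K by (intro mult_right_mono) (auto simp: pos_less_divide_eq mult.commute)
    also have "x + s *\<^sub>R d + (y - s) *\<^sub>R d = x + y *\<^sub>R d" by (simp add: algebra_simps)
    finally show "norm (u (x + y *\<^sub>R d) - u (x + s *\<^sub>R d) - (y - s) *\<^sub>R (\<Sum>i\<in>UNIV. d $ i *\<^sub>R partial_deriv i u (x + s *\<^sub>R d)))
        \<le> e * norm (y - s)"
      by (simp add: scaleR_sum_right)
  qed
qed

text \<open>Along the segment from \<open>x\<close> to \<open>x + d\<close> the derivative of the remainder is a combination of the first-order Taylor
  remainders of the coordinate derivatives.\<close>

lemma taylor_second_order:
  fixes u :: "real ^ 'n::finite \<Rightarrow> 'b::real_normed_vector"
  assumes d: "\<And>i x. has_partial i u x" and dd: "\<And>i j x. has_partial j (partial_deriv i u) x"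
    and B1: "0 \<le> B1" and B: "0 \<le> B"
    and lip1: "\<And>i x y. norm (partial_deriv i u (x + y) - partial_deriv i u x) \<le> B1 * l1_norm y"
    and lip: "\<And>i j x y. norm (partial_deriv j (partial_deriv i u) (x + y) - partial_deriv j (partial_deriv i u) x)
      \<le> B * l1_norm y"
  shows "norm (u (x + d) - u x - (\<Sum>i\<in>UNIV. d $ i *\<^sub>R partial_deriv i u x)
      - (1/2) *\<^sub>R (\<Sum>i\<in>UNIV. \<Sum>j\<in>UNIV. (d $ i * d $ j) *\<^sub>R partial_deriv j (partial_deriv i u) x))
    \<le> B * (l1_norm d) ^ 3"
proof -
  define P where "P = (\<Sum>i\<in>UNIV. d $ i *\<^sub>R partial_deriv i u x)"
  define Q where "Q = (\<Sum>i\<in>UNIV. \<Sum>j\<in>UNIV. (d $ i * d $ j) *\<^sub>R partial_deriv j (partial_deriv i u) x)"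
  define g where "g s = u (x + s *\<^sub>R d) - s *\<^sub>R P - (s\<^sup>2 / 2) *\<^sub>R Q" for s :: real
  define g' where "g' s = (\<Sum>i\<in>UNIV. d $ i *\<^sub>R partial_deriv i u (x + s *\<^sub>R d)) - P - s *\<^sub>R Q" for s
  have gd: "(g has_derivative (\<lambda>h. h *\<^sub>R g' s)) (at s within {0..1})" for s
  proof -
    have "((\<lambda>s. s\<^sup>2 / 2) has_field_derivative s) (at s)"
      by (auto intro!: derivative_eq_intros)
    then have "(g has_vector_derivative g' s) (at s)"
      unfolding g_def g'_def
      by (auto intro!: derivative_eq_intros has_vector_derivative_of_lipschitz_partials[OF d B1 lip1])
    then show ?thesis
      using has_derivative_at_withinI has_vector_derivative_def by blast
  qed
  have g'B: "norm (g' s) \<le> B * (l1_norm d) ^ 3" if s: "s \<in> {0..1}" for s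
  proof -
    have *: "norm (partial_deriv i u (x + s *\<^sub>R d) - partial_deriv i u x
        - (\<Sum>j\<in>UNIV. (s * d $ j) *\<^sub>R partial_deriv j (partial_deriv i u) x)) \<le> B * (l1_norm d)\<^sup>2" for i
    proof -
      have "norm (partial_deriv i u (x + s *\<^sub>R d) - partial_deriv i u x
        - (\<Sum>j\<in>UNIV. (s *\<^sub>R d) $ j *\<^sub>R partial_deriv j (partial_deriv i u) x)) \<le> B * (l1_norm (s *\<^sub>R d))\<^sup>2"
        by (rule taylor_first_order[OF dd B lip])
      also have "\<dots> \<le> B * (l1_norm d)\<^sup>2"
        using s B mult_left_le_one_le[of "l1_norm d" s]
        by (intro mult_left_mono power_mono) (auto simp: l1_norm_scaleR)
      finally show ?thesis by simp
    qed
    have "g' s = (\<Sum>i\<in>UNIV. d $ i *\<^sub>R (partial_deriv i u (x + s *\<^sub>R d) - partial_deriv i u x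
        - (\<Sum>j\<in>UNIV. (s * d $ j) *\<^sub>R partial_deriv j (partial_deriv i u) x)))"
      unfolding g'_def P_def Q_def
      by (simp add: scaleR_diff_right sum_subtractf scaleR_sum_right ac_simps)
    also have "norm \<dots> \<le> (\<Sum>i\<in>UNIV. \<bar>d $ i\<bar> * (B * (l1_norm d)\<^sup>2))"
      using * by (intro order_trans[OF norm_sum] sum_mono) (simp add: mult_left_mono)
    also have "\<dots> = l1_norm d * (B * (l1_norm d)\<^sup>2)"
      unfolding l1_norm_def by (simp add: sum_distrib_right)
    finally show ?thesis by (simp add: power2_eq_square power3_eq_cube ac_simps)
  qed
  have "norm (g 1 - g 0) \<le> B * (l1_norm d) ^ 3 * norm (1 - 0 :: real)"
  proof (rule differentiable_bound[OF _ gd])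
    fix s :: real assume s: "s \<in> {0..1}"
    show "onorm (\<lambda>h. h *\<^sub>R g' s) \<le> B * (l1_norm d) ^ 3"
    proof (rule onorm_le)
      fix h
      show "norm (h *\<^sub>R g' s) \<le> B * (l1_norm d) ^ 3 * norm h"
        using mult_left_mono[OF g'B[OF s], of "norm h"] by (simp add: mult.commute)
    qed
  qed auto
  then show ?thesis unfolding g_def P_def[symmetric] Q_def[symmetric] by (simp add: algebra_simps)
qed

section \<open>Fields with jointly continuous space derivatives\<close>

lemma partials_snoc: "partials (ds @ [i]) u = partials ds (partial_deriv i u)"
  by (simp add: partials_def)

lemma partial_deriv_const_fun: "partial_deriv i (\<lambda>_. c) = (\<lambda>_. 0)"
  by (rule ext) simp

lemma space_smooth_0: "space_smooth 0 T u \<longleftrightarrow> continuous_on ({0..T} \<times> UNIV) (\<lambda>(t, x). u t x)"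
  by (simp add: space_smooth_def)

text \<open>Recursion on the order of smoothness, peeling off the innermost derivative; the closure properties below
  are inductions along it.\<close>

lemma space_smooth_Suc:
  "space_smooth (Suc k) T u \<longleftrightarrow>
     continuous_on ({0..T} \<times> UNIV) (\<lambda>(t, x). u t x) \<and>
     (\<forall>t\<in>{0..T}. \<forall>x i. has_partial i (u t) x) \<and>
     (\<forall>i. space_smooth k T (\<lambda>t. partial_deriv i (u t)))" (is "?l \<longleftrightarrow> ?r")
proof
  assume l: ?l
  show ?r
  proof (intro conjI allI)
    show "continuous_on ({0..T} \<times> UNIV) (\<lambda>(t, x). u t x)"
      using l[unfolded space_smooth_def, THEN conjunct1, rule_format, of "[]"] by simp
    show "\<forall>t\<in>{0..T}. \<forall>x i. has_partial i (u t) x"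
      using l[unfolded space_smooth_def, THEN conjunct2, rule_format, of "[]"] by simp
    fix i
    show "space_smooth k T (\<lambda>t. partial_deriv i (u t))"
      unfolding space_smooth_def partials_snoc[symmetric]
      using l unfolding space_smooth_def by simp
  qed
next
  assume r: ?r
  have *: "ds = [] \<or> (\<exists>ds' i. ds = ds' @ [i])" for ds :: "'a list" using rev_exhaust by auto
  show ?l
    unfolding space_smooth_def
  proof (intro conjI allI impI)
    fix ds :: "'a list" assume "length ds \<le> Suc k"
    then show "continuous_on ({0..T} \<times> UNIV) (\<lambda>(t, x). partials ds (u t) x)"
      using r *[of ds] unfolding space_smooth_def by (auto simp: partials_snoc)
  next
    fix ds :: "'a list" assume "length ds < Suc k"
    then show "\<forall>t\<in>{0..T}. \<forall>x i. has_partial i (partials ds (u t)) x"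
      using r *[of ds] unfolding space_smooth_def by (auto simp: partials_snoc)
  qed
qed

lemma space_smooth_mono: "space_smooth m T u \<Longrightarrow> k \<le> m \<Longrightarrow> space_smooth k T u"
  unfolding space_smooth_def by auto

lemma space_smooth_partial: "space_smooth (Suc k) T u \<Longrightarrow> space_smooth k T (\<lambda>t. partial_deriv i (u t))"
  by (simp add: space_smooth_Suc)

lemma space_smooth_cong:
  assumes "\<And>t. t \<in> {0..T} \<Longrightarrow> u t = w t"
  shows "space_smooth k T u \<longleftrightarrow> space_smooth k T w"
proof -
  have "continuous_on ({0..T} \<times> UNIV) (\<lambda>(t, x). partials ds (u t) x) \<longleftrightarrow>
     continuous_on ({0..T} \<times> UNIV) (\<lambda>(t, x). partials ds (w t) x)" for ds
    by (intro continuous_on_cong) (auto simp: assms)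
  then show ?thesis unfolding space_smooth_def by (simp add: assms)
qed

lemma space_smooth_continuous:
  assumes "space_smooth k T u" "length ds \<le> k"
  shows "continuous_on ({0..T} \<times> UNIV) (\<lambda>(t, x). partials ds (u t) x)"
  using assms by (auto simp: space_smooth_def)

lemma space_smooth_has_partial:
  assumes "space_smooth k T u" "length ds < k" "t \<in> {0..T}"
  shows "has_partial i (partials ds (u t)) x"
  using assms by (auto simp: space_smooth_def)

lemma continuous_on_slice:
  fixes F :: "'a::topological_space \<Rightarrow> 'b::topological_space \<Rightarrow> 'c::topological_space"
  assumes "continuous_on (A \<times> UNIV) (\<lambda>(t, x). F t x)" "t \<in> A"
  shows "continuous_on UNIV (F t)"
proof -
  have "continuous_on UNIV (\<lambda>x :: 'b. (t, x))" by (intro continuous_intros)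
  from continuous_on_compose2[OF assms(1) this] assms(2) show ?thesis by auto
qed

lemma continuous_on_time_slice:
  fixes F :: "'a::topological_space \<Rightarrow> 'b::topological_space \<Rightarrow> 'c::topological_space"
  assumes "continuous_on (A \<times> UNIV) (\<lambda>(t, x). F t x)" "S \<subseteq> A"
  shows "continuous_on S (\<lambda>t. F t x)"
proof -
  have "continuous_on S (\<lambda>t. (t, x))" by (intro continuous_intros)
  from continuous_on_compose2[OF assms(1) this] assms(2) show ?thesis by auto
qed

lemma space_smooth_add:
  "space_smooth k T u \<Longrightarrow> space_smooth k T w \<Longrightarrow> space_smooth k T (\<lambda>t x. u t x + w t x)"
proof (induction k arbitrary: u w)
  case 0
  then show ?case by (auto simp: space_smooth_0 split_beta intro!: continuous_intros)
next
  case (Suc k)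
  have "space_smooth k T (\<lambda>t. partial_deriv i (\<lambda>x. u t x + w t x)) \<longleftrightarrow>
      space_smooth k T (\<lambda>t x. partial_deriv i (u t) x + partial_deriv i (w t) x)" for i
    using Suc.prems by (intro space_smooth_cong ext) (auto simp: space_smooth_Suc partial_add)
  then show ?case
    using Suc by (auto simp: space_smooth_Suc split_beta intro!: continuous_intros partial_add)
qed

lemma space_smooth_linear:
  assumes "bounded_linear F"
  shows "space_smooth k T u \<Longrightarrow> space_smooth k T (\<lambda>t x. F (u t x))"
proof (induction k arbitrary: u)
  case 0
  then show ?case
    by (auto simp: space_smooth_0 split_beta intro!: bounded_linear.continuous_on[OF assms])
next
  case (Suc k)
  have "space_smooth k T (\<lambda>t. partial_deriv i (\<lambda>x. F (u t x))) \<longleftrightarrow>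
      space_smooth k T (\<lambda>t x. F (partial_deriv i (u t) x))" for i
    using Suc.prems by (intro space_smooth_cong ext) (auto simp: space_smooth_Suc partial_bounded_linear[OF assms])
  then show ?case
    using Suc by (auto simp: space_smooth_Suc split_beta partial_bounded_linear[OF assms]
        intro!: bounded_linear.continuous_on[OF assms])
qed

lemma space_smooth_bilinear:
  assumes "bounded_bilinear B"
  shows "space_smooth k T u \<Longrightarrow> space_smooth k T w \<Longrightarrow> space_smooth k T (\<lambda>t x. B (u t x) (w t x))"
proof (induction k arbitrary: u w)
  case 0
  then show ?case
    by (auto simp: space_smooth_0 split_beta intro!: bounded_bilinear.continuous_on[OF assms])
next
  case (Suc k)
  have 1: "space_smooth k T u" "space_smooth k T w" using Suc.prems by (auto intro: space_smooth_mono)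
  have "space_smooth k T (\<lambda>t. partial_deriv i (\<lambda>x. B (u t x) (w t x))) \<longleftrightarrow>
      space_smooth k T (\<lambda>t x. B (u t x) (partial_deriv i (w t) x) + B (partial_deriv i (u t) x) (w t x))" for i
    using Suc.prems by (intro space_smooth_cong ext) (auto simp: space_smooth_Suc partial_bilinear[OF assms])
  moreover have "space_smooth k T (\<lambda>t x. B (u t x) (partial_deriv i (w t) x) + B (partial_deriv i (u t) x) (w t x))" for i
    using Suc.prems 1 by (intro space_smooth_add Suc.IH space_smooth_partial)
  ultimately show ?case
    using Suc.prems by (auto simp: space_smooth_Suc split_beta partial_bilinear[OF assms]
        intro!: bounded_bilinear.continuous_on[OF assms])
qed

lemma space_smooth_time:
  fixes c :: "real \<Rightarrow> 'b::real_normed_vector"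
  assumes "continuous_on {0..T} c"
  shows "space_smooth k T (\<lambda>t (x :: real ^ 'n::finite). c t)"
proof -
  have "continuous_on ({0..T} \<times> UNIV) (\<lambda>(t, x :: real ^ 'n). c t)"
    using continuous_on_compose2[OF assms continuous_on_fst[OF continuous_on_id], of "{0..T} \<times> UNIV"]
    by (auto simp: split_beta)
  moreover have z: "space_smooth k T (\<lambda>t (x :: real ^ 'n). 0 :: 'b)" for k
    by (induction k) (simp_all add: space_smooth_0 space_smooth_Suc partial_deriv_const_fun split_beta)
  moreover have "space_smooth k T (\<lambda>t. partial_deriv i (\<lambda>x :: real ^ 'n. c t))" for i k
    using z[of k] by (subst space_smooth_cong[of _ _ "\<lambda>t x. 0"]) auto
  ultimately show ?thesis by (cases k) (simp_all add: space_smooth_0 space_smooth_Suc)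
qed

lemma space_smooth_sum:
  assumes "finite S" "\<And>j. j \<in> S \<Longrightarrow> space_smooth k T (u j)"
  shows "space_smooth k T (\<lambda>t x. \<Sum>j\<in>S. u j t x)"
  using assms
  by (induction S) (auto intro!: space_smooth_add space_smooth_time[where c="\<lambda>_. 0"] continuous_intros)

lemmas space_smooth_scaleR = space_smooth_bilinear[OF bounded_bilinear_scaleR]
lemmas space_smooth_cmult = space_smooth_linear[OF bounded_linear_scaleR_right]
lemmas space_smooth_nth = space_smooth_linear[OF bounded_linear_vec_nth]

lemma space_smooth_diff:
  "space_smooth k T u \<Longrightarrow> space_smooth k T w \<Longrightarrow> space_smooth k T (\<lambda>t x. u t x - w t x)"
  using space_smooth_add[of k T u "\<lambda>t x. (-1) *\<^sub>R w t x"] space_smooth_cmult[of k T w "-1"] by simp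

lemma space_smooth_advection:
  assumes "space_smooth (Suc k) T v" "space_smooth (Suc k) T u"
  shows "space_smooth k T (\<lambda>t. advection (v t) (u t))"
  unfolding advection_def using assms
  by (intro space_smooth_sum space_smooth_scaleR space_smooth_nth space_smooth_partial)
     (auto intro: space_smooth_mono)

lemma space_smooth_gradient:
  assumes "space_smooth (Suc k) T (p :: real \<Rightarrow> real ^ 'n::finite \<Rightarrow> real)"
  shows "space_smooth k T (\<lambda>t. gradient (p t))"
proof -
  have "space_smooth k T (\<lambda>t x. \<Sum>i\<in>UNIV. partial_deriv i (p t) x *\<^sub>R (axis i 1 :: real ^ 'n))"
    using assms
    by (intro space_smooth_sum space_smooth_scaleR space_smooth_partial space_smooth_time continuous_intros) auto
  moreover have "(\<lambda>x. \<Sum>i\<in>UNIV. partial_deriv i (p t) x *\<^sub>R (axis i 1 :: real ^ 'n)) = gradient (p t)" for t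
    by (simp add: fun_eq_iff gradient_def vec_eq_iff axis_def if_distrib cong: if_cong)
  ultimately show ?thesis by simp
qed

lemma space_smooth_laplacian:
  assumes "space_smooth (Suc (Suc k)) T v"
  shows "space_smooth k T (\<lambda>t. laplacian (v t))"
  unfolding laplacian_def partials_Cons partials_Nil using assms
  by (intro space_smooth_sum space_smooth_partial) auto

subsection \<open>Uniform bounds from periodicity\<close>

text \<open>Coordinatewise reduction modulo \<open>L\<close> into a compact set, which turns continuity of periodic functions into
  uniform bounds.\<close>

definition cell_representative :: "real \<Rightarrow> real ^ 'n::finite \<Rightarrow> real ^ 'n" where
  "cell_representative L x = (\<chi> i. x $ i + real_of_int (- \<lfloor>x $ i / L\<rfloor>) * L)"

lemma cell_representative_mem: "0 < L \<Longrightarrow> cell_representative L x \<in> cbox 0 (\<chi> i. L)"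
  unfolding cell_representative_def mem_box_cart
proof (intro allI conjI)
  fix i assume L: "0 < L"
  show "0 $ i \<le> (\<chi> i. x $ i + real_of_int (- \<lfloor>x $ i / L\<rfloor>) * L) $ i"
    using floor_divide_lower[OF L, of "x $ i"] by simp
  show "(\<chi> i. x $ i + real_of_int (- \<lfloor>x $ i / L\<rfloor>) * L) $ i \<le> (\<chi> i. L) $ i"
    using floor_divide_upper[OF L, of "x $ i"] by (simp add: algebra_simps)
qed

lemma periodic_shift_lattice:
  fixes x :: "real ^ 'n::finite"
  assumes "periodic L u"
  shows "u (\<chi> i. x $ i + real_of_int (m i) * L) = u x"
proof -
  have "u (x + (\<Sum>i\<in>S. (real_of_int (m i) * L) *\<^sub>R axis i 1)) = u x" if "finite S" for S
    using that
  proof (induction S)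
    case (insert i S)
    have "x + (\<Sum>i\<in>insert i S. (real_of_int (m i) * L) *\<^sub>R axis i 1)
        = (x + (\<Sum>i\<in>S. (real_of_int (m i) * L) *\<^sub>R axis i 1)) + (real_of_int (m i) * L) *\<^sub>R axis i 1"
      using insert.hyps by (simp add: algebra_simps)
    then show ?case using insert.IH by (simp only: periodic_shift_int[OF assms])
  qed simp
  moreover have "(\<chi> i. x $ i + real_of_int (m i) * L) = x + (\<Sum>i\<in>UNIV. (real_of_int (m i) * L) *\<^sub>R axis i 1)"
    by (simp add: vec_eq_iff axis_def if_distrib cong: if_cong)
  ultimately show ?thesis by simp
qed

lemma periodic_cell_representative: "periodic L u \<Longrightarrow> u (cell_representative L x) = u x"
  unfolding cell_representative_def by (rule periodic_shift_lattice)

lemma periodic_bounded: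
  fixes u :: "real \<Rightarrow> real ^ 'n::finite \<Rightarrow> 'b::real_normed_vector"
  assumes L: "0 < L" and per: "\<And>t. t \<in> {0..T} \<Longrightarrow> periodic L (u t)"
    and c: "continuous_on ({0..T} \<times> UNIV) (\<lambda>(t, x). u t x)"
  shows "\<exists>B\<ge>0. \<forall>t\<in>{0..T}. \<forall>x. norm (u t x) \<le> B"
proof -
  have "compact ((\<lambda>(t, x). u t x) ` ({0..T} \<times> cbox 0 (\<chi> i. L)))"
    by (intro compact_continuous_image compact_Times compact_Icc compact_cbox continuous_on_subset[OF c]) auto
  from compact_imp_bounded[OF this]
  obtain B where "\<forall>z\<in>(\<lambda>(t, x). u t x) ` ({0..T} \<times> cbox 0 (\<chi> i. L)). norm z \<le> B"
    unfolding bounded_iff by blast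
  then have B: "norm (u t x) \<le> B" if "t \<in> {0..T}" "x \<in> cbox 0 (\<chi> i. L)" for t x
    using that by auto
  have "norm (u t x) \<le> max B 0" if "t \<in> {0..T}" for t x
    using B[OF that cell_representative_mem[OF L, of x]] periodic_cell_representative[OF per[OF that], of x]
    by simp
  then show ?thesis by (intro exI[of _ "max B 0"]) auto
qed

lemma periodic_uniform_modulus:
  fixes u :: "real \<Rightarrow> real ^ 'n::finite \<Rightarrow> 'b::real_normed_vector"
  assumes L: "0 < L" and per: "\<And>t. t \<in> {0..T} \<Longrightarrow> periodic L (u t)"
    and c: "continuous_on ({0..T} \<times> UNIV) (\<lambda>(t, x). u t x)" and e: "0 < e"
  shows "\<exists>\<delta>>0. \<forall>s\<in>{0..T}. \<forall>t\<in>{0..T}. \<bar>s - t\<bar> < \<delta> \<longrightarrow> (\<forall>x. norm (u s x - u t x) < e)"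
proof -
  have "uniformly_continuous_on ({0..T} \<times> cbox 0 (\<chi> i. L)) (\<lambda>(t, x). u t x)"
    by (intro compact_uniformly_continuous compact_Times compact_Icc compact_cbox continuous_on_subset[OF c]) auto
  then obtain \<delta> where \<delta>: "\<delta> > 0"
    "\<And>z z'. z \<in> {0..T} \<times> cbox 0 (\<chi> i. L) \<Longrightarrow> z' \<in> {0..T} \<times> cbox 0 (\<chi> i. L) \<Longrightarrow> dist z' z < \<delta> \<Longrightarrow>
      dist ((\<lambda>(t, x). u t x) z') ((\<lambda>(t, x). u t x) z) < e"
    unfolding uniformly_continuous_on_def using e by meson
  show ?thesis
  proof (intro exI[of _ \<delta>] conjI ballI impI allI)
    fix s t and x :: "real ^ 'n" assume st: "s \<in> {0..T}" "t \<in> {0..T}" "\<bar>s - t\<bar> < \<delta>"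
    define y :: "real ^ 'n" where "y = cell_representative L x"
    have y: "y \<in> cbox 0 (\<chi> i. L)" unfolding y_def by (rule cell_representative_mem[OF L])
    have "dist (u s y) (u t y) < e"
      using \<delta>(2)[of "(t, y)" "(s, y)"] st y by (simp add: dist_Pair_Pair dist_real_def)
    then show "norm (u s x - u t x) < e"
      using periodic_cell_representative[OF per, of _ x] st by (simp add: y_def dist_norm)
  qed (rule \<delta>(1))
qed

lemma space_smooth_bounded:
  fixes u :: "real \<Rightarrow> real ^ 'n::finite \<Rightarrow> 'b::real_normed_vector"
  assumes L: "0 < L" and per: "\<And>t. t \<in> {0..T} \<Longrightarrow> periodic L (u t)" and s: "space_smooth k T u"
  shows "\<exists>B\<ge>0. \<forall>ds. length ds \<le> k \<longrightarrow> (\<forall>t\<in>{0..T}. \<forall>x. norm (partials ds (u t) x) \<le> B)"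
proof -
  have "\<forall>ds. \<exists>B\<ge>0. length ds \<le> k \<longrightarrow> (\<forall>t\<in>{0..T}. \<forall>x. norm (partials ds (u t) x) \<le> B)"
  proof
    fix ds :: "'n list"
    show "\<exists>B\<ge>0. length ds \<le> k \<longrightarrow> (\<forall>t\<in>{0..T}. \<forall>x. norm (partials ds (u t) x) \<le> B)"
    proof (cases "length ds \<le> k")
      case True
      then show ?thesis
        using periodic_bounded[OF L periodic_partials[OF per] space_smooth_continuous[OF s True]] by auto
    qed auto
  qed
  then obtain B where B: "\<And>ds. 0 \<le> B ds"
    "\<And>ds t x. length ds \<le> k \<Longrightarrow> t \<in> {0..T} \<Longrightarrow> norm (partials ds (u t) x) \<le> B ds"
    by metis
  have fin: "finite {ds :: 'n list. length ds \<le> k}"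
    using finite_lists_length_le[of "UNIV :: 'n set" k] by simp
  show ?thesis
  proof (intro exI[of _ "\<Sum>ds\<in>{ds. length ds \<le> k}. B ds"] conjI allI impI ballI)
    show "0 \<le> (\<Sum>ds\<in>{ds. length ds \<le> k}. B ds)" using B by (intro sum_nonneg)
    fix ds :: "'n list" and t x assume "length ds \<le> k" "t \<in> {0..T}"
    then show "norm (partials ds (u t) x) \<le> (\<Sum>ds\<in>{ds. length ds \<le> k}. B ds)"
      using B(2)[of ds t x] member_le_sum[of ds "{ds. length ds \<le> k}" B] B(1) fin by fastforce
  qed
qed

subsection \<open>Time integrals\<close>

lemma partial_integral:
  fixes F :: "real \<Rightarrow> real ^ 'n::finite \<Rightarrow> 'b::euclidean_space"
  assumes d: "\<And>\<tau> x. \<tau> \<in> {a..b} \<Longrightarrow> has_partial i (F \<tau>) x"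
    and c: "continuous_on ({a..b} \<times> UNIV) (\<lambda>(\<tau>, x). F \<tau> x)"
    and c': "continuous_on ({a..b} \<times> UNIV) (\<lambda>(\<tau>, x). partial_deriv i (F \<tau>) x)"
  shows "has_partial i (\<lambda>x. integral {a..b} (\<lambda>\<tau>. F \<tau> x)) x"
    and "partial_deriv i (\<lambda>x. integral {a..b} (\<lambda>\<tau>. F \<tau> x)) x = integral {a..b} (\<lambda>\<tau>. partial_deriv i (F \<tau>) x)"
proof -
  have "((\<lambda>s. integral (cbox a b) (\<lambda>\<tau>. F \<tau> (x + s *\<^sub>R axis i 1))) has_vector_derivative
      integral (cbox a b) (\<lambda>\<tau>. partial_deriv i (F \<tau>) (x + 0 *\<^sub>R axis i 1))) (at 0 within UNIV)"
  proof (rule leibniz_rule_vector_derivative)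
    fix s \<tau> :: real assume "\<tau> \<in> cbox a b"
    then show "((\<lambda>s. F \<tau> (x + s *\<^sub>R axis i 1)) has_vector_derivative partial_deriv i (F \<tau>) (x + s *\<^sub>R axis i 1)) (at s within UNIV)"
      by (auto intro!: has_partial_line d)
  next
    fix s :: real
    show "(\<lambda>\<tau>. F \<tau> (x + s *\<^sub>R axis i 1)) integrable_on cbox a b"
      using continuous_on_time_slice[OF c order_refl]
      by (auto simp: cbox_interval intro!: integrable_continuous_interval)
  next
    have "continuous_on (UNIV \<times> cbox a b) ((\<lambda>(\<tau>, x). partial_deriv i (F \<tau>) x) \<circ> (\<lambda>(s, \<tau>). (\<tau>, x + s *\<^sub>R axis i 1)))"
      by (intro continuous_on_compose continuous_on_subset[OF c'])
         (auto simp: split_beta intro!: continuous_intros)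
    then show "continuous_on (UNIV \<times> cbox a b) (\<lambda>(s, \<tau>). partial_deriv i (F \<tau>) (x + s *\<^sub>R axis i 1))"
      by (simp add: o_def split_beta)
  qed auto
  then have "((\<lambda>s. integral {a..b} (\<lambda>\<tau>. F \<tau> (x + s *\<^sub>R axis i 1))) has_vector_derivative
      integral {a..b} (\<lambda>\<tau>. partial_deriv i (F \<tau>) x)) (at 0)"
    by (simp add: cbox_interval)
  from has_partialI[of "\<lambda>x. integral {a..b} (\<lambda>\<tau>. F \<tau> x)", OF this]
  show "has_partial i (\<lambda>x. integral {a..b} (\<lambda>\<tau>. F \<tau> x)) x"
    "partial_deriv i (\<lambda>x. integral {a..b} (\<lambda>\<tau>. F \<tau> x)) x = integral {a..b} (\<lambda>\<tau>. partial_deriv i (F \<tau>) x)"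
    by auto
qed

lemma continuous_on_time_integral:
  fixes F :: "real \<Rightarrow> real ^ 'n::finite \<Rightarrow> 'b::euclidean_space"
  assumes c: "continuous_on ({a..b} \<times> UNIV) (\<lambda>(\<tau>, x). F \<tau> x)"
  shows "continuous_on UNIV (\<lambda>x. integral {a..b} (\<lambda>\<tau>. F \<tau> x))"
proof -
  have "continuous_on (UNIV \<times> cbox a b) ((\<lambda>(\<tau>, x). F \<tau> x) \<circ> (\<lambda>(x, \<tau>). (\<tau>, x)))"
    by (intro continuous_on_compose continuous_on_subset[OF c]) (auto simp: split_beta intro!: continuous_intros)
  then have "continuous_on UNIV (\<lambda>x. integral (cbox a b) (\<lambda>\<tau>. F \<tau> x))"
    by (intro integral_continuous_on_param) (simp add: o_def split_beta)
  then show ?thesis by (simp add: cbox_interval)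
qed

lemma partials_time_integral:
  fixes F :: "real \<Rightarrow> real ^ 'n::finite \<Rightarrow> 'b::euclidean_space"
  assumes F: "space_smooth k T F" and ab: "0 \<le> a" "b \<le> T"
  shows "length ds \<le> k \<Longrightarrow> partials ds (\<lambda>x. integral {a..b} (\<lambda>\<tau>. F \<tau> x)) x = integral {a..b} (\<lambda>\<tau>. partials ds (F \<tau>) x)"
    and "length ds < k \<Longrightarrow> has_partial i (partials ds (\<lambda>x. integral {a..b} (\<lambda>\<tau>. F \<tau> x))) x"
proof -
  have sub: "{a..b} \<times> UNIV \<subseteq> {0..T} \<times> UNIV" using ab by auto
  have *: "partials ds (\<lambda>x. integral {a..b} (\<lambda>\<tau>. F \<tau> x)) = (\<lambda>x. integral {a..b} (\<lambda>\<tau>. partials ds (F \<tau>) x))"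
    if "length ds \<le> k" for ds
    using that
  proof (induction ds)
    case (Cons i ds)
    then have l: "length ds < k" by simp
    have IH: "partials ds (\<lambda>x. integral {a..b} (\<lambda>\<tau>. F \<tau> x)) = (\<lambda>x. integral {a..b} (\<lambda>\<tau>. partials ds (F \<tau>) x))"
      using Cons.IH l by simp
    show ?case
      unfolding partials_Cons IH
      using partial_integral(2)[of a b i "\<lambda>\<tau>. partials ds (F \<tau>)"] ab
        space_smooth_has_partial[OF F l]
        continuous_on_subset[OF space_smooth_continuous[OF F less_imp_le[OF l]] sub]
        continuous_on_subset[OF space_smooth_continuous[OF F Cons.prems] sub]
      by (intro ext) auto
  qed simp
  show "length ds \<le> k \<Longrightarrow> partials ds (\<lambda>x. integral {a..b} (\<lambda>\<tau>. F \<tau> x)) x = integral {a..b} (\<lambda>\<tau>. partials ds (F \<tau>) x)"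
    by (simp add: *)
  assume l: "length ds < k"
  then have l': "length (i # ds) \<le> k" by simp
  show "has_partial i (partials ds (\<lambda>x. integral {a..b} (\<lambda>\<tau>. F \<tau> x))) x"
    unfolding *[OF less_imp_le[OF l]]
    using partial_integral(1)[of a b i "\<lambda>\<tau>. partials ds (F \<tau>)"] ab
        space_smooth_has_partial[OF F l]
        continuous_on_subset[OF space_smooth_continuous[OF F less_imp_le[OF l]] sub]
        continuous_on_subset[OF space_smooth_continuous[OF F l'] sub]
    by auto
qed

subsection \<open>Data that are smooth in time and space\<close>

lemma spacetime_partials_space:
  "spacetime_partials T (map Some ds @ ds') u t = partials ds (spacetime_partials T ds' u t)"
  by (induction ds) auto

lemma spacetime_smooth_imp_space_smooth:
  assumes "spacetime_smooth K T u" "length ds' + k \<le> K"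
  shows "space_smooth k T (spacetime_partials T ds' u)"
  unfolding space_smooth_def spacetime_partials_space[symmetric]
  using assms unfolding spacetime_smooth_def by auto

definition time_deriv :: "real \<Rightarrow> (real \<Rightarrow> real ^ 'n::finite \<Rightarrow> 'b::real_normed_vector) \<Rightarrow> real \<Rightarrow> real ^ 'n \<Rightarrow> 'b" where
  "time_deriv T u = spacetime_partials T [None] u"

lemma spacetime_smooth_space:
  assumes "spacetime_smooth 3 T u"
  shows "space_smooth 3 T u" "space_smooth 2 T (time_deriv T u)"
  using spacetime_smooth_imp_space_smooth[OF assms, of "[]" 3]
    spacetime_smooth_imp_space_smooth[OF assms, of "[None]" 2] by (auto simp: time_deriv_def)

lemma has_time_deriv:
  assumes "spacetime_smooth 3 T u" "t \<in> {0..T}"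
  shows "((\<lambda>s. u s x) has_vector_derivative time_deriv T u t x) (at t within {0..T})"
proof -
  have "(\<lambda>s. spacetime_partials T [] u s x) differentiable (at t within {0..T})"
    using assms(1)[unfolded spacetime_smooth_def, THEN conjunct2, rule_format, of "[]" t x] assms(2) by simp
  then show ?thesis by (simp add: time_deriv_def vector_derivative_works)
qed

text \<open>Only the values on \<open>{0..T}\<close> are periodic, and the derivative within this interval only sees those.\<close>

lemma periodic_time_deriv:
  assumes "\<And>t. t \<in> {0..T} \<Longrightarrow> periodic L (u t)" "t \<in> {0..T}"
  shows "periodic L (time_deriv T u t)"
  unfolding periodic_def time_deriv_def
proof (intro allI)
  fix x i
  have eq: "u s (x + L *\<^sub>R axis i 1) = u s x" if "s \<in> {0..T}" for s
    using assms(1)[OF that] by (simp add: periodic_def)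
  have "((\<lambda>s. u s (x + L *\<^sub>R axis i 1)) has_vector_derivative D) (at t within {0..T}) \<longleftrightarrow>
      ((\<lambda>s. u s x) has_vector_derivative D) (at t within {0..T})" for D
    unfolding has_vector_derivative_def
    using has_derivative_transform[OF assms(2), of "\<lambda>s. u s x" "\<lambda>s. u s (x + L *\<^sub>R axis i 1)"]
      has_derivative_transform[OF assms(2), of "\<lambda>s. u s (x + L *\<^sub>R axis i 1)" "\<lambda>s. u s x"] eq
    by auto
  then have "vector_derivative (\<lambda>s. u s (x + L *\<^sub>R axis i 1)) (at t within {0..T})
      = vector_derivative (\<lambda>s. u s x) (at t within {0..T})"
    unfolding vector_derivative_def by simp
  then show "spacetime_partials T [None] u t (x + L *\<^sub>R axis i 1) = spacetime_partials T [None] u t x"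
    by simp
qed

section \<open>Square integrable periodic fields\<close>

lemma C1_fieldD:
  assumes "C1_field u"
  shows "continuous_on UNIV u" "has_partial i u x" "continuous_on UNIV (partial_deriv i u)"
  using assms by (auto simp: C1_field_def)

lemma C1_field_translate: "C1_field u \<Longrightarrow> C1_field (\<lambda>x. u (x + c))"
  unfolding C1_field_def
proof (intro conjI allI)
  assume u: "continuous_on UNIV u \<and> (\<forall>i. (\<forall>x. has_partial i u x) \<and> continuous_on UNIV (partial_deriv i u))"
  have c: "continuous_on UNIV (\<lambda>x. x + c)" by (intro continuous_intros)
  show "continuous_on UNIV (\<lambda>x. u (x + c))"
    using continuous_on_compose2[OF _ c, of UNIV u] u by auto
  fix i
  have "partial_deriv i (\<lambda>x. u (x + c)) = (\<lambda>x. partial_deriv i u (x + c))"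
    by (rule ext) (rule partial_translate)
  then show "continuous_on UNIV (partial_deriv i (\<lambda>x. u (x + c)))"
    using continuous_on_compose2[OF _ c, of UNIV "partial_deriv i u"] u by auto
  show "has_partial i (\<lambda>x. u (x + c)) x" for x using u by (simp add: partial_translate)
qed

lemma C1_field_bilinear:
  assumes B: "bounded_bilinear B" and "C1_field u" "C1_field w"
  shows "C1_field (\<lambda>x. B (u x) (w x))"
  unfolding C1_field_def
proof (intro conjI allI)
  note c = bounded_bilinear.continuous_on[OF B]
  show "continuous_on UNIV (\<lambda>x. B (u x) (w x))"
    using assms by (intro c) (auto dest: C1_fieldD)
  fix i
  have "partial_deriv i (\<lambda>x. B (u x) (w x)) = (\<lambda>x. B (u x) (partial_deriv i w x) + B (partial_deriv i u x) (w x))"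
    using assms by (intro ext partial_bilinear(2)[OF B]) (auto dest: C1_fieldD)
  then show "continuous_on UNIV (partial_deriv i (\<lambda>x. B (u x) (w x)))"
    using assms by (auto intro!: continuous_intros c dest: C1_fieldD)
  show "has_partial i (\<lambda>x. B (u x) (w x)) x" for x
    using assms by (intro partial_bilinear(1)[OF B]) (auto dest: C1_fieldD)
qed

lemma C1_field_linear:
  assumes B: "bounded_linear F" and "C1_field u"
  shows "C1_field (\<lambda>x. F (u x))"
  unfolding C1_field_def
proof (intro conjI allI)
  note c = bounded_linear.continuous_on[OF B]
  show "continuous_on UNIV (\<lambda>x. F (u x))"
    using assms by (intro c) (auto dest: C1_fieldD)
  fix i
  have "partial_deriv i (\<lambda>x. F (u x)) = (\<lambda>x. F (partial_deriv i u x))"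
    using assms by (intro ext partial_bounded_linear(2)[OF B]) (auto dest: C1_fieldD)
  then show "continuous_on UNIV (partial_deriv i (\<lambda>x. F (u x)))"
    using assms by (auto intro!: c dest: C1_fieldD)
  show "has_partial i (\<lambda>x. F (u x)) x" for x
    using assms by (intro partial_bounded_linear(1)[OF B]) (auto dest: C1_fieldD)
qed

lemma C1_field_add:
  assumes "C1_field u" "C1_field w"
  shows "C1_field (\<lambda>x. u x + w x)"
  unfolding C1_field_def
proof (intro conjI allI)
  show "continuous_on UNIV (\<lambda>x. u x + w x)"
    using assms by (intro continuous_intros) (auto dest: C1_fieldD)
  fix i
  have "partial_deriv i (\<lambda>x. u x + w x) = (\<lambda>x. partial_deriv i u x + partial_deriv i w x)"
    using assms by (intro ext partial_add(2)) (auto dest: C1_fieldD)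
  then show "continuous_on UNIV (partial_deriv i (\<lambda>x. u x + w x))"
    using assms by (auto intro!: continuous_intros dest: C1_fieldD)
  show "has_partial i (\<lambda>x. u x + w x) x" for x
    using assms by (intro partial_add(1)) (auto dest: C1_fieldD)
qed

lemma C1_field_const: "C1_field (\<lambda>_. c)"
  unfolding C1_field_def
proof (intro conjI allI)
  fix i
  have "partial_deriv i (\<lambda>_. c) = (\<lambda>_. 0)" by (rule ext) simp
  then show "continuous_on UNIV (partial_deriv i (\<lambda>_. c))" by simp
qed auto

lemma C1_field_sum:
  assumes "finite S" "\<And>j. j \<in> S \<Longrightarrow> C1_field (u j)"
  shows "C1_field (\<lambda>x. \<Sum>j\<in>S. u j x)"
  using assms by (induction S) (auto intro: C1_field_add C1_field_const)

lemma C1_field_diff: "C1_field u \<Longrightarrow> C1_field w \<Longrightarrow> C1_field (\<lambda>x. u x - w x)"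
  using C1_field_add[of u "\<lambda>x. (-1) *\<^sub>R w x"] C1_field_linear[OF bounded_linear_scaleR_right, of w "-1"]
  by simp

lemma gradient_continuous: "C1_field \<psi> \<Longrightarrow> continuous_on UNIV (gradient \<psi>)"
  unfolding gradient_def by (intro continuous_on_vec_lambda) (auto dest: C1_fieldD)

lemma periodic_gradient: "periodic L \<psi> \<Longrightarrow> periodic L (gradient \<psi>)"
  using periodic_partial[of L \<psi>] unfolding periodic_def gradient_def by simp

lemma gradient_translate: "gradient (\<lambda>x. \<psi> (x + c)) x = gradient \<psi> (x + c)"
  by (simp add: gradient_def partial_translate)

lemma L2_periodic_continuous:
  assumes "continuous_on UNIV u" "periodic L u"
  shows "L2_periodic L u"
  unfolding L2_periodic_def
  using assms by (auto intro!: borel_measurable_continuous_onI set_integrable_cell_continuous continuous_intros)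

lemma L2_inner_integrable:
  assumes "L2_periodic L u" "L2_periodic L w"
  shows "set_integrable lborel (cell L) (\<lambda>x. u x \<bullet> w x)"
proof -
  have [measurable]: "u \<in> borel_measurable borel" "w \<in> borel_measurable borel"
    using assms by (auto simp: L2_periodic_def)
  have i: "set_integrable lborel (cell L) (\<lambda>x. (norm (u x))\<^sup>2 + (norm (w x))\<^sup>2)"
    using assms by (intro set_integral_add) (auto simp: L2_periodic_def)
  show ?thesis
  proof (rule set_integrable_bound[OF i])
    show "set_borel_measurable lborel (cell L) (\<lambda>x. u x \<bullet> w x)"
      unfolding set_borel_measurable_def by measurable
    have "norm (u x \<bullet> w x) \<le> norm ((norm (u x))\<^sup>2 + (norm (w x))\<^sup>2)" for x
    proof -
      have "\<bar>u x \<bullet> w x\<bar> \<le> norm (u x) * norm (w x)" by (rule Cauchy_Schwarz_ineq2)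
      also have "\<dots> \<le> (norm (u x))\<^sup>2 + (norm (w x))\<^sup>2"
        using sum_squares_bound[of "norm (u x)" "norm (w x)"]
          mult_nonneg_nonneg[OF norm_ge_zero[of "u x"] norm_ge_zero[of "w x"]] by linarith
      finally show ?thesis by simp
    qed
    then show "AE x in lborel. x \<in> cell L \<longrightarrow> norm (u x \<bullet> w x) \<le> norm ((norm (u x))\<^sup>2 + (norm (w x))\<^sup>2)"
      by simp
  qed
qed

lemma L2_periodic_add:
  assumes "L2_periodic L u" "L2_periodic L w"
  shows "L2_periodic L (\<lambda>x. u x + w x)"
  unfolding L2_periodic_def
proof (intro conjI)
  show "(\<lambda>x. u x + w x) \<in> borel_measurable borel" using assms by (auto simp: L2_periodic_def)
  show "periodic L (\<lambda>x. u x + w x)" using assms by (auto simp: L2_periodic_def intro: periodic_compose2)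
  have "(norm (u x + w x))\<^sup>2 = (norm (u x))\<^sup>2 + 2 * (u x \<bullet> w x) + (norm (w x))\<^sup>2" for x
    by (simp add: power2_norm_eq_inner inner_add inner_commute)
  moreover have "set_integrable lborel (cell L) (\<lambda>x. (norm (u x))\<^sup>2 + 2 * (u x \<bullet> w x) + (norm (w x))\<^sup>2)"
    using assms L2_inner_integrable[OF assms]
    by (intro set_integral_add set_integrable_mult_right) (auto simp: L2_periodic_def)
  ultimately show "set_integrable lborel (cell L) (\<lambda>x. (norm (u x + w x))\<^sup>2)" by simp
qed

lemma L2_periodic_scaleR:
  assumes "L2_periodic L u"
  shows "L2_periodic L (\<lambda>x. c *\<^sub>R u x)"
  using assms unfolding L2_periodic_def
  by (auto simp: power_mult_distrib periodic_def intro!: borel_measurable_scaleR set_integrable_mult_right)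

lemma L2_divergence_free_add:
  assumes "L2_divergence_free L u" "L2_divergence_free L w"
  shows "L2_divergence_free L (\<lambda>x. u x + w x)"
  unfolding L2_divergence_free_def
proof (intro conjI allI impI)
  show "L2_periodic L (\<lambda>x. u x + w x)" using assms by (auto simp: L2_divergence_free_def intro: L2_periodic_add)
  fix \<psi> :: "real ^ 'a \<Rightarrow> real" assume \<psi>: "C1_field \<psi> \<and> periodic L \<psi>"
  then have g: "L2_periodic L (gradient \<psi>)"
    by (auto intro: L2_periodic_continuous gradient_continuous periodic_gradient)
  show "(LINT x:cell L|lborel. (u x + w x) \<bullet> gradient \<psi> x) = 0"
    using assms \<psi> L2_inner_integrable[OF _ g]
    unfolding inner_add_left L2_divergence_free_def by (subst set_integral_add(2)) auto
qed

lemma L2_divergence_free_scaleR: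
  assumes "L2_divergence_free L u"
  shows "L2_divergence_free L (\<lambda>x. c *\<^sub>R u x)"
  using assms unfolding L2_divergence_free_def by (auto intro: L2_periodic_scaleR)

lemma L2_divergence_free_zero: "L2_divergence_free L (\<lambda>x. 0)"
  unfolding L2_divergence_free_def
  by (auto intro!: L2_periodic_continuous simp: periodic_def set_lebesgue_integral_def)

lemma L2_divergence_free_sum:
  assumes "finite S" "\<And>j. j \<in> S \<Longrightarrow> L2_divergence_free L (u j)"
  shows "L2_divergence_free L (\<lambda>x. \<Sum>j\<in>S. u j x)"
  using assms by (induction S) (auto intro: L2_divergence_free_add L2_divergence_free_zero)

lemma L2_divergence_free_diff:
  "L2_divergence_free L u \<Longrightarrow> L2_divergence_free L w \<Longrightarrow> L2_divergence_free L (\<lambda>x. u x - w x)"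
  using L2_divergence_free_add[of L u "\<lambda>x. (-1) *\<^sub>R w x"] L2_divergence_free_scaleR[of L w "-1"] by simp

lemma integration_by_parts_cell:
  fixes a b :: "real ^ 'n::finite \<Rightarrow> real"
  assumes L: "0 < L" and a: "C1_field a" "periodic L a" and b: "C1_field b" "periodic L b"
  shows "(LINT x:cell L|lborel. a x * partial_deriv i b x) = - (LINT x:cell L|lborel. partial_deriv i a x * b x)"
proof -
  have d: "partial_deriv i (\<lambda>x. a x * b x) = (\<lambda>x. a x * partial_deriv i b x + partial_deriv i a x * b x)"
    using a b by (intro ext partial_mult(2)) (auto dest: C1_fieldD)
  have c1: "continuous_on UNIV (\<lambda>x. a x * partial_deriv i b x)" "continuous_on UNIV (\<lambda>x. partial_deriv i a x * b x)"
    by (intro continuous_intros C1_fieldD(1)[OF a(1)] C1_fieldD(3)[OF a(1)] C1_fieldD(1)[OF b(1)] C1_fieldD(3)[OF b(1)])+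
  then have c: "continuous_on UNIV (partial_deriv i (\<lambda>x. a x * b x))"
    unfolding d by (rule continuous_on_add)
  have "(LINT x:cell L|lborel. partial_deriv i (\<lambda>x. a x * b x) x) = 0"
    using a b by (intro integral_partial_deriv_cell L set_integrable_cell_continuous c
        borel_measurable_continuous_onI partial_mult(1)) (auto dest: C1_fieldD intro: periodic_compose2)
  then show ?thesis
    unfolding d using set_integrable_cell_continuous[OF c1(1), of L] set_integrable_cell_continuous[OF c1(2), of L]
    by (subst (asm) set_integral_add(2)) auto
qed

lemma set_integral_sum_cell:
  fixes u :: "'i \<Rightarrow> real ^ 'n::finite \<Rightarrow> real"
  assumes "\<And>i. i \<in> S \<Longrightarrow> set_integrable lborel (cell L) (u i)"
  shows "(LINT x:cell L|lborel. (\<Sum>i\<in>S. u i x)) = (\<Sum>i\<in>S. LINT x:cell L|lborel. u i x)"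
  using assms unfolding set_lebesgue_integral_def set_integrable_def
  by (simp add: scaleR_sum_right sum_distrib_left)

lemma L2_divergence_free_classical:
  fixes u :: "real ^ 'n::finite \<Rightarrow> real ^ 'n"
  assumes L: "0 < L" and u: "C1_field u" "periodic L u" and div: "\<And>x. divergence u x = 0"
  shows "L2_divergence_free L u"
  unfolding L2_divergence_free_def
proof (intro conjI allI impI)
  show "L2_periodic L u" using u by (intro L2_periodic_continuous) (auto dest: C1_fieldD)
  fix \<psi> :: "real ^ 'n \<Rightarrow> real" assume \<psi>: "C1_field \<psi> \<and> periodic L \<psi>"
  have ui: "C1_field (\<lambda>x. u x $ i)" "periodic L (\<lambda>x. u x $ i)" for i
    using u by (auto intro: C1_field_linear[OF bounded_linear_vec_nth] periodic_compose)
  have int: "set_integrable lborel (cell L) (\<lambda>x. u x $ i * partial_deriv i \<psi> x)"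
    "set_integrable lborel (cell L) (\<lambda>x. partial_deriv i (\<lambda>x. u x $ i) x * \<psi> x)" for i
    using \<psi> by (auto intro!: set_integrable_cell_continuous continuous_on_mult C1_fieldD(1)[OF ui(1)]
        C1_fieldD(3)[OF ui(1)] intro: C1_fieldD)
  have "(LINT x:cell L|lborel. u x \<bullet> gradient \<psi> x)
      = (LINT x:cell L|lborel. (\<Sum>i\<in>UNIV. u x $ i * partial_deriv i \<psi> x))"
    by (simp add: inner_vec_def gradient_def)
  also have "\<dots> = (\<Sum>i\<in>UNIV. LINT x:cell L|lborel. u x $ i * partial_deriv i \<psi> x)"
    using int by (intro set_integral_sum_cell)
  also have "\<dots> = (\<Sum>i\<in>UNIV. - (LINT x:cell L|lborel. partial_deriv i (\<lambda>x. u x $ i) x * \<psi> x))"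
    using ui \<psi> by (intro sum.cong refl integration_by_parts_cell[OF L]) auto
  also have "\<dots> = - (LINT x:cell L|lborel. (\<Sum>i\<in>UNIV. partial_deriv i (\<lambda>x. u x $ i) x * \<psi> x))"
    using int by (subst set_integral_sum_cell) (auto simp: sum_negf)
  also have "(\<lambda>x. \<Sum>i\<in>UNIV. partial_deriv i (\<lambda>x. u x $ i) x * \<psi> x) = (\<lambda>x. 0)"
  proof
    fix x
    have "partial_deriv i (\<lambda>x. u x $ i) x = partial_deriv i u x $ i" for i
      using u by (intro partial_nth(2)) (auto dest: C1_fieldD)
    then show "(\<Sum>i\<in>UNIV. partial_deriv i (\<lambda>x. u x $ i) x * \<psi> x) = 0"
      using div[of x] by (simp add: divergence_def sum_distrib_right[symmetric])
  qed
  finally show "(LINT x:cell L|lborel. u x \<bullet> gradient \<psi> x) = 0" by (simp add: set_lebesgue_integral_def)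
qed

lemma L2_divergence_free_translate:
  fixes u :: "real ^ 'n::finite \<Rightarrow> real ^ 'n"
  assumes L: "0 < L" and u: "continuous_on UNIV u" "L2_divergence_free L u"
    and \<psi>: "C1_field \<psi>" "periodic L \<psi>"
  shows "(LINT x:cell L|lborel. u (x + c) \<bullet> gradient \<psi> x) = 0"
proof -
  have per: "periodic L u" using u by (simp add: L2_divergence_free_def L2_periodic_def)
  define \<eta> where "\<eta> x = \<psi> (x + (- c))" for x
  have \<eta>: "C1_field \<eta>" "periodic L \<eta>"
    unfolding \<eta>_def by (rule C1_field_translate[OF \<psi>(1)], rule periodic_translate[OF \<psi>(2)])
  have g: "gradient \<eta> (x + c) = gradient \<psi> x" for x
    unfolding \<eta>_def gradient_translate by simp
  have "continuous_on UNIV (\<lambda>x. u x \<bullet> gradient \<eta> x)"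
    using u(1) gradient_continuous[OF \<eta>(1)] by (intro continuous_intros)
  then have "(LINT x:cell L|lborel. u (x + c) \<bullet> gradient \<eta> (x + c)) = (LINT x:cell L|lborel. u x \<bullet> gradient \<eta> x)"
    by (intro cell_integral_translate(2)[OF L] borel_measurable_continuous_onI set_integrable_cell_continuous
        periodic_compose2[OF per periodic_gradient[OF \<eta>(2)]])
  also have "\<dots> = 0" using u(2) \<eta> by (simp add: L2_divergence_free_def)
  finally show ?thesis by (simp add: g)
qed

lemma set_integral_cell_abs_le:
  fixes u w :: "real ^ 'n::finite \<Rightarrow> real"
  assumes "set_integrable lborel (cell L) u" "set_integrable lborel (cell L) w"
    "\<And>x. \<bar>u x\<bar> \<le> w x"
  shows "\<bar>LINT x:cell L|lborel. u x\<bar> \<le> (LINT x:cell L|lborel. w x)"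
proof -
  have "\<bar>LINT x:cell L|lborel. u x\<bar> \<le> (\<integral>x. \<bar>indicator (cell L) x *\<^sub>R u x\<bar> \<partial>lborel)"
    unfolding set_lebesgue_integral_def by (rule integral_abs_bound)
  also have "\<dots> \<le> (LINT x:cell L|lborel. w x)"
    unfolding set_lebesgue_integral_def
    using assms by (intro integral_mono) (auto simp: set_integrable_def indicator_def)
  finally show ?thesis .
qed

text \<open>Translates of a divergence-free field are divergence-free, hence so are difference quotients and
  their uniform limit; this spares the interchange of the order of differentiation.\<close>

lemma partial_deriv_orthogonal_gradient:
  fixes u :: "real ^ 'n::finite \<Rightarrow> real ^ 'n"
  assumes L: "0 < L" and u: "continuous_on UNIV u" "L2_divergence_free L u"
    and cd: "continuous_on UNIV (partial_deriv i u)"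
    and approx: "\<And>s x. norm (u (x + s *\<^sub>R axis i 1) - u x - s *\<^sub>R partial_deriv i u x) \<le> B * s\<^sup>2"
  shows "L2_divergence_free L (partial_deriv i u)"
  unfolding L2_divergence_free_def
proof (intro conjI allI impI)
  have per: "periodic L u" using u by (simp add: L2_divergence_free_def L2_periodic_def)
  show "L2_periodic L (partial_deriv i u)"
    by (intro L2_periodic_continuous cd periodic_partial per)
  fix \<psi> :: "real ^ 'n \<Rightarrow> real" assume \<psi>: "C1_field \<psi> \<and> periodic L \<psi>"
  define I where "I = (LINT x:cell L|lborel. partial_deriv i u x \<bullet> gradient \<psi> x)"
  define G where "G = (LINT x:cell L|lborel. norm (gradient \<psi> x))"
  have cg: "continuous_on UNIV (gradient \<psi>)" using \<psi> by (auto intro: gradient_continuous)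
  have cu: "continuous_on UNIV (\<lambda>x. u (x + c))" for c
    by (rule continuous_on_compose2[OF u(1)]) (auto intro!: continuous_intros)
  have bound: "\<bar>s * I\<bar> \<le> B * s\<^sup>2 * G" for s
  proof -
    define r where "r x = u (x + s *\<^sub>R axis i 1) - u x - s *\<^sub>R partial_deriv i u x" for x
    have c: "continuous_on UNIV (\<lambda>x. u (x + s *\<^sub>R axis i 1) \<bullet> gradient \<psi> x)"
      "continuous_on UNIV (\<lambda>x. u x \<bullet> gradient \<psi> x)"
      "continuous_on UNIV (\<lambda>x. partial_deriv i u x \<bullet> gradient \<psi> x)"
      "continuous_on UNIV (\<lambda>x. r x \<bullet> gradient \<psi> x)"
      "continuous_on UNIV (\<lambda>x. B * s\<^sup>2 * norm (gradient \<psi> x))"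
      using cu u(1) cd cg unfolding r_def by (auto intro!: continuous_intros)
    note int = c[THEN set_integrable_cell_continuous, of L]
    have "(LINT x:cell L|lborel. r x \<bullet> gradient \<psi> x)
        = (LINT x:cell L|lborel. u (x + s *\<^sub>R axis i 1) \<bullet> gradient \<psi> x)
          - (LINT x:cell L|lborel. u x \<bullet> gradient \<psi> x) - s * I"
      unfolding r_def I_def inner_diff_left inner_scaleR_left using int
      by (subst set_integral_diff(2), auto)+
    also have "\<dots> = - (s * I)"
      using L2_divergence_free_translate[OF L u, of \<psi>] u(2) \<psi> by (simp add: L2_divergence_free_def)
    finally have "\<bar>s * I\<bar> = \<bar>LINT x:cell L|lborel. r x \<bullet> gradient \<psi> x\<bar>" by simp
    also have "\<dots> \<le> (LINT x:cell L|lborel. B * s\<^sup>2 * norm (gradient \<psi> x))"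
    proof (rule set_integral_cell_abs_le)
      fix x
      have "\<bar>r x \<bullet> gradient \<psi> x\<bar> \<le> norm (r x) * norm (gradient \<psi> x)" by (rule Cauchy_Schwarz_ineq2)
      also have "\<dots> \<le> B * s\<^sup>2 * norm (gradient \<psi> x)"
        unfolding r_def using approx by (intro mult_right_mono) auto
      finally show "\<bar>r x \<bullet> gradient \<psi> x\<bar> \<le> B * s\<^sup>2 * norm (gradient \<psi> x)" .
    qed (use int in auto)
    finally show ?thesis by (simp add: G_def)
  qed
  have "\<bar>I\<bar> \<le> s * (B * G)" if s: "s > 0" for s
  proof -
    have "s * \<bar>I\<bar> \<le> s * (s * (B * G))" using bound[of s] s by (simp add: abs_mult power2_eq_square ac_simps)
    then show ?thesis using s by simp
  qed
  then have ev: "\<forall>\<^sub>F s in at_right 0. \<bar>I\<bar> \<le> s * (B * G)"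
    using eventually_at_right_less[of "0 :: real"] by (auto elim: eventually_mono)
  have "((\<lambda>s. s * (B * G)) \<longlongrightarrow> 0) (at_right 0)"
    by (intro tendsto_mult_left_zero tendsto_ident_at)
  from tendsto_lowerbound[OF this ev] have "\<bar>I\<bar> \<le> 0" by simp
  then show "(LINT x:cell L|lborel. partial_deriv i u x \<bullet> gradient \<psi> x) = 0" by (simp add: I_def)
qed

section \<open>The periodic Poisson equation for trigonometric polynomials\<close>

text \<open>The dual lattice, that is the wave vectors of \<open>L\<close>-periodic plane waves.\<close>

definition torus_freqs :: "real \<Rightarrow> (real ^ 'n::finite) set" where
  "torus_freqs L = {\<kappa>. \<forall>i. \<exists>m::int. \<kappa> $ i * L = 2 * pi * m}"

lemma torus_freqs_simps:
  fixes \<kappa> \<kappa>' :: "real ^ 'n::finite"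
  shows "(0 :: real ^ 'n) \<in> torus_freqs L"
  "\<kappa> \<in> torus_freqs L \<Longrightarrow> \<kappa>' \<in> torus_freqs L \<Longrightarrow> \<kappa> + \<kappa>' \<in> torus_freqs L"
  "\<kappa> \<in> torus_freqs L \<Longrightarrow> \<kappa>' \<in> torus_freqs L \<Longrightarrow> \<kappa> - \<kappa>' \<in> torus_freqs L"
proof -
  show "(0 :: real ^ 'n) \<in> torus_freqs L" by (auto simp: torus_freqs_def intro: exI[of _ "0 :: int"])
next
  assume k: "\<kappa> \<in> torus_freqs L" "\<kappa>' \<in> torus_freqs L"
  obtain m m' :: "'n \<Rightarrow> int" where m: "\<And>i. \<kappa> $ i * L = 2 * pi * m i" "\<And>i. \<kappa>' $ i * L = 2 * pi * m' i"
    using k[unfolded torus_freqs_def mem_Collect_eq, THEN choice] by blast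
  show "\<kappa> + \<kappa>' \<in> torus_freqs L" "\<kappa> - \<kappa>' \<in> torus_freqs L"
    unfolding torus_freqs_def
  proof (safe)
    fix i
    show "\<exists>n::int. (\<kappa> + \<kappa>') $ i * L = 2 * pi * n"
      by (rule exI[of _ "m i + m' i"]) (simp add: m distrib_left distrib_right)
    show "\<exists>n::int. (\<kappa> - \<kappa>') $ i * L = 2 * pi * n"
      by (rule exI[of _ "m i - m' i"]) (simp add: m right_diff_distrib left_diff_distrib)
  qed
qed

text \<open>Real waves with a phase instead of complex exponentials: products and derivatives of such waves are
  again waves, the derivative shifting the phase by \<open>pi / 2\<close>.\<close>

inductive trig_poly :: "real \<Rightarrow> (real ^ 'n::finite \<Rightarrow> real) \<Rightarrow> bool" for L where
  wave: "\<kappa> \<in> torus_freqs L \<Longrightarrow> trig_poly L (\<lambda>x. c * cos (\<kappa> \<bullet> x + \<theta>))"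
| add: "trig_poly L f \<Longrightarrow> trig_poly L g \<Longrightarrow> trig_poly L (\<lambda>x. f x + g x)"

lemma trig_poly_const: "trig_poly L (\<lambda>x. c)"
  using trig_poly.wave[OF torus_freqs_simps(1), of L c 0] by simp

lemma trig_poly_wave_mult:
  assumes "\<kappa> \<in> torus_freqs L" "trig_poly L g"
  shows "trig_poly L (\<lambda>x. (c * cos (\<kappa> \<bullet> x + \<theta>)) * g x)"
  using assms(2)
proof induction
  case (wave \<kappa>' c' \<theta>')
  have half: "c * c' * ((A + B) / 2) = (c * c' / 2) * A + (c * c' / 2) * B" for A B :: real
    by (simp add: field_simps)
  have eq: "(c * cos (\<kappa> \<bullet> x + \<theta>)) * (c' * cos (\<kappa>' \<bullet> x + \<theta>'))
      = (c * c' / 2) * cos ((\<kappa> - \<kappa>') \<bullet> x + (\<theta> - \<theta>')) + (c * c' / 2) * cos ((\<kappa> + \<kappa>') \<bullet> x + (\<theta> + \<theta>'))" for x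
  proof -
    have "(c * cos (\<kappa> \<bullet> x + \<theta>)) * (c' * cos (\<kappa>' \<bullet> x + \<theta>'))
        = c * c' * (cos (\<kappa> \<bullet> x + \<theta>) * cos (\<kappa>' \<bullet> x + \<theta>'))" by simp
    also have "\<dots> = (c * c' / 2) * cos ((\<kappa> \<bullet> x + \<theta>) - (\<kappa>' \<bullet> x + \<theta>')) + (c * c' / 2) * cos ((\<kappa> \<bullet> x + \<theta>) + (\<kappa>' \<bullet> x + \<theta>'))"
      unfolding cos_times_cos half ..
    moreover have "(\<kappa> \<bullet> x + \<theta>) - (\<kappa>' \<bullet> x + \<theta>') = (\<kappa> - \<kappa>') \<bullet> x + (\<theta> - \<theta>')"
      "(\<kappa> \<bullet> x + \<theta>) + (\<kappa>' \<bullet> x + \<theta>') = (\<kappa> + \<kappa>') \<bullet> x + (\<theta> + \<theta>')"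
      by (simp_all add: inner_diff_left inner_add_left)
    ultimately show ?thesis by simp
  qed
  show ?case
    unfolding eq by (intro trig_poly.intros torus_freqs_simps assms(1) wave)
next
  case (add f g)
  then show ?case by (auto simp: distrib_left intro: trig_poly.add)
qed

lemma trig_poly_mult:
  assumes "trig_poly L f" "trig_poly L g"
  shows "trig_poly L (\<lambda>x. f x * g x)"
  using assms(1)
proof induction
  case (wave \<kappa> c \<theta>)
  then show ?case by (rule trig_poly_wave_mult[OF _ assms(2)])
next
  case (add f g)
  then show ?case by (auto simp: distrib_right intro: trig_poly.add)
qed

lemma has_partial_wave:
  "has_partial i (\<lambda>x. c * cos (\<kappa> \<bullet> x + \<theta>)) x"
  "partial_deriv i (\<lambda>x. c * cos (\<kappa> \<bullet> x + \<theta>)) = (\<lambda>x. (c * \<kappa> $ i) * cos (\<kappa> \<bullet> x + (\<theta> + pi / 2)))"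
proof -
  have d: "((\<lambda>s. c * cos (\<kappa> \<bullet> (x + s *\<^sub>R axis i 1) + \<theta>)) has_vector_derivative
      (c * \<kappa> $ i) * cos (\<kappa> \<bullet> x + (\<theta> + pi / 2))) (at 0)" for x
  proof -
    have "cos (\<kappa> \<bullet> x + (\<theta> + pi / 2)) = - sin (\<kappa> \<bullet> x + \<theta>)"
      unfolding add.assoc[symmetric] cos_add by simp
    then show ?thesis
      by (auto simp: inner_add_right inner_axis has_real_derivative_iff_has_vector_derivative[symmetric]
          intro!: derivative_eq_intros)
  qed
  show "has_partial i (\<lambda>x. c * cos (\<kappa> \<bullet> x + \<theta>)) x"
    by (rule has_partialI(1)) (rule d)
  show "partial_deriv i (\<lambda>x. c * cos (\<kappa> \<bullet> x + \<theta>)) = (\<lambda>x. (c * \<kappa> $ i) * cos (\<kappa> \<bullet> x + (\<theta> + pi / 2)))"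
    by (rule ext, rule has_partialI(2)) (rule d)
qed

lemma trig_poly_partial:
  assumes "trig_poly L f"
  shows "(\<forall>x. has_partial i f x) \<and> trig_poly L (partial_deriv i f)"
  using assms
proof induction
  case (wave \<kappa> c \<theta>)
  then show ?case by (auto simp: has_partial_wave intro: trig_poly.wave)
next
  case (add f g)
  then have "partial_deriv i (\<lambda>x. f x + g x) = (\<lambda>x. partial_deriv i f x + partial_deriv i g x)"
    by (intro ext partial_add(2)) auto
  then show ?case using add by (auto intro: trig_poly.add partial_add(1))
qed

lemma partial_deriv_add_fun:
  assumes "\<And>x. has_partial i f x" "\<And>x. has_partial i g x"
  shows "partial_deriv i (\<lambda>x. f x + g x) = (\<lambda>x. partial_deriv i f x + partial_deriv i g x)"
  using assms by (intro ext partial_add(2)) auto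

lemma trig_poly_partial_commute:
  assumes "trig_poly L f"
  shows "partial_deriv j (partial_deriv i f) = partial_deriv i (partial_deriv j f)"
  using assms
proof induction
  case (wave \<kappa> c \<theta>)
  then show ?case unfolding has_partial_wave by (simp add: ac_simps)
next
  case (add f g)
  then show ?case
    using trig_poly_partial[OF add(1)] trig_poly_partial[OF add(2)]
      trig_poly_partial[OF trig_poly_partial[OF add(1), THEN conjunct2]]
      trig_poly_partial[OF trig_poly_partial[OF add(2), THEN conjunct2]]
    by (simp add: partial_deriv_add_fun)
qed

lemma trig_poly_continuous: "trig_poly L f \<Longrightarrow> continuous_on UNIV f"
  by (induction rule: trig_poly.induct) (auto intro!: continuous_intros)

lemma trig_poly_periodic: "trig_poly L f \<Longrightarrow> periodic L f"
proof (induction rule: trig_poly.induct)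
  case (wave \<kappa> c \<theta>)
  have "cos (\<kappa> \<bullet> (x + L *\<^sub>R axis i 1) + \<theta>) = cos (\<kappa> \<bullet> x + \<theta>)" for x i
  proof -
    from wave obtain m :: int where "\<kappa> $ i * L = 2 * pi * m" by (auto simp: torus_freqs_def)
    then have "\<kappa> \<bullet> (x + L *\<^sub>R axis i 1) + \<theta> = (\<kappa> \<bullet> x + \<theta>) + 2 * pi * m"
      by (simp add: inner_add_right inner_axis mult.commute)
    then show ?thesis using sin_cos_eq_iff[of "\<kappa> \<bullet> (x + L *\<^sub>R axis i 1) + \<theta>" "\<kappa> \<bullet> x + \<theta>"] by blast
  qed
  then show ?case by (simp add: periodic_def)
qed (auto intro: periodic_compose2)

lemma trig_poly_C1:
  assumes "trig_poly L f"
  shows "C1_field f"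
  unfolding C1_field_def
  using trig_poly_partial[OF assms] trig_poly_continuous[OF assms]
    trig_poly_continuous[OF trig_poly_partial[OF assms, THEN conjunct2]] by blast

definition scalar_laplacian :: "(real ^ 'n::finite \<Rightarrow> real) \<Rightarrow> real ^ 'n \<Rightarrow> real" where
  "scalar_laplacian \<psi> x = (\<Sum>i\<in>UNIV. partial_deriv i (partial_deriv i \<psi>) x)"

text \<open>Waves with nonzero wave vector are eigenfunctions of the Laplacian with nonzero eigenvalue; the waves
  with wave vector zero make up the constant.\<close>

lemma trig_poly_poisson:
  assumes "trig_poly L g"
  shows "\<exists>\<psi> c. trig_poly L \<psi> \<and> (\<forall>x. g x = c + scalar_laplacian \<psi> x)"
  using assms
proof induction
  case (wave \<kappa> c \<theta>)
  show ?case
  proof (cases "\<kappa> = 0")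
    case True
    have "scalar_laplacian (\<lambda>x. 0 * cos (\<kappa> \<bullet> x + \<theta>)) x = 0" for x
      unfolding scalar_laplacian_def has_partial_wave by simp
    then show ?thesis
      using True trig_poly.wave[OF wave, of 0 \<theta>]
      by (intro exI[of _ "\<lambda>x. 0 * cos (\<kappa> \<bullet> x + \<theta>)"] exI[of _ "c * cos \<theta>"]) auto
  next
    case False
    define d where "d = - c / (\<kappa> \<bullet> \<kappa>)"
    have "scalar_laplacian (\<lambda>x. d * cos (\<kappa> \<bullet> x + \<theta>)) x = c * cos (\<kappa> \<bullet> x + \<theta>)" for x
    proof -
      have "cos (\<kappa> \<bullet> x + (\<theta> + pi / 2 + pi / 2)) = - cos (\<kappa> \<bullet> x + \<theta>)"
        using cos_periodic_pi[of "\<kappa> \<bullet> x + \<theta>"] by (simp add: add.assoc)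
      then have "scalar_laplacian (\<lambda>x. d * cos (\<kappa> \<bullet> x + \<theta>)) x = (\<Sum>i\<in>UNIV. - d * cos (\<kappa> \<bullet> x + \<theta>) * (\<kappa> $ i * \<kappa> $ i))"
        unfolding scalar_laplacian_def has_partial_wave by (simp add: ac_simps)
      also have "\<dots> = - d * cos (\<kappa> \<bullet> x + \<theta>) * (\<kappa> \<bullet> \<kappa>)"
        by (simp add: inner_vec_def sum_distrib_left)
      finally show ?thesis using False by (simp add: d_def)
    qed
    then show ?thesis
      using trig_poly.wave[OF wave, of d \<theta>]
      by (intro exI[of _ "\<lambda>x. d * cos (\<kappa> \<bullet> x + \<theta>)"] exI[of _ 0]) auto
  qed
next
  case (add f g)
  then obtain \<psi> c \<psi>' c' where *: "trig_poly L \<psi>" "\<And>x. f x = c + scalar_laplacian \<psi> x"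
    "trig_poly L \<psi>'" "\<And>x. g x = c' + scalar_laplacian \<psi>' x" by blast
  have "scalar_laplacian (\<lambda>x. \<psi> x + \<psi>' x) x = scalar_laplacian \<psi> x + scalar_laplacian \<psi>' x" for x
    unfolding scalar_laplacian_def
    using trig_poly_partial[OF *(1)] trig_poly_partial[OF *(3)]
      trig_poly_partial[OF trig_poly_partial[OF *(1), THEN conjunct2]]
      trig_poly_partial[OF trig_poly_partial[OF *(3), THEN conjunct2]]
    by (simp add: partial_deriv_add_fun sum.distrib)
  then show ?case using *
    by (intro exI[of _ "\<lambda>x. \<psi> x + \<psi>' x"] exI[of _ "c + c'"]) (auto intro: trig_poly.add)
qed

text \<open>Two integrations by parts: the full second derivative costs no more than the Laplacian.\<close>

lemma hessian_eq_laplacian_L2: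
  assumes L: "0 < L" and t: "trig_poly L \<psi>"
  shows "(LINT x:cell L|lborel. (\<Sum>i\<in>UNIV. \<Sum>j\<in>UNIV. (partial_deriv j (partial_deriv i \<psi>) x)\<^sup>2))
    = (LINT x:cell L|lborel. (scalar_laplacian \<psi> x)\<^sup>2)"
proof -
  have p: "trig_poly L f \<Longrightarrow> trig_poly L (partial_deriv i f)" for f :: "real ^ 'a \<Rightarrow> real" and i
    using trig_poly_partial by blast
  have int: "set_integrable lborel (cell L) f" if "trig_poly L f" for f :: "real ^ 'a \<Rightarrow> real"
    by (rule set_integrable_cell_continuous[OF trig_poly_continuous[OF that]])
  note comm = trig_poly_partial_commute
  have parts: "(LINT x:cell L|lborel. a x * partial_deriv i b x) = - (LINT x:cell L|lborel. partial_deriv i a x * b x)"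
    if "trig_poly L a" "trig_poly L b" for a b :: "real ^ 'a \<Rightarrow> real" and i
    using that by (intro integration_by_parts_cell[OF L] trig_poly_C1 trig_poly_periodic)
  have swap: "(LINT x:cell L|lborel. (partial_deriv j (partial_deriv i \<psi>) x)\<^sup>2)
      = (LINT x:cell L|lborel. partial_deriv i (partial_deriv i \<psi>) x * partial_deriv j (partial_deriv j \<psi>) x)" for i j
  proof -
    have "(LINT x:cell L|lborel. partial_deriv j (partial_deriv i \<psi>) x * partial_deriv j (partial_deriv i \<psi>) x)
        = - (LINT x:cell L|lborel. partial_deriv j (partial_deriv j (partial_deriv i \<psi>)) x * partial_deriv i \<psi> x)"
      by (intro parts p t)
    also have "partial_deriv j (partial_deriv j (partial_deriv i \<psi>)) = partial_deriv i (partial_deriv j (partial_deriv j \<psi>))"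
      using comm[OF t, of j i] comm[OF p[OF t], of i j j] by simp
    also have "- (LINT x:cell L|lborel. partial_deriv i (partial_deriv j (partial_deriv j \<psi>)) x * partial_deriv i \<psi> x)
        = (LINT x:cell L|lborel. partial_deriv j (partial_deriv j \<psi>) x * partial_deriv i (partial_deriv i \<psi>) x)"
      using parts[of "partial_deriv j (partial_deriv j \<psi>)" "partial_deriv i \<psi>" i] p t by simp
    finally show ?thesis by (simp add: power2_eq_square mult.commute)
  qed
  have i1: "set_integrable lborel (cell L) (\<lambda>x. (partial_deriv j (partial_deriv i \<psi>) x)\<^sup>2)" for i j
    unfolding power2_eq_square by (intro int trig_poly_mult p t)
  have i2: "set_integrable lborel (cell L) (\<lambda>x. partial_deriv i (partial_deriv i \<psi>) x * partial_deriv j (partial_deriv j \<psi>) x)" for i j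
    by (intro int trig_poly_mult p t)
  have pc: "continuous_on UNIV (partial_deriv j (partial_deriv i \<psi>))" for i j
    by (rule trig_poly_continuous[OF p[OF p[OF t]]])
  have i1': "set_integrable lborel (cell L) (\<lambda>x. \<Sum>j\<in>UNIV. (partial_deriv j (partial_deriv i \<psi>) x)\<^sup>2)" for i
    by (intro set_integrable_cell_continuous continuous_intros pc)
  have i2': "set_integrable lborel (cell L) (\<lambda>x. \<Sum>j\<in>UNIV. partial_deriv i (partial_deriv i \<psi>) x * partial_deriv j (partial_deriv j \<psi>) x)" for i
    by (intro set_integrable_cell_continuous continuous_intros pc)
  have "(LINT x:cell L|lborel. (\<Sum>i\<in>UNIV. \<Sum>j\<in>UNIV. (partial_deriv j (partial_deriv i \<psi>) x)\<^sup>2))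
      = (\<Sum>i\<in>UNIV. \<Sum>j\<in>UNIV. LINT x:cell L|lborel. (partial_deriv j (partial_deriv i \<psi>) x)\<^sup>2)"
    using i1 i1' by (simp add: set_integral_sum_cell)
  also have "\<dots> = (LINT x:cell L|lborel. (\<Sum>i\<in>UNIV. \<Sum>j\<in>UNIV. partial_deriv i (partial_deriv i \<psi>) x * partial_deriv j (partial_deriv j \<psi>) x))"
    unfolding swap using i2 i2' by (simp add: set_integral_sum_cell)
  also have "\<dots> = (LINT x:cell L|lborel. (scalar_laplacian \<psi> x)\<^sup>2)"
    unfolding scalar_laplacian_def power2_eq_square sum_product ..
  finally show ?thesis .
qed

section \<open>Density of trigonometric polynomials\<close>

text \<open>The quotient map onto the torus, realised inside a vector space so that its image is a compact set.\<close>

definition torus_map :: "real \<Rightarrow> real ^ 'n::finite \<Rightarrow> complex ^ 'n" where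
  "torus_map L x = (\<chi> i. Complex (cos (2 * pi / L * x $ i)) (sin (2 * pi / L * x $ i)))"

lemma torus_map_eq:
  assumes L: "0 < L" and "torus_map L x = torus_map L y" and per: "periodic L q"
  shows "q x = q y"
proof -
  have "\<exists>m::int. x $ i = y $ i + m * L" for i
  proof -
    have "torus_map L x $ i = torus_map L y $ i" using assms by simp
    then have "sin (2 * pi / L * x $ i) = sin (2 * pi / L * y $ i) \<and> cos (2 * pi / L * x $ i) = cos (2 * pi / L * y $ i)"
      by (simp add: torus_map_def)
    then obtain m :: int where m: "2 * pi / L * x $ i = 2 * pi / L * y $ i + 2 * pi * m"
      unfolding sin_cos_eq_iff by blast
    have "x $ i = L / (2 * pi) * (2 * pi / L * x $ i)" using L by simp
    also have "\<dots> = y $ i + m * L" unfolding m using L by (simp add: field_simps)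
    finally show ?thesis by blast
  qed
  then obtain m :: "'a \<Rightarrow> int" where m: "\<And>i. x $ i = y $ i + m i * L" by metis
  have "x = (\<chi> i. y $ i + real_of_int (m i) * L)" by (simp add: vec_eq_iff m)
  then show ?thesis using periodic_shift_lattice[OF per, of y m] by simp
qed

text \<open>Stone--Weierstrass on the torus.  A continuous periodic function descends to a continuous function
  \<open>q'\<close> there, since preimages of closed sets under \<open>q'\<close> are images of compact subsets of the closed cell; real and
  imaginary parts of the coordinates separate points and pull back to waves.\<close>

lemma trig_poly_dense:
  fixes q :: "real ^ 'n::finite \<Rightarrow> real"
  assumes L: "0 < L" and c: "continuous_on UNIV q" and per: "periodic L q" and e: "0 < e"
  shows "\<exists>g. trig_poly L g \<and> (\<forall>x. \<bar>q x - g x\<bar> < e)"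
proof -
  define K where "K = (cbox 0 (\<chi> i. L) :: (real ^ 'n) set)"
  define E where "E = (torus_map L :: real ^ 'n \<Rightarrow> complex ^ 'n) ` K"
  have rep: "cell_representative L x \<in> K" for x :: "real ^ 'n"
    unfolding K_def by (rule cell_representative_mem[OF L])
  have ct: "continuous_on UNIV (torus_map L :: real ^ 'n \<Rightarrow> complex ^ 'n)"
    unfolding torus_map_def Complex_eq by (intro continuous_intros)
  have compE: "compact E"
    unfolding E_def K_def by (intro compact_continuous_image compact_cbox continuous_on_subset[OF ct]) auto
  have tper: "periodic L (torus_map L :: real ^ 'n \<Rightarrow> complex ^ 'n)"
    unfolding periodic_def
  proof (intro allI)
    fix x :: "real ^ 'n" and i
    have "2 * pi / L * (x + L *\<^sub>R axis i 1) $ j = 2 * pi / L * x $ j + 2 * pi * real_of_int (if j = i then 1 else 0)" for j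
      using L by (auto simp: axis_def field_simps)
    then have "sin (2 * pi / L * (x + L *\<^sub>R axis i 1) $ j) = sin (2 * pi / L * x $ j) \<and>
        cos (2 * pi / L * (x + L *\<^sub>R axis i 1) $ j) = cos (2 * pi / L * x $ j)" for j
      unfolding sin_cos_eq_iff by blast
    then show "torus_map L (x + L *\<^sub>R axis i 1) = torus_map L x"
      by (simp add: torus_map_def vec_eq_iff)
  qed
  have inE: "torus_map L x \<in> E" for x :: "real ^ 'n"
    unfolding E_def using rep[of x] periodic_cell_representative[OF tper, of x] by (metis imageI)
  define q' where "q' z = q (SOME x. x \<in> K \<and> torus_map L x = z)" for z
  have q': "q' (torus_map L x) = q x" for x
  proof -
    have "\<exists>y. y \<in> K \<and> torus_map L y = torus_map L x" using inE[of x] by (auto simp: E_def)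
    from someI_ex[OF this] show ?thesis unfolding q'_def by (intro torus_map_eq[OF L _ per]) auto
  qed
  have "continuous_on E q'"
    unfolding continuous_on_closed_vimage[OF compact_imp_closed[OF compE]]
  proof (intro allI impI)
    fix B :: "real set" assume "closed B"
    have "q' -` B \<inter> E = torus_map L ` (K \<inter> q -` B)"
      unfolding E_def by (auto simp: q')
    moreover have "compact (K \<inter> q -` B)"
    proof -
      have "closed (q -` B)" using c \<open>closed B\<close> by (rule closed_vimage[rotated]) 
      then show ?thesis unfolding K_def by (intro compact_Int_closed compact_cbox)
    qed
    ultimately have "compact (q' -` B \<inter> E)"
      using compact_continuous_image[OF continuous_on_subset[OF ct]] by simp
    then show "closed (q' -` B \<inter> E)" by (rule compact_imp_closed)
  qed
  define P where "P f \<longleftrightarrow> continuous_on E f \<and> trig_poly L (\<lambda>x. f (torus_map L x))" for f :: "complex ^ 'n \<Rightarrow> real"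
  have "\<exists>g. P g \<and> (\<forall>z\<in>E. \<bar>q' z - g z\<bar> < e)"
  proof (rule Stone_Weierstrass_HOL[OF compE _ _ _ _ _ \<open>continuous_on E q'\<close> e])
    show "P (\<lambda>x. c)" for c by (simp add: P_def trig_poly_const)
    show "P f \<Longrightarrow> continuous_on E f" for f by (simp add: P_def)
    show "P f \<and> P g \<Longrightarrow> P (\<lambda>x. f x + g x)" for f g
      by (auto simp: P_def intro: continuous_intros trig_poly.add)
    show "P f \<and> P g \<Longrightarrow> P (\<lambda>x. f x * g x)" for f g
      by (auto simp: P_def intro: continuous_intros trig_poly_mult)
  next
    fix x y assume "x \<in> E \<and> y \<in> E \<and> x \<noteq> y"
    then obtain i where i: "x $ i \<noteq> y $ i" by (auto simp: vec_eq_iff)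
    have fr: "axis i (2 * pi / L) \<in> torus_freqs L"
      unfolding torus_freqs_def
    proof safe
      fix j
      show "\<exists>m::int. axis i (2 * pi / L) $ j * L = 2 * pi * m"
        using L by (intro exI[of _ "if j = i then 1 else 0"]) (auto simp: axis_def)
    qed
    have "P (\<lambda>z. Re (z $ i))"
      using trig_poly.wave[OF fr, of 1 0]
      by (auto simp: P_def torus_map_def inner_axis' intro!: continuous_intros)
    moreover have "P (\<lambda>z. Im (z $ i))"
      using trig_poly.wave[OF fr, of 1 "- (pi / 2)"]
      by (auto simp: P_def torus_map_def inner_axis' cos_diff intro!: continuous_intros)
    ultimately show "\<exists>f. P f \<and> f x \<noteq> f y"
      using i by (metis complex_eqI)
  qed
  then obtain g where "P g" "\<And>z. z \<in> E \<Longrightarrow> \<bar>q' z - g z\<bar> < e" by blast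
  then show ?thesis
    using q' inE by (intro exI[of _ "\<lambda>x. g (torus_map L x)"]) (auto simp: P_def, metis)
qed

section \<open>A duality estimate\<close>

lemma cell_cauchy_schwarz:
  fixes a b :: "real ^ 'n::finite \<Rightarrow> 'b::real_inner"
  assumes "set_integrable lborel (cell L) (\<lambda>x. a x \<bullet> b x)"
    and "set_integrable lborel (cell L) (\<lambda>x. (norm (a x))\<^sup>2)"
    and "set_integrable lborel (cell L) (\<lambda>x. (norm (b x))\<^sup>2)"
  shows "\<bar>LINT x:cell L|lborel. a x \<bullet> b x\<bar>
    \<le> sqrt (LINT x:cell L|lborel. (norm (a x))\<^sup>2) * sqrt (LINT x:cell L|lborel. (norm (b x))\<^sup>2)"
proof -
  define A where "A = (LINT x:cell L|lborel. (norm (a x))\<^sup>2)"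
  define B where "B = (LINT x:cell L|lborel. (norm (b x))\<^sup>2)"
  define D where "D = (LINT x:cell L|lborel. a x \<bullet> b x)"
  have nn: "0 \<le> A" "0 \<le> B" unfolding A_def B_def set_lebesgue_integral_def by auto
  have quad: "0 \<le> s\<^sup>2 * A - 2 * s * t * D + t\<^sup>2 * B" for s t
  proof -
    have "(norm (s *\<^sub>R a x - t *\<^sub>R b x))\<^sup>2 = s\<^sup>2 * (norm (a x))\<^sup>2 - 2 * s * t * (a x \<bullet> b x) + t\<^sup>2 * (norm (b x))\<^sup>2" for x
      unfolding power2_norm_eq_inner by (simp add: inner_diff inner_commute algebra_simps power2_eq_square)
    moreover have "0 \<le> (LINT x:cell L|lborel. (norm (s *\<^sub>R a x - t *\<^sub>R b x))\<^sup>2)"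
      unfolding set_lebesgue_integral_def by (rule integral_nonneg_AE) auto
    ultimately have "0 \<le> (LINT x:cell L|lborel. s\<^sup>2 * (norm (a x))\<^sup>2 - 2 * s * t * (a x \<bullet> b x) + t\<^sup>2 * (norm (b x))\<^sup>2)"
      by simp
    also have "\<dots> = s\<^sup>2 * A - 2 * s * t * D + t\<^sup>2 * B"
      unfolding A_def B_def D_def using assms
      by (subst set_integral_add set_integral_diff; simp)+
    finally show ?thesis .
  qed
  have "D\<^sup>2 \<le> A * B"
  proof (cases "A = 0 \<and> B = 0")
    case True
    then show ?thesis using quad[of 1 1] quad[of 1 "-1"] by simp
  next
    case False
    then consider "0 < A" | "0 < B" using nn by force
    then show ?thesis
    proof cases
      case 1
      \<comment> \<open>the minimiser of the quadratic form, scaled so that no division occurs\<close>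
      have "A * D\<^sup>2 \<le> A * (A * B)"
        using quad[of D A] by (simp add: power2_eq_square algebra_simps)
      then show ?thesis using 1 by simp
    next
      case 2
      have "B * D\<^sup>2 \<le> B * (A * B)"
        using quad[of B D] by (simp add: power2_eq_square algebra_simps)
      then show ?thesis using 2 by simp
    qed
  qed
  then have "\<bar>D\<bar> \<le> sqrt (A * B)" by (simp add: real_le_rsqrt)
  then show ?thesis by (simp add: A_def B_def D_def real_sqrt_mult)
qed

text \<open>For the Laplacian of a trigonometric polynomial only the weak gradient of \<open>q\<close> enters, so a
  differentiable \<open>q\<close> whose gradient is merely square integrable is admitted.\<close>

lemma weak_laplacian_pairing:
  fixes q :: "real ^ 'n::finite \<Rightarrow> real"
  assumes L: "0 < L" and c: "continuous_on UNIV q" and per: "periodic L q"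
    and d: "\<And>i x. has_partial i q x" and g: "L2_periodic L (gradient q)" and t: "trig_poly L \<psi>"
  shows "(LINT x:cell L|lborel. q x * scalar_laplacian \<psi> x) = - (LINT x:cell L|lborel. gradient q x \<bullet> gradient \<psi> x)"
proof -
  have p: "trig_poly L (partial_deriv i \<psi>)" "trig_poly L (partial_deriv i (partial_deriv i \<psi>))" for i
    using trig_poly_partial t by blast+
  have bd: "partial_deriv i q \<in> borel_measurable borel" for i
  proof -
    have "(\<lambda>y :: real ^ 'n. y $ i) \<in> borel_measurable borel"
      by (intro borel_measurable_continuous_onI continuous_intros)
    then have "(\<lambda>x. gradient q x $ i) \<in> borel_measurable borel"
      using g measurable_compose[of "gradient q" borel borel "\<lambda>y. y $ i" borel] unfolding L2_periodic_def by auto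
    then show ?thesis by (simp add: gradient_def)
  qed
  have gax: "L2_periodic L (\<lambda>x. partial_deriv i \<psi> x *\<^sub>R (axis i 1 :: real ^ 'n))" for i
    by (intro L2_periodic_continuous continuous_intros trig_poly_continuous[OF p(1)]
        periodic_compose[OF trig_poly_periodic[OF p(1)], of "\<lambda>r. r *\<^sub>R axis i 1"])
  have int1: "set_integrable lborel (cell L) (\<lambda>x. partial_deriv i q x * partial_deriv i \<psi> x)" for i
    using L2_inner_integrable[OF g gax[of i]] by (simp add: gradient_def inner_axis mult.commute)
  have cc: "continuous_on UNIV (\<lambda>x. q x * partial_deriv i (partial_deriv i \<psi>) x)" for i
    by (intro continuous_intros c trig_poly_continuous[OF p(2)])
  have int2: "set_integrable lborel (cell L) (\<lambda>x. q x * partial_deriv i (partial_deriv i \<psi>) x)" for i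
    by (rule set_integrable_cell_continuous[OF cc])
  have each: "(LINT x:cell L|lborel. q x * partial_deriv i (partial_deriv i \<psi>) x)
      = - (LINT x:cell L|lborel. partial_deriv i q x * partial_deriv i \<psi> x)" for i
  proof -
    have dd: "partial_deriv i (\<lambda>x. q x * partial_deriv i \<psi> x)
        = (\<lambda>x. q x * partial_deriv i (partial_deriv i \<psi>) x + partial_deriv i q x * partial_deriv i \<psi> x)"
      using trig_poly_partial[OF p(1)] d by (intro ext partial_mult(2)) auto
    have "(LINT x:cell L|lborel. partial_deriv i (\<lambda>x. q x * partial_deriv i \<psi> x) x) = 0"
    proof (rule integral_partial_deriv_cell[OF L])
      show "periodic L (\<lambda>x. q x * partial_deriv i \<psi> x)"
        by (rule periodic_compose2[OF per trig_poly_periodic[OF p(1)]])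
      show "has_partial i (\<lambda>x. q x * partial_deriv i \<psi> x) x" for x
        using trig_poly_partial[OF p(1)] d by (intro partial_mult(1)) auto
      show "partial_deriv i (\<lambda>x. q x * partial_deriv i \<psi> x) \<in> borel_measurable borel"
        unfolding dd by (intro borel_measurable_add borel_measurable_times bd
            borel_measurable_continuous_onI c trig_poly_continuous[OF p(1)] trig_poly_continuous[OF p(2)])
      show "set_integrable lborel (cell L) (partial_deriv i (\<lambda>x. q x * partial_deriv i \<psi> x))"
        unfolding dd by (intro set_integral_add int1 int2)
    qed
    then show ?thesis unfolding dd using int1 int2 by (subst (asm) set_integral_add(2)) auto
  qed
  have "(LINT x:cell L|lborel. q x * scalar_laplacian \<psi> x)
      = (\<Sum>i\<in>UNIV. LINT x:cell L|lborel. q x * partial_deriv i (partial_deriv i \<psi>) x)"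
    unfolding scalar_laplacian_def sum_distrib_left by (intro set_integral_sum_cell int2)
  also have "\<dots> = - (\<Sum>i\<in>UNIV. LINT x:cell L|lborel. partial_deriv i q x * partial_deriv i \<psi> x)"
    by (simp add: each sum_negf)
  also have "(\<Sum>i\<in>UNIV. LINT x:cell L|lborel. partial_deriv i q x * partial_deriv i \<psi> x)
      = (LINT x:cell L|lborel. gradient q x \<bullet> gradient \<psi> x)"
    unfolding inner_vec_def gradient_def by (simp add: set_integral_sum_cell int1)
  finally show ?thesis .
qed

lemma cell_integral_add_continuous:
  fixes a b :: "real ^ 'n::finite \<Rightarrow> real"
  assumes "continuous_on UNIV a" "continuous_on UNIV b"
  shows "(LINT x:cell L|lborel. a x + b x) = (LINT x:cell L|lborel. a x) + (LINT x:cell L|lborel. b x)"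
  by (intro set_integral_add(2) set_integrable_cell_continuous assms)

text \<open>The function \<open>q\<close> would be tested with itself; a uniformly close trigonometric polynomial \<open>g\<close> takes its place,
  which is a Laplacian up to a constant that \<open>q\<close> does not see.\<close>

lemma L2_bound_by_duality:
  fixes q :: "real ^ 'n::finite \<Rightarrow> real"
  assumes L: "0 < L" and c: "continuous_on UNIV q" and per: "periodic L q" and zm: "zero_mean L q"
    and K: "0 \<le> K"
    and bound: "\<And>\<psi>. trig_poly L \<psi> \<Longrightarrow>
      \<bar>LINT x:cell L|lborel. q x * scalar_laplacian \<psi> x\<bar> \<le> K * sqrt (LINT x:cell L|lborel. (scalar_laplacian \<psi> x)\<^sup>2)"
  shows "L2_cell_norm L q \<le> K"
proof -
  define X where "X = (LINT x:cell L|lborel. (q x)\<^sup>2)"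
  define A where "A = (LINT x:cell L|lborel. \<bar>q x\<bar>)"
  define m where "m = (LINT x:(cell L :: (real ^ 'n) set)|lborel. (1 :: real))"
  note int = set_integrable_cell_continuous
  have iq: "set_integrable lborel (cell L) (\<lambda>x. (q x)\<^sup>2)" "set_integrable lborel (cell L) (\<lambda>x. \<bar>q x\<bar>)"
    "set_integrable lborel (cell L) q" "set_integrable lborel (cell L :: (real ^ 'n) set) (\<lambda>x. k :: real)" for k
    by (intro int continuous_intros c)+
  have hc: "(LINT x:(cell L :: (real ^ 'n) set)|lborel. k) = k * m" for k :: real
    unfolding m_def set_lebesgue_integral_def by simp
  have step: "X \<le> K * sqrt (X + 2 * e * A + e\<^sup>2 * m) + e * A" if e: "0 < e" for e
  proof -
    obtain g where g: "trig_poly L g" "\<And>x. \<bar>q x - g x\<bar> < e" using trig_poly_dense[OF L c per e] by blast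
    obtain \<psi> k where \<psi>: "trig_poly L \<psi>" "\<And>x. g x = k + scalar_laplacian \<psi> x"
      using trig_poly_poisson[OF g(1)] by blast
    define S where "S = scalar_laplacian \<psi>"
    have p: "trig_poly L (partial_deriv i \<psi>)" "trig_poly L (partial_deriv i (partial_deriv i \<psi>))" for i
      using trig_poly_partial \<psi>(1) by blast+
    have cS: "continuous_on UNIV S"
      unfolding S_def scalar_laplacian_def by (intro continuous_intros trig_poly_continuous[OF p(2)])
    have cg: "continuous_on UNIV g" by (rule trig_poly_continuous[OF g(1)])
    have mS: "(LINT x:cell L|lborel. S x) = 0"
    proof -
      have "(LINT x:cell L|lborel. S x) = (\<Sum>i\<in>UNIV. LINT x:cell L|lborel. partial_deriv i (partial_deriv i \<psi>) x)"
        unfolding S_def scalar_laplacian_def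
        by (intro set_integral_sum_cell int trig_poly_continuous[OF p(2)])
      also have "\<dots> = 0"
        by (intro sum.neutral ballI integral_partial_deriv_cell[OF L] trig_poly_periodic p(1)
            borel_measurable_continuous_onI int trig_poly_continuous[OF p(2)])
           (use trig_poly_partial[OF p(1)] in auto)
      finally show ?thesis .
    qed
    have qS: "(LINT x:cell L|lborel. q x * g x) = (LINT x:cell L|lborel. q x * S x)"
    proof -
      have "(LINT x:cell L|lborel. q x * g x) = (LINT x:cell L|lborel. k * q x + q x * S x)"
        by (simp add: \<psi>(2) S_def algebra_simps)
      also have "\<dots> = k * (LINT x:cell L|lborel. q x) + (LINT x:cell L|lborel. q x * S x)"
        by (subst cell_integral_add_continuous) (auto intro!: continuous_intros c cS)
      finally show ?thesis using zm by (simp add: zero_mean_def)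
    qed
    \<comment> \<open>a Laplacian has mean zero, so it is orthogonal to the constant \<open>k\<close>\<close>
    have SS: "(LINT x:cell L|lborel. (S x)\<^sup>2) \<le> (LINT x:cell L|lborel. (g x)\<^sup>2)"
    proof -
      have "(LINT x:cell L|lborel. (g x)\<^sup>2) = (LINT x:cell L|lborel. k\<^sup>2 + (2 * k * S x + (S x)\<^sup>2))"
        by (simp add: \<psi>(2) S_def power2_sum algebra_simps)
      also have "\<dots> = (LINT x:(cell L :: (real ^ 'n) set)|lborel. k\<^sup>2) + (2 * k * (LINT x:cell L|lborel. S x) + (LINT x:cell L|lborel. (S x)\<^sup>2))"
        by (simp add: cell_integral_add_continuous cS continuous_on_add continuous_on_mult continuous_on_power continuous_on_const)
      moreover have "0 \<le> (LINT x:(cell L :: (real ^ 'n) set)|lborel. k\<^sup>2)"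
        unfolding set_lebesgue_integral_def by (rule integral_nonneg_AE) auto
      ultimately show ?thesis by (simp add: mS)
    qed
    have gg: "(LINT x:cell L|lborel. (g x)\<^sup>2) \<le> X + 2 * e * A + e\<^sup>2 * m"
    proof -
      have "(LINT x:cell L|lborel. (g x)\<^sup>2) \<le> (LINT x:cell L|lborel. (q x)\<^sup>2 + (2 * e * \<bar>q x\<bar> + e\<^sup>2 * 1))"
      proof (rule set_integral_mono)
        fix x
        have "\<bar>g x\<bar> \<le> \<bar>q x\<bar> + e" using g(2)[of x] by linarith
        then have "\<bar>g x\<bar>\<^sup>2 \<le> (\<bar>q x\<bar> + e)\<^sup>2" by (intro power_mono) auto
        then show "(g x)\<^sup>2 \<le> (q x)\<^sup>2 + (2 * e * \<bar>q x\<bar> + e\<^sup>2 * 1)" by (simp add: power2_sum algebra_simps)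
      qed (intro int continuous_intros c cg)+
      also have "\<dots> = X + 2 * e * A + e\<^sup>2 * m"
        unfolding X_def A_def
        by (simp add: hc cell_integral_add_continuous c continuous_on_add continuous_on_mult continuous_on_power continuous_on_const continuous_on_rabs)
      finally show ?thesis .
    qed
    have "X = (LINT x:cell L|lborel. q x * g x) + (LINT x:cell L|lborel. q x * (q x - g x))"
      unfolding X_def
      by (subst cell_integral_add_continuous[symmetric])
         (auto intro!: continuous_intros c cg simp: power2_eq_square algebra_simps)
    also have "(LINT x:cell L|lborel. q x * (q x - g x)) \<le> (LINT x:cell L|lborel. e * \<bar>q x\<bar>)"
    proof (rule set_integral_mono)
      fix x
      have "q x * (q x - g x) \<le> \<bar>q x\<bar> * \<bar>q x - g x\<bar>" by (metis abs_ge_self abs_mult)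
      also have "\<dots> \<le> \<bar>q x\<bar> * e" using g(2)[of x] by (intro mult_left_mono) auto
      finally show "q x * (q x - g x) \<le> e * \<bar>q x\<bar>" by (simp add: mult.commute)
    qed (intro int continuous_intros c cg)+
    also have "(LINT x:cell L|lborel. e * \<bar>q x\<bar>) = e * A" by (simp add: A_def)
    also have "(LINT x:cell L|lborel. q x * g x) \<le> K * sqrt (X + 2 * e * A + e\<^sup>2 * m)"
    proof -
      have "(LINT x:cell L|lborel. q x * g x) \<le> K * sqrt (LINT x:cell L|lborel. (S x)\<^sup>2)"
        using bound[OF \<psi>(1)] unfolding qS S_def by linarith
      also have "\<dots> \<le> K * sqrt (X + 2 * e * A + e\<^sup>2 * m)"
        using SS gg K by (intro mult_left_mono real_sqrt_le_mono) auto
      finally show ?thesis .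
    qed
    finally show ?thesis by simp
  qed
  \<comment> \<open>letting the quality \<open>e\<close> of the approximation tend to zero\<close>
  have "((\<lambda>e. K * sqrt (X + 2 * e * A + e\<^sup>2 * m) + e * A) \<longlongrightarrow> K * sqrt (X + 2 * 0 * A + 0\<^sup>2 * m) + 0 * A) (at_right 0)"
    by (intro tendsto_intros)
  moreover have "\<forall>\<^sub>F e in at_right 0. X \<le> K * sqrt (X + 2 * e * A + e\<^sup>2 * m) + e * A"
    using eventually_at_right_less[of "0 :: real"] by eventually_elim (rule step)
  ultimately have XK: "X \<le> K * sqrt X"
    using tendsto_lowerbound[of "\<lambda>e. K * sqrt (X + 2 * e * A + e\<^sup>2 * m) + e * A" _ "at_right 0" X] by simp
  have X: "0 \<le> X" unfolding X_def set_lebesgue_integral_def by (rule integral_nonneg_AE) auto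
  have "sqrt X \<le> K"
  proof (cases "X = 0")
    case False
    then have "sqrt X * sqrt X \<le> K * sqrt X" using XK X by simp
    moreover have "0 < sqrt X" using False X by simp
    ultimately show ?thesis by (rule mult_right_le_imp_le)
  qed (use K in simp)
  then show ?thesis by (simp add: L2_cell_norm_def X_def)
qed

section \<open>Hoelder continuity of Wiener paths\<close>

lemma wiener_increment_measurable:
  assumes "wiener_process M w" "0 \<le> s" "0 \<le> t"
  shows "(\<lambda>\<omega>. w t \<omega> $ r - w s \<omega> $ r) \<in> borel_measurable M"
proof -
  have [measurable]: "(\<lambda>y :: real ^ 'b. y $ r) \<in> borel_measurable borel"
    by (intro borel_measurable_continuous_onI continuous_intros)
  have [measurable]: "w t \<in> borel_measurable M" "w s \<in> borel_measurable M"
    using assms by (auto simp: wiener_process_def)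
  show ?thesis by measurable
qed

text \<open>By the Kolmogorov criterion the moment of order \<open>2 m\<close> yields Hoelder exponents below \<open>(m - 1) / (2 m)\<close>;
  order eight is the first even order that reaches the exponent \<open>1/3\<close>.\<close>

lemma wiener_eighth_moment:
  assumes "wiener_process M w" "0 \<le> s" "s < t"
  shows "(\<integral>\<^sup>+\<omega>. ennreal ((w t \<omega> $ r - w s \<omega> $ r) ^ 8) \<partial>M) = ennreal (105 * (t - s) ^ 4)"
proof -
  have D: "distributed M lborel (\<lambda>\<omega>. w t \<omega> $ r - w s \<omega> $ r) (\<lambda>y. ennreal (normal_density 0 (sqrt (t - s)) y))"
    using assms unfolding wiener_process_def by blast
  have s: "0 < sqrt (t - s)" using assms by simp
  have "has_bochner_integral lborel (\<lambda>x. normal_density 0 (sqrt (t - s)) x * (x - 0) ^ (2 * 4))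
      (fact (2 * 4) / ((2 / (sqrt (t - s))\<^sup>2) ^ 4 * fact 4))"
    by (rule normal_moment_even[OF s])
  moreover have "(fact (2 * 4) / ((2 / (sqrt (t - s))\<^sup>2) ^ 4 * fact 4) :: real) = 105 * (t - s) ^ 4"
    using assms by (simp add: fact_numeral power_divide field_simps)
  ultimately have hb: "has_bochner_integral lborel (\<lambda>x. normal_density 0 (sqrt (t - s)) x * x ^ 8) (105 * (t - s) ^ 4)"
    by simp
  have "(\<integral>\<^sup>+\<omega>. ennreal ((w t \<omega> $ r - w s \<omega> $ r) ^ 8) \<partial>M)
      = (\<integral>\<^sup>+x. ennreal (normal_density 0 (sqrt (t - s)) x) * ennreal (x ^ 8) \<partial>lborel)"
    by (rule distributed_nn_integral[OF D, symmetric]) simp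
  also have "\<dots> = (\<integral>\<^sup>+x. ennreal (normal_density 0 (sqrt (t - s)) x * x ^ 8) \<partial>lborel)"
    by (intro nn_integral_cong) (simp add: ennreal_mult)
  also have "\<dots> = ennreal (105 * (t - s) ^ 4)"
    using hb assms by (subst nn_integral_eq_integral)
      (auto simp: has_bochner_integral_iff intro!: AE_I2)
  finally show ?thesis .
qed

lemma floor_double_cases:
  fixes y :: real
  shows "\<lfloor>2 * y\<rfloor> = 2 * \<lfloor>y\<rfloor> \<or> \<lfloor>2 * y\<rfloor> = 2 * \<lfloor>y\<rfloor> + 1"
  by linarith

text \<open>Chaining along the dyadic approximations from below of a point.  Since \<open>\<rho> ^ 3 = 1 / 2\<close>, the bound
  \<open>K * \<rho> ^ n\<close> on the increments of level \<open>n\<close> is proportional to the cube root of the mesh, and the contributions of all finer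
  levels add up to a geometric series.\<close>

lemma dyadic_chaining:
  fixes x :: "real \<Rightarrow> real"
  assumes T: "0 < T" and c: "continuous_on {0..T} x" and \<rho>: "0 < \<rho>" "\<rho> < 1" "\<rho> ^ 3 = 1 / 2" and K: "0 \<le> K"
    and step: "\<And>n k. k < 2 ^ n \<Longrightarrow> \<bar>x (T * real (Suc k) / 2 ^ n) - x (T * real k / 2 ^ n)\<bar> \<le> K * \<rho> ^ n"
    and st: "0 \<le> s" "s \<le> t" "t \<le> T"
  shows "\<bar>x t - x s\<bar> \<le> (K * (1 + 2 / (1 - \<rho>)) / (\<rho> * T powr (1/3))) * (t - s) powr (1/3)"
proof -
  define k where "k n s = nat \<lfloor>s * 2 ^ n / T\<rfloor>" for n s
  define d where "d n s = T * real (k n s) / 2 ^ n" for n s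
  have kf: "int (k n s) = \<lfloor>s * 2 ^ n / T\<rfloor>" if "0 \<le> s" for n s
    using that T by (simp add: k_def)
  have kle: "k n s \<le> 2 ^ n" if "0 \<le> s" "s \<le> T" for n s
  proof -
    have "s * 2 ^ n / T \<le> 2 ^ n" using that T by (simp add: field_simps mult_right_mono)
    then have "\<lfloor>s * 2 ^ n / T\<rfloor> \<le> 2 ^ n" by (simp add: floor_le_iff)
    then show ?thesis using kf[OF that(1), of n] by (simp flip: of_nat_le_iff[where 'a=int])
  qed
  have d1: "d n s \<le> s" "s < d n s + T / 2 ^ n" if "0 \<le> s" for n s
  proof -
    have e: "real (k n s) = real_of_int \<lfloor>s * 2 ^ n / T\<rfloor>" using kf[OF that, of n] by (metis of_int_of_nat_eq)
    have "real (k n s) \<le> s * 2 ^ n / T" "s * 2 ^ n / T < real (k n s) + 1" unfolding e by linarith+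
    then show "d n s \<le> s" "s < d n s + T / 2 ^ n" using T unfolding d_def by (auto simp: field_simps)
  qed
  have d0: "0 \<le> d n s" for n s unfolding d_def using T by simp
  have dstep: "\<bar>x (d (Suc n) s) - x (d n s)\<bar> \<le> K * \<rho> ^ n" if s: "0 \<le> s" "s \<le> T" for n s
  proof -
    have e: "s * 2 ^ Suc n / T = 2 * (s * 2 ^ n / T)" by simp
    have "int (k (Suc n) s) = 2 * int (k n s) \<or> int (k (Suc n) s) = 2 * int (k n s) + 1"
      using floor_double_cases[of "s * 2 ^ n / T"] unfolding kf[OF s(1)] e .
    then have cs: "k (Suc n) s = 2 * k n s \<or> k (Suc n) s = Suc (2 * k n s)" by linarith
    have dn: "d n s = T * real (2 * k n s) / 2 ^ Suc n" by (simp add: d_def)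
    from cs show ?thesis
    proof
      assume "k (Suc n) s = 2 * k n s"
      then show ?thesis using K \<rho> by (simp add: dn) (simp add: d_def)
    next
      assume e: "k (Suc n) s = Suc (2 * k n s)"
      then have "2 * k n s < 2 ^ Suc n" using kle[OF s, of "Suc n"] by simp
      from step[OF this] have "\<bar>x (d (Suc n) s) - x (d n s)\<bar> \<le> K * \<rho> ^ Suc n"
        unfolding dn by (simp only: d_def e)
      also have "\<dots> \<le> K * \<rho> ^ n" using \<rho> K by (intro mult_left_mono power_decreasing) auto
      finally show ?thesis .
    qed
  qed
  have fin: "\<bar>x (d (n + j) s) - x (d n s)\<bar> \<le> K * \<rho> ^ n * (\<Sum>i<j. \<rho> ^ i)" if s: "0 \<le> s" "s \<le> T" for n j s
  proof (induction j)
    case (Suc j)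
    have "\<bar>x (d (n + Suc j) s) - x (d n s)\<bar> \<le> K * \<rho> ^ (n + j) + K * \<rho> ^ n * (\<Sum>i<j. \<rho> ^ i)"
      using Suc dstep[OF s, of "n + j"] by simp
    also have "\<dots> = K * \<rho> ^ n * (\<Sum>i<Suc j. \<rho> ^ i)" by (simp add: power_add algebra_simps)
    finally show ?case .
  qed simp
  have geo: "(\<Sum>i<j. \<rho> ^ i) \<le> 1 / (1 - \<rho>)" for j
  proof -
    have "(\<Sum>i<j. \<rho> ^ i) = (1 - \<rho> ^ j) / (1 - \<rho>)" using \<rho> by (simp add: sum_gp_strict)
    also have "\<dots> \<le> 1 / (1 - \<rho>)" using \<rho> by (intro divide_right_mono) auto
    finally show ?thesis .
  qed
  have fin': "\<bar>x (d (n + j) s) - x (d n s)\<bar> \<le> K * \<rho> ^ n * (1 / (1 - \<rho>))" if s: "0 \<le> s" "s \<le> T" for n j s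
    using fin[OF s, of n j] mult_left_mono[OF geo[of j], of "K * \<rho> ^ n"] K \<rho> by simp
  have lim: "\<bar>x s - x (d n s)\<bar> \<le> K * \<rho> ^ n * (1 / (1 - \<rho>))" if s: "0 \<le> s" "s \<le> T" for n s
  proof -
    have "(\<lambda>j. d (n + j) s) \<longlonglongrightarrow> s"
    proof (rule tendsto_sandwich[where f="\<lambda>j. s - T * (1 / 2) ^ (n + j)" and h="\<lambda>j. s"])
      have "(\<lambda>j. s - T * ((1 / 2) ^ n * (1 / 2) ^ j)) \<longlonglongrightarrow> s - T * ((1 / 2) ^ n * 0)"
        by (intro tendsto_intros LIMSEQ_realpow_zero) auto
      then show "(\<lambda>j. s - T * (1 / 2) ^ (n + j)) \<longlonglongrightarrow> s" by (simp add: power_add)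
      have "s - T * (1 / 2) ^ (n + j) \<le> d (n + j) s" for j
        using d1(2)[OF s(1), of "n + j"] by (simp add: power_one_over)
      then show "\<forall>\<^sub>F j in sequentially. s - T * (1 / 2) ^ (n + j) \<le> d (n + j) s" by simp
    qed (use d1[OF s(1)] in auto)
    moreover have "d m s \<in> {0..T}" for m using d0[of m s] d1(1)[OF s(1), of m] s by simp
    ultimately have "(\<lambda>j. x (d (n + j) s)) \<longlonglongrightarrow> x s"
      using c s by (auto simp: continuous_on_sequentially o_def)
    then have "(\<lambda>j. \<bar>x (d (n + j) s) - x (d n s)\<bar>) \<longlonglongrightarrow> \<bar>x s - x (d n s)\<bar>" by (intro tendsto_intros)
    from LIMSEQ_le_const2[OF this] fin'[OF s] show ?thesis by blast
  qed
  show ?thesis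
  proof (cases "s = t")
    case False
    then have lt: "0 < (t - s) / T" "(t - s) / T \<le> 1" using st T by auto
    have ex: "\<exists>n. (1 / 2 :: real) ^ n < (t - s) / T" by (rule real_arch_pow_inv) (use lt in auto)
    \<comment> \<open>the first level with mesh below \<open>t - s\<close>; one level up, the approximations of \<open>s\<close> and \<open>t\<close> are equal or adjacent\<close>
    define m where "m = (LEAST n. (1 / 2 :: real) ^ n < (t - s) / T)"
    have m: "(1 / 2 :: real) ^ m < (t - s) / T" unfolding m_def by (rule LeastI_ex[OF ex])
    have "m \<noteq> 0" using m lt by (metis not_less power_0)
    then obtain n where n: "m = Suc n" using not0_implies_Suc by blast
    have n1: "(t - s) / T \<le> (1 / 2) ^ n"
      using not_less_Least[of n "\<lambda>n. (1 / 2 :: real) ^ n < (t - s) / T"] n m_def by force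
    have ts: "t * 2 ^ n / T - s * 2 ^ n / T \<le> 1"
    proof -
      have "t * 2 ^ n / T - s * 2 ^ n / T = (t - s) / T * 2 ^ n"
        by (simp add: diff_divide_distrib left_diff_distrib)
      also have "\<dots> \<le> (1 / 2) ^ n * 2 ^ n" by (intro mult_right_mono n1) auto
      finally show ?thesis by (simp add: power_one_over)
    qed
    have "s * 2 ^ n / T \<le> t * 2 ^ n / T" using st T by (simp add: divide_right_mono)
    then have "\<lfloor>t * 2 ^ n / T\<rfloor> = \<lfloor>s * 2 ^ n / T\<rfloor> \<or> \<lfloor>t * 2 ^ n / T\<rfloor> = \<lfloor>s * 2 ^ n / T\<rfloor> + 1"
      using ts by linarith
    then have "int (k n t) = int (k n s) \<or> int (k n t) = int (k n s) + 1"
      using kf[of s n] kf[of t n] st by auto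
    then have cs: "k n t = k n s \<or> k n t = Suc (k n s)" by linarith
    have mid: "\<bar>x (d n t) - x (d n s)\<bar> \<le> K * \<rho> ^ n"
    proof (cases "k n t = k n s")
      case True
      then show ?thesis using K \<rho> by (simp add: d_def)
    next
      case False
      then have e: "k n t = Suc (k n s)" using cs by simp
      then have "k n s < 2 ^ n" using kle[of t n] st by simp
      from step[OF this] show ?thesis unfolding d_def e .
    qed
    have "\<bar>x t - x s\<bar> \<le> K * \<rho> ^ n * (1 / (1 - \<rho>)) + K * \<rho> ^ n + K * \<rho> ^ n * (1 / (1 - \<rho>))"
      using lim[of t n] lim[of s n] mid st by linarith
    also have "\<dots> = K * (1 + 2 / (1 - \<rho>)) * \<rho> ^ n" by (simp add: algebra_simps)
    also have "\<dots> \<le> K * (1 + 2 / (1 - \<rho>)) * (((t - s) / T) powr (1/3) / \<rho>)"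
    proof (intro mult_left_mono)
      have "\<rho> ^ m = ((1/2) ^ m) powr (1/3)"
      proof -
        have cube: "(y ^ 3) powr (1/3) = y" if "0 < y" for y :: real
        proof -
          have "y ^ 3 = y powr 3" using that by simp
          then have "(y ^ 3) powr (1/3) = y powr (3 * (1/3))" by (simp only: powr_powr)
          then show ?thesis using that by simp
        qed
        have "\<rho> ^ m = ((\<rho> ^ m) ^ 3) powr (1/3)" using cube[of "\<rho> ^ m"] \<rho> by simp
        also have "(\<rho> ^ m) ^ 3 = (1/2) ^ m" using \<rho>(3) by (metis power_mult mult.commute)
        finally show ?thesis .
      qed
      also have "\<dots> \<le> ((t - s) / T) powr (1/3)" using m by (intro powr_mono2) auto
      finally have "\<rho> * \<rho> ^ n \<le> ((t - s) / T) powr (1/3)" by (simp add: n)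
      then show "\<rho> ^ n \<le> ((t - s) / T) powr (1/3) / \<rho>" using \<rho> by (simp add: field_simps)
    qed (use K \<rho> in auto)
    also have "\<dots> = (K * (1 + 2 / (1 - \<rho>)) / (\<rho> * T powr (1/3))) * (t - s) powr (1/3)"
      using st T by (simp add: powr_divide)
    finally show ?thesis .
  qed simp
qed

text \<open>The eighth powers of the \<open>2 ^ n\<close> increments of level \<open>n\<close> have a total expectation of order
  \<open>2 ^ n * (1 / 2 ^ n) ^ 4 = 1 / 8 ^ n\<close>.  The weights \<open>7 ^ n\<close> leave it summable, so almost surely every increment of level \<open>n\<close> is at
  most a constant times \<open>(1/7) powr (n/8)\<close>, which is below the required \<open>2 powr (- n/3)\<close> because
  \<open>2 powr (8/3) < 7 < 8\<close>.\<close>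

lemma wiener_component_hoelder:
  assumes W: "wiener_process M w" and T: "0 < T"
  shows "AE \<omega> in M. \<exists>C\<ge>0. \<forall>s t. 0 \<le> s \<longrightarrow> s \<le> t \<longrightarrow> t \<le> T \<longrightarrow> \<bar>w t \<omega> $ r - w s \<omega> $ r\<bar> \<le> C * (t - s) powr (1/3)"
proof -
  define \<rho> :: real where "\<rho> = (1/2) powr (1/3)"
  have \<rho>0: "0 < \<rho>" "\<rho> ^ 3 = 1 / 2"
    unfolding \<rho>_def by (auto simp: powr_power)
  have "\<rho> < 1"
  proof (rule ccontr)
    assume "\<not> \<rho> < 1"
    then have "1 ^ 3 \<le> \<rho> ^ 3" by (intro power_mono) auto
    then show False using \<rho>0 by simp
  qed
  with \<rho>0 have \<rho>: "0 < \<rho>" "\<rho> < 1" "\<rho> ^ 3 = 1 / 2" by auto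
  have \<rho>8: "1 / 7 \<le> \<rho> ^ 8"
  proof (rule power_le_imp_le_base)
    have "(\<rho> ^ 8) ^ Suc 2 = (\<rho> ^ 3) ^ 8" by (simp flip: power_mult)
    also have "\<dots> = 1 / 256" unfolding \<rho>(3) by (simp add: power_one_over)
    finally show "(1 / 7) ^ Suc 2 \<le> (\<rho> ^ 8) ^ Suc 2" by (simp add: power_divide)
  qed (use \<rho> in simp)
  define \<Delta> where "\<Delta> n k \<omega> = w (T * real (Suc k) / 2 ^ n) \<omega> $ r - w (T * real k / 2 ^ n) \<omega> $ r" for n k \<omega>
  define D where "D n \<omega> = (\<Sum>k<2 ^ n. ennreal (\<Delta> n k \<omega> ^ 8))" for n \<omega>
  have m\<Delta>[measurable]: "\<Delta> n k \<in> borel_measurable M" for n k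
    unfolding \<Delta>_def using T by (intro wiener_increment_measurable[OF W]) auto
  have mD[measurable]: "D n \<in> borel_measurable M" for n
    unfolding D_def by measurable
  have "(\<integral>\<^sup>+\<omega>. D n \<omega> \<partial>M) = ennreal (105 * T ^ 4 * (1 / 8) ^ n)" for n
  proof -
    have "(\<integral>\<^sup>+\<omega>. D n \<omega> \<partial>M) = (\<Sum>k<2 ^ n. \<integral>\<^sup>+\<omega>. ennreal (\<Delta> n k \<omega> ^ 8) \<partial>M)"
      unfolding D_def by (rule nn_integral_sum) simp
    also have "\<dots> = (\<Sum>k<(2::nat) ^ n. ennreal (105 * (T / 2 ^ n) ^ 4))"
    proof (rule sum.cong)
      fix k :: nat
      have "T * real (Suc k) / 2 ^ n - T * real k / 2 ^ n = T / 2 ^ n" by (simp add: field_simps)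
      moreover have "T * real k / 2 ^ n < T * real (Suc k) / 2 ^ n"
        using T by (intro divide_strict_right_mono mult_strict_left_mono) auto
      ultimately show "(\<integral>\<^sup>+\<omega>. ennreal (\<Delta> n k \<omega> ^ 8) \<partial>M) = ennreal (105 * (T / 2 ^ n) ^ 4)"
        unfolding \<Delta>_def using T by (subst wiener_eighth_moment[OF W]) auto
    qed simp
    also have "\<dots> = ennreal (2 ^ n * (105 * (T / 2 ^ n) ^ 4))"
      using T by (simp add: ennreal_of_nat_eq_real_of_nat flip: ennreal_mult)
    also have "2 ^ n * (105 * (T / 2 ^ n) ^ 4) = 105 * T ^ 4 * (1 / 8) ^ n"
    proof -
      have "(2 ^ n :: real) / (2 ^ n) ^ 4 = (1/8) ^ n"
      proof -
        have "((2 :: real) ^ n) ^ 4 = 2 ^ n * 8 ^ n"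
          by (simp flip: power_mult power_mult_distrib) (simp add: power_mult mult.commute[of n])
        then show ?thesis by (simp add: power_one_over)
      qed
      then show ?thesis by (simp add: power_divide field_simps)
    qed
    finally show ?thesis .
  qed
  then have "(\<integral>\<^sup>+\<omega>. (\<Sum>n. ennreal (7 ^ n) * D n \<omega>) \<partial>M) = (\<Sum>n. ennreal (7 ^ n) * ennreal (105 * T ^ 4 * (1 / 8) ^ n))"
    by (subst nn_integral_suminf) (auto simp: nn_integral_cmult)
  also have "\<dots> = (\<Sum>n. ennreal (105 * T ^ 4 * (7 / 8) ^ n))"
    using T by (intro suminf_cong) (simp add: power_divide field_simps flip: ennreal_mult)
  also have "\<dots> = ennreal (\<Sum>n. 105 * T ^ 4 * (7 / 8) ^ n)"
    using T by (intro suminf_ennreal_eq summable_sums summable_mult summable_geometric) auto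
  finally have "(\<integral>\<^sup>+\<omega>. (\<Sum>n. ennreal (7 ^ n) * D n \<omega>) \<partial>M) \<noteq> \<infinity>" by simp
  then have "AE \<omega> in M. (\<Sum>n. ennreal (7 ^ n) * D n \<omega>) \<noteq> \<infinity>"
    by (intro nn_integral_PInf_AE) measurable
  moreover have "AE \<omega> in M. continuous_on {0..} (\<lambda>t. w t \<omega>)"
    using W by (simp add: wiener_process_def)
  ultimately show ?thesis
  proof eventually_elim
    case (elim \<omega>)
    obtain S where S: "0 \<le> S" "(\<Sum>n. ennreal (7 ^ n) * D n \<omega>) = ennreal S"
      using elim(1) by (cases "\<Sum>n. ennreal (7 ^ n) * D n \<omega>") auto
    define K where "K = max 1 S"
    have step: "\<bar>\<Delta> n k \<omega>\<bar> \<le> K * \<rho> ^ n" if k: "k < 2 ^ n" for n k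
    proof -
      have "ennreal (7 ^ n * \<Delta> n k \<omega> ^ 8) = ennreal (7 ^ n) * ennreal (\<Delta> n k \<omega> ^ 8)"
        by (simp add: ennreal_mult)
      also have "\<dots> \<le> ennreal (7 ^ n) * D n \<omega>"
        unfolding D_def using k by (intro mult_left_mono member_le_sum) auto
      also have "\<dots> \<le> (\<Sum>n. ennreal (7 ^ n) * D n \<omega>)"
        using sum_le_suminf[of "\<lambda>n. ennreal (7 ^ n) * D n \<omega>" "{n}"] by simp
      also have "\<dots> = ennreal S" by (rule S)
      finally have "7 ^ n * \<Delta> n k \<omega> ^ 8 \<le> S" using S by simp
      then have "\<Delta> n k \<omega> ^ 8 \<le> S * (1 / 7) ^ n" by (simp add: power_one_over field_simps)
      also have "\<dots> \<le> K ^ 8 * (\<rho> ^ 8) ^ n"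
      proof (intro mult_mono power_mono \<rho>8)
        have "K ^ 1 \<le> K ^ 8" unfolding K_def by (intro power_increasing) auto
        then show "S \<le> K ^ 8" unfolding K_def by simp
      qed (auto simp: K_def)
      also have "\<dots> = (K * \<rho> ^ n) ^ 8"
        by (simp add: power_mult_distrib mult.commute flip: power_mult)
      finally have "\<bar>\<Delta> n k \<omega>\<bar> ^ Suc 7 \<le> (K * \<rho> ^ n) ^ Suc 7" by (simp add: power_even_abs)
      then show ?thesis by (rule power_le_imp_le_base) (use \<rho> in \<open>auto simp: K_def\<close>)
    qed
    have cont: "continuous_on {0..T} (\<lambda>t. w t \<omega> $ r)"
      using elim(2) by (intro continuous_intros continuous_on_subset[OF elim(2)]) auto
    have K0: "0 \<le> K" by (simp add: K_def)
    show ?case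
      using dyadic_chaining[OF T cont \<rho> K0, of _ _] step T \<rho> K0 unfolding \<Delta>_def
      by (intro exI[of _ "K * (1 + 2 / (1 - \<rho>)) / (\<rho> * T powr (1/3))"]) auto
  qed
qed

lemma wiener_hoelder:
  fixes w :: "real \<Rightarrow> 'w \<Rightarrow> real ^ 'q::finite"
  assumes W: "wiener_process M w" and T: "0 < T"
  shows "AE \<omega> in M. \<exists>C\<ge>0. \<forall>r s t. 0 \<le> s \<longrightarrow> s \<le> t \<longrightarrow> t \<le> T \<longrightarrow> \<bar>w t \<omega> $ r - w s \<omega> $ r\<bar> \<le> C * (t - s) powr (1/3)"
proof -
  have "AE \<omega> in M. \<forall>r\<in>UNIV. \<exists>C\<ge>0. \<forall>s t. 0 \<le> s \<longrightarrow> s \<le> t \<longrightarrow> t \<le> T \<longrightarrow> \<bar>w t \<omega> $ r - w s \<omega> $ r\<bar> \<le> C * (t - s) powr (1/3)"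
    using wiener_component_hoelder[OF W T] by (intro AE_finite_allI) auto
  then show ?thesis
  proof eventually_elim
    case (elim \<omega>)
    then have "\<forall>r. \<exists>C. 0 \<le> C \<and>
        (\<forall>s t. 0 \<le> s \<longrightarrow> s \<le> t \<longrightarrow> t \<le> T \<longrightarrow> \<bar>w t \<omega> $ r - w s \<omega> $ r\<bar> \<le> C * (t - s) powr (1/3))"
      by auto
    from choice[OF this] obtain C where C: "\<And>r. 0 \<le> C r"
      "\<And>r s t. 0 \<le> s \<Longrightarrow> s \<le> t \<Longrightarrow> t \<le> T \<Longrightarrow> \<bar>w t \<omega> $ r - w s \<omega> $ r\<bar> \<le> C r * (t - s) powr (1/3)"
      by blast
    show ?case
    proof (intro exI[of _ "\<Sum>r\<in>UNIV. C r"] conjI allI impI)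
      show "0 \<le> (\<Sum>r\<in>UNIV. C r)" using C(1) by (intro sum_nonneg)
      fix r and s t :: real assume st: "0 \<le> s" "s \<le> t" "t \<le> T"
      have "C r \<le> (\<Sum>r\<in>UNIV. C r)" using C(1) by (intro member_le_sum) auto
      then show "\<bar>w t \<omega> $ r - w s \<omega> $ r\<bar> \<le> (\<Sum>r\<in>UNIV. C r) * (t - s) powr (1/3)"
        using C(2)[OF st, of r] by (meson mult_right_mono order_trans powr_ge_zero)
    qed
  qed
qed

section \<open>The Ito isometry\<close>

lemma wiener_measurable:
  assumes "wiener_process M w" "0 \<le> t"
  shows "w t \<in> borel_measurable M"
  using assms by (auto simp: wiener_process_def)

lemma space_generated_filtration [simp]: "space (generated_filtration M w t) = space M"
  unfolding generated_filtration_def by (subst space_measure_of) auto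

lemma sets_generated_filtration:
  "sets (generated_filtration M w t) =
     sigma_sets (space M) (\<Union>s\<in>{0..t}. {w s -` A \<inter> space M | A. A \<in> sets borel})"
  unfolding generated_filtration_def by (subst sets_measure_of) auto

lemma generated_filtration_mono:
  assumes "s \<le> t"
  shows "sets (generated_filtration M w s) \<subseteq> sets (generated_filtration M w t)"
  unfolding sets_generated_filtration using assms by (intro sigma_sets_mono' UN_mono) auto

lemma generated_filtration_subset:
  assumes "wiener_process M w"
  shows "sets (generated_filtration M w t) \<subseteq> sets M"
  unfolding sets_generated_filtration
proof (rule sets.sigma_sets_subset)
  show "(\<Union>s\<in>{0..t}. {w s -` A \<inter> space M | A. A \<in> sets borel}) \<subseteq> sets M"
    using wiener_measurable[OF assms] by (auto intro: measurable_sets)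
qed

lemma measurable_generated_filtration_mono:
  assumes "X \<in> borel_measurable (generated_filtration M w s)" "s \<le> t"
  shows "X \<in> borel_measurable (generated_filtration M w t)"
  using assms(1) generated_filtration_mono[OF assms(2), of M w]
  by (auto simp: measurable_def)

lemma measurable_generated_filtration:
  assumes "wiener_process M w" "X \<in> borel_measurable (generated_filtration M w s)"
  shows "X \<in> borel_measurable M"
  using assms(2) generated_filtration_subset[OF assms(1), of s] by (auto simp: measurable_def)

lemma wiener_adapted:
  assumes "0 \<le> u" "u \<le> t"
  shows "w u \<in> borel_measurable (generated_filtration M w t)"
proof (rule measurableI)
  fix A :: "'b::topological_space set" assume "A \<in> sets borel"
  then have "w u -` A \<inter> space M \<in> (\<Union>s\<in>{0..t}. {w s -` A \<inter> space M | A. A \<in> sets borel})"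
    using assms by (intro UN_I[of u]) auto
  then show "w u -` A \<inter> space (generated_filtration M w t) \<in> sets (generated_filtration M w t)"
    unfolding sets_generated_filtration by (simp add: sigma_sets.Basic)
qed simp

lemma wiener_component_adapted:
  fixes w :: "real \<Rightarrow> 'w \<Rightarrow> real ^ 'q::finite"
  assumes "0 \<le> u" "u \<le> t"
  shows "(\<lambda>\<omega>. w u \<omega> $ r) \<in> borel_measurable (generated_filtration M w t)"
proof -
  have [measurable]: "(\<lambda>y :: real ^ 'q. y $ r) \<in> borel_measurable borel"
    by (intro borel_measurable_continuous_onI continuous_intros)
  have [measurable]: "w u \<in> borel_measurable (generated_filtration M w t)" by (rule wiener_adapted[OF assms])
  show ?thesis by measurable
qed

text \<open>Events that constrain the path at finitely many times form an intersection-stable generator of the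
  past, and up to a null set they only involve increments over disjoint intervals before \<open>s\<close>.\<close>

lemma wiener_increment_indep_past:
  fixes w :: "real \<Rightarrow> 'w \<Rightarrow> real ^ 'q::finite"
  assumes P: "prob_space M" and W: "wiener_process M w" and st: "0 \<le> s" "s \<le> t"
  shows "prob_space.indep_set M (sets (generated_filtration M w s))
    {(\<lambda>\<omega>. w t \<omega> - w s \<omega>) -` B \<inter> space M | B. B \<in> sets borel}"
proof -
  interpret prob_space M by (rule P)
  note wm[measurable] = wiener_measurable[OF W]
  define G where "G = {{\<omega>\<in>space M. \<forall>u\<in>U. w u \<omega> \<in> A u} | U A. finite U \<and> U \<subseteq> {0..s} \<and> (\<forall>u\<in>U. A u \<in> sets borel)}"
  define H where "H = {(\<lambda>\<omega>. w t \<omega> - w s \<omega>) -` B \<inter> space M | B. B \<in> sets borel}"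
  have incm: "(\<lambda>\<omega>. w t \<omega> - w s \<omega>) \<in> borel_measurable M"
    using st by (intro borel_measurable_diff wm) auto
  have G_ev: "G \<subseteq> events"
  proof
    fix E assume "E \<in> G"
    then obtain U A where U: "E = {\<omega>\<in>space M. \<forall>u\<in>U. w u \<omega> \<in> A u}" "finite U" "U \<subseteq> {0..s}" "\<And>u. u \<in> U \<Longrightarrow> A u \<in> sets borel"
      unfolding G_def by blast
    have "Measurable.pred M (\<lambda>\<omega>. \<forall>u\<in>U. w u \<omega> \<in> A u)"
    proof (rule pred_intros_finite(3)[OF U(2)])
      fix u assume u: "u \<in> U"
      show "Measurable.pred M (\<lambda>\<omega>. w u \<omega> \<in> A u)"
        using wm[of u] U(3,4) u by (intro pred_sets2[of "A u" borel]) auto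
    qed
    then show "E \<in> events" unfolding U(1) pred_def .
  qed
  have G_stable: "Int_stable G"
  proof (rule Int_stableI)
    fix E E' assume "E \<in> G" "E' \<in> G"
    then obtain U A U' A' where U: "E = {\<omega>\<in>space M. \<forall>u\<in>U. w u \<omega> \<in> A u}" "finite U" "U \<subseteq> {0..s}" "\<forall>u\<in>U. A u \<in> sets borel"
      and U': "E' = {\<omega>\<in>space M. \<forall>u\<in>U'. w u \<omega> \<in> A' u}" "finite U'" "U' \<subseteq> {0..s}" "\<forall>u\<in>U'. A' u \<in> sets borel"
      unfolding G_def by blast
    define A'' where "A'' u = (if u \<in> U then A u else UNIV) \<inter> (if u \<in> U' then A' u else UNIV)" for u
    have "E \<inter> E' = {\<omega>\<in>space M. \<forall>u\<in>U \<union> U'. w u \<omega> \<in> A'' u}"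
      unfolding U(1) U'(1) A''_def by auto
    moreover have "finite (U \<union> U') \<and> U \<union> U' \<subseteq> {0..s} \<and> (\<forall>u\<in>U \<union> U'. A'' u \<in> sets borel)"
      using U U' unfolding A''_def by auto
    ultimately show "E \<inter> E' \<in> G" unfolding G_def by blast
  qed
  have H_ev: "H \<subseteq> events" unfolding H_def using incm by (auto intro: measurable_sets)
  have H_stable: "Int_stable H"
  proof (rule Int_stableI)
    fix E E' assume "E \<in> H" "E' \<in> H"
    then obtain B B' where "E = (\<lambda>\<omega>. w t \<omega> - w s \<omega>) -` B \<inter> space M" "B \<in> sets borel"
      "E' = (\<lambda>\<omega>. w t \<omega> - w s \<omega>) -` B' \<inter> space M" "B' \<in> sets borel"
      unfolding H_def by blast
    then show "E \<inter> E' \<in> H"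
      unfolding H_def by (intro CollectI exI[of _ "B \<inter> B'"]) auto
  qed
  have "indep_set G H"
    unfolding indep_set_def
  proof (rule indep_setI[unfolded indep_set_def])
    show "G \<subseteq> events" "H \<subseteq> events" by (rule G_ev, rule H_ev)
    fix E D assume "E \<in> G" "D \<in> H"
    then obtain U A B where U: "E = {\<omega>\<in>space M. \<forall>u\<in>U. w u \<omega> \<in> A u}" "finite U" "U \<subseteq> {0..s}" "\<And>u. u \<in> U \<Longrightarrow> A u \<in> sets borel"
      and B: "D = (\<lambda>\<omega>. w t \<omega> - w s \<omega>) -` B \<inter> space M" "B \<in> sets borel"
      unfolding G_def H_def by blast
    define us where "us = sorted_list_of_set U"
    define m where "m = length us"
    have us: "sorted us" "set us = U" unfolding us_def using U(2) by auto
    \<comment> \<open>time zero, the constrained times in order, then \<open>s\<close> and \<open>t\<close>: the increment over the last interval is the one in \<open>D\<close>, all others belong to the past\<close>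
    define \<tau> where "\<tau> i = (if i = 0 then 0 else if i \<le> m then us ! (i - 1) else if i = Suc m then s else t)" for i
    have \<tau>us: "us ! i \<in> {0..s}" if "i < m" for i
      using that us(2) U(3) nth_mem[of i us] unfolding m_def by auto
    have \<tau>mono: "\<tau> i \<le> \<tau> (Suc i)" for i
    proof -
      consider "i = 0" | "0 < i" "i < m" | "0 < i" "i = m" | "i > m" by linarith
      then show ?thesis
      proof cases
        case 2
        then have "us ! (i - 1) \<le> us ! i" using us(1) unfolding m_def by (intro sorted_nth_mono) auto
        then show ?thesis using 2 by (simp add: \<tau>_def)
      qed (use \<tau>us[of 0] \<tau>us[of "i - 1"] st in \<open>auto simp: \<tau>_def\<close>)
    qed
    define X where "X i \<omega> = w (\<tau> (Suc i)) \<omega> - w (\<tau> i) \<omega>" for i \<omega>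
    have ind: "indep_vars (\<lambda>_. borel) X {..<m + 2}"
    proof -
      have "\<forall>m \<tau>. 0 \<le> \<tau> 0 \<and> (\<forall>i<m. \<tau> i \<le> \<tau> (Suc i)) \<longrightarrow>
        indep_vars (\<lambda>_. borel) (\<lambda>i \<omega>. w (\<tau> (Suc i)) \<omega> - w (\<tau> i) \<omega>) {..<m}"
        using W unfolding wiener_process_def by blast
      from this[rule_format, of \<tau> "m + 2"] \<tau>mono show ?thesis unfolding X_def[abs_def] by (simp add: \<tau>_def)
    qed
    define Z where "Z = (\<lambda>\<omega>. restrict (\<lambda>i. X i \<omega>) {..<Suc m})"
    define Y where "Y = (\<lambda>\<omega>. restrict (\<lambda>i. X i \<omega>) {Suc m})"
    have ZY: "indep_var (PiM {..<Suc m} (\<lambda>_. borel)) Z (PiM {Suc m} (\<lambda>_. borel)) Y"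
      unfolding Z_def Y_def by (rule indep_var_restrict[OF ind]) auto
    \<comment> \<open>the partial sums of the increments recover the path at the constrained times, as it starts in zero almost surely\<close>
    define C where "C = {z\<in>space (PiM {..<Suc m} (\<lambda>_. borel)). \<forall>k<m. (\<Sum>i<Suc k. z i) \<in> A (us ! k)}"
    define B' where "B' = {z\<in>space (PiM {Suc m} (\<lambda>_. borel :: (real ^ 'q) measure)). z (Suc m) \<in> B}"
    have C: "C \<in> sets (PiM {..<Suc m} (\<lambda>_. borel))"
    proof -
      have "Measurable.pred (PiM {..<Suc m} (\<lambda>_. borel)) (\<lambda>z. \<forall>k\<in>{..<m}. (\<Sum>i<Suc k. z i) \<in> A (us ! k))"
      proof (rule pred_intros_finite(3))
        fix k assume k: "k \<in> {..<m}"
        have "us ! k \<in> U" using k us(2) nth_mem[of k us] unfolding m_def by auto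
        then have "A (us ! k) \<in> sets borel" by (rule U(4))
        moreover have "(\<lambda>z. z i) \<in> borel_measurable (PiM {..<Suc m} (\<lambda>_. borel :: (real ^ 'q) measure))" if "i < Suc k" for i
          using measurable_component_singleton[of i "{..<Suc m}" "\<lambda>_. borel :: (real ^ 'q) measure"] that k by simp
        then have "(\<lambda>z. \<Sum>i<Suc k. z i) \<in> borel_measurable (PiM {..<Suc m} (\<lambda>_. borel :: (real ^ 'q) measure))"
          by (rule borel_measurable_sum) simp
        ultimately show "Measurable.pred (PiM {..<Suc m} (\<lambda>_. borel)) (\<lambda>z. (\<Sum>i<Suc k. z i) \<in> A (us ! k))"
          by (rule pred_sets2)
      qed (rule finite_lessThan)
      then show ?thesis unfolding C_def pred_def by (simp only: Ball_def lessThan_iff)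
    qed
    have B': "B' \<in> sets (PiM {Suc m} (\<lambda>_. borel))"
    proof -
      have "Measurable.pred (PiM {Suc m} (\<lambda>_. borel)) (\<lambda>z. z (Suc m) \<in> B)"
        using measurable_component_singleton[of "Suc m" "{Suc m}" "\<lambda>_. borel :: (real ^ 'q) measure"]
        by (intro pred_sets2[OF B(2)]) simp
      then show ?thesis unfolding B'_def pred_def .
    qed
    have prod: "prob ((\<lambda>\<omega>. (Z \<omega>, Y \<omega>)) -` (C \<times> B') \<inter> space M) = prob (Z -` C \<inter> space M) * prob (Y -` B' \<inter> space M)"
      by (rule indep_varD[OF ZY C B'])
    have YB: "Y -` B' \<inter> space M = D"
      unfolding Y_def B'_def B(1) X_def by (auto simp: \<tau>_def space_PiM PiE_def extensional_def)
    have Zm: "Z -` C \<inter> space M \<in> events"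
      using indep_var_rv1[OF ZY] C by (rule measurable_sets)
    have ae: "AE \<omega> in M. \<omega> \<in> E \<longleftrightarrow> \<omega> \<in> Z -` C \<inter> space M"
    proof -
      have "AE \<omega> in M. w 0 \<omega> = 0" using W by (simp add: wiener_process_def)
      then show ?thesis
      proof (rule AE_mp[OF _ AE_I2], intro impI)
        fix \<omega> assume \<omega>: "\<omega> \<in> space M" and w0: "w 0 \<omega> = 0"
        have "(\<Sum>i<Suc k. Z \<omega> i) = w (us ! k) \<omega>" if "k < m" for k
        proof -
          have "(\<Sum>i<Suc k. Z \<omega> i) = (\<Sum>i<Suc k. w (\<tau> (Suc i)) \<omega> - w (\<tau> i) \<omega>)"
            using that by (intro sum.cong) (auto simp: Z_def X_def)
          also have "\<dots> = w (\<tau> (Suc k)) \<omega> - w (\<tau> 0) \<omega>" by (rule sum_lessThan_telescope)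
          finally show ?thesis using that w0 by (simp add: \<tau>_def)
        qed
        moreover have "Z \<omega> \<in> space (PiM {..<Suc m} (\<lambda>_. borel :: (real ^ 'q) measure))"
          unfolding Z_def by (auto simp: space_PiM)
        ultimately have "\<omega> \<in> Z -` C \<inter> space M \<longleftrightarrow> (\<forall>k<m. w (us ! k) \<omega> \<in> A (us ! k))"
          using \<omega> unfolding C_def by auto
        also have "\<dots> \<longleftrightarrow> (\<forall>u\<in>set us. w u \<omega> \<in> A u)"
          unfolding m_def by (metis in_set_conv_nth)
        finally show "\<omega> \<in> E \<longleftrightarrow> \<omega> \<in> Z -` C \<inter> space M"
          using \<omega> us(2) U(1) by auto
      qed
    qed
    have E: "E \<in> events" "D \<in> events" using G_ev H_ev \<open>E \<in> G\<close> \<open>D \<in> H\<close> by auto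
    have "prob (E \<inter> D) = prob ((Z -` C \<inter> space M) \<inter> D)"
      using ae by (intro finite_measure_eq_AE) (use E Zm in auto)
    also have "(Z -` C \<inter> space M) \<inter> D = (\<lambda>\<omega>. (Z \<omega>, Y \<omega>)) -` (C \<times> B') \<inter> space M"
      using YB by auto
    also have "prob \<dots> = prob (Z -` C \<inter> space M) * prob D" unfolding prod YB ..
    also have "prob (Z -` C \<inter> space M) = prob E"
      using ae by (intro finite_measure_eq_AE) (use E Zm in auto)
    finally show "prob (E \<inter> D) = prob E * prob D" .
  qed
  from indep_set_sigma_sets[OF this G_stable H_stable]
  have ind: "indep_set (sigma_sets (space M) G) (sigma_sets (space M) H)" .
  have "(\<Union>u\<in>{0..s}. {w u -` A \<inter> space M | A. A \<in> sets borel}) \<subseteq> G"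
  proof safe
    fix u and A :: "(real ^ 'q) set" assume "u \<in> {0..s}" "A \<in> sets borel"
    then show "w u -` A \<inter> space M \<in> G"
      unfolding G_def by (intro CollectI exI[of _ "{u}"] exI[of _ "\<lambda>_. A"]) auto
  qed
  then have sub: "sets (generated_filtration M w s) \<subseteq> sigma_sets (space M) G"
    unfolding sets_generated_filtration by (rule sigma_sets_mono')
  have subH: "H \<subseteq> sigma_sets (space M) H" by auto
  show ?thesis
    unfolding H_def[symmetric] indep_set_def
    using ind[unfolded indep_set_def]
    by (rule indep_sets_mono_sets) (use sub subH in \<open>auto split: bool.split\<close>)
qed

lemma wiener_increment_indep_var:
  fixes w :: "real \<Rightarrow> 'w \<Rightarrow> real ^ 'q::finite" and X :: "'w \<Rightarrow> real"
  assumes P: "prob_space M" and W: "wiener_process M w" and st: "0 \<le> s" "s \<le> t"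
    and X: "X \<in> borel_measurable (generated_filtration M w s)"
  shows "prob_space.indep_var M borel X borel (\<lambda>\<omega>. w t \<omega> $ r - w s \<omega> $ r)"
proof -
  interpret prob_space M by (rule P)
  have nth: "(\<lambda>y :: real ^ 'q. y $ r) \<in> borel_measurable borel"
    by (intro borel_measurable_continuous_onI continuous_intros)
  have Y: "(\<lambda>\<omega>. w t \<omega> - w s \<omega>) \<in> borel_measurable M"
    using st by (intro borel_measurable_diff wiener_measurable[OF W]) auto
  have Yr: "(\<lambda>\<omega>. w t \<omega> $ r - w s \<omega> $ r) \<in> borel_measurable M"
    using measurable_compose[OF Y nth] by simp
  show ?thesis
    unfolding indep_var_eq
  proof (intro conjI)
    show "random_variable borel X" by (rule measurable_generated_filtration[OF W X])
    show "random_variable borel (\<lambda>\<omega>. w t \<omega> $ r - w s \<omega> $ r)" by (rule Yr)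
    have "{X -` A \<inter> space M | A. A \<in> sets borel} \<subseteq> sets (generated_filtration M w s)"
      using measurable_sets[OF X] by auto
    then have 1: "sigma_sets (space M) {X -` A \<inter> space M | A. A \<in> sets borel} \<subseteq> sets (generated_filtration M w s)"
      using sets.sigma_sets_subset[of _ "generated_filtration M w s"] by simp
    define H where "H = {(\<lambda>\<omega>. w t \<omega> - w s \<omega>) -` B \<inter> space M | B. B \<in> sets borel}"
    have st: "Int_stable H"
    proof (rule Int_stableI)
      fix E E' assume "E \<in> H" "E' \<in> H"
      then obtain B B' where "E = (\<lambda>\<omega>. w t \<omega> - w s \<omega>) -` B \<inter> space M" "B \<in> sets borel"
        "E' = (\<lambda>\<omega>. w t \<omega> - w s \<omega>) -` B' \<inter> space M" "B' \<in> sets borel" unfolding H_def by blast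
      then show "E \<inter> E' \<in> H"
        unfolding H_def by (intro CollectI exI[of _ "B \<inter> B'"]) auto
    qed
    have ind: "indep_set (sigma_sets (space M) (sets (generated_filtration M w s))) (sigma_sets (space M) H)"
      unfolding H_def
      by (rule indep_set_sigma_sets[OF wiener_increment_indep_past[OF P W assms(3,4)] sets.Int_stable st[unfolded H_def]])
    have 2: "sigma_sets (space M) (sets (generated_filtration M w s)) = sets (generated_filtration M w s)"
      using sets.sigma_sets_eq[of "generated_filtration M w s"] by simp
    have 3: "sigma_sets (space M) {(\<lambda>\<omega>. w t \<omega> $ r - w s \<omega> $ r) -` A \<inter> space M | A. A \<in> sets borel}
        \<subseteq> sigma_sets (space M) H"
    proof (rule sigma_sets_mono', safe)
      fix A :: "real set" assume "A \<in> sets borel"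
      then have "(\<lambda>y :: real ^ 'q. y $ r) -` A \<in> sets borel"
        using measurable_sets[OF nth, of A] by simp
      then show "(\<lambda>\<omega>. w t \<omega> $ r - w s \<omega> $ r) -` A \<inter> space M \<in> H"
        unfolding H_def by (intro CollectI exI[of _ "(\<lambda>y :: real ^ 'q. y $ r) -` A"]) auto
    qed
    show "indep_set (sigma_sets (space M) {X -` A \<inter> space M | A. A \<in> sets borel})
        (sigma_sets (space M) {(\<lambda>\<omega>. w t \<omega> $ r - w s \<omega> $ r) -` A \<inter> space M | A. A \<in> sets borel})"
      unfolding indep_set_def
      by (rule indep_sets_mono_sets[OF ind[unfolded indep_set_def 2]])
         (use 1 3 in \<open>auto split: bool.split\<close>)
  qed
qed

lemma wiener_increment_moments:
  fixes w :: "real \<Rightarrow> 'w \<Rightarrow> real ^ 'q::finite"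
  assumes P: "prob_space M" and W: "wiener_process M w" and st: "0 \<le> s" "s \<le> t"
  shows "integrable M (\<lambda>\<omega>. w t \<omega> $ r - w s \<omega> $ r)"
    and "(\<integral>\<omega>. w t \<omega> $ r - w s \<omega> $ r \<partial>M) = 0"
    and "integrable M (\<lambda>\<omega>. (w t \<omega> $ r - w s \<omega> $ r)\<^sup>2)"
    and "(\<integral>\<omega>. (w t \<omega> $ r - w s \<omega> $ r)\<^sup>2 \<partial>M) = t - s"
proof -
  interpret prob_space M by (rule P)
  have "integrable M (\<lambda>\<omega>. w t \<omega> $ r - w s \<omega> $ r) \<and> (\<integral>\<omega>. w t \<omega> $ r - w s \<omega> $ r \<partial>M) = 0 \<and>
    integrable M (\<lambda>\<omega>. (w t \<omega> $ r - w s \<omega> $ r)\<^sup>2) \<and> (\<integral>\<omega>. (w t \<omega> $ r - w s \<omega> $ r)\<^sup>2 \<partial>M) = t - s"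
  proof (cases "s = t")
    case False
    then have lt: "s < t" and \<sigma>: "0 < sqrt (t - s)" using st by auto
    have D: "distributed M lborel (\<lambda>\<omega>. w t \<omega> $ r - w s \<omega> $ r) (normal_density 0 (sqrt (t - s)))"
      using W st lt unfolding wiener_process_def by blast
    have 1: "integrable M (\<lambda>\<omega>. w t \<omega> $ r - w s \<omega> $ r)"
      using integrable_normal_moment[OF \<sigma>, of 0 1]
      by (subst distributed_integrable[OF D, of "\<lambda>x. x", symmetric]) auto
    have 2: "integrable M (\<lambda>\<omega>. (w t \<omega> $ r - w s \<omega> $ r)\<^sup>2)"
      using integrable_normal_moment[OF \<sigma>, of 0 2]
      by (subst distributed_integrable[OF D, of "\<lambda>x. x\<^sup>2", symmetric]) auto
    have 3: "expectation (\<lambda>\<omega>. w t \<omega> $ r - w s \<omega> $ r) = 0"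
      by (rule normal_distributed_expectation[OF \<sigma> D])
    have "variance (\<lambda>\<omega>. w t \<omega> $ r - w s \<omega> $ r) = (sqrt (t - s))\<^sup>2"
      by (rule normal_distributed_variance[OF \<sigma> D])
    then show ?thesis using 1 2 3 lt by simp
  qed simp
  then show "integrable M (\<lambda>\<omega>. w t \<omega> $ r - w s \<omega> $ r)" "(\<integral>\<omega>. w t \<omega> $ r - w s \<omega> $ r \<partial>M) = 0"
    "integrable M (\<lambda>\<omega>. (w t \<omega> $ r - w s \<omega> $ r)\<^sup>2)" "(\<integral>\<omega>. (w t \<omega> $ r - w s \<omega> $ r)\<^sup>2 \<partial>M) = t - s"
    by auto
qed

lemma wiener_past_times_increment:
  fixes w :: "real \<Rightarrow> 'w \<Rightarrow> real ^ 'q::finite" and X :: "'w \<Rightarrow> real"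
  assumes P: "prob_space M" and W: "wiener_process M w" and st: "0 \<le> s" "s \<le> t"
    and X: "X \<in> borel_measurable (generated_filtration M w s)" "integrable M X"
  shows "integrable M (\<lambda>\<omega>. X \<omega> * (w t \<omega> $ r - w s \<omega> $ r))"
    and "(\<integral>\<omega>. X \<omega> * (w t \<omega> $ r - w s \<omega> $ r) \<partial>M) = 0"
    and "integrable M (\<lambda>\<omega>. X \<omega> * (w t \<omega> $ r - w s \<omega> $ r)\<^sup>2)"
    and "(\<integral>\<omega>. X \<omega> * (w t \<omega> $ r - w s \<omega> $ r)\<^sup>2 \<partial>M) = (\<integral>\<omega>. X \<omega> \<partial>M) * (t - s)"
proof -
  interpret prob_space M by (rule P)
  note m = wiener_increment_moments[OF P W st, of r]
  note ind = wiener_increment_indep_var[OF P W st X(1), of r]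
  show "integrable M (\<lambda>\<omega>. X \<omega> * (w t \<omega> $ r - w s \<omega> $ r))"
    by (rule indep_var_integrable[OF ind X(2) m(1)])
  show "(\<integral>\<omega>. X \<omega> * (w t \<omega> $ r - w s \<omega> $ r) \<partial>M) = 0"
    using indep_var_lebesgue_integral[OF ind X(2) m(1)] m(2) by simp
  have ind2: "indep_var borel X borel (\<lambda>\<omega>. (w t \<omega> $ r - w s \<omega> $ r)\<^sup>2)"
    using indep_var_compose[OF ind, of "\<lambda>x. x" borel "\<lambda>x. x\<^sup>2" borel] by (simp add: o_def)
  show "integrable M (\<lambda>\<omega>. X \<omega> * (w t \<omega> $ r - w s \<omega> $ r)\<^sup>2)"
    by (rule indep_var_integrable[OF ind2 X(2) m(3)])
  show "(\<integral>\<omega>. X \<omega> * (w t \<omega> $ r - w s \<omega> $ r)\<^sup>2 \<partial>M) = (\<integral>\<omega>. X \<omega> \<partial>M) * (t - s)"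
    using indep_var_lebesgue_integral[OF ind2 X(2) m(3)] m(4) by simp
qed

text \<open>The length of the intersection of \<open>{a<..b}\<close> and \<open>{c<..d}\<close>.\<close>

definition overlap :: "real \<Rightarrow> real \<Rightarrow> real \<Rightarrow> real \<Rightarrow> real" where
  "overlap a b c d = max 0 (min b d - max a c)"

text \<open>The increments are cut at the start \<open>c\<close> and at the end \<open>e\<close> of the overlap.  Every product of pieces except the
  square over the overlap contains an increment that is independent of the other factors and has mean zero.\<close>

lemma wiener_increment_covariance_aux:
  fixes w :: "real \<Rightarrow> 'w \<Rightarrow> real ^ 'q::finite" and X :: "'w \<Rightarrow> real"
  assumes P: "prob_space M" and W: "wiener_process M w" and abcd: "0 \<le> a" "a \<le> b" "a \<le> c" "c \<le> d"
    and X: "X \<in> borel_measurable (generated_filtration M w c)" and B: "\<And>\<omega>. \<omega> \<in> space M \<Longrightarrow> \<bar>X \<omega>\<bar> \<le> B"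
  shows "integrable M (\<lambda>\<omega>. X \<omega> * (w b \<omega> $ r - w a \<omega> $ r) * (w d \<omega> $ r - w c \<omega> $ r))"
    and "(\<integral>\<omega>. X \<omega> * (w b \<omega> $ r - w a \<omega> $ r) * (w d \<omega> $ r - w c \<omega> $ r) \<partial>M) = (\<integral>\<omega>. X \<omega> \<partial>M) * overlap a b c d"
proof -
  interpret prob_space M by (rule P)
  have XM[measurable]: "X \<in> borel_measurable M" by (rule measurable_generated_filtration[OF W X])
  have Xi: "integrable M X"
    using B by (intro integrable_const_bound[where B=B] AE_I2) auto
  define x where "x u \<omega> = w u \<omega> $ r" for u \<omega>
  have Xinc: "integrable M (\<lambda>\<omega>. X \<omega> * (x t \<omega> - x s \<omega>))" if "0 \<le> s" "s \<le> t" for s t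
  proof -
    have i: "integrable M (\<lambda>\<omega>. x t \<omega> - x s \<omega>)"
      using wiener_increment_moments(1)[OF P W that, of r] by (simp add: x_def)
    then have [measurable]: "(\<lambda>\<omega>. x t \<omega> - x s \<omega>) \<in> borel_measurable M" by simp
    have "integrable M (\<lambda>\<omega>. B * (x t \<omega> - x s \<omega>))" using i by simp
    then show ?thesis
    proof (rule Bochner_Integration.integrable_bound)
      show "AE \<omega> in M. norm (X \<omega> * (x t \<omega> - x s \<omega>)) \<le> norm (B * (x t \<omega> - x s \<omega>))"
        using B by (intro AE_I2) (force simp: abs_mult intro!: mult_right_mono)
    qed measurable
  qed
  have xa: "x u \<in> borel_measurable (generated_filtration M w t)" if "0 \<le> u" "u \<le> t" for u t
    unfolding x_def[abs_def] by (rule wiener_component_adapted[OF that])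
  have orth: "integrable M (\<lambda>\<omega>. Y \<omega> * (x t \<omega> - x s \<omega>))" "(\<integral>\<omega>. Y \<omega> * (x t \<omega> - x s \<omega>) \<partial>M) = 0"
    if "0 \<le> s" "s \<le> t" "Y \<in> borel_measurable (generated_filtration M w s)" "integrable M Y" for Y s t
    using wiener_past_times_increment(1,2)[OF P W that, of r] by (auto simp: x_def)
  have c0: "0 \<le> c" using abcd by simp
  have "integrable M (\<lambda>\<omega>. X \<omega> * (x b \<omega> - x a \<omega>) * (x d \<omega> - x c \<omega>)) \<and>
    (\<integral>\<omega>. X \<omega> * (x b \<omega> - x a \<omega>) * (x d \<omega> - x c \<omega>) \<partial>M) = (\<integral>\<omega>. X \<omega> \<partial>M) * overlap a b c d"
  proof (cases "b \<le> c")
    case True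
    have "(\<lambda>\<omega>. X \<omega> * (x b \<omega> - x a \<omega>)) \<in> borel_measurable (generated_filtration M w c)"
      using abcd True by (intro borel_measurable_times borel_measurable_diff X xa) auto
    from orth[OF c0 abcd(4) this Xinc[OF abcd(1,2)]] True show ?thesis
      by (simp add: overlap_def)
  next
    case False
    define e where "e = min b d"
    have e: "c \<le> e" "e \<le> b" "e \<le> d" using False abcd by (auto simp: e_def)
    have m1: "(\<lambda>\<omega>. X \<omega> * (x c \<omega> - x a \<omega>)) \<in> borel_measurable (generated_filtration M w c)"
      using abcd by (intro borel_measurable_times borel_measurable_diff X xa) auto
    have 1: "integrable M (\<lambda>\<omega>. X \<omega> * (x c \<omega> - x a \<omega>) * (x d \<omega> - x c \<omega>))"
      "(\<integral>\<omega>. X \<omega> * (x c \<omega> - x a \<omega>) * (x d \<omega> - x c \<omega>) \<partial>M) = 0"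
      using orth[OF c0 abcd(4) m1 Xinc[OF abcd(1,3)]] by auto
    have 2: "integrable M (\<lambda>\<omega>. X \<omega> * (x e \<omega> - x c \<omega>)\<^sup>2)"
      "(\<integral>\<omega>. X \<omega> * (x e \<omega> - x c \<omega>)\<^sup>2 \<partial>M) = (\<integral>\<omega>. X \<omega> \<partial>M) * (e - c)"
      using wiener_past_times_increment(3,4)[OF P W c0 e(1) X Xi, of r] by (auto simp: x_def)
    have m3: "(\<lambda>\<omega>. X \<omega> * (x e \<omega> - x c \<omega>)) \<in> borel_measurable (generated_filtration M w e)"
      using c0 e by (intro borel_measurable_times borel_measurable_diff xa measurable_generated_filtration_mono[OF X]) auto
    have 3: "integrable M (\<lambda>\<omega>. X \<omega> * (x e \<omega> - x c \<omega>) * (x t \<omega> - x e \<omega>))"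
      "(\<integral>\<omega>. X \<omega> * (x e \<omega> - x c \<omega>) * (x t \<omega> - x e \<omega>) \<partial>M) = 0" if "e \<le> t" for t
      using orth[OF _ that m3 Xinc[OF c0 e(1)]] c0 e by auto
    have split: "X \<omega> * (x b \<omega> - x a \<omega>) * (x d \<omega> - x c \<omega>)
        = X \<omega> * (x c \<omega> - x a \<omega>) * (x d \<omega> - x c \<omega>) + (X \<omega> * (x e \<omega> - x c \<omega>)\<^sup>2
          + (X \<omega> * (x e \<omega> - x c \<omega>) * (x d \<omega> - x e \<omega>) + X \<omega> * (x e \<omega> - x c \<omega>) * (x b \<omega> - x e \<omega>)))" for \<omega>
    proof -
      have "e = b \<or> e = d" by (auto simp: e_def)
      then have z: "(x b \<omega> - x e \<omega>) * (x d \<omega> - x e \<omega>) = 0" by auto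
      have "X \<omega> * (x b \<omega> - x a \<omega>) * (x d \<omega> - x c \<omega>)
        = X \<omega> * (x c \<omega> - x a \<omega>) * (x d \<omega> - x c \<omega>) + (X \<omega> * (x e \<omega> - x c \<omega>)\<^sup>2
          + (X \<omega> * (x e \<omega> - x c \<omega>) * (x d \<omega> - x e \<omega>) + X \<omega> * (x e \<omega> - x c \<omega>) * (x b \<omega> - x e \<omega>)))
          + X \<omega> * ((x b \<omega> - x e \<omega>) * (x d \<omega> - x e \<omega>))" by (simp add: power2_eq_square algebra_simps)
      then show ?thesis unfolding z by simp
    qed
    show ?thesis
      unfolding split using 1 2 3[OF e(2)] 3[OF e(3)] False abcd by (simp add: overlap_def e_def)
  qed
  then show "integrable M (\<lambda>\<omega>. X \<omega> * (w b \<omega> $ r - w a \<omega> $ r) * (w d \<omega> $ r - w c \<omega> $ r))"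
    "(\<integral>\<omega>. X \<omega> * (w b \<omega> $ r - w a \<omega> $ r) * (w d \<omega> $ r - w c \<omega> $ r) \<partial>M) = (\<integral>\<omega>. X \<omega> \<partial>M) * overlap a b c d"
    by (auto simp: x_def)
qed

lemma wiener_increment_covariance:
  fixes w :: "real \<Rightarrow> 'w \<Rightarrow> real ^ 'q::finite" and X :: "'w \<Rightarrow> real"
  assumes P: "prob_space M" and W: "wiener_process M w" and abcd: "0 \<le> a" "a \<le> b" "0 \<le> c" "c \<le> d"
    and X: "X \<in> borel_measurable (generated_filtration M w (max a c))" and B: "\<And>\<omega>. \<omega> \<in> space M \<Longrightarrow> \<bar>X \<omega>\<bar> \<le> B"
  shows "integrable M (\<lambda>\<omega>. X \<omega> * (w b \<omega> $ r - w a \<omega> $ r) * (w d \<omega> $ r - w c \<omega> $ r)) \<and>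
    (\<integral>\<omega>. X \<omega> * (w b \<omega> $ r - w a \<omega> $ r) * (w d \<omega> $ r - w c \<omega> $ r) \<partial>M) = (\<integral>\<omega>. X \<omega> \<partial>M) * overlap a b c d"
proof (cases "a \<le> c")
  case True
  then show ?thesis
    using wiener_increment_covariance_aux[OF P W abcd(1,2) True abcd(4), of X B r] X B by (simp add: max_def)
next
  case False
  then have ca: "c \<le> a" and X': "X \<in> borel_measurable (generated_filtration M w a)" using X by (auto simp: max_def)
  have "overlap c d a b = overlap a b c d" by (simp add: overlap_def max.commute min.commute)
  then show ?thesis
    using wiener_increment_covariance_aux[OF P W abcd(3,4) ca abcd(2) X' B, of r]
    by (simp add: mult.assoc mult.commute[of "w d _ $ r - w c _ $ r"])
qed

lemma measure_Ioc_inter: "(\<integral>s. indicator {a<..b} s * indicator {c<..d} s \<partial>lborel) = overlap a b c d"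
proof -
  have "(\<lambda>s. indicator {a<..b} s * indicator {c<..d} s :: real) = indicator {max a c<..min b d}"
    by (auto simp: indicator_def fun_eq_iff)
  moreover have "measure lborel {max a c<..min b d} = overlap a b c d"
    by (cases "max a c \<le> min b d") (auto simp: overlap_def)
  ultimately show ?thesis by simp
qed

lemma norm_sum_scaleR_squared:
  fixes y :: "'i \<Rightarrow> 'a::real_inner"
  shows "(norm (\<Sum>i\<in>I. c i *\<^sub>R y i))\<^sup>2 = (\<Sum>i\<in>I. \<Sum>j\<in>I. (y i \<bullet> y j) * (c i * c j))"
  unfolding power2_norm_eq_inner inner_sum_left inner_sum_right by (simp add: ac_simps inner_commute)

text \<open>Written for a finite family of adapted rectangles instead of one partition, the isometry applies
  to the difference of two elementary processes without a common refinement.\<close>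

lemma ito_isometry_rectangles:
  fixes w :: "real \<Rightarrow> 'w \<Rightarrow> real ^ 'q::finite" and \<eta> :: "'i \<Rightarrow> 'w \<Rightarrow> 'a::euclidean_space"
  assumes P: "prob_space M" and W: "wiener_process M w" and I: "finite I"
    and ab: "\<And>i. i \<in> I \<Longrightarrow> 0 \<le> a i" "\<And>i. i \<in> I \<Longrightarrow> a i \<le> b i" "\<And>i. i \<in> I \<Longrightarrow> b i \<le> t"
    and \<eta>: "\<And>i. i \<in> I \<Longrightarrow> \<eta> i \<in> borel_measurable (generated_filtration M w (a i))"
    and bd: "\<And>i. i \<in> I \<Longrightarrow> \<exists>B. \<forall>\<omega>\<in>space M. norm (\<eta> i \<omega>) \<le> B"
  shows "(\<integral>\<^sup>+\<omega>. ennreal ((norm (\<Sum>i\<in>I. (w (b i) \<omega> $ r - w (a i) \<omega> $ r) *\<^sub>R \<eta> i \<omega>))\<^sup>2) \<partial>M)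
    = (\<integral>\<^sup>+\<omega>. (\<integral>\<^sup>+s\<in>{0..t}. ennreal ((norm (\<Sum>i\<in>I. indicator {a i<..b i} s *\<^sub>R \<eta> i \<omega>))\<^sup>2) \<partial>lborel) \<partial>M)"
proof -
  interpret prob_space M by (rule P)
  from bd obtain B where B: "\<And>i \<omega>. i \<in> I \<Longrightarrow> \<omega> \<in> space M \<Longrightarrow> norm (\<eta> i \<omega>) \<le> B i"
    by metis
  have B0: "0 \<le> B i" if "i \<in> I" for i
  proof -
    obtain \<omega> where "\<omega> \<in> space M" using not_empty by blast
    then show ?thesis using B[OF that] norm_ge_zero order_trans by blast
  qed
  have meas: "(\<lambda>\<omega>. \<eta> i \<omega> \<bullet> \<eta> j \<omega>) \<in> borel_measurable (generated_filtration M w (max (a i) (a j)))"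
    if "i \<in> I" "j \<in> I" for i j
    using that by (intro borel_measurable_inner measurable_generated_filtration_mono[OF \<eta>]) auto
  have bdd: "\<bar>\<eta> i \<omega> \<bullet> \<eta> j \<omega>\<bar> \<le> B i * B j" if "i \<in> I" "j \<in> I" "\<omega> \<in> space M" for i j \<omega>
  proof -
    have "\<bar>\<eta> i \<omega> \<bullet> \<eta> j \<omega>\<bar> \<le> norm (\<eta> i \<omega>) * norm (\<eta> j \<omega>)" by (rule Cauchy_Schwarz_ineq2)
    also have "\<dots> \<le> B i * B j" using that B B0 by (intro mult_mono) auto
    finally show ?thesis .
  qed
  have int: "integrable M (\<lambda>\<omega>. \<eta> i \<omega> \<bullet> \<eta> j \<omega>)" if "i \<in> I" "j \<in> I" for i j
    using that bdd measurable_generated_filtration[OF W meas]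
    by (intro integrable_const_bound[where B="B i * B j"] AE_I2) auto
  define Ev where "Ev = (\<Sum>i\<in>I. \<Sum>j\<in>I. (\<integral>\<omega>. \<eta> i \<omega> \<bullet> \<eta> j \<omega> \<partial>M) * overlap (a i) (b i) (a j) (b j))"
  define \<Delta> where "\<Delta> i \<omega> = w (b i) \<omega> $ r - w (a i) \<omega> $ r" for i \<omega>
  have cov: "integrable M (\<lambda>\<omega>. (\<eta> i \<omega> \<bullet> \<eta> j \<omega>) * (\<Delta> i \<omega> * \<Delta> j \<omega>))"
    "(\<integral>\<omega>. (\<eta> i \<omega> \<bullet> \<eta> j \<omega>) * (\<Delta> i \<omega> * \<Delta> j \<omega>) \<partial>M) = (\<integral>\<omega>. \<eta> i \<omega> \<bullet> \<eta> j \<omega> \<partial>M) * overlap (a i) (b i) (a j) (b j)"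
    if "i \<in> I" "j \<in> I" for i j
    using wiener_increment_covariance[OF P W ab(1,2)[OF that(1)] ab(1,2)[OF that(2)] meas[OF that] bdd[OF that], of r]
    by (auto simp: \<Delta>_def mult.assoc)
  have "(\<integral>\<^sup>+\<omega>. ennreal ((norm (\<Sum>i\<in>I. \<Delta> i \<omega> *\<^sub>R \<eta> i \<omega>))\<^sup>2) \<partial>M)
      = ennreal (\<integral>\<omega>. (norm (\<Sum>i\<in>I. \<Delta> i \<omega> *\<^sub>R \<eta> i \<omega>))\<^sup>2 \<partial>M)"
  proof (rule nn_integral_eq_integral)
    show "integrable M (\<lambda>\<omega>. (norm (\<Sum>i\<in>I. \<Delta> i \<omega> *\<^sub>R \<eta> i \<omega>))\<^sup>2)"
      unfolding norm_sum_scaleR_squared using cov(1) by (intro Bochner_Integration.integrable_sum)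
  qed simp
  also have "(\<integral>\<omega>. (norm (\<Sum>i\<in>I. \<Delta> i \<omega> *\<^sub>R \<eta> i \<omega>))\<^sup>2 \<partial>M) = Ev"
    unfolding norm_sum_scaleR_squared Ev_def
    using cov by (simp add: Bochner_Integration.integral_sum Bochner_Integration.integrable_sum)
  finally have lhs: "(\<integral>\<^sup>+\<omega>. ennreal ((norm (\<Sum>i\<in>I. \<Delta> i \<omega> *\<^sub>R \<eta> i \<omega>))\<^sup>2) \<partial>M) = ennreal Ev" .
  define Q where "Q \<omega> = (\<Sum>i\<in>I. \<Sum>j\<in>I. (\<eta> i \<omega> \<bullet> \<eta> j \<omega>) * overlap (a i) (b i) (a j) (b j))" for \<omega>
  have indint: "integrable lborel (\<lambda>s. indicator {a i<..b i} s * indicator {a j<..b j} s :: real)" for i j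
  proof -
    have "(\<lambda>s. indicator {a i<..b i} s * indicator {a j<..b j} s :: real) = indicator ({a i<..b i} \<inter> {a j<..b j})"
      by (auto simp: indicator_def fun_eq_iff)
    moreover have "emeasure lborel ({a i<..b i} \<inter> {a j<..b j}) < \<infinity>"
    proof -
      have "emeasure lborel ({a i<..b i} \<inter> {a j<..b j}) \<le> emeasure lborel {a i..b i}"
        by (intro emeasure_mono) auto
      also have "\<dots> < \<infinity>" by (simp add: emeasure_lborel_Icc_eq)
      finally show ?thesis .
    qed
    ultimately show ?thesis by simp
  qed
  have inner: "(\<integral>\<^sup>+s\<in>{0..t}. ennreal ((norm (\<Sum>i\<in>I. indicator {a i<..b i} s *\<^sub>R \<eta> i \<omega>))\<^sup>2) \<partial>lborel) = ennreal (Q \<omega>)" for \<omega>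
  proof -
    have "(\<integral>\<^sup>+s\<in>{0..t}. ennreal ((norm (\<Sum>i\<in>I. indicator {a i<..b i} s *\<^sub>R \<eta> i \<omega>))\<^sup>2) \<partial>lborel)
        = (\<integral>\<^sup>+s. ennreal ((norm (\<Sum>i\<in>I. indicator {a i<..b i} s *\<^sub>R \<eta> i \<omega>))\<^sup>2) \<partial>lborel)"
    proof (rule nn_integral_cong)
      fix s
      show "ennreal ((norm (\<Sum>i\<in>I. indicator {a i<..b i} s *\<^sub>R \<eta> i \<omega>))\<^sup>2) * indicator {0..t} s
          = ennreal ((norm (\<Sum>i\<in>I. indicator {a i<..b i} s *\<^sub>R \<eta> i \<omega>))\<^sup>2)"
      proof (cases "s \<in> {0..t}")
        case False
        have "indicator {a i<..b i} s *\<^sub>R \<eta> i \<omega> = 0" if "i \<in> I" for i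
          using False ab(1,3)[OF that] by (auto simp: indicator_def)
        then have "(\<Sum>i\<in>I. indicator {a i<..b i} s *\<^sub>R \<eta> i \<omega>) = 0" by (intro sum.neutral) auto
        then show ?thesis by simp
      qed simp
    qed
    also have "\<dots> = ennreal (\<integral>s. (norm (\<Sum>i\<in>I. indicator {a i<..b i} s *\<^sub>R \<eta> i \<omega>))\<^sup>2 \<partial>lborel)"
      unfolding norm_sum_scaleR_squared
    proof (rule nn_integral_eq_integral)
      show "integrable lborel (\<lambda>s. \<Sum>i\<in>I. \<Sum>j\<in>I. (\<eta> i \<omega> \<bullet> \<eta> j \<omega>) * (indicator {a i<..b i} s * indicator {a j<..b j} s))"
        by (intro Bochner_Integration.integrable_sum integrable_mult_right indint)
      show "AE s in lborel. 0 \<le> (\<Sum>i\<in>I. \<Sum>j\<in>I. (\<eta> i \<omega> \<bullet> \<eta> j \<omega>) * (indicator {a i<..b i} s * indicator {a j<..b j} s))"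
        unfolding norm_sum_scaleR_squared[symmetric] by simp
    qed
    also have "(\<integral>s. (norm (\<Sum>i\<in>I. indicator {a i<..b i} s *\<^sub>R \<eta> i \<omega>))\<^sup>2 \<partial>lborel) = Q \<omega>"
      unfolding norm_sum_scaleR_squared Q_def using indint
      by (simp add: Bochner_Integration.integral_sum Bochner_Integration.integrable_sum measure_Ioc_inter)
    finally show ?thesis .
  qed
  have "(\<integral>\<^sup>+\<omega>. ennreal (Q \<omega>) \<partial>M) = ennreal (\<integral>\<omega>. Q \<omega> \<partial>M)"
  proof (rule nn_integral_eq_integral)
    show "integrable M Q" unfolding Q_def
      by (intro Bochner_Integration.integrable_sum integrable_mult_left int)
    have "0 \<le> Q \<omega>" for \<omega>
    proof -
      have "Q \<omega> = (\<integral>s. (norm (\<Sum>i\<in>I. indicator {a i<..b i} s *\<^sub>R \<eta> i \<omega>))\<^sup>2 \<partial>lborel)"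
        unfolding norm_sum_scaleR_squared Q_def using indint
        by (simp add: Bochner_Integration.integral_sum Bochner_Integration.integrable_sum measure_Ioc_inter)
      then show ?thesis by simp
    qed
    then show "AE \<omega> in M. 0 \<le> Q \<omega>" by simp
  qed
  also have "(\<integral>\<omega>. Q \<omega> \<partial>M) = Ev"
    unfolding Q_def Ev_def using int
    by (simp add: Bochner_Integration.integral_sum Bochner_Integration.integrable_sum)
  finally have "(\<integral>\<^sup>+\<omega>. ennreal (Q \<omega>) \<partial>M) = ennreal Ev" .
  then show ?thesis using lhs unfolding inner \<Delta>_def by simp
qed

section \<open>Wiener integrals by parts\<close>

text \<open>The first term on the right is the contribution of the interval to a left-endpoint Riemann sum; the second
  one is of smaller order than the length of the interval by continuity of \<open>x\<close>.\<close>

lemma by_parts_increment: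
  fixes x :: "real \<Rightarrow> real" and X X' :: "real \<Rightarrow> 'a::euclidean_space"
  assumes x: "continuous_on {0..t} x" and X': "continuous_on {0..t} X'"
    and X: "\<And>s. s \<in> {0..t} \<Longrightarrow> (X has_vector_derivative X' s) (at s within {0..t})"
    and ab: "0 \<le> a" "a \<le> b" "b \<le> t"
  shows "(x b *\<^sub>R X b - integral {0..b} (\<lambda>s. x s *\<^sub>R X' s)) - (x a *\<^sub>R X a - integral {0..a} (\<lambda>s. x s *\<^sub>R X' s))
    = (x b - x a) *\<^sub>R X a + integral {a..b} (\<lambda>s. (x b - x s) *\<^sub>R X' s)"
proof -
  have cont: "continuous_on {0..t} (\<lambda>s. x s *\<^sub>R X' s)" by (intro continuous_intros x X')
  have int: "(\<lambda>s. x s *\<^sub>R X' s) integrable_on {0..b}" "(\<lambda>s. x s *\<^sub>R X' s) integrable_on {a..b}"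
    "X' integrable_on {a..b}"
    using ab by (auto intro!: integrable_continuous_interval continuous_on_subset[OF cont] continuous_on_subset[OF X'])
  have e1: "integral {0..a} (\<lambda>s. x s *\<^sub>R X' s) + integral {a..b} (\<lambda>s. x s *\<^sub>R X' s) = integral {0..b} (\<lambda>s. x s *\<^sub>R X' s)"
    by (rule Henstock_Kurzweil_Integration.integral_combine[OF ab(1,2) int(1)])
  have "(X' has_integral (X b - X a)) {a..b}"
    using ab by (intro fundamental_theorem_of_calculus has_vector_derivative_within_subset[OF X]) auto
  then have e2: "integral {a..b} X' = X b - X a" by (rule integral_unique)
  have e3: "integral {a..b} (\<lambda>s. (x b - x s) *\<^sub>R X' s) = x b *\<^sub>R integral {a..b} X' - integral {a..b} (\<lambda>s. x s *\<^sub>R X' s)"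
    unfolding scaleR_diff_left using int
    by (subst Henstock_Kurzweil_Integration.integral_diff) (auto intro: integrable_cmul)
  show ?thesis unfolding e3 e2 e1[symmetric] by (simp add: algebra_simps)
qed

lemma ennreal_norm_add_squared:
  fixes a b :: "'a::real_inner"
  shows "ennreal ((norm (a + b))\<^sup>2) \<le> 2 * ennreal ((norm a)\<^sup>2) + 2 * ennreal ((norm b)\<^sup>2)"
proof -
  have "(norm (a + b))\<^sup>2 \<le> (norm a + norm b)\<^sup>2" by (intro power_mono norm_triangle_ineq) auto
  also have "\<dots> \<le> 2 * (norm a)\<^sup>2 + 2 * (norm b)\<^sup>2"
    using sum_squares_bound[of "norm a" "norm b"] by (simp add: power2_sum)
  finally have "ennreal ((norm (a + b))\<^sup>2) \<le> ennreal (2 * (norm a)\<^sup>2 + 2 * (norm b)\<^sup>2)" by (rule ennreal_leI)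
  also have "\<dots> = 2 * ennreal ((norm a)\<^sup>2) + 2 * ennreal ((norm b)\<^sup>2)"
    by (simp add: ennreal_plus ennreal_mult)
  finally show ?thesis .
qed

lemma uniform_modulus_interval:
  fixes x :: "real \<Rightarrow> 'a::metric_space"
  assumes "continuous_on {0..t} x" "0 < e"
  shows "\<exists>N0. \<forall>N\<ge>N0. \<forall>s\<in>{0..t}. \<forall>s'\<in>{0..t}. \<bar>s - s'\<bar> \<le> t / real N \<longrightarrow> dist (x s) (x s') \<le> e"
proof -
  have "uniformly_continuous_on {0..t} x" by (rule compact_uniformly_continuous[OF assms(1)]) simp
  then obtain \<delta> where \<delta>: "0 < \<delta>" "\<And>s s'. s \<in> {0..t} \<Longrightarrow> s' \<in> {0..t} \<Longrightarrow> dist s' s < \<delta> \<Longrightarrow> dist (x s') (x s) < e"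
    unfolding uniformly_continuous_on_def using assms(2) by meson
  obtain N0 :: nat where N0: "\<bar>t\<bar> / \<delta> < N0" using reals_Archimedean2 by blast
  show ?thesis
  proof (intro exI[of _ "N0 + 1"] allI impI ballI)
    fix N s s' assume N: "N0 + 1 \<le> N" and s: "s \<in> {0..t}" "s' \<in> {0..t}" "\<bar>s - s'\<bar> \<le> t / real N"
    have "t / real N < \<delta>"
    proof -
      have "\<bar>t\<bar> < N0 * \<delta>" using N0 \<delta>(1) by (simp add: field_simps)
      also have "\<dots> \<le> real N * \<delta>" using N \<delta>(1) by (intro mult_right_mono) auto
      finally show ?thesis using N by (simp add: field_simps)
    qed
    then show "dist (x s) (x s') \<le> e" using \<delta>(2)[of s' s] s by (auto simp: dist_real_def intro: less_imp_le)
  qed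
qed

lemma riemann_ito_sum_converges:
  fixes x :: "real \<Rightarrow> real" and X X' :: "real \<Rightarrow> 'a::euclidean_space"
  assumes t: "0 \<le> t" and x: "continuous_on {0..t} x" "x 0 = 0" and X': "continuous_on {0..t} X'"
    and X: "\<And>s. s \<in> {0..t} \<Longrightarrow> (X has_vector_derivative X' s) (at s within {0..t})"
  shows "(\<lambda>N. \<Sum>l<N. (x (t * real (Suc l) / real N) - x (t * real l / real N)) *\<^sub>R X (t * real l / real N))
    \<longlonglongrightarrow> x t *\<^sub>R X t - integral {0..t} (\<lambda>s. x s *\<^sub>R X' s)"
proof (rule metric_LIMSEQ_I)
  fix e :: real assume e: "0 < e"
  define Z where "Z u = x u *\<^sub>R X u - integral {0..u} (\<lambda>s. x s *\<^sub>R X' s)" for u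
  obtain B where B: "0 \<le> B" "\<And>s. s \<in> {0..t} \<Longrightarrow> norm (X' s) \<le> B"
  proof -
    have "compact (X' ` {0..t})" by (rule compact_continuous_image[OF X']) simp
    then obtain B where "\<forall>y\<in>X' ` {0..t}. norm y \<le> B" using compact_imp_bounded bounded_iff by blast
    then show ?thesis using that[of "max B 0"] by (auto simp: le_max_iff_disj)
  qed
  define e' where "e' = e / (2 * (B * t + 1))"
  have Bt: "0 < B * t + 1" using B t by (simp add: add_nonneg_pos)
  have e': "0 < e'" unfolding e'_def using e Bt by simp
  obtain N0 where N0: "\<And>N s s'. N \<ge> N0 \<Longrightarrow> s \<in> {0..t} \<Longrightarrow> s' \<in> {0..t} \<Longrightarrow> \<bar>s - s'\<bar> \<le> t / real N \<Longrightarrow> dist (x s) (x s') \<le> e'"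
    using uniform_modulus_interval[OF x(1) e'] by meson
  have "dist (\<Sum>l<N. (x (t * real (Suc l) / real N) - x (t * real l / real N)) *\<^sub>R X (t * real l / real N)) (Z t) < e"
    if N: "N \<ge> N0 + 1" for N
  proof -
    define s where "s l = t * real l / real N" for l
    have sm: "s l \<le> s (Suc l)" for l unfolding s_def using t by (intro divide_right_mono mult_left_mono) auto
    have sb: "0 \<le> s l" "s l \<le> t" if "l \<le> N" for l
      using that t N by (auto simp: s_def field_simps mult_left_mono)
    have sd: "s (Suc l) - s l = t / real N" for l by (simp add: s_def add_divide_distrib distrib_left)
    have "(\<Sum>l<N. Z (s (Suc l)) - Z (s l)) = Z t - Z 0"
      using sum_lessThan_telescope[of "\<lambda>l. Z (s l)" N] N by (simp add: s_def)
    then have Zt: "Z t = (\<Sum>l<N. Z (s (Suc l)) - Z (s l))" by (simp add: Z_def x(2))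
    have each: "norm (Z (s (Suc l)) - Z (s l) - (x (s (Suc l)) - x (s l)) *\<^sub>R X (s l)) \<le> e' * B * (t / real N)"
      if l: "l < N" for l
    proof -
      have b: "0 \<le> s l" "s l \<le> s (Suc l)" "s (Suc l) \<le> t" using sb[of l] sb[of "Suc l"] sm l by auto
      have "Z (s (Suc l)) - Z (s l) - (x (s (Suc l)) - x (s l)) *\<^sub>R X (s l)
          = integral {s l..s (Suc l)} (\<lambda>u. (x (s (Suc l)) - x u) *\<^sub>R X' u)"
        unfolding Z_def using by_parts_increment[OF x(1) X' X b] by simp
      also have "norm \<dots> \<le> e' * B * (s (Suc l) - s l)"
      proof (rule integral_bound[OF b(2)])
        show "continuous_on {s l..s (Suc l)} (\<lambda>u. (x (s (Suc l)) - x u) *\<^sub>R X' u)"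
          using b by (intro continuous_intros continuous_on_subset[OF x(1)] continuous_on_subset[OF X']) auto
        fix u assume u: "u \<in> {s l..s (Suc l)}"
        have "dist (x (s (Suc l))) (x u) \<le> e'"
          using u b sd[of l] N by (intro N0[of N]) auto
        then show "norm ((x (s (Suc l)) - x u) *\<^sub>R X' u) \<le> e' * B"
          using u b B e' by (auto simp: dist_real_def intro!: mult_mono)
      qed
      finally show ?thesis by (simp add: sd)
    qed
    have "dist (\<Sum>l<N. (x (s (Suc l)) - x (s l)) *\<^sub>R X (s l)) (Z t)
        = norm (\<Sum>l<N. Z (s (Suc l)) - Z (s l) - (x (s (Suc l)) - x (s l)) *\<^sub>R X (s l))"
      unfolding Zt sum_subtractf[of "\<lambda>l. Z (s (Suc l)) - Z (s l)"] by (rule dist_commute[THEN trans]) (simp add: dist_norm)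
    also have "\<dots> \<le> (\<Sum>l<N. e' * B * (t / real N))"
      using each by (intro order_trans[OF norm_sum] sum_mono) auto
    also have "\<dots> = e' * (B * t)" using N by simp
    also have "\<dots> < e' * (2 * (B * t + 1))" using Bt e' by (intro mult_strict_left_mono) auto
    also have "\<dots> = e" using Bt by (simp add: e'_def)
    finally show ?thesis unfolding s_def .
  qed
  then show "\<exists>no. \<forall>n\<ge>no. dist (\<Sum>l<n. (x (t * real (Suc l) / real n) - x (t * real l / real n)) *\<^sub>R X (t * real l / real n))
      (x t *\<^sub>R X t - integral {0..t} (\<lambda>s. x s *\<^sub>R X' s)) < e"
    unfolding Z_def by blast
qed

lemma step_function_value:
  fixes X :: "real \<Rightarrow> 'a::real_vector"
  assumes t: "0 < t" and s: "0 < s" "s \<le> t" and N: "0 < N"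
  shows "\<exists>l<N. \<bar>s - t * real l / real N\<bar> \<le> t / real N \<and>
    (\<Sum>l<N. indicator {t * real l / real N<..t * real (Suc l) / real N} s *\<^sub>R X (t * real l / real N)) = X (t * real l / real N)"
proof -
  define y where "y = s * real N / t"
  define l0 where "l0 = nat (\<lceil>y\<rceil> - 1)"
  have y: "0 < y" "y \<le> real N" using assms by (auto simp: y_def field_simps mult_right_mono)
  have c: "0 \<le> \<lceil>y\<rceil> - 1" "real_of_int \<lceil>y\<rceil> - 1 < y" "y \<le> real_of_int \<lceil>y\<rceil>" "\<lceil>y\<rceil> \<le> int N"
  proof -
    have "0 < \<lceil>y\<rceil>" using y(1) by simp
    then show "0 \<le> \<lceil>y\<rceil> - 1" by simp
    show "real_of_int \<lceil>y\<rceil> - 1 < y" "y \<le> real_of_int \<lceil>y\<rceil>" by linarith+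
    show "\<lceil>y\<rceil> \<le> int N" using y(2) by (simp add: ceiling_le_iff)
  qed
  have l0: "real l0 < y" "y \<le> real (Suc l0)" "l0 < N"
    using c unfolding l0_def by (auto simp: nat_less_iff of_nat_nat)
  have iff: "s \<in> {t * real l / real N<..t * real (Suc l) / real N} \<longleftrightarrow> l = l0" for l
  proof -
    have "s \<in> {t * real l / real N<..t * real (Suc l) / real N} \<longleftrightarrow> real l < y \<and> y \<le> real (Suc l)"
      unfolding y_def greaterThanAtMost_iff using t N by (simp add: field_simps)
    also have "\<dots> \<longleftrightarrow> l = l0" using l0 by auto
    finally show ?thesis .
  qed
  have "(\<Sum>l<N. indicator {t * real l / real N<..t * real (Suc l) / real N} s *\<^sub>R X (t * real l / real N))
      = (\<Sum>l<N. if l = l0 then X (t * real l0 / real N) else 0)"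
    by (intro sum.cong refl) (use iff in \<open>auto simp: indicator_def\<close>)
  also have "\<dots> = X (t * real l0 / real N)" using l0(3) by simp
  finally have 1: "(\<Sum>l<N. indicator {t * real l / real N<..t * real (Suc l) / real N} s *\<^sub>R X (t * real l / real N))
      = X (t * real l0 / real N)" .
  have "s \<in> {t * real l0 / real N<..t * real (Suc l0) / real N}" using iff by blast
  moreover have "t * real (Suc l0) / real N = t * real l0 / real N + t / real N"
    by (simp add: add_divide_distrib distrib_left)
  ultimately have "\<bar>s - t * real l0 / real N\<bar> \<le> t / real N" by auto
  then show ?thesis using l0(3) 1 by blast
qed


text \<open>Elementary approximations of the deterministic integrand may be random, but by the isometry their
  integrals have the same limit as left-endpoint Riemann sums, which converge path by path.\<close>

lemma wiener_integral_by_parts: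
  fixes w :: "real \<Rightarrow> 'w \<Rightarrow> real ^ 'q::finite" and X X' :: "real \<Rightarrow> 'a::euclidean_space"
  assumes P: "prob_space M" and W: "wiener_process M w" and t: "0 \<le> t"
    and X': "continuous_on {0..t} X'"
    and X: "\<And>s. s \<in> {0..t} \<Longrightarrow> (X has_vector_derivative X' s) (at s within {0..t})"
    and ito: "has_ito_integral M (generated_filtration M w) (\<lambda>s \<omega>. w s \<omega> $ r) t (\<lambda>s \<omega>. X s) J"
  shows "AE \<omega> in M. J \<omega> = (w t \<omega> $ r) *\<^sub>R X t - integral {0..t} (\<lambda>s. (w s \<omega> $ r) *\<^sub>R X' s)"
proof -
  interpret prob_space M by (rule P)
  define F where "F = generated_filtration M w"
  have Jm[measurable]: "J \<in> borel_measurable M" using ito by (simp add: has_ito_integral_def)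
  obtain m \<tau> \<eta> where el: "\<And>j. elementary_process M F t (m j) (\<tau> j) (\<eta> j)"
    and A: "(\<lambda>j::nat. \<integral>\<^sup>+ \<omega>. (\<integral>\<^sup>+ s\<in>{0..t}.
             ennreal ((norm (X s - elementary_value (m j) (\<tau> j) (\<eta> j) s \<omega>))\<^sup>2) \<partial>lborel) \<partial>M) \<longlonglongrightarrow> 0"
    and Bc: "(\<lambda>j. \<integral>\<^sup>+ \<omega>. ennreal ((norm (J \<omega> - elementary_integral (\<lambda>s \<omega>. w s \<omega> $ r) (m j) (\<tau> j) (\<eta> j) \<omega>))\<^sup>2) \<partial>M)
           \<longlonglongrightarrow> 0"
    using ito unfolding has_ito_integral_def F_def by blast
  define A' where "A' j = (\<integral>\<^sup>+ \<omega>. (\<integral>\<^sup>+ s\<in>{0..t}.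
             ennreal ((norm (X s - elementary_value (m j) (\<tau> j) (\<eta> j) s \<omega>))\<^sup>2) \<partial>lborel) \<partial>M)" for j
  define B' where "B' j = (\<integral>\<^sup>+ \<omega>. ennreal ((norm (J \<omega> - elementary_integral (\<lambda>s \<omega>. w s \<omega> $ r) (m j) (\<tau> j) (\<eta> j) \<omega>))\<^sup>2) \<partial>M)" for j
  have contX: "continuous_on {0..t} X"
    using X by (intro continuous_on_vector_derivative)
  \<comment> \<open>a continuous extension to the whole line, which is Borel measurable\<close>
  define Xc where "Xc s = X (max 0 (min t s))" for s
  have "continuous_on UNIV Xc"
    unfolding Xc_def using t by (intro continuous_on_compose2[OF contX] continuous_intros) auto
  then have Xcm[measurable]: "Xc \<in> borel_measurable borel" by (rule borel_measurable_continuous_onI)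
  have XcX: "Xc s = X s" if "s \<in> {0..t}" for s using that by (simp add: Xc_def)
  define sl where "sl N l = t * real l / real N" for N l :: nat
  have sl: "0 \<le> sl N l" "sl N l \<le> sl N (Suc l)" for N l
    unfolding sl_def using t by (auto intro!: divide_right_mono mult_left_mono)
  have slt: "sl N (Suc l) \<le> t" if "l < N" for N l
  proof -
    have "t * real (Suc l) \<le> t * real N" using that t by (intro mult_left_mono) auto
    then show ?thesis using that unfolding sl_def by (simp add: field_simps)
  qed
  define XN where "XN N s = (\<Sum>l<N. indicator {sl N l<..sl N (Suc l)} s *\<^sub>R X (sl N l))" for N s
  have XNm[measurable]: "XN N \<in> borel_measurable borel" for N unfolding XN_def by measurable
  define SN where "SN N \<omega> = (\<Sum>l<N. (w (sl N (Suc l)) \<omega> $ r - w (sl N l) \<omega> $ r) *\<^sub>R X (sl N l))" for N \<omega>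
  have nthm[measurable]: "(\<lambda>y :: real ^ 'q. y $ r) \<in> borel_measurable borel"
    by (intro borel_measurable_continuous_onI continuous_intros)
  have wmr: "(\<lambda>\<omega>. w s \<omega> $ r) \<in> borel_measurable M" if "0 \<le> s" for s
    using measurable_compose[OF wiener_measurable[OF W that] nthm] .
  have SNm[measurable]: "SN N \<in> borel_measurable M" for N
    unfolding SN_def by (intro borel_measurable_sum borel_measurable_scaleR borel_measurable_diff wmr sl) auto
  define R where "R N = (\<integral>\<^sup>+s\<in>{0..t}. ennreal ((norm (Xc s - XN N s))\<^sup>2) \<partial>lborel)" for N
  have \<tau>: "0 \<le> \<tau> j i" "\<tau> j i \<le> \<tau> j (Suc i)" "\<tau> j (Suc i) \<le> t" if i: "i < m j" for j i
  proof -
    have mono: "\<tau> j i \<le> \<tau> j (Suc i)" if "i < m j" for i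
      using el[of j] that unfolding elementary_process_def by blast
    have lo: "i \<le> m j \<Longrightarrow> \<tau> j 0 \<le> \<tau> j i" for i
    proof (induction i)
      case (Suc i)
      then show ?case using mono[of i] by simp
    qed simp
    have up: "\<tau> j i \<le> \<tau> j (m j)" if "i \<le> m j" for i
      using that
    proof (induction rule: inc_induct)
      case (step n)
      then show ?case using mono[of n] by simp
    qed simp
    show "0 \<le> \<tau> j i" using lo[of i] i el[of j] by (simp add: elementary_process_def)
    show "\<tau> j i \<le> \<tau> j (Suc i)" by (rule mono[OF i])
    show "\<tau> j (Suc i) \<le> t" using up[of "Suc i"] i el[of j] by (simp add: elementary_process_def)
  qed
  define I where "I j \<omega> = elementary_integral (\<lambda>s \<omega>. w s \<omega> $ r) (m j) (\<tau> j) (\<eta> j) \<omega>" for j \<omega>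
  define V where "V j s \<omega> = elementary_value (m j) (\<tau> j) (\<eta> j) s \<omega>" for j s \<omega>
  have \<eta>F: "\<eta> j i \<in> borel_measurable (generated_filtration M w (\<tau> j i))" "\<exists>B. \<forall>\<omega>\<in>space M. norm (\<eta> j i \<omega>) \<le> B"
    if "i < m j" for i j
    using el[of j] that unfolding elementary_process_def F_def by auto
  have \<eta>m: "\<eta> j i \<in> borel_measurable M" if "i < m j" for i j
    by (rule measurable_generated_filtration[OF W \<eta>F(1)[OF that]])
  have Im[measurable]: "I j \<in> borel_measurable M" for j
    unfolding I_def elementary_integral_def using \<tau>(1) order_trans[OF \<tau>(1) \<tau>(2)]
    by (intro borel_measurable_sum borel_measurable_scaleR borel_measurable_diff wmr \<eta>m) auto
  have Vm[measurable]: "(\<lambda>(\<omega>, s). V j s \<omega>) \<in> borel_measurable (M \<Otimes>\<^sub>M lborel)" for j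
  proof -
    have "(\<lambda>z. \<Sum>i<m j. indicator {\<tau> j i<..\<tau> j (Suc i)} (snd z) *\<^sub>R \<eta> j i (fst z)) \<in> borel_measurable (M \<Otimes>\<^sub>M lborel)"
    proof (rule borel_measurable_sum)
      fix i assume "i \<in> {..<m j}"
      then have [measurable]: "\<eta> j i \<in> borel_measurable M" using \<eta>m by simp
      show "(\<lambda>z. indicator {\<tau> j i<..\<tau> j (Suc i)} (snd z) *\<^sub>R \<eta> j i (fst z)) \<in> borel_measurable (M \<Otimes>\<^sub>M lborel)"
        by measurable
    qed
    then show ?thesis by (simp add: V_def elementary_value_def split_beta)
  qed
  have iso: "(\<integral>\<^sup>+\<omega>. ennreal ((norm (I j \<omega> - SN N \<omega>))\<^sup>2) \<partial>M)
      = (\<integral>\<^sup>+\<omega>. (\<integral>\<^sup>+s\<in>{0..t}. ennreal ((norm (V j s \<omega> - XN N s))\<^sup>2) \<partial>lborel) \<partial>M)" for j N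
  proof -
    \<comment> \<open>the difference of the two elementary integrals is a single family of rectangles over the disjoint union of the index sets\<close>
    define K :: "(nat + nat) set" where "K = {..<m j} <+> {..<N}"
    define a where "a = case_sum (\<tau> j) (sl N)"
    define b where "b = case_sum (\<lambda>i. \<tau> j (Suc i)) (\<lambda>l. sl N (Suc l))"
    define \<zeta> where "\<zeta> = case_sum (\<eta> j) (\<lambda>l \<omega>. - X (sl N l))"
    have "(\<integral>\<^sup>+\<omega>. ennreal ((norm (\<Sum>i\<in>K. (w (b i) \<omega> $ r - w (a i) \<omega> $ r) *\<^sub>R \<zeta> i \<omega>))\<^sup>2) \<partial>M)
      = (\<integral>\<^sup>+\<omega>. (\<integral>\<^sup>+s\<in>{0..t}. ennreal ((norm (\<Sum>i\<in>K. indicator {a i<..b i} s *\<^sub>R \<zeta> i \<omega>))\<^sup>2) \<partial>lborel) \<partial>M)"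
    proof (rule ito_isometry_rectangles[OF P W])
      show "finite K" by (simp add: K_def)
      fix i assume "i \<in> K"
      then show "0 \<le> a i" "a i \<le> b i" "b i \<le> t" "\<zeta> i \<in> borel_measurable (generated_filtration M w (a i))"
        "\<exists>B. \<forall>\<omega>\<in>space M. norm (\<zeta> i \<omega>) \<le> B"
        using \<tau> sl slt \<eta>F by (auto simp: K_def a_def b_def \<zeta>_def)
    qed
    moreover have "(\<Sum>i\<in>K. (w (b i) \<omega> $ r - w (a i) \<omega> $ r) *\<^sub>R \<zeta> i \<omega>) = I j \<omega> - SN N \<omega>" for \<omega>
      by (simp add: K_def sum.Plus o_def a_def b_def \<zeta>_def I_def SN_def elementary_integral_def sum_negf)
    moreover have "(\<Sum>i\<in>K. indicator {a i<..b i} s *\<^sub>R \<zeta> i \<omega>) = V j s \<omega> - XN N s" for s \<omega>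
      unfolding K_def V_def XN_def elementary_value_def
      by (simp only: sum.Plus finite_lessThan o_def a_def b_def \<zeta>_def sum.case scaleR_minus_right sum_negf add_uminus_conv_diff)
    ultimately show ?thesis by simp
  qed
  have bound: "(\<integral>\<^sup>+\<omega>. ennreal ((norm (J \<omega> - SN N \<omega>))\<^sup>2) \<partial>M) \<le> 2 * B' j + 2 * (2 * A' j + 2 * R N)" for j N
  proof -
    have "(\<integral>\<^sup>+\<omega>. ennreal ((norm (J \<omega> - SN N \<omega>))\<^sup>2) \<partial>M)
        \<le> (\<integral>\<^sup>+\<omega>. 2 * ennreal ((norm (J \<omega> - I j \<omega>))\<^sup>2) + 2 * ennreal ((norm (I j \<omega> - SN N \<omega>))\<^sup>2) \<partial>M)"
    proof (rule nn_integral_mono)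
      fix \<omega>
      show "ennreal ((norm (J \<omega> - SN N \<omega>))\<^sup>2) \<le> 2 * ennreal ((norm (J \<omega> - I j \<omega>))\<^sup>2) + 2 * ennreal ((norm (I j \<omega> - SN N \<omega>))\<^sup>2)"
        using ennreal_norm_add_squared[of "J \<omega> - I j \<omega>" "I j \<omega> - SN N \<omega>"] by simp
    qed
    also have "\<dots> = 2 * B' j + 2 * (\<integral>\<^sup>+\<omega>. ennreal ((norm (I j \<omega> - SN N \<omega>))\<^sup>2) \<partial>M)"
      by (subst nn_integral_add) (auto simp: nn_integral_cmult B'_def I_def[symmetric])
    also have "(\<integral>\<^sup>+\<omega>. ennreal ((norm (I j \<omega> - SN N \<omega>))\<^sup>2) \<partial>M) \<le> 2 * A' j + 2 * R N"
    proof -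
      have "(\<integral>\<^sup>+s\<in>{0..t}. ennreal ((norm (V j s \<omega> - XN N s))\<^sup>2) \<partial>lborel)
          \<le> 2 * (\<integral>\<^sup>+s\<in>{0..t}. ennreal ((norm (Xc s - V j s \<omega>))\<^sup>2) \<partial>lborel) + 2 * R N" if \<omega>: "\<omega> \<in> space M" for \<omega>
      proof -
        have [measurable]: "(\<lambda>s. V j s \<omega>) \<in> borel_measurable lborel"
          using measurable_compose[OF measurable_Pair1'[OF \<omega>] Vm[of j]] by simp
        have "(\<integral>\<^sup>+s\<in>{0..t}. ennreal ((norm (V j s \<omega> - XN N s))\<^sup>2) \<partial>lborel)
          \<le> (\<integral>\<^sup>+s. 2 * (ennreal ((norm (Xc s - V j s \<omega>))\<^sup>2) * indicator {0..t} s) + 2 * (ennreal ((norm (Xc s - XN N s))\<^sup>2) * indicator {0..t} s) \<partial>lborel)"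
        proof (rule nn_integral_mono)
          fix s
          have "ennreal ((norm (V j s \<omega> - XN N s))\<^sup>2) \<le> 2 * ennreal ((norm (Xc s - V j s \<omega>))\<^sup>2) + 2 * ennreal ((norm (Xc s - XN N s))\<^sup>2)"
            using ennreal_norm_add_squared[of "V j s \<omega> - Xc s" "Xc s - XN N s"] by (simp add: norm_minus_commute)
          then show "ennreal ((norm (V j s \<omega> - XN N s))\<^sup>2) * indicator {0..t} s
            \<le> 2 * (ennreal ((norm (Xc s - V j s \<omega>))\<^sup>2) * indicator {0..t} s) + 2 * (ennreal ((norm (Xc s - XN N s))\<^sup>2) * indicator {0..t} s)"
            by (cases "s \<in> {0..t}") auto
        qed
        also have "\<dots> = 2 * (\<integral>\<^sup>+s\<in>{0..t}. ennreal ((norm (Xc s - V j s \<omega>))\<^sup>2) \<partial>lborel) + 2 * R N"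
          unfolding R_def by (subst nn_integral_add) (auto simp: nn_integral_cmult)
        finally show ?thesis .
      qed
      then have "(\<integral>\<^sup>+\<omega>. ennreal ((norm (I j \<omega> - SN N \<omega>))\<^sup>2) \<partial>M)
          \<le> (\<integral>\<^sup>+\<omega>. 2 * (\<integral>\<^sup>+s\<in>{0..t}. ennreal ((norm (Xc s - V j s \<omega>))\<^sup>2) \<partial>lborel) + 2 * R N \<partial>M)"
        unfolding iso by (intro nn_integral_mono)
      also have "\<dots> = 2 * (\<integral>\<^sup>+\<omega>. (\<integral>\<^sup>+s\<in>{0..t}. ennreal ((norm (Xc s - V j s \<omega>))\<^sup>2) \<partial>lborel) \<partial>M) + 2 * R N"
      proof -
        have [measurable]: "(\<lambda>\<omega>. \<integral>\<^sup>+s\<in>{0..t}. ennreal ((norm (Xc s - V j s \<omega>))\<^sup>2) \<partial>lborel) \<in> borel_measurable M"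
        proof (rule lborel.borel_measurable_nn_integral)
          show "(\<lambda>(\<omega>, s). ennreal ((norm (Xc s - V j s \<omega>))\<^sup>2) * indicator {0..t} s) \<in> borel_measurable (M \<Otimes>\<^sub>M lborel)"
            using Vm[of j] unfolding split_beta by measurable
        qed
        show ?thesis by (subst nn_integral_add) (auto simp: nn_integral_cmult emeasure_space_1)
      qed
      also have "(\<integral>\<^sup>+\<omega>. (\<integral>\<^sup>+s\<in>{0..t}. ennreal ((norm (Xc s - V j s \<omega>))\<^sup>2) \<partial>lborel) \<partial>M) = A' j"
        unfolding A'_def V_def by (intro nn_integral_cong) (auto simp: XcX indicator_def)
      finally show ?thesis .
    qed
    finally show ?thesis by (simp add: mult_left_mono add_left_mono)
  qed
  have bound': "(\<integral>\<^sup>+\<omega>. ennreal ((norm (J \<omega> - SN N \<omega>))\<^sup>2) \<partial>M) \<le> 4 * R N" for N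
  proof -
    have "(\<lambda>j. 2 * B' j + 2 * (2 * A' j + 2 * R N)) \<longlonglongrightarrow> 2 * 0 + 2 * (2 * 0 + 2 * R N)"
      using A Bc unfolding A'_def[symmetric] B'_def[symmetric]
      by (intro tendsto_add ennreal_tendsto_cmult tendsto_const) auto
    from LIMSEQ_le_const[OF this] bound
    have "(\<integral>\<^sup>+\<omega>. ennreal ((norm (J \<omega> - SN N \<omega>))\<^sup>2) \<partial>M) \<le> 2 * 0 + 2 * (2 * 0 + 2 * R N)" by blast
    then show ?thesis by (simp add: mult.assoc[symmetric])
  qed
  have Rlim: "R \<longlonglongrightarrow> 0"
  proof (cases "t = 0")
    case True
    have "R N = 0" for N
    proof -
      have "AE s in lborel. s \<noteq> (0 :: real)" by (rule AE_lborel_singleton)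
      then have "AE s in lborel. ennreal ((norm (Xc s - XN N s))\<^sup>2) * indicator {0..t} s = 0"
        by eventually_elim (use True in \<open>auto simp: indicator_def\<close>)
      then show ?thesis unfolding R_def by (subst nn_integral_0_iff_AE) auto
    qed
    then have "R = (\<lambda>_. 0)" by (rule ext)
    then show ?thesis by simp
  next
    case False
    then have t0: "0 < t" using t by simp
    show ?thesis
    proof (rule order_tendstoI)
      fix e :: ennreal assume "0 < e"
      then obtain z where z: "0 < z" "z < e" using dense by blast
      then obtain e1 where e1: "0 < e1" "ennreal e1 < e"
        by (cases z) (auto simp: ennreal_less_zero_iff)
      define e2 where "e2 = sqrt (e1 / t)"
      have e2: "0 < e2" "e2\<^sup>2 * t = e1" unfolding e2_def using e1 t0 by auto
      obtain N0 where N0: "\<And>N s s'. N \<ge> N0 \<Longrightarrow> s \<in> {0..t} \<Longrightarrow> s' \<in> {0..t} \<Longrightarrow> \<bar>s - s'\<bar> \<le> t / real N \<Longrightarrow> dist (X s) (X s') \<le> e2"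
        using uniform_modulus_interval[OF contX e2(1)] by meson
      have "R N < e" if N: "N \<ge> N0 + 1" for N
      proof -
        have "AE s in lborel. s \<noteq> (0 :: real)" by (rule AE_lborel_singleton)
        then have "R N \<le> (\<integral>\<^sup>+s. ennreal (e2\<^sup>2) * indicator {0..t} s \<partial>lborel)"
          unfolding R_def
        proof (intro nn_integral_mono_AE, eventually_elim)
          case (elim s)
          show ?case
          proof (cases "s \<in> {0..t}")
            case True
            then have s: "0 < s" "s \<le> t" using elim by auto
            obtain l where l: "l < N" "\<bar>s - sl N l\<bar> \<le> t / real N" "XN N s = X (sl N l)"
              using step_function_value[OF t0 s, of N X] N unfolding sl_def XN_def by auto
            have "dist (X s) (X (sl N l)) \<le> e2"
              using True l N sl[of N l] slt[OF l(1)] by (intro N0[of N]) auto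
            then have "(norm (Xc s - XN N s))\<^sup>2 \<le> e2\<^sup>2"
              using XcX[OF True] l(3) by (intro power_mono) (auto simp: dist_norm)
            then show ?thesis using True by (simp add: ennreal_leI)
          qed simp
        qed
        also have "\<dots> = ennreal (e2\<^sup>2) * ennreal t"
          using t0 by (subst nn_integral_cmult_indicator) auto
        also have "\<dots> = ennreal e1" using e2 t0 by (simp flip: ennreal_mult)
        finally show ?thesis using e1(2) by (rule le_less_trans)
      qed
      then show "\<forall>\<^sub>F N in sequentially. R N < e" unfolding eventually_sequentially by blast
    qed simp
  qed
  define Z where "Z \<omega> = (w t \<omega> $ r) *\<^sub>R X t - integral {0..t} (\<lambda>s. (w s \<omega> $ r) *\<^sub>R X' s)" for \<omega>
  have lim: "AE \<omega> in M. (\<lambda>N. SN N \<omega>) \<longlonglongrightarrow> Z \<omega>"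
  proof -
    have "AE \<omega> in M. w 0 \<omega> = 0" "AE \<omega> in M. continuous_on {0..} (\<lambda>t. w t \<omega>)"
      using W by (auto simp: wiener_process_def)
    then show ?thesis
    proof eventually_elim
      case (elim \<omega>)
      have "continuous_on {0..t} (\<lambda>s. w s \<omega> $ r)"
        by (intro continuous_intros continuous_on_subset[OF elim(2)]) auto
      from riemann_ito_sum_converges[OF t this _ X' X] elim(1)
      show ?case unfolding SN_def Z_def sl_def by simp
    qed
  qed
  \<comment> \<open>the Riemann sums converge to \<open>J\<close> in mean square and to \<open>Z\<close> path by path; Fatou identifies the limits\<close>
  have "(\<integral>\<^sup>+\<omega>. liminf (\<lambda>N. ennreal ((norm (J \<omega> - SN N \<omega>))\<^sup>2)) \<partial>M) \<le> liminf (\<lambda>N. \<integral>\<^sup>+\<omega>. ennreal ((norm (J \<omega> - SN N \<omega>))\<^sup>2) \<partial>M)"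
    by (rule nn_integral_liminf) measurable
  also have "\<dots> \<le> liminf (\<lambda>N. 4 * R N)"
    by (rule Liminf_mono) (simp add: bound')
  also have "\<dots> = 0"
  proof -
    have "(\<lambda>N. 4 * R N) \<longlonglongrightarrow> 4 * 0" by (intro ennreal_tendsto_cmult Rlim) simp
    then show ?thesis using lim_imp_Liminf[OF sequentially_bot] by fastforce
  qed
  finally have "(\<integral>\<^sup>+\<omega>. liminf (\<lambda>N. ennreal ((norm (J \<omega> - SN N \<omega>))\<^sup>2)) \<partial>M) = 0" by simp
  then have "AE \<omega> in M. liminf (\<lambda>N. ennreal ((norm (J \<omega> - SN N \<omega>))\<^sup>2)) = 0"
    by (subst (asm) nn_integral_0_iff_AE) measurable
  with lim show ?thesis
  proof eventually_elim
    case (elim \<omega>)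
    have "(\<lambda>N. ennreal ((norm (J \<omega> - SN N \<omega>))\<^sup>2)) \<longlonglongrightarrow> ennreal ((norm (J \<omega> - Z \<omega>))\<^sup>2)"
      by (intro tendsto_ennrealI tendsto_intros elim(1))
    from lim_imp_Liminf[OF sequentially_bot this] elim(2)
    have "ennreal ((norm (J \<omega> - Z \<omega>))\<^sup>2) = 0" by simp
    then show ?case by (simp add: Z_def)
  qed
qed

section \<open>Averages over sign vectors\<close>

lemma sign_vectors_eq: "(sign_vectors :: (real ^ 'n::finite) set) = vec_lambda ` (PiE UNIV (\<lambda>_. {-1, 1}))"
proof
  show "(sign_vectors :: (real ^ 'n) set) \<subseteq> vec_lambda ` (PiE UNIV (\<lambda>_. {-1, 1}))"
  proof
    fix \<xi> :: "real ^ 'n" assume "\<xi> \<in> sign_vectors"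
    then have "vec_nth \<xi> \<in> PiE UNIV (\<lambda>_. {-1, 1})" by (auto simp: sign_vectors_def PiE_def Pi_def)
    then show "\<xi> \<in> vec_lambda ` (PiE UNIV (\<lambda>_. {-1, 1}))" by (metis imageI vec_nth_inverse)
  qed
qed (auto simp: sign_vectors_def PiE_def Pi_def)

lemma card_sign_vectors: "card (sign_vectors :: (real ^ 'n::finite) set) = 2 ^ CARD('n)"
proof -
  have "inj_on vec_lambda (PiE (UNIV :: 'n set) (\<lambda>_. {-1, 1 :: real}))"
    by (auto simp: inj_on_def vec_lambda_inject)
  then show ?thesis unfolding sign_vectors_eq by (simp add: card_image card_PiE numeral_2_eq_2)
qed

definition sign_avg :: "(real ^ 'n::finite \<Rightarrow> 'b::real_vector) \<Rightarrow> 'b" where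
  "sign_avg F = (1 / 2 ^ CARD('n)) *\<^sub>R (\<Sum>\<xi>\<in>sign_vectors. F \<xi>)"

lemma layer_average_eq: "layer_average \<sigma> h V x = sign_avg (\<lambda>\<xi>. V (x - h *\<^sub>R V x + (\<sigma> * sqrt h) *\<^sub>R \<xi>))"
  by (simp add: layer_average_def sign_avg_def)

lemma sign_avg_const [simp]: "sign_avg (\<lambda>\<xi> :: real ^ 'n::finite. y) = y"
  by (simp add: sign_avg_def sum_constant_scaleR card_sign_vectors)

lemma sign_avg_add: "sign_avg (\<lambda>\<xi>. F \<xi> + G \<xi>) = sign_avg F + sign_avg G"
  by (simp add: sign_avg_def sum.distrib scaleR_add_right)

lemma sign_avg_diff: "sign_avg (\<lambda>\<xi>. F \<xi> - G \<xi>) = sign_avg F - sign_avg G"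
  by (simp add: sign_avg_def sum_subtractf scaleR_diff_right)

lemma sign_avg_scaleR: "sign_avg (\<lambda>\<xi>. c *\<^sub>R F \<xi>) = c *\<^sub>R sign_avg F"
  by (simp add: sign_avg_def scaleR_sum_right ac_simps)

lemma sign_avg_sum: "sign_avg (\<lambda>\<xi>. \<Sum>i\<in>I. F i \<xi>) = (\<Sum>i\<in>I. sign_avg (F i))"
  unfolding sign_avg_def by (subst sum.swap) (simp add: scaleR_sum_right)

lemma sign_avg_mono:
  fixes F G :: "real ^ 'n::finite \<Rightarrow> real"
  shows "(\<And>\<xi>. \<xi> \<in> sign_vectors \<Longrightarrow> F \<xi> \<le> G \<xi>) \<Longrightarrow> sign_avg F \<le> sign_avg G"
  unfolding sign_avg_def by (intro scaleR_left_mono sum_mono) auto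

lemma norm_sign_avg: "norm (sign_avg F) \<le> sign_avg (\<lambda>\<xi>. norm (F \<xi>))"
  unfolding sign_avg_def by (simp add: divide_right_mono norm_sum)

lemma norm_sign_avg_le:
  assumes "\<And>\<xi>. \<xi> \<in> sign_vectors \<Longrightarrow> norm (F \<xi>) \<le> K"
  shows "norm (sign_avg F) \<le> K"
  using norm_sign_avg[of F] sign_avg_mono[of "\<lambda>\<xi>. norm (F \<xi>)" "\<lambda>_. K"] assms by simp

lemma norm_sign_avg_squared:
  fixes F :: "real ^ 'n::finite \<Rightarrow> 'b::real_normed_vector"
  shows "(norm (sign_avg F))\<^sup>2 \<le> sign_avg (\<lambda>\<xi>. (norm (F \<xi>))\<^sup>2)"
proof -
  have "(norm (sign_avg F))\<^sup>2 \<le> (sign_avg (\<lambda>\<xi>. norm (F \<xi>)))\<^sup>2"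
    by (intro power_mono norm_sign_avg) auto
  also have "\<dots> = (1 / 2 ^ CARD('n))\<^sup>2 * (\<Sum>\<xi>\<in>sign_vectors. norm (F \<xi>))\<^sup>2"
    by (simp add: sign_avg_def power_mult_distrib power_divide)
  also have "\<dots> \<le> (1 / 2 ^ CARD('n))\<^sup>2 * ((\<Sum>\<xi>\<in>sign_vectors. (norm (F \<xi>))\<^sup>2) * 2 ^ CARD('n))"
    using sum_squared_le_sum_of_squares[of "\<lambda>\<xi>. norm (F \<xi>)" sign_vectors]
    by (intro mult_left_mono) (auto simp: card_sign_vectors)
  also have "\<dots> = sign_avg (\<lambda>\<xi>. (norm (F \<xi>))\<^sup>2)"
    by (simp add: sign_avg_def power2_eq_square)
  finally show ?thesis .
qed

text \<open>Flipping one coordinate permutes the sign vectors, so functions odd in that coordinate average to zero.\<close>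

lemma sign_vectors_flip_sum:
  fixes g :: "real ^ 'n::finite \<Rightarrow> real"
  assumes "\<And>\<xi>. g (\<chi> j. if j = i then - \<xi> $ j else \<xi> $ j) = - g \<xi>"
  shows "(\<Sum>\<xi>\<in>sign_vectors. g \<xi>) = 0"
proof -
  define flip where "flip \<xi> = (\<chi> j. if j = i then - \<xi> $ j else \<xi> $ j)" for \<xi> :: "real ^ 'n"
  have "(\<Sum>\<xi>\<in>sign_vectors. g \<xi>) = (\<Sum>\<xi>\<in>sign_vectors. g (flip \<xi>))"
  proof (rule sum.reindex_bij_witness[where i=flip and j=flip])
    fix \<xi> :: "real ^ 'n" assume \<xi>: "\<xi> \<in> sign_vectors"
    show "flip (flip \<xi>) = \<xi>" by (simp add: flip_def vec_eq_iff)
    then show "g (flip (flip \<xi>)) = g \<xi>" "flip (flip \<xi>) = \<xi>" by simp_all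
    show "flip \<xi> \<in> sign_vectors" "flip \<xi> \<in> sign_vectors" using \<xi> by (auto simp: flip_def sign_vectors_def)
  qed
  also have "\<dots> = - (\<Sum>\<xi>\<in>sign_vectors. g \<xi>)" using assms by (simp add: flip_def sum_negf)
  finally show ?thesis by simp
qed

lemma sign_avg_first_moment: "sign_avg (\<lambda>\<xi> :: real ^ 'n::finite. (\<xi> $ i) *\<^sub>R y) = 0"
proof -
  have "(\<Sum>\<xi>\<in>sign_vectors. (\<xi> :: real ^ 'n) $ i) = 0" by (rule sign_vectors_flip_sum[of _ i]) simp
  then show ?thesis by (simp add: sign_avg_def scaleR_sum_left[symmetric])
qed

lemma sign_avg_second_moment:
  "sign_avg (\<lambda>\<xi> :: real ^ 'n::finite. (\<xi> $ i * \<xi> $ j) *\<^sub>R y) = (if i = j then y else 0)"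
proof (cases "i = j")
  case True
  have "sign_avg (\<lambda>\<xi> :: real ^ 'n. (\<xi> $ i * \<xi> $ j) *\<^sub>R y) = sign_avg (\<lambda>\<xi> :: real ^ 'n. y)"
    unfolding sign_avg_def
    by (intro arg_cong[where f="\<lambda>z. _ *\<^sub>R z"] sum.cong) (auto simp: sign_vectors_def True dest!: spec[of _ j])
  then show ?thesis using True by simp
next
  case False
  then have "(\<Sum>\<xi>\<in>sign_vectors. (\<xi> :: real ^ 'n) $ i * \<xi> $ j) = 0" by (intro sign_vectors_flip_sum[of _ i]) simp
  then show ?thesis using False by (simp add: sign_avg_def scaleR_sum_left[symmetric])
qed

section \<open>The layer average\<close>

lemma l1_norm_sign_vector: "\<xi> \<in> sign_vectors \<Longrightarrow> l1_norm (\<xi> :: real ^ 'n::finite) = real CARD('n)"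
proof -
  assume "\<xi> \<in> sign_vectors"
  then have "\<bar>\<xi> $ i\<bar> = 1" for i by (auto simp: sign_vectors_def dest!: spec[of _ i])
  then show ?thesis by (simp add: l1_norm_def)
qed

lemma l1_norm_add: "l1_norm (a + b) \<le> l1_norm a + l1_norm (b :: real ^ 'n::finite)"
  unfolding l1_norm_def sum.distrib[symmetric] by (intro sum_mono) simp

text \<open>The first two moments of the averaged displacement produce transport by the field itself and the
  Laplacian; the third-order terms are bounded by the cube of the step \<open>sqrt h\<close>.\<close>

lemma layer_average_expansion:
  fixes u :: "real ^ 'n::finite \<Rightarrow> real ^ 'n"
  assumes h: "0 \<le> h" "h \<le> T" and \<sigma>: "0 \<le> \<sigma>" and B: "0 \<le> B"
    and d: "\<And>ds i x. length ds < 3 \<Longrightarrow> has_partial i (partials ds u) x"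
    and bd: "\<And>ds x. length ds \<le> 3 \<Longrightarrow> norm (partials ds u x) \<le> B"
  shows "norm (layer_average \<sigma> h u x - u x - h *\<^sub>R ((\<sigma>\<^sup>2 / 2) *\<^sub>R laplacian u x - advection u u x))
    \<le> (sqrt T * (real CARD('n))\<^sup>2 * B ^ 3 / 2 + B * (real CARD('n) * (sqrt T * B + \<sigma>)) ^ 3) * (h * sqrt h)"
proof -
  define c where "c = \<sigma> * sqrt h"
  define n where "n = real CARD('n)"
  define dd where "dd \<xi> = c *\<^sub>R \<xi> - h *\<^sub>R u x" for \<xi> :: "real ^ 'n"
  define D where "D i j = partial_deriv j (partial_deriv i u) x" for i j
  have c2: "c * c = \<sigma>\<^sup>2 * h" unfolding c_def using h by (simp add: power2_eq_square)
  have d0: "has_partial i u y" for i y using d[of "[]"] by simp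
  have d1: "has_partial j (partial_deriv i u) y" for i j y using d[of "[i]"] by simp
  have d2: "has_partial k (partial_deriv j (partial_deriv i u)) y" for i j k y using d[of "[j, i]"] by simp
  have b0: "norm (u y) \<le> B" for y using bd[of "[]"] by simp
  have b2: "norm (partial_deriv j (partial_deriv i u) y) \<le> B" for i j y using bd[of "[j, i]"] by simp
  have b3: "norm (partial_deriv k (partial_deriv j (partial_deriv i u)) y) \<le> B" for i j k y using bd[of "[k, j, i]"] by simp
  define rem where "rem \<xi> = u (x + dd \<xi>) - u x - (\<Sum>i\<in>UNIV. dd \<xi> $ i *\<^sub>R partial_deriv i u x)
      - (1/2) *\<^sub>R (\<Sum>i\<in>UNIV. \<Sum>j\<in>UNIV. (dd \<xi> $ i * dd \<xi> $ j) *\<^sub>R D i j)" for \<xi>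
  have un: "\<bar>u x $ i\<bar> \<le> B" for i using b0[of x] component_le_norm_cart[of "u x" i] by linarith
  have rem: "norm (rem \<xi>) \<le> B * (n * (sqrt T * B + \<sigma>)) ^ 3 * (h * sqrt h)" if \<xi>: "\<xi> \<in> sign_vectors" for \<xi>
  proof -
    have "norm (rem \<xi>) \<le> B * (l1_norm (dd \<xi>)) ^ 3"
      unfolding rem_def D_def
      by (rule taylor_second_order[OF d0 d1 B B]) (intro lipschitz_of_bounded_partials d1 d2 b2 b3)+
    also have "l1_norm (dd \<xi>) \<le> sqrt h * (n * (sqrt T * B + \<sigma>))"
    proof -
      have "l1_norm (dd \<xi>) \<le> l1_norm (c *\<^sub>R \<xi>) + l1_norm ((- h) *\<^sub>R u x)"
        using l1_norm_add[of "c *\<^sub>R \<xi>" "(- h) *\<^sub>R u x"] by (simp add: dd_def)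
      also have "\<dots> \<le> c * n + h * (n * B)"
        unfolding l1_norm_scaleR using h \<sigma> l1_norm_sign_vector[OF \<xi>] l1_norm_le[of "u x"] b0[of x]
        by (auto simp: c_def n_def intro!: mult_left_mono order_trans[OF l1_norm_le])
      also have "h * (n * B) \<le> (sqrt h * sqrt T) * (n * B)"
      proof (rule mult_right_mono)
        have "h = sqrt h * sqrt h" using h by simp
        also have "\<dots> \<le> sqrt h * sqrt T" using h by (intro mult_left_mono) auto
        finally show "h \<le> sqrt h * sqrt T" .
      qed (use B in \<open>simp add: n_def\<close>)
      finally show ?thesis by (simp add: c_def algebra_simps)
    qed
    then have "B * (l1_norm (dd \<xi>)) ^ 3 \<le> B * (sqrt h * (n * (sqrt T * B + \<sigma>))) ^ 3"
      using B by (intro mult_left_mono power_mono) auto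
    also have "\<dots> = B * (n * (sqrt T * B + \<sigma>)) ^ 3 * (h * sqrt h)"
      using h by (simp add: power_mult_distrib power3_eq_cube)
    finally show ?thesis .
  qed
  have first: "sign_avg (\<lambda>\<xi>. \<Sum>i\<in>UNIV. dd \<xi> $ i *\<^sub>R partial_deriv i u x) = - h *\<^sub>R advection u u x"
  proof -
    have "sign_avg (\<lambda>\<xi>. dd \<xi> $ i *\<^sub>R partial_deriv i u x) = - h *\<^sub>R (u x $ i *\<^sub>R partial_deriv i u x)" for i
    proof -
      have "dd \<xi> $ i *\<^sub>R partial_deriv i u x = c *\<^sub>R (\<xi> $ i *\<^sub>R partial_deriv i u x) - h *\<^sub>R (u x $ i *\<^sub>R partial_deriv i u x)" for \<xi>
        by (simp add: dd_def scaleR_diff_left)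
      then show ?thesis by (simp only: sign_avg_diff sign_avg_scaleR sign_avg_first_moment sign_avg_const) simp
    qed
    then show ?thesis by (simp add: sign_avg_sum advection_def scaleR_sum_right sum_negf)
  qed
  have second: "sign_avg (\<lambda>\<xi>. \<Sum>i\<in>UNIV. \<Sum>j\<in>UNIV. (dd \<xi> $ i * dd \<xi> $ j) *\<^sub>R D i j)
      = (\<sigma>\<^sup>2 * h) *\<^sub>R laplacian u x + (h * h) *\<^sub>R (\<Sum>i\<in>UNIV. \<Sum>j\<in>UNIV. (u x $ i * u x $ j) *\<^sub>R D i j)"
  proof -
    have each: "sign_avg (\<lambda>\<xi>. (dd \<xi> $ i * dd \<xi> $ j) *\<^sub>R D i j)
      = (\<sigma>\<^sup>2 * h) *\<^sub>R (if i = j then D i j else 0) + (h * h) *\<^sub>R ((u x $ i * u x $ j) *\<^sub>R D i j)" for i j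
    proof -
      have "(dd \<xi> $ i * dd \<xi> $ j) *\<^sub>R D i j = (c * c) *\<^sub>R ((\<xi> $ i * \<xi> $ j) *\<^sub>R D i j)
          - (c * h * u x $ j) *\<^sub>R (\<xi> $ i *\<^sub>R D i j) - (c * h * u x $ i) *\<^sub>R (\<xi> $ j *\<^sub>R D i j)
          + (h * h) *\<^sub>R ((u x $ i * u x $ j) *\<^sub>R D i j)" for \<xi>
        by (simp add: dd_def algebra_simps flip: scaleR_add_left scaleR_diff_left)
      then show ?thesis
        by (simp only: sign_avg_add sign_avg_diff sign_avg_scaleR sign_avg_first_moment sign_avg_second_moment sign_avg_const c2) simp
    qed
    have lap: "(\<Sum>i\<in>UNIV. \<Sum>j\<in>UNIV. if i = j then D i j else 0) = laplacian u x"
      by (simp add: laplacian_def D_def)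
    show ?thesis
      by (simp only: sign_avg_sum each sum.distrib scaleR_sum_right[symmetric] lap)
  qed
  have "sign_avg rem = layer_average \<sigma> h u x - u x + h *\<^sub>R advection u u x
      - (1/2) *\<^sub>R ((\<sigma>\<^sup>2 * h) *\<^sub>R laplacian u x + (h * h) *\<^sub>R (\<Sum>i\<in>UNIV. \<Sum>j\<in>UNIV. (u x $ i * u x $ j) *\<^sub>R D i j))"
  proof -
    have "x + dd \<xi> = x - h *\<^sub>R u x + (\<sigma> * sqrt h) *\<^sub>R \<xi>" for \<xi> by (simp add: dd_def c_def)
    then show ?thesis
      unfolding rem_def by (simp only: sign_avg_diff sign_avg_scaleR first second sign_avg_const layer_average_eq) simp
  qed
  then have "layer_average \<sigma> h u x - u x - h *\<^sub>R ((\<sigma>\<^sup>2 / 2) *\<^sub>R laplacian u x - advection u u x)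
      = sign_avg rem + (h * h / 2) *\<^sub>R (\<Sum>i\<in>UNIV. \<Sum>j\<in>UNIV. (u x $ i * u x $ j) *\<^sub>R D i j)"
    by (simp add: algebra_simps)
  also have "norm \<dots> \<le> B * (n * (sqrt T * B + \<sigma>)) ^ 3 * (h * sqrt h) + (h * sqrt h) * (sqrt T * n\<^sup>2 * B ^ 3 / 2)"
  proof (rule norm_triangle_mono)
    show "norm (sign_avg rem) \<le> B * (n * (sqrt T * B + \<sigma>)) ^ 3 * (h * sqrt h)"
      by (rule norm_sign_avg_le[OF rem])
    have "norm (\<Sum>i\<in>UNIV. \<Sum>j\<in>UNIV. (u x $ i * u x $ j) *\<^sub>R D i j) \<le> (\<Sum>i\<in>(UNIV :: 'n set). \<Sum>j\<in>(UNIV :: 'n set). B * B * B)"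
    proof (intro order_trans[OF norm_sum] sum_mono)
      fix i j :: 'n
      show "norm ((u x $ i * u x $ j) *\<^sub>R D i j) \<le> B * B * B"
        unfolding norm_scaleR abs_mult D_def using un B by (intro mult_mono b2) auto
    qed
    also have "\<dots> = n\<^sup>2 * B ^ 3" by (simp add: n_def power2_eq_square power3_eq_cube)
    finally have "norm ((h * h / 2) *\<^sub>R (\<Sum>i\<in>UNIV. \<Sum>j\<in>UNIV. (u x $ i * u x $ j) *\<^sub>R D i j)) \<le> (h * h / 2) * (n\<^sup>2 * B ^ 3)"
      unfolding norm_scaleR using h by (intro mult_mono) auto
    also have "\<dots> \<le> (h * (sqrt h * sqrt T) / 2) * (n\<^sup>2 * B ^ 3)"
    proof (intro mult_right_mono divide_right_mono mult_left_mono)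
      have "h = sqrt h * sqrt h" using h by simp
      also have "\<dots> \<le> sqrt h * sqrt T" using h by (intro mult_left_mono) auto
      finally show "h \<le> sqrt h * sqrt T" .
    qed (use h B in auto)
    finally show "norm ((h * h / 2) *\<^sub>R (\<Sum>i\<in>UNIV. \<Sum>j\<in>UNIV. (u x $ i * u x $ j) *\<^sub>R D i j))
        \<le> (h * sqrt h) * (sqrt T * n\<^sup>2 * B ^ 3 / 2)" by (simp add: algebra_simps)
  qed
  also have "\<dots> = (sqrt T * n\<^sup>2 * B ^ 3 / 2 + B * (n * (sqrt T * B + \<sigma>)) ^ 3) * (h * sqrt h)"
    by (simp add: distrib_right distrib_left mult.commute add.commute)
  finally show ?thesis unfolding n_def .
qed

text \<open>The first-order expansion in \<open>h\<close> of the average of \<open>e\<close> over the points \<open>x - h V(x) + c \<xi>\<close>, where the layer average evaluates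
  its field; \<open>c\<close> stands for \<open>\<sigma> * sqrt h\<close>.\<close>

definition transport_avg ::
  "real \<Rightarrow> real \<Rightarrow> (real ^ 'n::finite \<Rightarrow> real ^ 'n) \<Rightarrow> (real ^ 'n \<Rightarrow> real ^ 'n) \<Rightarrow> real ^ 'n \<Rightarrow> real ^ 'n" where
  "transport_avg h c V e x =
     sign_avg (\<lambda>\<xi>. e (x + c *\<^sub>R \<xi>) - h *\<^sub>R (\<Sum>i\<in>UNIV. V x $ i *\<^sub>R partial_deriv i e (x + c *\<^sub>R \<xi>)))"

text \<open>The points where \<open>V\<close> and \<open>u\<close> are evaluated differ by \<open>h e(x)\<close>.  Moving \<open>u\<close> between them gives the first term of the bound;
  what remains is \<open>e\<close> at one point, and its Taylor remainder gives the second term.\<close>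

lemma layer_average_difference:
  fixes V u :: "real ^ 'n::finite \<Rightarrow> real ^ 'n"
  assumes h: "0 \<le> h" and B: "0 \<le> B" and B2: "0 \<le> B2"
    and V: "\<And>x. norm (V x) \<le> B"
    and u: "\<And>i x. has_partial i u x" "\<And>i x. norm (partial_deriv i u x) \<le> B"
    and e: "\<And>x. e x = V x - u x" "\<And>i x. has_partial i e x" "\<And>i j x. has_partial j (partial_deriv i e) x"
      "\<And>i j x. norm (partial_deriv j (partial_deriv i e) x) \<le> B2"
  shows "norm (layer_average \<sigma> h V x - layer_average \<sigma> h u x - transport_avg h (\<sigma> * sqrt h) V e x)
    \<le> B * real CARD('n) * h * norm (e x) + B2 * (h * (real CARD('n) * B))\<^sup>2"
proof -
  define c where "c = \<sigma> * sqrt h"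
  have "layer_average \<sigma> h V x - layer_average \<sigma> h u x - transport_avg h c V e x
    = sign_avg (\<lambda>\<xi>. (V (x - h *\<^sub>R V x + c *\<^sub>R \<xi>) - u (x - h *\<^sub>R u x + c *\<^sub>R \<xi>))
        - (e (x + c *\<^sub>R \<xi>) - h *\<^sub>R (\<Sum>i\<in>UNIV. V x $ i *\<^sub>R partial_deriv i e (x + c *\<^sub>R \<xi>))))"
    unfolding layer_average_eq transport_avg_def c_def by (simp only: sign_avg_diff)
  also have "norm \<dots> \<le> B * real CARD('n) * h * norm (e x) + B2 * (h * (real CARD('n) * B))\<^sup>2"
  proof (rule norm_sign_avg_le)
    fix \<xi> :: "real ^ 'n"
    define y where "y = x + c *\<^sub>R \<xi>"
    define d where "d = (- h) *\<^sub>R V x"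
    have 1: "norm (e (y + d) - e y - (\<Sum>i\<in>UNIV. d $ i *\<^sub>R partial_deriv i e y)) \<le> B2 * (l1_norm d)\<^sup>2"
      by (rule taylor_first_order[OF e(2) B2]) (intro lipschitz_of_bounded_partials e)
    have "l1_norm d \<le> h * (real CARD('n) * B)"
      unfolding d_def l1_norm_scaleR using h l1_norm_le[of "V x"] V[of x]
      by (auto intro!: mult_left_mono order_trans[OF l1_norm_le])
    then have 2: "B2 * (l1_norm d)\<^sup>2 \<le> B2 * (h * (real CARD('n) * B))\<^sup>2"
      using B2 by (intro mult_left_mono power_mono) auto
    define z where "z = x - h *\<^sub>R u x + c *\<^sub>R \<xi>"
    have "norm (u (z + (- h) *\<^sub>R e x) - u z) \<le> B * l1_norm ((- h) *\<^sub>R e x)"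
      by (rule lipschitz_of_bounded_partials[OF u])
    also have "\<dots> \<le> B * (h * (real CARD('n) * norm (e x)))"
      unfolding l1_norm_scaleR using h B l1_norm_le[of "e x"] by (intro mult_left_mono mult_mono) auto
    finally have 3: "norm (u (z + (- h) *\<^sub>R e x) - u z) \<le> B * real CARD('n) * h * norm (e x)" by (simp add: ac_simps)
    have yd: "y + d = x - h *\<^sub>R V x + c *\<^sub>R \<xi>" "z + (- h) *\<^sub>R e x = y + d"
      by (simp_all add: y_def d_def z_def e(1) algebra_simps)
    have "(V (x - h *\<^sub>R V x + c *\<^sub>R \<xi>) - u (x - h *\<^sub>R u x + c *\<^sub>R \<xi>))
        - (e (x + c *\<^sub>R \<xi>) - h *\<^sub>R (\<Sum>i\<in>UNIV. V x $ i *\<^sub>R partial_deriv i e (x + c *\<^sub>R \<xi>)))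
      = (u (z + (- h) *\<^sub>R e x) - u z) + (e (y + d) - e y - (\<Sum>i\<in>UNIV. d $ i *\<^sub>R partial_deriv i e y))"
    proof -
      have "(\<Sum>i\<in>UNIV. d $ i *\<^sub>R partial_deriv i e y) = - (h *\<^sub>R (\<Sum>i\<in>UNIV. V x $ i *\<^sub>R partial_deriv i e y))"
        by (simp add: d_def scaleR_sum_right sum_negf)
      then show ?thesis unfolding yd(2) yd(1)[symmetric] z_def[symmetric] y_def[symmetric]
        by (simp add: e(1)[of "y + d"])
    qed
    also have "norm \<dots> \<le> B * real CARD('n) * h * norm (e x) + B2 * (h * (real CARD('n) * B))\<^sup>2"
      using 1 2 3 by (intro norm_triangle_mono) auto
    finally show "norm ((V (x - h *\<^sub>R V x + c *\<^sub>R \<xi>) - u (x - h *\<^sub>R u x + c *\<^sub>R \<xi>))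
        - (e (x + c *\<^sub>R \<xi>) - h *\<^sub>R (\<Sum>i\<in>UNIV. V x $ i *\<^sub>R partial_deriv i e (x + c *\<^sub>R \<xi>))))
      \<le> B * real CARD('n) * h * norm (e x) + B2 * (h * (real CARD('n) * B))\<^sup>2" .
  qed
  finally show ?thesis unfolding c_def .
qed

text \<open>Transport by a divergence-free field conserves the \<open>L\<^sup>2\<close> norm to first order in the step:
  the cross term is half of the pairing of \<open>V\<close> with the gradient of \<open>|e|\<^sup>2\<close>.\<close>

lemma transport_energy:
  fixes V e :: "real ^ 'n::finite \<Rightarrow> real ^ 'n"
  assumes L: "0 < L" and e: "C1_field e" "periodic L e" and eB: "\<And>i x. norm (partial_deriv i e x) \<le> B1"
    and V: "continuous_on UNIV V" "L2_divergence_free L V" "\<And>x. norm (V x) \<le> B" and B: "0 \<le> B" "0 \<le> B1"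
  shows "(LINT x:cell L|lborel. (norm (e (x + c) - h *\<^sub>R (\<Sum>i\<in>UNIV. V x $ i *\<^sub>R partial_deriv i e (x + c))))\<^sup>2)
    \<le> (LINT x:cell L|lborel. (norm (e x))\<^sup>2) + h\<^sup>2 * (real CARD('n) * B * B1)\<^sup>2 * measure lborel (cell L :: (real ^ 'n) set)"
proof -
  define b where "b x = e (x + c)" for x
  define G where "G x = (\<Sum>i\<in>UNIV. V x $ i *\<^sub>R partial_deriv i b x)" for x
  define \<psi> where "\<psi> x = (1/2) *\<^sub>R (b x \<bullet> b x)" for x
  have b: "C1_field b" "periodic L b" unfolding b_def by (intro C1_field_translate periodic_translate e)+
  have pb: "partial_deriv i b x = partial_deriv i e (x + c)" for i x
    unfolding b_def by (rule partial_translate)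
  have \<psi>: "C1_field \<psi>" "periodic L \<psi>"
    unfolding \<psi>_def by (intro C1_field_linear[OF bounded_linear_scaleR_right] C1_field_bilinear[OF bounded_bilinear_inner] b)
      (rule periodic_compose[OF b(2), of "\<lambda>y. (1/2) *\<^sub>R (y \<bullet> y)"])
  have grad: "V x \<bullet> gradient \<psi> x = b x \<bullet> G x" for x
  proof -
    have "partial_deriv i \<psi> x = b x \<bullet> partial_deriv i b x" for i
    proof -
      have "has_partial i (\<lambda>x. b x \<bullet> b x) x" "partial_deriv i (\<lambda>x. b x \<bullet> b x) x = b x \<bullet> partial_deriv i b x + partial_deriv i b x \<bullet> b x"
        using C1_fieldD(2)[OF b(1)] by (auto intro: partial_inner)
      then show ?thesis unfolding \<psi>_def by (subst partial_cmult(2)) (auto simp: inner_commute)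
    qed
    then show ?thesis by (simp add: gradient_def inner_vec_def[of "V x"] G_def inner_sum_right)
  qed
  have orth: "(LINT x:cell L|lborel. b x \<bullet> G x) = 0"
    unfolding grad[symmetric] using V(2) \<psi> by (simp add: L2_divergence_free_def)
  have Vi: "continuous_on UNIV (\<lambda>x. V x $ i)" for i by (intro continuous_intros V(1))
  have cb: "continuous_on UNIV b" "continuous_on UNIV G"
    unfolding G_def by (intro continuous_intros C1_fieldD(1)[OF b(1)] C1_fieldD(3)[OF b(1)] Vi)+
  note int = set_integrable_cell_continuous
  have GB: "(norm (G x))\<^sup>2 \<le> (real CARD('n) * B * B1)\<^sup>2" for x
  proof -
    have "norm (G x) \<le> (\<Sum>i\<in>(UNIV :: 'n set). B * B1)"
      unfolding G_def
    proof (intro order_trans[OF norm_sum] sum_mono)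
      fix i
      have "\<bar>V x $ i\<bar> \<le> B" using V(3)[of x] component_le_norm_cart[of "V x" i] by linarith
      then show "norm (V x $ i *\<^sub>R partial_deriv i b x) \<le> B * B1"
        unfolding norm_scaleR pb using B by (intro mult_mono eB) auto
    qed
    then show ?thesis by (intro power_mono) auto
  qed
  have "(norm (b x - h *\<^sub>R G x))\<^sup>2 = (norm (b x))\<^sup>2 - 2 * h * (b x \<bullet> G x) + h\<^sup>2 * (norm (G x))\<^sup>2" for x
    unfolding power2_norm_eq_inner by (simp add: inner_diff inner_commute algebra_simps power2_eq_square)
  then have "(LINT x:cell L|lborel. (norm (b x - h *\<^sub>R G x))\<^sup>2)
      = (LINT x:cell L|lborel. (norm (b x))\<^sup>2 - 2 * h * (b x \<bullet> G x) + h\<^sup>2 * (norm (G x))\<^sup>2)" by simp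
  also have "\<dots> = (LINT x:cell L|lborel. (norm (b x))\<^sup>2 - 2 * h * (b x \<bullet> G x)) + (LINT x:cell L|lborel. h\<^sup>2 * (norm (G x))\<^sup>2)"
    by (intro set_integral_add(2) int continuous_intros cb)
  also have "(LINT x:cell L|lborel. (norm (b x))\<^sup>2 - 2 * h * (b x \<bullet> G x))
      = (LINT x:cell L|lborel. (norm (b x))\<^sup>2) - (LINT x:cell L|lborel. 2 * h * (b x \<bullet> G x))"
    by (intro set_integral_diff(2) int continuous_intros cb)
  also have "(LINT x:cell L|lborel. 2 * h * (b x \<bullet> G x)) = 0" using orth by simp
  also have "(LINT x:cell L|lborel. (norm (b x))\<^sup>2) = (LINT x:cell L|lborel. (norm (e x))\<^sup>2)"
    unfolding b_def
    by (rule cell_integral_translate(2)[OF L periodic_compose[OF e(2), of "\<lambda>y. (norm y)\<^sup>2"]])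
       (intro borel_measurable_continuous_onI int continuous_intros C1_fieldD(1)[OF e(1)])+
  also have "(LINT x:cell L|lborel. h\<^sup>2 * (norm (G x))\<^sup>2) \<le> (LINT x:(cell L :: (real ^ 'n) set)|lborel. h\<^sup>2 * (real CARD('n) * B * B1)\<^sup>2)"
    by (rule set_integral_mono) (intro int continuous_intros cb mult_left_mono GB zero_le_power2)+
  also have "\<dots> = h\<^sup>2 * (real CARD('n) * B * B1)\<^sup>2 * measure lborel (cell L :: (real ^ 'n) set)"
    unfolding set_lebesgue_integral_def by simp
  finally show ?thesis unfolding G_def pb b_def by simp
qed

text \<open>Averaging over the sign vectors does not increase the norm, by convexity.\<close>

lemma transport_avg_energy:
  fixes V e :: "real ^ 'n::finite \<Rightarrow> real ^ 'n"
  assumes L: "0 < L" and e: "C1_field e" "periodic L e" and eB: "\<And>i x. norm (partial_deriv i e x) \<le> B1"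
    and V: "continuous_on UNIV V" "L2_divergence_free L V" "\<And>x. norm (V x) \<le> B" and B: "0 \<le> B" "0 \<le> B1"
  shows "continuous_on UNIV (transport_avg h c V e)"
    and "(LINT x:cell L|lborel. (norm (transport_avg h c V e x))\<^sup>2)
    \<le> (LINT x:cell L|lborel. (norm (e x))\<^sup>2) + h\<^sup>2 * (real CARD('n) * B * B1)\<^sup>2 * measure lborel (cell L :: (real ^ 'n) set)"
proof -
  define a where "a \<xi> x = e (x + c *\<^sub>R \<xi>) - h *\<^sub>R (\<Sum>i\<in>UNIV. V x $ i *\<^sub>R partial_deriv i e (x + c *\<^sub>R \<xi>))" for \<xi> x
  define K where "K = (LINT x:cell L|lborel. (norm (e x))\<^sup>2) + h\<^sup>2 * (real CARD('n) * B * B1)\<^sup>2 * measure lborel (cell L :: (real ^ 'n) set)"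
  have ca: "continuous_on UNIV (a \<xi>)" for \<xi>
  proof -
    have 1: "continuous_on UNIV (\<lambda>x :: real ^ 'n. x + c *\<^sub>R \<xi>)" by (intro continuous_intros)
    have "continuous_on UNIV (\<lambda>x. e (x + c *\<^sub>R \<xi>))" "continuous_on UNIV (\<lambda>x. partial_deriv i e (x + c *\<^sub>R \<xi>))" for i
      using continuous_on_compose2[OF C1_fieldD(1)[OF e(1)] 1] continuous_on_compose2[OF C1_fieldD(3)[OF e(1)] 1] by auto
    then show ?thesis unfolding a_def by (intro continuous_intros V(1))
  qed
  have t: "transport_avg h c V e x = sign_avg (\<lambda>\<xi>. a \<xi> x)" for x
    unfolding transport_avg_def a_def ..
  show ct: "continuous_on UNIV (transport_avg h c V e)"
    unfolding t[abs_def] sign_avg_def by (intro continuous_intros ca)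
  note int = set_integrable_cell_continuous
  have "(LINT x:cell L|lborel. (norm (transport_avg h c V e x))\<^sup>2)
      \<le> (LINT x:cell L|lborel. (\<Sum>\<xi>\<in>sign_vectors. (1 / 2 ^ CARD('n)) * (norm (a \<xi> x))\<^sup>2))"
  proof (rule set_integral_mono)
    fix x
    have "(norm (transport_avg h c V e x))\<^sup>2 \<le> sign_avg (\<lambda>\<xi>. (norm (a \<xi> x))\<^sup>2)"
      unfolding t by (rule norm_sign_avg_squared)
    then show "(norm (transport_avg h c V e x))\<^sup>2 \<le> (\<Sum>\<xi>\<in>sign_vectors. (1 / 2 ^ CARD('n)) * (norm (a \<xi> x))\<^sup>2)"
      by (simp add: sign_avg_def sum_divide_distrib)
  qed (intro int continuous_intros ct ca)+
  also have "\<dots> = (\<Sum>\<xi>\<in>sign_vectors. LINT x:cell L|lborel. (1 / 2 ^ CARD('n)) * (norm (a \<xi> x))\<^sup>2)"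
    by (intro set_integral_sum_cell int continuous_intros ca)
  also have "\<dots> \<le> (\<Sum>\<xi>\<in>(sign_vectors :: (real ^ 'n) set). (1 / 2 ^ CARD('n)) * K)"
  proof (rule sum_mono)
    fix \<xi> :: "real ^ 'n"
    have "(LINT x:cell L|lborel. (1 / 2 ^ CARD('n)) * (norm (a \<xi> x))\<^sup>2) = (1 / 2 ^ CARD('n)) * (LINT x:cell L|lborel. (norm (a \<xi> x))\<^sup>2)"
      by (rule set_integral_mult_right)
    also have "\<dots> \<le> (1 / 2 ^ CARD('n)) * K"
      unfolding a_def K_def using transport_energy[OF L e eB V B, of "c *\<^sub>R \<xi>" h] by (intro mult_left_mono) auto
    finally show "(LINT x:cell L|lborel. (1 / 2 ^ CARD('n)) * (norm (a \<xi> x))\<^sup>2) \<le> (1 / 2 ^ CARD('n)) * K" .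
  qed
  also have "\<dots> = K" by (simp add: card_sign_vectors)
  finally show "(LINT x:cell L|lborel. (norm (transport_avg h c V e x))\<^sup>2) \<le> (LINT x:cell L|lborel. (norm (e x))\<^sup>2)
      + h\<^sup>2 * (real CARD('n) * B * B1)\<^sup>2 * measure lborel (cell L :: (real ^ 'n) set)"
    unfolding K_def .
qed

section \<open>Linearity of iterated partial derivatives\<close>

lemma partials_add_at:
  assumes "space_smooth k T u" "space_smooth k T w" "t \<in> {0..T}" "length ds \<le> k"
  shows "partials ds (\<lambda>x. u t x + w t x) = (\<lambda>x. partials ds (u t) x + partials ds (w t) x)"
  using assms(4)
proof (induction ds)
  case (Cons i ds)
  then have IH: "partials ds (\<lambda>x. u t x + w t x) = (\<lambda>x. partials ds (u t) x + partials ds (w t) x)" by simp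
  have "has_partial i (partials ds (u t)) x" "has_partial i (partials ds (w t)) x" for x
    using Cons.prems by (auto intro!: space_smooth_has_partial[OF assms(1)] space_smooth_has_partial[OF assms(2)] assms(3))
  then show ?case unfolding partials_Cons IH by (intro ext partial_add(2))
qed simp

lemma partials_linear_at:
  assumes F: "bounded_linear F" and "space_smooth k T u" "t \<in> {0..T}" "length ds \<le> k"
  shows "partials ds (\<lambda>x. F (u t x)) = (\<lambda>x. F (partials ds (u t) x))"
  using assms(4)
proof (induction ds)
  case (Cons i ds)
  then have IH: "partials ds (\<lambda>x. F (u t x)) = (\<lambda>x. F (partials ds (u t) x))" by simp
  have "has_partial i (partials ds (u t)) x" for x
    using Cons.prems by (auto intro!: space_smooth_has_partial[OF assms(2)] assms(3))
  then show ?case unfolding partials_Cons IH by (intro ext partial_bounded_linear(2)[OF F])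
qed simp

lemma partials_zero: "partials ds (\<lambda>x. 0) = (\<lambda>x. 0)"
  by (induction ds) (auto simp: partial_deriv_const_fun)

lemma partials_sum_at:
  assumes "finite S" "\<And>j. j \<in> S \<Longrightarrow> space_smooth k T (u j)" "t \<in> {0..T}" "length ds \<le> k"
  shows "partials ds (\<lambda>x. \<Sum>j\<in>S. u j t x) = (\<lambda>x. \<Sum>j\<in>S. partials ds (u j t) x)"
  using assms(1,2)
proof (induction S)
  case (insert j S)
  then show ?case
    using partials_add_at[OF insert.prems[of j] space_smooth_sum[of S k T u] assms(3,4)] by simp
qed (simp add: partials_zero)

lemma partials_diff_at:
  assumes "space_smooth k T u" "space_smooth k T w" "t \<in> {0..T}" "length ds \<le> k"
  shows "partials ds (\<lambda>x. u t x - w t x) x = partials ds (u t) x - partials ds (w t) x"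
proof -
  have "partials ds (\<lambda>x. u t x + (-1) *\<^sub>R w t x) = (\<lambda>x. partials ds (u t) x + partials ds (\<lambda>x. (-1) *\<^sub>R w t x) x)"
    by (rule partials_add_at[OF assms(1) space_smooth_cmult[OF assms(2)] assms(3,4)])
  moreover have "partials ds (\<lambda>x. (-1) *\<^sub>R w t x) = (\<lambda>x. (-1) *\<^sub>R partials ds (w t) x)"
    by (rule partials_linear_at[OF bounded_linear_scaleR_right assms(2,3,4)])
  ultimately show ?thesis by simp
qed

lemma continuous_on_snd_compose:
  assumes "continuous_on UNIV u"
  shows "continuous_on (A \<times> UNIV) (\<lambda>(t, x). u x)"
proof -
  have "continuous_on (A \<times> UNIV) (\<lambda>z. u (snd z))"
    by (rule continuous_on_compose2[OF assms]) (auto intro: continuous_intros)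
  then show ?thesis by (simp add: split_beta)
qed

lemma space_smooth_frozen:
  assumes "space_smooth k T u" "s \<in> {0..T}"
  shows "space_smooth k T (\<lambda>_. u s)"
  unfolding space_smooth_def
  using continuous_on_snd_compose[OF continuous_on_slice[OF space_smooth_continuous[OF assms(1)] assms(2)]]
    space_smooth_has_partial[OF assms(1) _ assms(2)] by auto

lemma space_smooth_time_integral:
  fixes F :: "real \<Rightarrow> real ^ 'n::finite \<Rightarrow> 'b::euclidean_space"
  assumes F: "space_smooth k T F" and ab: "0 \<le> a" "b \<le> T"
  shows "space_smooth k T (\<lambda>_ x. integral {a..b} (\<lambda>\<tau>. F \<tau> x))"
  unfolding space_smooth_def
proof (intro conjI allI impI)
  fix ds :: "'n list" assume l: "length ds \<le> k"
  have "partials ds (\<lambda>x. integral {a..b} (\<lambda>\<tau>. F \<tau> x)) = (\<lambda>x. integral {a..b} (\<lambda>\<tau>. partials ds (F \<tau>) x))"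
    using partials_time_integral(1)[OF F ab l] by (rule ext)
  moreover have "continuous_on UNIV (\<lambda>x. integral {a..b} (\<lambda>\<tau>. partials ds (F \<tau>) x))"
    using ab by (intro continuous_on_time_integral continuous_on_subset[OF space_smooth_continuous[OF F l]]) auto
  ultimately show "continuous_on ({0..T} \<times> UNIV) (\<lambda>(t, x). partials ds (\<lambda>x. integral {a..b} (\<lambda>\<tau>. F \<tau> x)) x)"
    by (intro continuous_on_snd_compose) simp
next
  fix ds :: "'n list" assume "length ds < k"
  then show "\<forall>t\<in>{0..T}. \<forall>x i. has_partial i (partials ds (\<lambda>x. integral {a..b} (\<lambda>\<tau>. F \<tau> x))) x"
    using partials_time_integral(2)[OF F ab] by blast
qed

text \<open>All error terms are expressed by the cube root of the step length; powers of \<open>T\<close> make up for the difference in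
  the exponents.\<close>

lemma le_cube_root:
  fixes h T :: real
  assumes "0 \<le> h" "h \<le> T"
  shows "h \<le> T powr (2/3) * h powr (1/3)" "h \<le> T powr (1/3) * (h powr (1/3))\<^sup>2" "sqrt h \<le> T powr (1/6) * h powr (1/3)"
proof -
  have "h = h powr (2/3) * h powr (1/3)" using assms by (simp flip: powr_add)
  also have "\<dots> \<le> T powr (2/3) * h powr (1/3)" using assms by (intro mult_right_mono powr_mono2) auto
  finally show "h \<le> T powr (2/3) * h powr (1/3)" .
  have "h = h powr (1/3) * (h powr (1/3))\<^sup>2" using assms by (simp add: power2_eq_square flip: powr_add)
  also have "\<dots> \<le> T powr (1/3) * (h powr (1/3))\<^sup>2" using assms by (intro mult_right_mono powr_mono2) auto
  finally show "h \<le> T powr (1/3) * (h powr (1/3))\<^sup>2" .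
  have "sqrt h = h powr (1/6) * h powr (1/3)" using assms by (simp add: powr_half_sqrt[symmetric] flip: powr_add)
  also have "\<dots> \<le> T powr (1/6) * h powr (1/3)" using assms by (intro mult_right_mono powr_mono2) auto
  finally show "sqrt h \<le> T powr (1/6) * h powr (1/3)" .
qed

section \<open>Trajectories of the Navier--Stokes equations\<close>

definition snse_drift ::
  "real \<Rightarrow> (real \<Rightarrow> real ^ 'n::finite \<Rightarrow> real ^ 'n) \<Rightarrow> (real \<Rightarrow> real ^ 'n \<Rightarrow> real ^ 'n) \<Rightarrow> (real \<Rightarrow> real ^ 'n \<Rightarrow> real) \<Rightarrow>
     real \<Rightarrow> real ^ 'n \<Rightarrow> real ^ 'n" where
  "snse_drift \<sigma> f v p s x = (\<sigma>\<^sup>2 / 2) *\<^sub>R laplacian (v s) x - advection (v s) (v s) x - gradient (p s) x + f s x"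

lemma snse_drift_smooth:
  assumes v: "space_smooth 4 T v" and p: "space_smooth 3 T p" and f: "space_smooth 3 T f"
  shows "space_smooth 2 T (snse_drift \<sigma> f v p)"
proof -
  have "space_smooth 2 T (\<lambda>t x. (\<sigma>\<^sup>2 / 2) *\<^sub>R laplacian (v t) x - advection (v t) (v t) x - gradient (p t) x + f t x)"
  proof (intro space_smooth_add space_smooth_diff space_smooth_cmult)
    show "space_smooth 2 T (\<lambda>t. laplacian (v t))"
      by (rule space_smooth_laplacian) (use v in \<open>simp add: numeral_eq_Suc\<close>)
    have S: "space_smooth (Suc 2) T v" by (rule space_smooth_mono[OF v]) simp
    show "space_smooth 2 T (\<lambda>t. advection (v t) (v t))" by (rule space_smooth_advection[OF S S])
    show "space_smooth 2 T (\<lambda>t. gradient (p t))"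
      by (rule space_smooth_gradient) (use p in \<open>simp add: numeral_eq_Suc\<close>)
    show "space_smooth 2 T f" by (rule space_smooth_mono[OF f]) simp
  qed
  then show ?thesis by (simp add: snse_drift_def[abs_def])
qed

lemma periodic_laplacian: "periodic L u \<Longrightarrow> periodic L (laplacian u)"
  using periodic_partials[of L u "[i, i]" for i]
  by (simp add: periodic_def laplacian_def del: partials_Cons)

lemma periodic_advection: "periodic L u \<Longrightarrow> periodic L w \<Longrightarrow> periodic L (advection u w)"
  using periodic_partial[of L w] unfolding periodic_def advection_def by simp

lemma smooth_imp_continuous_time: "space_smooth k T u \<Longrightarrow> continuous_on {0..T} (\<lambda>t. u t x)"
  using continuous_on_time_slice[OF space_smooth_continuous[of k T u "[]"] order_refl, of x] by simp

text \<open>A single trajectory, with the stochastic integral already integrated by parts; \<open>CW\<close> is a Hoelder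
  constant of the driving path.  All constants obtained in this locale depend on the trajectory.\<close>

locale pathwise_snse =
  fixes \<sigma> T L CW :: real
    and f :: "real \<Rightarrow> real ^ 'n::finite \<Rightarrow> real ^ 'n"
    and \<gamma> :: "'q::finite \<Rightarrow> real \<Rightarrow> real ^ 'n \<Rightarrow> real ^ 'n"
    and \<phi> :: "real ^ 'n \<Rightarrow> real ^ 'n"
    and v :: "real \<Rightarrow> real ^ 'n \<Rightarrow> real ^ 'n"
    and p :: "real \<Rightarrow> real ^ 'n \<Rightarrow> real"
    and W :: "real \<Rightarrow> real ^ 'q"
  assumes pos: "0 < \<sigma>" "0 < T" "0 < L" "0 \<le> CW"
    and f: "spacetime_smooth 3 T f" "\<And>t. t \<in> {0..T} \<Longrightarrow> periodic L (f t)"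
    and \<gamma>: "\<And>r. spacetime_smooth 3 T (\<gamma> r)" "\<And>r t. t \<in> {0..T} \<Longrightarrow> periodic L (\<gamma> r t)"
      "\<And>r t x. t \<in> {0..T} \<Longrightarrow> divergence (\<gamma> r t) x = 0"
    and v: "space_smooth 4 T v" "\<And>t. t \<in> {0..T} \<Longrightarrow> periodic L (v t)"
      "\<And>t x. t \<in> {0..T} \<Longrightarrow> divergence (v t) x = 0"
    and p: "space_smooth 3 T p" "\<And>t. t \<in> {0..T} \<Longrightarrow> periodic L (p t)"
    and init: "v 0 = \<phi>"
    and W: "\<And>r. continuous_on {0..T} (\<lambda>t. W t $ r)"
      "\<And>r s t. 0 \<le> s \<Longrightarrow> s \<le> t \<Longrightarrow> t \<le> T \<Longrightarrow> \<bar>W t $ r - W s $ r\<bar> \<le> CW * (t - s) powr (1/3)"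
    and eq: "\<And>t x. t \<in> {0..T} \<Longrightarrow> v t x = \<phi> x + integral {0..t} (\<lambda>s. snse_drift \<sigma> f v p s x)
      + (\<Sum>r\<in>UNIV. W t $ r *\<^sub>R \<gamma> r t x - integral {0..t} (\<lambda>s. W s $ r *\<^sub>R time_deriv T (\<gamma> r) s x))"
begin

lemma drift_smooth: "space_smooth 2 T (snse_drift \<sigma> f v p)"
  by (rule snse_drift_smooth[OF v(1) p(1) spacetime_smooth_space(1)[OF f(1)]])

lemma drift_periodic: "t \<in> {0..T} \<Longrightarrow> periodic L (snse_drift \<sigma> f v p t)"
  using periodic_laplacian[OF v(2)[of t]] periodic_advection[OF v(2)[of t] v(2)[of t]] periodic_gradient[OF p(2)[of t]] f(2)[of t]
  unfolding periodic_def snse_drift_def by simp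

text \<open>After integration by parts the values of \<open>W\<close> cancel and only its increments from \<open>s\<close> or \<open>\<tau>\<close> to \<open>t\<close> remain, so the
  last term gains a factor \<open>(t - s) powr (1/3)\<close> over the length of the interval.\<close>

lemma velocity_increment:
  assumes st: "0 \<le> s" "s \<le> t" "t \<le> T"
  shows "v t x - v s x = integral {s..t} (\<lambda>\<tau>. snse_drift \<sigma> f v p \<tau> x)
    + (\<Sum>r\<in>UNIV. (W t $ r - W s $ r) *\<^sub>R \<gamma> r s x + integral {s..t} (\<lambda>\<tau>. (W t $ r - W \<tau> $ r) *\<^sub>R time_deriv T (\<gamma> r) \<tau> x))"
proof -
  have cd: "continuous_on {0..T} (\<lambda>\<tau>. snse_drift \<sigma> f v p \<tau> x)"
    by (rule smooth_imp_continuous_time[OF drift_smooth])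
  have "integral {0..s} (\<lambda>\<tau>. snse_drift \<sigma> f v p \<tau> x) + integral {s..t} (\<lambda>\<tau>. snse_drift \<sigma> f v p \<tau> x)
      = integral {0..t} (\<lambda>\<tau>. snse_drift \<sigma> f v p \<tau> x)"
    using st by (intro Henstock_Kurzweil_Integration.integral_combine integrable_continuous_interval continuous_on_subset[OF cd]) auto
  moreover have "(W t $ r *\<^sub>R \<gamma> r t x - integral {0..t} (\<lambda>\<tau>. W \<tau> $ r *\<^sub>R time_deriv T (\<gamma> r) \<tau> x))
      - (W s $ r *\<^sub>R \<gamma> r s x - integral {0..s} (\<lambda>\<tau>. W \<tau> $ r *\<^sub>R time_deriv T (\<gamma> r) \<tau> x))
      = (W t $ r - W s $ r) *\<^sub>R \<gamma> r s x + integral {s..t} (\<lambda>\<tau>. (W t $ r - W \<tau> $ r) *\<^sub>R time_deriv T (\<gamma> r) \<tau> x)" for r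
    by (rule by_parts_increment[OF W(1) smooth_imp_continuous_time[OF spacetime_smooth_space(2)[OF \<gamma>(1)]]
          has_time_deriv[OF \<gamma>(1)] st])
  then have "(\<Sum>r\<in>UNIV. W t $ r *\<^sub>R \<gamma> r t x - integral {0..t} (\<lambda>\<tau>. W \<tau> $ r *\<^sub>R time_deriv T (\<gamma> r) \<tau> x))
      - (\<Sum>r\<in>UNIV. W s $ r *\<^sub>R \<gamma> r s x - integral {0..s} (\<lambda>\<tau>. W \<tau> $ r *\<^sub>R time_deriv T (\<gamma> r) \<tau> x))
    = (\<Sum>r\<in>UNIV. (W t $ r - W s $ r) *\<^sub>R \<gamma> r s x + integral {s..t} (\<lambda>\<tau>. (W t $ r - W \<tau> $ r) *\<^sub>R time_deriv T (\<gamma> r) \<tau> x))"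
    by (simp only: sum_subtractf[symmetric])
  moreover have "s \<in> {0..T}" "t \<in> {0..T}" using st by auto
  ultimately show ?thesis
    unfolding eq[OF \<open>s \<in> {0..T}\<close>] eq[OF \<open>t \<in> {0..T}\<close>] by (simp add: algebra_simps)
qed

lemma noise_correction_smooth:
  "space_smooth 2 T (\<lambda>\<tau> x. (W t $ r - W \<tau> $ r) *\<^sub>R time_deriv T (\<gamma> r) \<tau> x)"
  by (intro space_smooth_scaleR[OF space_smooth_time] continuous_intros W(1) spacetime_smooth_space(2) \<gamma>(1))

text \<open>Differentiating the integrated equation twice in space uses up the fourth derivatives of the
  velocity and the third ones of the pressure; the noise limits the time regularity.\<close>

lemma velocity_hoelder:
  "\<exists>C\<ge>0. \<forall>s t ds x. 0 \<le> s \<longrightarrow> s \<le> t \<longrightarrow> t \<le> T \<longrightarrow> length ds \<le> 2 \<longrightarrow>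
     norm (partials ds (v t) x - partials ds (v s) x) \<le> C * (t - s) powr (1/3)"
proof -
  obtain Bd where Bd: "0 \<le> Bd" "\<And>ds t x. length ds \<le> 2 \<Longrightarrow> t \<in> {0..T} \<Longrightarrow> norm (partials ds (snse_drift \<sigma> f v p t) x) \<le> Bd"
    using space_smooth_bounded[OF pos(3) drift_periodic drift_smooth] by blast
  have "\<forall>r. \<exists>B\<ge>0. \<forall>ds. length ds \<le> 2 \<longrightarrow> (\<forall>t\<in>{0..T}. \<forall>x. norm (partials ds (\<gamma> r t) x) \<le> B)"
    using space_smooth_bounded[OF pos(3) \<gamma>(2) space_smooth_mono[OF spacetime_smooth_space(1)[OF \<gamma>(1)], of 2]] by simp
  from choice[OF this] obtain Bg where Bg: "\<And>r. 0 \<le> Bg r"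
    "\<And>r ds t x. length ds \<le> 2 \<Longrightarrow> t \<in> {0..T} \<Longrightarrow> norm (partials ds (\<gamma> r t) x) \<le> Bg r" by blast
  have "\<forall>r. \<exists>B\<ge>0. \<forall>ds. length ds \<le> 2 \<longrightarrow> (\<forall>t\<in>{0..T}. \<forall>x. norm (partials ds (time_deriv T (\<gamma> r) t) x) \<le> B)"
    using space_smooth_bounded[OF pos(3) periodic_time_deriv[OF \<gamma>(2)] spacetime_smooth_space(2)[OF \<gamma>(1)]] by simp
  from choice[OF this] obtain Bh where Bh: "\<And>r. 0 \<le> Bh r"
    "\<And>r ds t x. length ds \<le> 2 \<Longrightarrow> t \<in> {0..T} \<Longrightarrow> norm (partials ds (time_deriv T (\<gamma> r) t) x) \<le> Bh r" by blast
  define C where "C = Bd * T powr (2/3) + (\<Sum>r\<in>UNIV. CW * Bg r + CW * Bh r * T)"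
  show ?thesis
  proof (intro exI[of _ C] conjI allI impI)
    show "0 \<le> C" unfolding C_def using Bd(1) Bg(1) Bh(1) pos by (intro add_nonneg_nonneg sum_nonneg) auto
    fix s t x and ds :: "'n list"
    assume st: "0 \<le> s" "s \<le> t" "t \<le> T" and l: "length ds \<le> 2"
    define \<eta> where "\<eta> = (t - s) powr (1/3)"
    have \<eta>: "0 \<le> \<eta>" by (simp add: \<eta>_def)
    have h: "t - s \<le> T powr (2/3) * \<eta>" unfolding \<eta>_def using st by (intro le_cube_root) auto
    have T0: "0 \<in> {0..T}" and sT: "s \<in> {0..T}" and tT: "t \<in> {0..T}" using pos st by auto
    define I0 where "I0 x = integral {s..t} (\<lambda>\<tau>. snse_drift \<sigma> f v p \<tau> x)" for x
    define G where "G r \<tau> x = (W t $ r - W \<tau> $ r) *\<^sub>R time_deriv T (\<gamma> r) \<tau> x" for r \<tau> x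
    define Ir where "Ir r x = integral {s..t} (\<lambda>\<tau>. G r \<tau> x)" for r x
    have Gs: "space_smooth 2 T (G r)" for r
      unfolding G_def[abs_def] by (rule noise_correction_smooth)
    have sv: "space_smooth 2 T (\<lambda>_. v s)" "space_smooth 2 T (\<lambda>_. v t)"
      using space_smooth_frozen[OF space_smooth_mono[OF v(1)]] sT tT by auto
    have sI0: "space_smooth 2 T (\<lambda>_. I0)"
      unfolding I0_def[abs_def] by (rule space_smooth_time_integral[OF drift_smooth st(1,3)])
    have sIr: "space_smooth 2 T (\<lambda>_. Ir r)" for r
      unfolding Ir_def[abs_def] by (rule space_smooth_time_integral[OF Gs st(1,3)])
    have sg: "space_smooth 2 T (\<lambda>_. \<gamma> r s)" for r
      by (rule space_smooth_frozen[OF space_smooth_mono[OF spacetime_smooth_space(1)[OF \<gamma>(1)]] sT]) simp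
    define Q where "Q r x = (W t $ r - W s $ r) *\<^sub>R \<gamma> r s x + Ir r x" for r x
    have sQ: "space_smooth 2 T (\<lambda>_. Q r)" for r
      unfolding Q_def[abs_def] by (intro space_smooth_add space_smooth_cmult sg sIr)
    have sQS: "space_smooth 2 T (\<lambda>_ x. \<Sum>r\<in>UNIV. Q r x)"
      using space_smooth_sum[of UNIV 2 T "\<lambda>r _. Q r"] sQ by simp
    have Q: "partials ds (Q r) x = (W t $ r - W s $ r) *\<^sub>R partials ds (\<gamma> r s) x + partials ds (Ir r) x" for r
      unfolding Q_def[abs_def]
      using partials_add_at[OF space_smooth_cmult[OF sg] sIr T0 l, of "W t $ r - W s $ r" r r]
        partials_linear_at[OF bounded_linear_scaleR_right sg T0 l, of "W t $ r - W s $ r" r]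
      by simp
    have "partials ds (v t) x - partials ds (v s) x = partials ds (\<lambda>x. v t x - v s x) x"
      using partials_diff_at[OF sv(2,1) T0 l] by simp
    also have "(\<lambda>x. v t x - v s x) = (\<lambda>x. I0 x + (\<Sum>r\<in>UNIV. Q r x))"
      unfolding velocity_increment[OF st] I0_def Q_def Ir_def G_def ..
    also have "partials ds (\<lambda>x. I0 x + (\<Sum>r\<in>UNIV. Q r x)) x = partials ds I0 x + (\<Sum>r\<in>UNIV. partials ds (Q r) x)"
      using partials_add_at[OF sI0 sQS T0 l] partials_sum_at[of UNIV 2 T "\<lambda>r _. Q r" 0 ds, OF _ sQ T0 l] by simp
    also have "norm \<dots> \<le> Bd * (t - s) + (\<Sum>r\<in>UNIV. CW * Bg r * \<eta> + CW * Bh r * T * \<eta>)"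
    proof (intro norm_triangle_mono order_trans[OF norm_sum] sum_mono)
      have cdr: "continuous_on {s..t} (\<lambda>\<tau>. partials ds (snse_drift \<sigma> f v p \<tau>) x)"
        using st by (intro continuous_on_time_slice[OF space_smooth_continuous[OF drift_smooth l]]) auto
      have "partials ds I0 x = integral {s..t} (\<lambda>\<tau>. partials ds (snse_drift \<sigma> f v p \<tau>) x)"
        unfolding I0_def[abs_def] by (rule partials_time_integral(1)[OF drift_smooth st(1,3) l])
      then show "norm (partials ds I0 x) \<le> Bd * (t - s)"
        using integral_bound[OF st(2) cdr, of Bd] Bd(2)[OF l] st by simp
      fix r :: 'q
      have cG: "continuous_on {s..t} (\<lambda>\<tau>. partials ds (G r \<tau>) x)"
        using st by (intro continuous_on_time_slice[OF space_smooth_continuous[OF Gs l]]) auto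
      have Gb: "norm (partials ds (G r \<tau>) x) \<le> CW * \<eta> * Bh r" if \<tau>: "\<tau> \<in> {s..t}" for \<tau>
      proof -
        have \<tau>T: "\<tau> \<in> {0..T}" using \<tau> st by auto
        have "partials ds (G r \<tau>) = (\<lambda>x. (W t $ r - W \<tau> $ r) *\<^sub>R partials ds (time_deriv T (\<gamma> r) \<tau>) x)"
          unfolding G_def[abs_def]
          by (rule partials_linear_at[OF bounded_linear_scaleR_right spacetime_smooth_space(2)[OF \<gamma>(1)] \<tau>T l])
        moreover have "\<bar>W t $ r - W \<tau> $ r\<bar> \<le> CW * \<eta>"
        proof -
          have "\<bar>W t $ r - W \<tau> $ r\<bar> \<le> CW * (t - \<tau>) powr (1/3)" using \<tau> st by (intro W(2)) auto
          also have "\<dots> \<le> CW * \<eta>" unfolding \<eta>_def using \<tau> pos by (intro mult_left_mono powr_mono2) auto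
          finally show ?thesis .
        qed
        ultimately show ?thesis using Bh(2)[OF l \<tau>T, of r x] pos \<eta> by (auto intro!: mult_mono)
      qed
      have "partials ds (Ir r) x = integral {s..t} (\<lambda>\<tau>. partials ds (G r \<tau>) x)"
        unfolding Ir_def[abs_def] by (rule partials_time_integral(1)[OF Gs st(1,3) l])
      then have "norm (partials ds (Ir r) x) \<le> CW * \<eta> * Bh r * (t - s)"
        using integral_bound[OF st(2) cG Gb] by simp
      also have "\<dots> \<le> CW * \<eta> * Bh r * T"
        using st pos \<eta> Bh(1)[of r] by (intro mult_left_mono) auto
      finally have 1: "norm (partials ds (Ir r) x) \<le> CW * Bh r * T * \<eta>" by (simp add: ac_simps)
      have "norm ((W t $ r - W s $ r) *\<^sub>R partials ds (\<gamma> r s) x) \<le> (CW * \<eta>) * Bg r"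
        unfolding norm_scaleR real_norm_def using W(2)[OF st, of r] Bg(2)[OF l sT, of r x] pos \<eta>
        by (intro mult_mono) (auto simp: \<eta>_def)
      with 1 show "norm (partials ds (Q r) x) \<le> CW * Bg r * \<eta> + CW * Bh r * T * \<eta>"
        unfolding Q by (intro norm_triangle_mono) (auto simp: ac_simps)
    qed
    also have "\<dots> \<le> Bd * (T powr (2/3) * \<eta>) + (\<Sum>r\<in>UNIV. CW * Bg r * \<eta> + CW * Bh r * T * \<eta>)"
      using h Bd(1) by (intro add_right_mono mult_left_mono)
    also have "\<dots> = C * \<eta>"
      by (simp add: C_def distrib_right sum_distrib_right sum.distrib)
    finally show "norm (partials ds (v t) x - partials ds (v s) x) \<le> C * (t - s) powr (1/3)" by (simp add: \<eta>_def)
  qed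
qed

end

section \<open>One step of the layer method\<close>

lemma gradient_time_integral:
  fixes F :: "real \<Rightarrow> real ^ 'n::finite \<Rightarrow> real"
  assumes F: "space_smooth 1 T F" and ab: "0 \<le> a" "b \<le> T"
  shows "gradient (\<lambda>x. integral {a..b} (\<lambda>\<tau>. F \<tau> x)) x = integral {a..b} (\<lambda>\<tau>. gradient (F \<tau>) x)"
proof -
  have cg: "continuous_on {a..b} (\<lambda>\<tau>. gradient (F \<tau>) x)"
    unfolding gradient_def
  proof (intro continuous_on_vec_lambda)
    fix i
    have "continuous_on {a..b} (\<lambda>\<tau>. partials [i] (F \<tau>) x)"
      using ab by (intro continuous_on_time_slice[OF space_smooth_continuous[OF F]]) auto
    then show "continuous_on {a..b} (\<lambda>\<tau>. partial_deriv i (F \<tau>) x)" by simp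
  qed
  have "gradient (\<lambda>x. integral {a..b} (\<lambda>\<tau>. F \<tau> x)) x $ i = integral {a..b} (\<lambda>\<tau>. gradient (F \<tau>) x) $ i" for i
  proof -
    have "gradient (\<lambda>x. integral {a..b} (\<lambda>\<tau>. F \<tau> x)) x $ i = integral {a..b} (\<lambda>\<tau>. gradient (F \<tau>) x $ i)"
      using partials_time_integral(1)[OF F ab, of "[i]" x] by (simp add: gradient_def)
    also have "\<dots> = integral {a..b} (\<lambda>\<tau>. gradient (F \<tau>) x) $ i"
      by (rule integral_component_eq_cart[OF integrable_continuous_interval[OF cg]])
    finally show ?thesis .
  qed
  then show ?thesis by (simp add: vec_eq_iff)
qed

lemma frozen_integral_error:
  fixes g :: "real \<Rightarrow> 'b::euclidean_space"
  assumes "s \<le> t" "continuous_on {s..t} g" "\<And>\<tau>. \<tau> \<in> {s..t} \<Longrightarrow> norm (g \<tau> - y) \<le> K"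
  shows "norm (integral {s..t} g - (t - s) *\<^sub>R y) \<le> K * (t - s)"
proof -
  have "integral {s..t} g - (t - s) *\<^sub>R y = integral {s..t} (\<lambda>\<tau>. g \<tau> - y)"
    using assms by (subst Henstock_Kurzweil_Integration.integral_diff)
      (auto intro: integrable_continuous_interval)
  also have "norm \<dots> \<le> K * (t - s)"
    using assms by (intro integral_bound continuous_intros) auto
  finally show ?thesis .
qed

lemma continuous_layer_average:
  fixes V :: "real ^ 'n::finite \<Rightarrow> real ^ 'n"
  assumes "continuous_on UNIV V"
  shows "continuous_on UNIV (layer_average \<sigma> h V)"
proof -
  have "continuous_on UNIV (\<lambda>x. V (x - h *\<^sub>R V x + (\<sigma> * sqrt h) *\<^sub>R \<xi>))" for \<xi>
    by (rule continuous_on_compose2[OF assms]) (auto intro!: continuous_intros assms)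
  then show ?thesis unfolding layer_average_def[abs_def] by (intro continuous_intros)
qed

text \<open>The weights give the main part the factor \<open>1 + h\<close> that Gronwall can iterate; the factor \<open>1 / h\<close> is harmless for a
  remainder whose square carries \<open>h\<^sup>2\<close>.\<close>

lemma norm_add_squared_weighted:
  fixes a b :: "'a::real_inner"
  assumes "0 < h"
  shows "(norm (a + b))\<^sup>2 \<le> (1 + h) * (norm a)\<^sup>2 + (1 + 1 / h) * (norm b)\<^sup>2"
proof -
  have "(norm (a + b))\<^sup>2 \<le> (norm a + norm b)\<^sup>2" by (intro power_mono norm_triangle_ineq) auto
  also have "\<dots> \<le> (1 + h) * (norm a)\<^sup>2 + (1 + 1 / h) * (norm b)\<^sup>2"
  proof -
    have "0 \<le> (h * norm a - norm b)\<^sup>2 / h" using assms by simp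
    also have "\<dots> = h * (norm a)\<^sup>2 - 2 * norm a * norm b + (1 / h) * (norm b)\<^sup>2"
      using assms by (simp add: power2_eq_square field_simps)
    finally show ?thesis by (simp add: power2_sum algebra_simps)
  qed
  finally show ?thesis .
qed

context pathwise_snse
begin

lemma velocity_bounds:
  "\<exists>B\<ge>0. \<forall>ds t x. length ds \<le> 4 \<longrightarrow> t \<in> {0..T} \<longrightarrow> norm (partials ds (v t) x) \<le> B"
  using space_smooth_bounded[OF pos(3) v(2) v(1)] by blast

lemma velocity_has_partial: "length ds < 4 \<Longrightarrow> t \<in> {0..T} \<Longrightarrow> has_partial i (partials ds (v t)) x"
  by (rule space_smooth_has_partial[OF v(1)])

lemma velocity_C1: "t \<in> {0..T} \<Longrightarrow> C1_field (v t)"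
  unfolding C1_field_def
  using velocity_has_partial[of "[]" t] continuous_on_slice[OF space_smooth_continuous[OF v(1)], of "[]" t]
    continuous_on_slice[OF space_smooth_continuous[OF v(1)], of "[i]" t for i] by auto

lemma velocity_divergence_free: "t \<in> {0..T} \<Longrightarrow> L2_divergence_free L (v t)"
  by (intro L2_divergence_free_classical pos velocity_C1 v)

lemma noise_divergence_free:
  assumes t: "t \<in> {0..T}"
  shows "continuous_on UNIV (\<gamma> r t)" "L2_divergence_free L (\<gamma> r t)"
proof -
  note s = spacetime_smooth_space(1)[OF \<gamma>(1)]
  have "C1_field (\<gamma> r t)"
    unfolding C1_field_def
    using space_smooth_has_partial[OF s, of "[]" t] continuous_on_slice[OF space_smooth_continuous[OF s], of "[]" t]
      continuous_on_slice[OF space_smooth_continuous[OF s], of "[i]" t for i] t by auto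
  then show "continuous_on UNIV (\<gamma> r t)" "L2_divergence_free L (\<gamma> r t)"
    by (auto intro: C1_fieldD L2_divergence_free_classical pos \<gamma> t)
qed

lemma force_continuous: "t \<in> {0..T} \<Longrightarrow> continuous_on UNIV (f t)"
  using continuous_on_slice[OF space_smooth_continuous[OF spacetime_smooth_space(1)[OF f(1)]], of "[]" t] by simp

text \<open>The part of the drift that the layer average reproduces.\<close>

definition "momentum \<tau> x = (\<sigma>\<^sup>2 / 2) *\<^sub>R laplacian (v \<tau>) x - advection (v \<tau>) (v \<tau>) x"

lemma momentum_hoelder:
  "\<exists>C\<ge>0. \<forall>s t x. 0 \<le> s \<longrightarrow> s \<le> t \<longrightarrow> t \<le> T \<longrightarrow> norm (momentum t x - momentum s x) \<le> C * (t - s) powr (1/3)"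
proof -
  obtain C where C: "0 \<le> C" "\<And>s t ds x. 0 \<le> s \<Longrightarrow> s \<le> t \<Longrightarrow> t \<le> T \<Longrightarrow> length ds \<le> 2 \<Longrightarrow>
     norm (partials ds (v t) x - partials ds (v s) x) \<le> C * (t - s) powr (1/3)"
    using velocity_hoelder by blast
  obtain B where B: "0 \<le> B" "\<And>ds t x. length ds \<le> 4 \<Longrightarrow> t \<in> {0..T} \<Longrightarrow> norm (partials ds (v t) x) \<le> B"
    using velocity_bounds by blast
  define n where "n = real CARD('n)"
  show ?thesis
  proof (intro exI[of _ "\<sigma>\<^sup>2 / 2 * (n * C) + n * (2 * B * C)"] conjI allI impI)
    show "0 \<le> \<sigma>\<^sup>2 / 2 * (n * C) + n * (2 * B * C)" using B C by (simp add: n_def)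
    fix s t x assume st: "0 \<le> s" "s \<le> t" "t \<le> T"
    define \<eta> where "\<eta> = (t - s) powr (1/3)"
    have sT: "s \<in> {0..T}" and tT: "t \<in> {0..T}" using st by auto
    have 1: "norm (laplacian (v t) x - laplacian (v s) x) \<le> n * (C * \<eta>)"
    proof -
      have "norm (laplacian (v t) x - laplacian (v s) x) \<le> (\<Sum>i\<in>(UNIV :: 'n set). C * \<eta>)"
        unfolding laplacian_def sum_subtractf[symmetric] \<eta>_def
        by (intro order_trans[OF norm_sum] sum_mono C(2)[OF st]) simp
      then show ?thesis by (simp add: n_def)
    qed
    have 2: "norm (advection (v t) (v t) x - advection (v s) (v s) x) \<le> n * (2 * B * C * \<eta>)"
    proof -
      have "norm (advection (v t) (v t) x - advection (v s) (v s) x) \<le> (\<Sum>i\<in>(UNIV :: 'n set). 2 * B * C * \<eta>)"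
        unfolding advection_def sum_subtractf[symmetric]
      proof (intro order_trans[OF norm_sum] sum_mono)
        fix i
        have b: "\<bar>v t x $ i - v s x $ i\<bar> \<le> C * \<eta>" "\<bar>v s x $ i\<bar> \<le> B"
          using order_trans[OF component_le_norm_cart[of "v t x - v s x" i] C(2)[OF st, of "[]" x, simplified]]
            order_trans[OF component_le_norm_cart[of "v s x" i] B(2)[of "[]", OF _ sT, of x, simplified]] by (auto simp: \<eta>_def)
        have "v t x $ i *\<^sub>R partial_deriv i (v t) x - v s x $ i *\<^sub>R partial_deriv i (v s) x
          = (v t x $ i - v s x $ i) *\<^sub>R partial_deriv i (v t) x + v s x $ i *\<^sub>R (partial_deriv i (v t) x - partial_deriv i (v s) x)"
          by (simp add: algebra_simps)
        also have "norm \<dots> \<le> (C * \<eta>) * B + B * (C * \<eta>)"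
          using b B C(2)[OF st, of "[i]" x] B(2)[of "[i]", OF _ tT, of x]
          by (intro norm_triangle_mono) (auto simp: \<eta>_def intro!: mult_mono mult_nonneg_nonneg C(1))
        finally show "norm (v t x $ i *\<^sub>R partial_deriv i (v t) x - v s x $ i *\<^sub>R partial_deriv i (v s) x) \<le> 2 * B * C * \<eta>"
          by (simp add: ac_simps)
      qed
      then show ?thesis by (simp add: n_def)
    qed
    have "momentum t x - momentum s x = (\<sigma>\<^sup>2 / 2) *\<^sub>R (laplacian (v t) x - laplacian (v s) x)
        - (advection (v t) (v t) x - advection (v s) (v s) x)"
      by (simp add: momentum_def algebra_simps)
    also have "norm \<dots> \<le> \<sigma>\<^sup>2 / 2 * (n * (C * \<eta>)) + n * (2 * B * C * \<eta>)"
      using 1 2 by (intro order_trans[OF norm_triangle_ineq4 add_mono]) (auto intro!: mult_left_mono)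
    finally show "norm (momentum t x - momentum s x) \<le> (\<sigma>\<^sup>2 / 2 * (n * C) + n * (2 * B * C)) * (t - s) powr (1/3)"
      by (simp add: \<eta>_def algebra_simps)
  qed
qed

lemma force_lipschitz:
  "\<exists>C\<ge>0. \<forall>s t x. 0 \<le> s \<longrightarrow> s \<le> t \<longrightarrow> t \<le> T \<longrightarrow> norm (f t x - f s x) \<le> C * (t - s)"
proof -
  obtain B where B: "0 \<le> B" "\<And>ds t x. length ds \<le> 2 \<Longrightarrow> t \<in> {0..T} \<Longrightarrow> norm (partials ds (time_deriv T f t) x) \<le> B"
    using space_smooth_bounded[OF pos(3) periodic_time_deriv[OF f(2)] spacetime_smooth_space(2)[OF f(1)]] by blast
  show ?thesis
  proof (intro exI[of _ B] conjI allI impI B)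
    fix s t x assume st: "0 \<le> s" "s \<le> t" "t \<le> T"
    have "((\<lambda>\<tau>. time_deriv T f \<tau> x) has_integral (f t x - f s x)) {s..t}"
      using st by (intro fundamental_theorem_of_calculus has_vector_derivative_within_subset[OF has_time_deriv[OF f(1)]]) auto
    then have "f t x - f s x = integral {s..t} (\<lambda>\<tau>. time_deriv T f \<tau> x)" by (simp add: integral_unique)
    also have "norm \<dots> \<le> B * (t - s)"
      using st B(2)[of "[]"]
      by (intro integral_bound continuous_on_subset[OF smooth_imp_continuous_time[OF spacetime_smooth_space(2)[OF f(1)]]]) auto
    finally show "norm (f t x - f s x) \<le> B * (t - s)" .
  qed
qed

lemma noise_correction_bound:
  "\<exists>C\<ge>0. \<forall>s t x. 0 \<le> s \<longrightarrow> s \<le> t \<longrightarrow> t \<le> T \<longrightarrow>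
     norm (\<Sum>r\<in>UNIV. integral {s..t} (\<lambda>\<tau>. (W t $ r - W \<tau> $ r) *\<^sub>R time_deriv T (\<gamma> r) \<tau> x)) \<le> C * (t - s) * (t - s) powr (1/3)"
proof -
  have "\<forall>r. \<exists>B\<ge>0. \<forall>ds. length ds \<le> 2 \<longrightarrow> (\<forall>t\<in>{0..T}. \<forall>x. norm (partials ds (time_deriv T (\<gamma> r) t) x) \<le> B)"
    using space_smooth_bounded[OF pos(3) periodic_time_deriv[OF \<gamma>(2)] spacetime_smooth_space(2)[OF \<gamma>(1)]] by simp
  from choice[OF this] obtain B where B: "\<And>r. 0 \<le> B r"
    "\<And>r ds t x. length ds \<le> 2 \<Longrightarrow> t \<in> {0..T} \<Longrightarrow> norm (partials ds (time_deriv T (\<gamma> r) t) x) \<le> B r" by blast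
  show ?thesis
  proof (intro exI[of _ "\<Sum>r\<in>UNIV. CW * B r"] conjI allI impI)
    show "0 \<le> (\<Sum>r\<in>UNIV. CW * B r)" using B(1) pos by (intro sum_nonneg) auto
    fix s t x assume st: "0 \<le> s" "s \<le> t" "t \<le> T"
    define \<eta> where "\<eta> = (t - s) powr (1/3)"
    have "norm (\<Sum>r\<in>UNIV. integral {s..t} (\<lambda>\<tau>. (W t $ r - W \<tau> $ r) *\<^sub>R time_deriv T (\<gamma> r) \<tau> x)) \<le> (\<Sum>r\<in>UNIV. (CW * \<eta> * B r) * (t - s))"
    proof (intro order_trans[OF norm_sum] sum_mono integral_bound st(2))
      fix r
      show "continuous_on {s..t} (\<lambda>\<tau>. (W t $ r - W \<tau> $ r) *\<^sub>R time_deriv T (\<gamma> r) \<tau> x)"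
        using st by (intro continuous_on_subset[OF smooth_imp_continuous_time[OF noise_correction_smooth]]) auto
      fix \<tau> assume \<tau>: "\<tau> \<in> {s..t}"
      have "\<bar>W t $ r - W \<tau> $ r\<bar> \<le> CW * (t - \<tau>) powr (1/3)" using \<tau> st by (intro W(2)) auto
      also have "\<dots> \<le> CW * \<eta>" unfolding \<eta>_def using \<tau> pos by (intro mult_left_mono powr_mono2) auto
      finally have "\<bar>W t $ r - W \<tau> $ r\<bar> \<le> CW * \<eta>" .
      moreover have "norm (time_deriv T (\<gamma> r) \<tau> x) \<le> B r" using B(2)[of "[]" \<tau> r x] \<tau> st by auto
      ultimately show "norm ((W t $ r - W \<tau> $ r) *\<^sub>R time_deriv T (\<gamma> r) \<tau> x) \<le> CW * \<eta> * B r"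
        using pos by (auto intro!: mult_mono simp: \<eta>_def)
    qed
    also have "\<dots> = (\<Sum>r\<in>UNIV. CW * B r) * (t - s) * \<eta>"
      by (simp add: sum_distrib_left sum_distrib_right ac_simps)
    finally show "norm (\<Sum>r\<in>UNIV. integral {s..t} (\<lambda>\<tau>. (W t $ r - W \<tau> $ r) *\<^sub>R time_deriv T (\<gamma> r) \<tau> x))
        \<le> (\<Sum>r\<in>UNIV. CW * B r) * (t - s) * (t - s) powr (1/3)" by (simp add: \<eta>_def)
  qed
qed

text \<open>The layer average contributes the momentum at time \<open>s\<close>; momentum and force vary in time by at most
  a multiple of the cube root of the step, so they may be frozen at \<open>s\<close>, and the noise leaves only its correction term.  The pressure
  appears as a gradient, which the projection removes.\<close>

lemma local_error:
  "\<exists>C\<ge>0. \<forall>s t x. 0 \<le> s \<longrightarrow> s \<le> t \<longrightarrow> t \<le> T \<longrightarrow>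
     norm (layer_average \<sigma> (t - s) (v s) x + (t - s) *\<^sub>R f s x + (\<Sum>r\<in>UNIV. (W t $ r - W s $ r) *\<^sub>R \<gamma> r s x)
       - (v t x + integral {s..t} (\<lambda>\<tau>. gradient (p \<tau>) x))) \<le> C * (t - s) * (t - s) powr (1/3)"
proof -
  obtain B where B: "0 \<le> B" "\<And>ds t x. length ds \<le> 4 \<Longrightarrow> t \<in> {0..T} \<Longrightarrow> norm (partials ds (v t) x) \<le> B"
    using velocity_bounds by blast
  obtain C1 where C1: "0 \<le> C1" "\<And>s t x. 0 \<le> s \<Longrightarrow> s \<le> t \<Longrightarrow> t \<le> T \<Longrightarrow> norm (momentum t x - momentum s x) \<le> C1 * (t - s) powr (1/3)"
    using momentum_hoelder by blast
  obtain C2 where C2: "0 \<le> C2" "\<And>s t x. 0 \<le> s \<Longrightarrow> s \<le> t \<Longrightarrow> t \<le> T \<Longrightarrow> norm (f t x - f s x) \<le> C2 * (t - s)"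
    using force_lipschitz by blast
  obtain C3 where C3: "0 \<le> C3" "\<And>s t x. 0 \<le> s \<Longrightarrow> s \<le> t \<Longrightarrow> t \<le> T \<Longrightarrow>
     norm (\<Sum>r\<in>UNIV. integral {s..t} (\<lambda>\<tau>. (W t $ r - W \<tau> $ r) *\<^sub>R time_deriv T (\<gamma> r) \<tau> x)) \<le> C3 * (t - s) * (t - s) powr (1/3)"
    using noise_correction_bound by blast
  define C0 where "C0 = sqrt T * (real CARD('n))\<^sup>2 * B ^ 3 / 2 + B * (real CARD('n) * (sqrt T * B + \<sigma>)) ^ 3"
  have C0: "0 \<le> C0" unfolding C0_def using B pos by auto
  show ?thesis
  proof (intro exI[of _ "C0 * T powr (1/6) + C1 + C2 * T powr (2/3) + C3"] conjI allI impI)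
    show "0 \<le> C0 * T powr (1/6) + C1 + C2 * T powr (2/3) + C3" using C0 C1 C2 C3 by simp
    fix s t x assume st: "0 \<le> s" "s \<le> t" "t \<le> T"
    define h where "h = t - s"
    define \<eta> where "\<eta> = h powr (1/3)"
    have h: "0 \<le> h" "h \<le> T" using st by (auto simp: h_def)
    have \<eta>: "0 \<le> \<eta>" by (simp add: \<eta>_def)
    note cube = le_cube_root[OF h, folded \<eta>_def]
    have sT: "s \<in> {0..T}" using st by auto
    have cont_slice: "continuous_on {s..t} (\<lambda>\<tau>. g \<tau> x)" if "space_smooth k T g" for k and g :: "real \<Rightarrow> real ^ 'n \<Rightarrow> real ^ 'n"
      using st by (intro continuous_on_subset[OF smooth_imp_continuous_time[OF that]]) auto
    have S: "space_smooth (Suc 2) T v" by (rule space_smooth_mono[OF v(1)]) simp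
    have cm: "continuous_on {s..t} (\<lambda>\<tau>. momentum \<tau> x)"
      unfolding momentum_def
      by (intro continuous_intros cont_slice[OF space_smooth_laplacian] cont_slice[OF space_smooth_advection[OF S S]])
         (use v(1) in \<open>simp add: numeral_eq_Suc\<close>)
    have cg: "continuous_on {s..t} (\<lambda>\<tau>. gradient (p \<tau>) x)"
      by (rule cont_slice[OF space_smooth_gradient]) (use p(1) in \<open>simp add: numeral_eq_Suc\<close>)
    have cf: "continuous_on {s..t} (\<lambda>\<tau>. f \<tau> x)"
      by (rule cont_slice[OF spacetime_smooth_space(1)[OF f(1)]])
    have dr: "integral {s..t} (\<lambda>\<tau>. snse_drift \<sigma> f v p \<tau> x)
        = integral {s..t} (\<lambda>\<tau>. momentum \<tau> x) - integral {s..t} (\<lambda>\<tau>. gradient (p \<tau>) x) + integral {s..t} (\<lambda>\<tau>. f \<tau> x)"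
      unfolding snse_drift_def momentum_def[symmetric] using cm cg cf
      by (simp add: Henstock_Kurzweil_Integration.integral_add Henstock_Kurzweil_Integration.integral_diff
          integrable_continuous_interval Henstock_Kurzweil_Integration.integrable_diff)
    have e1: "norm (layer_average \<sigma> h (v s) x - v s x - h *\<^sub>R momentum s x) \<le> C0 * (h * sqrt h)"
      unfolding momentum_def C0_def
      by (rule layer_average_expansion[OF h less_imp_le[OF pos(1)] B(1)])
         (auto intro!: velocity_has_partial B(2) sT)
    have e2: "norm (integral {s..t} (\<lambda>\<tau>. momentum \<tau> x) - (t - s) *\<^sub>R momentum s x) \<le> (C1 * \<eta>) * (t - s)"
    proof (rule frozen_integral_error[OF st(2) cm])
      fix \<tau> assume \<tau>: "\<tau> \<in> {s..t}"
      have "norm (momentum \<tau> x - momentum s x) \<le> C1 * (\<tau> - s) powr (1/3)" using \<tau> st by (intro C1(2)) auto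
      also have "\<dots> \<le> C1 * \<eta>" unfolding \<eta>_def h_def using \<tau> C1(1) by (intro mult_left_mono powr_mono2) auto
      finally show "norm (momentum \<tau> x - momentum s x) \<le> C1 * \<eta>" .
    qed
    have e3: "norm (integral {s..t} (\<lambda>\<tau>. f \<tau> x) - (t - s) *\<^sub>R f s x) \<le> (C2 * h) * (t - s)"
    proof (rule frozen_integral_error[OF st(2) cf])
      fix \<tau> assume \<tau>: "\<tau> \<in> {s..t}"
      have "norm (f \<tau> x - f s x) \<le> C2 * (\<tau> - s)" using \<tau> st by (intro C2(2)) auto
      also have "\<dots> \<le> C2 * h" unfolding h_def using \<tau> C2(1) by (intro mult_left_mono) auto
      finally show "norm (f \<tau> x - f s x) \<le> C2 * h" .
    qed
    note e4 = C3(2)[OF st, of x, folded h_def, folded \<eta>_def]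
    have "layer_average \<sigma> (t - s) (v s) x + (t - s) *\<^sub>R f s x + (\<Sum>r\<in>UNIV. (W t $ r - W s $ r) *\<^sub>R \<gamma> r s x)
       - (v t x + integral {s..t} (\<lambda>\<tau>. gradient (p \<tau>) x))
      = (layer_average \<sigma> h (v s) x - v s x - h *\<^sub>R momentum s x)
        - (integral {s..t} (\<lambda>\<tau>. momentum \<tau> x) - (t - s) *\<^sub>R momentum s x)
        - (integral {s..t} (\<lambda>\<tau>. f \<tau> x) - (t - s) *\<^sub>R f s x)
        - (\<Sum>r\<in>UNIV. integral {s..t} (\<lambda>\<tau>. (W t $ r - W \<tau> $ r) *\<^sub>R time_deriv T (\<gamma> r) \<tau> x))"
      using velocity_increment[OF st, of x] unfolding dr sum.distrib h_def by (simp add: algebra_simps)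
    also have "norm \<dots> \<le> C0 * (h * sqrt h) + (C1 * \<eta>) * (t - s) + (C2 * h) * (t - s) + C3 * h * \<eta>"
      by (intro order_trans[OF norm_triangle_ineq4] add_mono e1 e2 e3 e4)
    also have "\<dots> \<le> C0 * (h * (T powr (1/6) * \<eta>)) + (C1 * \<eta>) * h + (C2 * (T powr (2/3) * \<eta>)) * h + C3 * h * \<eta>"
      unfolding h_def[symmetric] using C0 C1(1) C2(1) C3(1) h \<eta> cube by (intro add_mono mult_left_mono mult_right_mono) auto
    also have "\<dots> = (C0 * T powr (1/6) + C1 + C2 * T powr (2/3) + C3) * h * \<eta>" by (simp add: algebra_simps)
    finally show "norm (layer_average \<sigma> (t - s) (v s) x + (t - s) *\<^sub>R f s x + (\<Sum>r\<in>UNIV. (W t $ r - W s $ r) *\<^sub>R \<gamma> r s x)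
       - (v t x + integral {s..t} (\<lambda>\<tau>. gradient (p \<tau>) x))) \<le> (C0 * T powr (1/6) + C1 + C2 * T powr (2/3) + C3) * (t - s) * (t - s) powr (1/3)"
      by (simp add: h_def \<eta>_def)
  qed
qed

text \<open>The error after one step is divergence-free, so testing with it removes both the projections and
  the pressure gradient.\<close>

lemma velocity_step:
  assumes C0: "0 \<le> C0"
  shows "\<exists>C\<ge>0. \<forall>s t V V' Pv Pf. 0 \<le> s \<longrightarrow> s < t \<longrightarrow> t \<le> T \<longrightarrow> layer_bounds C0 V \<longrightarrow> layer_bounds C0 V' \<longrightarrow>
     L2_divergence_free L V \<longrightarrow> leray_projection L (layer_average \<sigma> (t - s) V) Pv \<longrightarrow> leray_projection L (f s) Pf \<longrightarrow>
     (\<forall>x. V' x = Pv x + (t - s) *\<^sub>R Pf x + (\<Sum>r\<in>UNIV. (W t $ r - W s $ r) *\<^sub>R \<gamma> r s x)) \<longrightarrow>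
     L2_divergence_free L V' \<and>
     (LINT x:cell L|lborel. (norm (V' x - v t x))\<^sup>2)
       \<le> (1 + C * (t - s)) * (LINT x:cell L|lborel. (norm (V x - v s x))\<^sup>2) + C * (t - s) * ((t - s) powr (1/3))\<^sup>2"
proof -
  obtain Bv where Bv: "0 \<le> Bv" "\<And>ds t x. length ds \<le> 4 \<Longrightarrow> t \<in> {0..T} \<Longrightarrow> norm (partials ds (v t) x) \<le> Bv"
    using velocity_bounds by blast
  obtain Cl where Cl: "0 \<le> Cl" "\<And>s t x. 0 \<le> s \<Longrightarrow> s \<le> t \<Longrightarrow> t \<le> T \<Longrightarrow>
     norm (layer_average \<sigma> (t - s) (v s) x + (t - s) *\<^sub>R f s x + (\<Sum>r\<in>UNIV. (W t $ r - W s $ r) *\<^sub>R \<gamma> r s x)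
       - (v t x + integral {s..t} (\<lambda>\<tau>. gradient (p \<tau>) x))) \<le> Cl * (t - s) * (t - s) powr (1/3)"
    using local_error by blast
  define B where "B = Bv + C0"
  define n where "n = real CARD('n)"
  define m where "m = measure lborel (cell L :: (real ^ 'n) set)"
  have B: "0 \<le> B" "Bv \<le> B" "C0 \<le> B" using Bv C0 by (auto simp: B_def)
  have m0: "0 \<le> m" by (simp add: m_def)
  define K where "K = B * n + B * (n * B)\<^sup>2 * T powr (2/3) + Cl"
  have K: "0 \<le> K" "B * n \<le> K" "B * (n * B)\<^sup>2 * T powr (2/3) + Cl \<le> K"
    using B Cl(1) by (auto simp: K_def n_def)
  define K2 where "K2 = (n * B * B)\<^sup>2 * m"
  have K2: "0 \<le> K2" using m0 by (simp add: K2_def)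
  \<comment> \<open>dominates both coefficients in the last estimate of the proof\<close>
  define C where "C = 1 + 2 * K\<^sup>2 * (T + 1) + (1 + T) * K2 * T powr (1/3) + 2 * K\<^sup>2 * (T + 1) * m"
  show ?thesis
  proof (intro exI[of _ C] conjI allI impI)
    show "0 \<le> C" unfolding C_def using K2 m0 pos by (intro add_nonneg_nonneg mult_nonneg_nonneg) auto
    fix s t and V V' Pv Pf :: "real ^ 'n \<Rightarrow> real ^ 'n"
    assume s0: "0 \<le> s" and st: "s < t" and tT: "t \<le> T" and V: "layer_bounds C0 V" and V': "layer_bounds C0 V'"
      and dV: "L2_divergence_free L V" and Pv: "leray_projection L (layer_average \<sigma> (t - s) V) Pv"
      and Pf: "leray_projection L (f s) Pf"
      and eqV: "\<forall>x. V' x = Pv x + (t - s) *\<^sub>R Pf x + (\<Sum>r\<in>UNIV. (W t $ r - W s $ r) *\<^sub>R \<gamma> r s x)"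
    have sT: "s \<in> {0..T}" and tT': "t \<in> {0..T}" and st': "s \<le> t" using s0 st tT by auto
    define h where "h = t - s"
    define \<eta> where "\<eta> = h powr (1/3)"
    have h: "0 < h" "h \<le> T" "0 \<le> h" using s0 st tT by (auto simp: h_def)
    have \<eta>: "0 \<le> \<eta>" by (simp add: \<eta>_def)
    note cube = le_cube_root[OF h(3,2), folded \<eta>_def]
    have VC1: "C1_field V" and V'C1: "C1_field V'" using V V' by (auto simp: layer_bounds_def)
    show dV': "L2_divergence_free L V'"
    proof -
      have "L2_divergence_free L (\<lambda>x. Pv x + (t - s) *\<^sub>R Pf x + (\<Sum>r\<in>UNIV. (W t $ r - W s $ r) *\<^sub>R \<gamma> r s x))"
        using Pv Pf by (intro L2_divergence_free_add L2_divergence_free_scaleR L2_divergence_free_sum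
            noise_divergence_free(2)[OF sT]) (auto simp: leray_projection_def)
      moreover have "V' = (\<lambda>x. Pv x + (t - s) *\<^sub>R Pf x + (\<Sum>r\<in>UNIV. (W t $ r - W s $ r) *\<^sub>R \<gamma> r s x))"
        using eqV by (intro ext) simp
      ultimately show ?thesis by simp
    qed
    have per: "periodic L V" "periodic L V'" using dV dV' by (auto simp: L2_divergence_free_def L2_periodic_def)
    define e where "e x = V x - v s x" for x
    define d where "d x = V' x - v t x" for x
    define g where "g x = integral {s..t} (\<lambda>\<tau>. gradient (p \<tau>) x)" for x
    define D where "D x = layer_average \<sigma> h V x + h *\<^sub>R f s x + (\<Sum>r\<in>UNIV. (W t $ r - W s $ r) *\<^sub>R \<gamma> r s x) - (v t x + g x)" for x
    define a where "a = transport_avg h (\<sigma> * sqrt h) V e"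
    \<comment> \<open>\<open>D\<close> is the error after the step up to gradients; it splits into the transported old error \<open>a\<close> and a remainder \<open>S\<close> with a factor \<open>h\<close>\<close>
    define S where "S x = D x - a x" for x
    have eC1: "C1_field e" unfolding e_def[abs_def] by (intro C1_field_diff VC1 velocity_C1 sT)
    have eper: "periodic L e" unfolding e_def[abs_def] by (rule periodic_compose2[OF per(1) v(2)[OF sT]])
    have de: "partial_deriv i e = (\<lambda>x. partial_deriv i V x - partial_deriv i (v s) x)" for i
      unfolding e_def[abs_def] using C1_fieldD(2)[OF VC1] C1_fieldD(2)[OF velocity_C1[OF sT]]
      by (intro ext partial_diff(2)) auto
    have V2: "has_partial j (partial_deriv i V) x" "norm (partial_deriv j (partial_deriv i V) x) \<le> C0" for i j x
      using V by (auto simp: layer_bounds_def)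
    have v2: "has_partial j (partial_deriv i (v s)) x" "norm (partial_deriv j (partial_deriv i (v s)) x) \<le> Bv" for i j x
      using velocity_has_partial[of "[i]" s j x] Bv(2)[of "[j, i]" s x] sT by auto
    have e2: "has_partial j (partial_deriv i e) x" "norm (partial_deriv j (partial_deriv i e) x) \<le> B" for i j x
    proof -
      show "has_partial j (partial_deriv i e) x" unfolding de by (intro partial_diff(1) V2 v2)
      have "partial_deriv j (partial_deriv i e) x = partial_deriv j (partial_deriv i V) x - partial_deriv j (partial_deriv i (v s)) x"
        unfolding de by (intro partial_diff(2) V2 v2)
      also have "norm \<dots> \<le> C0 + Bv" by (intro order_trans[OF norm_triangle_ineq4 add_mono] V2 v2)
      finally show "norm (partial_deriv j (partial_deriv i e) x) \<le> B" by (simp add: B_def)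
    qed
    have e1: "norm (partial_deriv i e x) \<le> B" for i x
    proof -
      have "norm (partial_deriv i e x) \<le> C0 + Bv"
        unfolding de using V Bv(2)[of "[i]" s x] sT
        by (intro order_trans[OF norm_triangle_ineq4 add_mono]) (auto simp: layer_bounds_def)
      then show ?thesis by (simp add: B_def)
    qed
    have VB: "norm (V x) \<le> B" for x using V B(3) by (auto simp: layer_bounds_def intro: order_trans)
    have SB: "norm (S x) \<le> K * h * (norm (e x) + \<eta>)" for x
    proof -
      have b1: "norm (layer_average \<sigma> h V x - layer_average \<sigma> h (v s) x - a x) \<le> B * n * h * norm (e x) + B * (h * (n * B))\<^sup>2"
        unfolding a_def n_def
      proof (rule layer_average_difference[OF h(3) B(1) B(1) VB])
        show "has_partial i (v s) x" for i x using velocity_has_partial[of "[]" s i x] sT by simp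
        show "norm (partial_deriv i (v s) x) \<le> B" for i x using Bv(2)[of "[i]" s x] sT B(2) by simp
      qed (use e2 C1_fieldD(2)[OF eC1] in \<open>auto simp: e_def\<close>)
      note b2 = Cl(2)[OF s0 st' tT, of x]
      have "S x = (layer_average \<sigma> h V x - layer_average \<sigma> h (v s) x - a x)
        + (layer_average \<sigma> (t - s) (v s) x + (t - s) *\<^sub>R f s x + (\<Sum>r\<in>UNIV. (W t $ r - W s $ r) *\<^sub>R \<gamma> r s x)
          - (v t x + integral {s..t} (\<lambda>\<tau>. gradient (p \<tau>) x)))"
        by (simp add: S_def D_def g_def h_def algebra_simps)
      then have "norm (S x) \<le> (B * n * h * norm (e x) + B * (h * (n * B))\<^sup>2) + Cl * h * \<eta>"
        using norm_triangle_mono[OF b1 b2] by (simp only: h_def[symmetric] \<eta>_def[symmetric])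
      also have "B * (h * (n * B))\<^sup>2 = B * (n * B)\<^sup>2 * h * h" by (simp add: power2_eq_square)
      also have "\<dots> \<le> B * (n * B)\<^sup>2 * h * (T powr (2/3) * \<eta>)"
        using cube B h by (intro mult_left_mono) auto
      finally have "norm (S x) \<le> (B * n) * (h * norm (e x)) + (B * (n * B)\<^sup>2 * T powr (2/3) + Cl) * (h * \<eta>)"
        by (simp add: algebra_simps)
      also have "\<dots> \<le> K * (h * norm (e x)) + K * (h * \<eta>)"
        using K h \<eta> by (intro add_mono mult_right_mono) auto
      finally show ?thesis by (simp add: algebra_simps)
    qed
    have cV: "continuous_on UNIV V" "continuous_on UNIV V'" "continuous_on UNIV (v t)" "continuous_on UNIV e"
      using C1_fieldD(1)[OF VC1] C1_fieldD(1)[OF V'C1] C1_fieldD(1)[OF velocity_C1[OF tT']] C1_fieldD(1)[OF eC1] by auto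
    have p1: "space_smooth 1 T p" by (rule space_smooth_mono[OF p(1)]) simp
    have geq: "g = gradient (\<lambda>x. integral {s..t} (\<lambda>\<tau>. p \<tau> x))"
      unfolding g_def[abs_def] using gradient_time_integral[OF p1 s0 tT] by (intro ext) simp
    have qC1: "C1_field (\<lambda>x. integral {s..t} (\<lambda>\<tau>. p \<tau> x))"
    proof -
      have sq: "space_smooth 1 T (\<lambda>_ x. integral {s..t} (\<lambda>\<tau>. p \<tau> x))"
        by (rule space_smooth_time_integral[OF p1 s0 tT])
      show ?thesis unfolding C1_field_def
        using space_smooth_has_partial[OF sq, of "[]" t] continuous_on_slice[OF space_smooth_continuous[OF sq], of "[]" t]
          continuous_on_slice[OF space_smooth_continuous[OF sq], of "[i]" t for i] tT' by auto
    qed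
    have qper: "periodic L (\<lambda>x. integral {s..t} (\<lambda>\<tau>. p \<tau> x))"
      unfolding periodic_def
    proof (intro allI)
      fix x i
      show "integral {s..t} (\<lambda>\<tau>. p \<tau> (x + L *\<^sub>R axis i 1)) = integral {s..t} (\<lambda>\<tau>. p \<tau> x)"
        using p(2) s0 tT by (intro Henstock_Kurzweil_Integration.integral_cong) (auto simp: periodic_def)
    qed
    have cg: "continuous_on UNIV g" unfolding geq by (rule gradient_continuous[OF qC1])
    have ca: "continuous_on UNIV a"
      unfolding a_def by (rule transport_avg_energy(1)[OF pos(3) eC1 eper e1 cV(1) dV VB B(1) B(1)])
    have cD: "continuous_on UNIV D"
      unfolding D_def by (intro continuous_intros continuous_layer_average cV force_continuous[OF sT] noise_divergence_free(1)[OF sT] cg)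
    have cS: "continuous_on UNIV S" unfolding S_def by (intro continuous_intros cD ca)
    have cd: "continuous_on UNIV d" unfolding d_def by (intro continuous_intros cV)
    have dd: "L2_divergence_free L d"
      unfolding d_def[abs_def] by (intro L2_divergence_free_diff dV' velocity_divergence_free tT')
    note int = set_integrable_cell_continuous
    define E where "E = (LINT x:cell L|lborel. (norm (e x))\<^sup>2)"
    have E0: "0 \<le> E" unfolding E_def set_lebesgue_integral_def by (rule integral_nonneg_AE) auto
    \<comment> \<open>the projections and the pressure gradient are invisible to the divergence-free \<open>d\<close>\<close>
    have test: "(LINT x:cell L|lborel. D x \<bullet> d x) = (LINT x:cell L|lborel. d x \<bullet> d x)"
    proof -
      define u1 where "u1 x = layer_average \<sigma> h V x - Pv x" for x
      define u2 where "u2 x = f s x - Pf x" for x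
      have o: "(LINT x:cell L|lborel. u1 x \<bullet> d x) = 0" "(LINT x:cell L|lborel. u2 x \<bullet> d x) = 0"
        using Pv Pf dd by (auto simp: leray_projection_def u1_def u2_def h_def)
      have og: "(LINT x:cell L|lborel. g x \<bullet> d x) = 0"
        using dd qC1 qper unfolding geq by (simp add: L2_divergence_free_def inner_commute)
      have L2d: "L2_periodic L d" using dd by (simp add: L2_divergence_free_def)
      have L2u: "L2_periodic L u1" "L2_periodic L u2"
        using Pv Pf L2_periodic_add[of L _ "\<lambda>x. (-1) *\<^sub>R Pv x"] L2_periodic_add[of L _ "\<lambda>x. (-1) *\<^sub>R Pf x"]
          L2_periodic_scaleR[of L Pv "-1"] L2_periodic_scaleR[of L Pf "-1"]
        unfolding u1_def[abs_def] u2_def[abs_def] by (auto simp: leray_projection_def L2_divergence_free_def h_def)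
      have iu: "set_integrable lborel (cell L) (\<lambda>x. u1 x \<bullet> d x)" "set_integrable lborel (cell L) (\<lambda>x. h * (u2 x \<bullet> d x))"
        using L2_inner_integrable[OF L2u(1) L2d] L2_inner_integrable[OF L2u(2) L2d] by auto
      have ig: "set_integrable lborel (cell L) (\<lambda>x. g x \<bullet> d x)" "set_integrable lborel (cell L) (\<lambda>x. d x \<bullet> d x)"
        by (intro int continuous_intros cg cd)+
      have "D x \<bullet> d x = ((d x \<bullet> d x + u1 x \<bullet> d x) + h * (u2 x \<bullet> d x)) - g x \<bullet> d x" for x
      proof -
        have "D x = d x + u1 x + h *\<^sub>R u2 x - g x"
          unfolding D_def d_def u1_def u2_def using eqV by (simp add: h_def algebra_simps)
        then show ?thesis by (simp add: inner_add_left inner_diff_left)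
      qed
      then have "(LINT x:cell L|lborel. D x \<bullet> d x) = (LINT x:cell L|lborel. ((d x \<bullet> d x + u1 x \<bullet> d x) + h * (u2 x \<bullet> d x)) - g x \<bullet> d x)"
        by simp
      also have "\<dots> = ((LINT x:cell L|lborel. d x \<bullet> d x) + (LINT x:cell L|lborel. u1 x \<bullet> d x))
          + (LINT x:cell L|lborel. h * (u2 x \<bullet> d x)) - (LINT x:cell L|lborel. g x \<bullet> d x)"
        using iu ig by (simp add: set_integral_add set_integral_diff)
      finally show ?thesis using o og by simp
    qed
    have dD: "(LINT x:cell L|lborel. (norm (d x))\<^sup>2) \<le> (LINT x:cell L|lborel. (norm (D x))\<^sup>2)"
    proof -
      have "(LINT x:cell L|lborel. D x \<bullet> d x) \<le> (LINT x:cell L|lborel. (1/2) * (norm (D x))\<^sup>2 + (1/2) * (norm (d x))\<^sup>2)"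
      proof (rule set_integral_mono)
        fix x
        have "D x \<bullet> d x \<le> norm (D x) * norm (d x)" by (rule norm_cauchy_schwarz)
        also have "\<dots> \<le> (1/2) * (norm (D x))\<^sup>2 + (1/2) * (norm (d x))\<^sup>2"
          using sum_squares_bound[of "norm (D x)" "norm (d x)"] by simp
        finally show "D x \<bullet> d x \<le> (1/2) * (norm (D x))\<^sup>2 + (1/2) * (norm (d x))\<^sup>2" .
      qed (intro int continuous_intros cD cd)+
      also have "\<dots> = (LINT x:cell L|lborel. (1/2) * (norm (D x))\<^sup>2) + (LINT x:cell L|lborel. (1/2) * (norm (d x))\<^sup>2)"
        by (intro cell_integral_add_continuous continuous_intros cD cd)
      finally show ?thesis unfolding test by (simp add: power2_norm_eq_inner)
    qed
    have A: "(LINT x:cell L|lborel. (norm (a x))\<^sup>2) \<le> E + h\<^sup>2 * K2"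
      using transport_avg_energy(2)[OF pos(3) eC1 eper e1 cV(1) dV VB B(1) B(1), of h "\<sigma> * sqrt h"]
      unfolding a_def E_def K2_def n_def m_def by (simp add: mult.assoc)
    have S2: "(LINT x:cell L|lborel. (norm (S x))\<^sup>2) \<le> 2 * K\<^sup>2 * h\<^sup>2 * (E + \<eta>\<^sup>2 * m)"
    proof -
      have "(LINT x:cell L|lborel. (norm (S x))\<^sup>2) \<le> (LINT x:cell L|lborel. 2 * K\<^sup>2 * h\<^sup>2 * (norm (e x))\<^sup>2 + 2 * K\<^sup>2 * h\<^sup>2 * \<eta>\<^sup>2)"
      proof (rule set_integral_mono)
        fix x
        have "(norm (S x))\<^sup>2 \<le> (K * h * (norm (e x) + \<eta>))\<^sup>2" by (intro power_mono SB) auto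
        also have "\<dots> = K\<^sup>2 * h\<^sup>2 * (norm (e x) + \<eta>)\<^sup>2" by (simp add: power_mult_distrib)
        also have "\<dots> \<le> K\<^sup>2 * h\<^sup>2 * (2 * (norm (e x))\<^sup>2 + 2 * \<eta>\<^sup>2)"
          using sum_squares_bound[of "norm (e x)" \<eta>] by (intro mult_left_mono) (auto simp: power2_sum)
        finally show "(norm (S x))\<^sup>2 \<le> 2 * K\<^sup>2 * h\<^sup>2 * (norm (e x))\<^sup>2 + 2 * K\<^sup>2 * h\<^sup>2 * \<eta>\<^sup>2" by (simp add: algebra_simps)
      qed (intro int continuous_intros cS cV)+
      also have "\<dots> = (LINT x:cell L|lborel. 2 * K\<^sup>2 * h\<^sup>2 * (norm (e x))\<^sup>2) + (LINT x:(cell L :: (real ^ 'n) set)|lborel. 2 * K\<^sup>2 * h\<^sup>2 * \<eta>\<^sup>2)"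
        by (intro cell_integral_add_continuous continuous_intros cV)
      also have "(LINT x:(cell L :: (real ^ 'n) set)|lborel. 2 * K\<^sup>2 * h\<^sup>2 * \<eta>\<^sup>2) = 2 * K\<^sup>2 * h\<^sup>2 * \<eta>\<^sup>2 * m"
        unfolding set_lebesgue_integral_def m_def by simp
      finally show ?thesis by (simp add: E_def algebra_simps)
    qed
    have "(LINT x:cell L|lborel. (norm (D x))\<^sup>2) \<le> (LINT x:cell L|lborel. (1 + h) * (norm (a x))\<^sup>2 + (1 + 1 / h) * (norm (S x))\<^sup>2)"
    proof (rule set_integral_mono)
      fix x
      show "(norm (D x))\<^sup>2 \<le> (1 + h) * (norm (a x))\<^sup>2 + (1 + 1 / h) * (norm (S x))\<^sup>2"
        using norm_add_squared_weighted[OF h(1), of "a x" "S x"] by (simp add: S_def)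
    qed (intro int continuous_intros cD ca cS)+
    also have "\<dots> = (LINT x:cell L|lborel. (1 + h) * (norm (a x))\<^sup>2) + (LINT x:cell L|lborel. (1 + 1 / h) * (norm (S x))\<^sup>2)"
      by (intro cell_integral_add_continuous continuous_intros ca cS)
    also have "\<dots> = (1 + h) * (LINT x:cell L|lborel. (norm (a x))\<^sup>2) + (1 + 1 / h) * (LINT x:cell L|lborel. (norm (S x))\<^sup>2)"
      by (simp only: set_integral_mult_right)
    also have "\<dots> \<le> (1 + h) * (E + h\<^sup>2 * K2) + (1 + 1 / h) * (2 * K\<^sup>2 * h\<^sup>2 * (E + \<eta>\<^sup>2 * m))"
      using A S2 h by (intro add_mono mult_left_mono) auto
    also have "(1 + 1 / h) * (2 * K\<^sup>2 * h\<^sup>2 * (E + \<eta>\<^sup>2 * m)) = 2 * K\<^sup>2 * ((h + 1) * h) * (E + \<eta>\<^sup>2 * m)"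
      using h by (simp add: power2_eq_square field_simps)
    also have "\<dots> \<le> 2 * K\<^sup>2 * ((T + 1) * h) * (E + \<eta>\<^sup>2 * m)"
      using h E0 m0 by (intro mult_right_mono mult_left_mono) auto
    also have "(1 + h) * (E + h\<^sup>2 * K2) = (1 + h) * E + (1 + h) * K2 * h * h" by (simp add: power2_eq_square algebra_simps)
    also have "\<dots> \<le> (1 + h) * E + (1 + T) * K2 * h * (T powr (1/3) * \<eta>\<^sup>2)"
      using h K2 cube(2) by (intro add_left_mono mult_mono) auto
    finally have "(LINT x:cell L|lborel. (norm (D x))\<^sup>2)
      \<le> (1 + h) * E + (1 + T) * K2 * h * (T powr (1/3) * \<eta>\<^sup>2) + 2 * K\<^sup>2 * ((T + 1) * h) * (E + \<eta>\<^sup>2 * m)" by simp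
    also have "\<dots> = (1 + (1 + 2 * K\<^sup>2 * (T + 1)) * h) * E + ((1 + T) * K2 * T powr (1/3) + 2 * K\<^sup>2 * (T + 1) * m) * h * \<eta>\<^sup>2"
      by (simp add: algebra_simps)
    also have "\<dots> \<le> (1 + C * h) * E + C * h * \<eta>\<^sup>2"
    proof -
      have "1 + 2 * K\<^sup>2 * (T + 1) \<le> C" "(1 + T) * K2 * T powr (1/3) + 2 * K\<^sup>2 * (T + 1) * m \<le> C"
        unfolding C_def using K2 m0 pos by auto
      then show ?thesis using h E0 by (intro add_mono mult_right_mono add_left_mono) auto
    qed
    finally have "(LINT x:cell L|lborel. (norm (d x))\<^sup>2) \<le> (1 + C * h) * E + C * h * \<eta>\<^sup>2"
      using dD by linarith
    then show "(LINT x:cell L|lborel. (norm (V' x - v t x))\<^sup>2)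
       \<le> (1 + C * (t - s)) * (LINT x:cell L|lborel. (norm (V x - v s x))\<^sup>2) + C * (t - s) * ((t - s) powr (1/3))\<^sup>2"
      by (simp add: d_def E_def e_def h_def \<eta>_def)
  qed
qed

text \<open>Discrete Gronwall argument: the bound \<open>\<eta>\<^sup>2 * ((1 + C * h) ^ k - 1)\<close> vanishes at the start and reproduces itself
  exactly in one step.\<close>

lemma velocity_error:
  assumes C0: "0 \<le> C0"
    and bounds: "\<And>N k. 1 \<le> N \<Longrightarrow> k \<le> N \<Longrightarrow> layer_bounds C0 (V N k)"
    and scheme: "\<And>N. 1 \<le> N \<Longrightarrow> layer_method \<sigma> L f \<gamma> \<phi> W N (T / real N) (V N)"
  shows "\<exists>C\<ge>0. \<forall>N\<ge>1. \<forall>k\<le>N. L2_divergence_free L (V N k) \<and>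
    (LINT x:cell L|lborel. (norm (V N k x - v (real k * (T / real N)) x))\<^sup>2) \<le> C * ((T / real N) powr (1/3))\<^sup>2"
proof -
  obtain C where C: "0 \<le> C" "\<And>s t V V' Pv Pf. 0 \<le> s \<Longrightarrow> s < t \<Longrightarrow> t \<le> T \<Longrightarrow> layer_bounds C0 V \<Longrightarrow> layer_bounds C0 V' \<Longrightarrow>
     L2_divergence_free L V \<Longrightarrow> leray_projection L (layer_average \<sigma> (t - s) V) Pv \<Longrightarrow> leray_projection L (f s) Pf \<Longrightarrow>
     (\<forall>x. V' x = Pv x + (t - s) *\<^sub>R Pf x + (\<Sum>r\<in>UNIV. (W t $ r - W s $ r) *\<^sub>R \<gamma> r s x)) \<Longrightarrow>
     L2_divergence_free L V' \<and>
     (LINT x:cell L|lborel. (norm (V' x - v t x))\<^sup>2)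
       \<le> (1 + C * (t - s)) * (LINT x:cell L|lborel. (norm (V x - v s x))\<^sup>2) + C * (t - s) * ((t - s) powr (1/3))\<^sup>2"
    using velocity_step[OF C0] by blast
  show ?thesis
  proof (intro exI[of _ "exp (C * T)"] conjI allI impI)
    fix N k :: nat assume N: "1 \<le> N" and kN: "k \<le> N"
    define h where "h = T / real N"
    define \<eta> where "\<eta> = h powr (1/3)"
    have h: "0 < h" using N pos by (simp add: h_def)
    have hN: "real N * h = T" using N by (simp add: h_def)
    have *: "k \<le> N \<Longrightarrow> L2_divergence_free L (V N k) \<and>
      (LINT x:cell L|lborel. (norm (V N k x - v (real k * h) x))\<^sup>2) \<le> \<eta>\<^sup>2 * ((1 + C * h) ^ k - 1)" for k
    proof (induction k)
      case 0
      have "V N 0 = v 0" using scheme[OF N] init by (simp add: layer_method_def)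
      then show ?case using velocity_divergence_free[of 0] pos by (simp add: set_lebesgue_integral_def)
    next
      case (Suc k)
      define E where "E = (LINT x:cell L|lborel. (norm (V N k x - v (real k * h) x))\<^sup>2)"
      from Suc have IH: "L2_divergence_free L (V N k)" "E \<le> \<eta>\<^sup>2 * ((1 + C * h) ^ k - 1)" by (auto simp: E_def)
      from scheme[OF N] Suc.prems obtain Pv Pf where P:
        "leray_projection L (layer_average \<sigma> h (V N k)) Pv" "leray_projection L (f (real k * h)) Pf"
        "\<forall>x. V N (Suc k) x = Pv x + h *\<^sub>R Pf x + (\<Sum>r\<in>UNIV. (W (real (Suc k) * h) $ r - W (real k * h) $ r) *\<^sub>R \<gamma> r (real k * h) x)"
        unfolding layer_method_def h_def[symmetric] by (meson Suc_le_lessD)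
      have st: "real (Suc k) * h - real k * h = h" by (simp add: algebra_simps)
      have "real (Suc k) * h \<le> T"
        using mult_right_mono[of "real (Suc k)" "real N" h] Suc.prems h hN by simp
      then have step: "L2_divergence_free L (V N (Suc k)) \<and>
        (LINT x:cell L|lborel. (norm (V N (Suc k) x - v (real (Suc k) * h) x))\<^sup>2) \<le> (1 + C * h) * E + C * h * \<eta>\<^sup>2"
        using C(2)[of "real k * h" "real (Suc k) * h" "V N k" "V N (Suc k)" Pv Pf, unfolded st] P IH(1)
          bounds[OF N, of k] bounds[OF N Suc.prems] Suc.prems h
        by (simp add: E_def \<eta>_def)
      have "(1 + C * h) * E + C * h * \<eta>\<^sup>2 \<le> (1 + C * h) * (\<eta>\<^sup>2 * ((1 + C * h) ^ k - 1)) + C * h * \<eta>\<^sup>2"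
        using IH(2) C(1) h by (intro add_right_mono mult_left_mono) auto
      also have "\<dots> = \<eta>\<^sup>2 * ((1 + C * h) ^ Suc k - 1)" by (simp add: algebra_simps)
      finally show ?case using step by linarith
    qed
    show "L2_divergence_free L (V N k)" using *[OF kN] by simp
    have "(1 + C * h) ^ k - 1 \<le> exp (C * T)"
    proof -
      have "(1 + C * h) ^ k \<le> exp (C * h) ^ k"
        using C(1) h exp_ge_add_one_self[of "C * h"] by (intro power_mono) auto
      also have "\<dots> = exp (real k * (C * h))" by (rule exp_of_nat_mult[symmetric])
      also have "\<dots> \<le> exp (C * T)"
      proof -
        have rk: "real k * h \<le> T" using mult_right_mono[of "real k" "real N" h] kN h hN by simp
        show ?thesis using mult_left_mono[OF rk C(1)] by (simp add: ac_simps)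
      qed
      finally show ?thesis by simp
    qed
    then have "\<eta>\<^sup>2 * ((1 + C * h) ^ k - 1) \<le> exp (C * T) * \<eta>\<^sup>2"
      by (subst mult.commute) (intro mult_right_mono, auto)
    then show "(LINT x:cell L|lborel. (norm (V N k x - v (real k * (T / real N)) x))\<^sup>2) \<le> exp (C * T) * ((T / real N) powr (1/3))\<^sup>2"
      using *[OF kN] unfolding h_def \<eta>_def by linarith
  qed simp
qed

end

section \<open>The pressure\<close>

text \<open>A bound on the second derivative along the axis controls the error of the difference quotients.\<close>

lemma partial_deriv_divergence_free:
  fixes u :: "real ^ 'n::finite \<Rightarrow> real ^ 'n"
  assumes L: "0 < L" and u: "continuous_on UNIV u" "L2_divergence_free L u"
    and d: "\<And>x. has_partial i u x" "\<And>x. has_partial i (partial_deriv i u) x"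
    and c: "continuous_on UNIV (partial_deriv i u)"
    and B: "\<And>x. norm (partial_deriv i (partial_deriv i u) x) \<le> B"
  shows "L2_divergence_free L (partial_deriv i u)"
proof (rule partial_deriv_orthogonal_gradient[OF L u c])
  have B0: "0 \<le> B" using B[of 0] norm_ge_zero order_trans by blast
  fix s :: real and x :: "real ^ 'n"
  have lip: "norm (partial_deriv i u (x + r *\<^sub>R axis i 1) - partial_deriv i u x) \<le> B * \<bar>r\<bar>" for r
    using increment_bound_along_axis[of r i "partial_deriv i u" x 0 B] d(2) B by simp
  have "norm (partial_deriv i u (x + r *\<^sub>R axis i 1) - partial_deriv i u x) \<le> B * \<bar>s\<bar>" if "\<bar>r\<bar> \<le> \<bar>s\<bar>" for r
    using lip[of r] mult_left_mono[OF that B0] by linarith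
  then have "norm (u (x + s *\<^sub>R axis i 1) - u x - s *\<^sub>R partial_deriv i u x) \<le> B * \<bar>s\<bar> * \<bar>s\<bar>"
    using d(1) by (intro increment_bound_along_axis)
  then show "norm (u (x + s *\<^sub>R axis i 1) - u x - s *\<^sub>R partial_deriv i u x) \<le> B * s\<^sup>2"
    by (simp add: power2_eq_square mult.assoc)
qed

text \<open>Since the transporting field is divergence-free, both derivatives can be moved onto the test
  function; this is what makes the pressure as accurate as the velocity itself.\<close>

lemma advection_by_parts:
  fixes V :: "real ^ 'n::finite \<Rightarrow> real ^ 'n"
  assumes V: "C1_field V" "L2_divergence_free L V" and t: "trig_poly L \<psi>"
  shows "(LINT x:cell L|lborel. advection V V x \<bullet> gradient \<psi> x)
    = - (LINT x:cell L|lborel. (\<Sum>i\<in>UNIV. \<Sum>j\<in>UNIV. V x $ i * V x $ j * partial_deriv i (partial_deriv j \<psi>) x))"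
proof -
  have per: "periodic L V" using V(2) by (simp add: L2_divergence_free_def L2_periodic_def)
  have p: "trig_poly L (partial_deriv j \<psi>)" "trig_poly L (partial_deriv i (partial_deriv j \<psi>))"
    "has_partial i (partial_deriv j \<psi>) x" for i j x
    using trig_poly_partial t by blast+
  have Vj: "C1_field (\<lambda>x. V x $ j)" for j by (rule C1_field_linear[OF bounded_linear_vec_nth V(1)])
  define \<eta> where "\<eta> x = (\<Sum>j\<in>UNIV. V x $ j * partial_deriv j \<psi> x)" for x
  have C: "C1_field \<eta>"
    unfolding \<eta>_def by (intro C1_field_sum C1_field_bilinear[OF bounded_bilinear_mult] Vj trig_poly_C1[OF p(1)]) simp
  have pe: "periodic L \<eta>"
    using per trig_poly_periodic[OF p(1)] unfolding periodic_def \<eta>_def by simp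
  have d: "partial_deriv i \<eta> x = (\<Sum>j\<in>UNIV. V x $ j * partial_deriv i (partial_deriv j \<psi>) x + partial_deriv i V x $ j * partial_deriv j \<psi> x)" for i x
  proof -
    have "has_partial i (\<lambda>x. V x $ j) x" "partial_deriv i (\<lambda>x. V x $ j) x = partial_deriv i V x $ j" for j
      using C1_fieldD(2)[OF V(1)] by (auto intro: partial_nth)
    then have "has_partial i (\<lambda>x. V x $ j * partial_deriv j \<psi> x) x"
      "partial_deriv i (\<lambda>x. V x $ j * partial_deriv j \<psi> x) x = V x $ j * partial_deriv i (partial_deriv j \<psi>) x + partial_deriv i V x $ j * partial_deriv j \<psi> x" for j
      using partial_mult[of i "\<lambda>x. V x $ j" x "partial_deriv j \<psi>"] p(3) by auto
    then show ?thesis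
      unfolding \<eta>_def using partial_sum[of UNIV i "\<lambda>j x. V x $ j * partial_deriv j \<psi> x" x] by simp
  qed
  have Vd: "V x \<bullet> gradient \<eta> x = advection V V x \<bullet> gradient \<psi> x
      + (\<Sum>i\<in>UNIV. \<Sum>j\<in>UNIV. V x $ i * V x $ j * partial_deriv i (partial_deriv j \<psi>) x)" for x
  proof -
    have "V x \<bullet> gradient \<eta> x = (\<Sum>i\<in>UNIV. V x $ i * (\<Sum>j\<in>UNIV. V x $ j * partial_deriv i (partial_deriv j \<psi>) x + partial_deriv i V x $ j * partial_deriv j \<psi> x))"
      by (simp add: inner_vec_def gradient_def d)
    also have "\<dots> = (\<Sum>i\<in>UNIV. \<Sum>j\<in>UNIV. V x $ i * V x $ j * partial_deriv i (partial_deriv j \<psi>) x)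
        + (\<Sum>i\<in>UNIV. \<Sum>j\<in>UNIV. V x $ i * (partial_deriv i V x $ j * partial_deriv j \<psi> x))"
      by (simp add: sum_distrib_left distrib_left sum.distrib mult.assoc)
    also have "(\<Sum>i\<in>UNIV. \<Sum>j\<in>UNIV. V x $ i * (partial_deriv i V x $ j * partial_deriv j \<psi> x)) = advection V V x \<bullet> gradient \<psi> x"
      unfolding advection_def inner_sum_left inner_scaleR_left
      unfolding inner_vec_def gradient_def by (simp add: sum_distrib_left)
    finally show ?thesis by simp
  qed
  have cV: "continuous_on UNIV (\<lambda>x. V x $ i)" for i by (rule C1_fieldD(1)[OF Vj])
  have c1: "continuous_on UNIV (\<lambda>x. advection V V x \<bullet> gradient \<psi> x)"
    unfolding advection_def by (intro continuous_intros cV C1_fieldD(3)[OF V(1)] gradient_continuous[OF trig_poly_C1[OF t]])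
  have c2: "continuous_on UNIV (\<lambda>x. \<Sum>i\<in>UNIV. \<Sum>j\<in>UNIV. V x $ i * V x $ j * partial_deriv i (partial_deriv j \<psi>) x)"
    by (intro continuous_intros cV trig_poly_continuous[OF p(2)])
  have "(LINT x:cell L|lborel. V x \<bullet> gradient \<eta> x) = 0"
    using V(2) C pe by (simp add: L2_divergence_free_def)
  then show ?thesis
    unfolding Vd cell_integral_add_continuous[OF c1 c2] by simp
qed

lemma leray_complement_test:
  assumes R: "leray_complement L u R" and \<psi>: "C1_field \<psi>" "periodic L \<psi>"
  shows "L2_periodic L R" "(LINT x:cell L|lborel. R x \<bullet> gradient \<psi> x) = (LINT x:cell L|lborel. u x \<bullet> gradient \<psi> x)"
proof -
  obtain Pu where Pu: "leray_projection L u Pu" "R = (\<lambda>x. u x - Pu x)" using R by (auto simp: leray_complement_def)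
  have u: "L2_periodic L u" "L2_periodic L Pu" using Pu by (auto simp: leray_projection_def L2_divergence_free_def)
  show "L2_periodic L R"
    unfolding Pu(2) using L2_periodic_add[OF u(1) L2_periodic_scaleR[OF u(2), of "-1"]] by simp
  have g: "L2_periodic L (gradient \<psi>)" by (intro L2_periodic_continuous gradient_continuous periodic_gradient \<psi>)
  have "(LINT x:cell L|lborel. Pu x \<bullet> gradient \<psi> x) = 0"
    using Pu \<psi> by (simp add: leray_projection_def L2_divergence_free_def)
  then show "(LINT x:cell L|lborel. R x \<bullet> gradient \<psi> x) = (LINT x:cell L|lborel. u x \<bullet> gradient \<psi> x)"
    unfolding Pu(2) inner_diff_left
    using L2_inner_integrable[OF u(1) g] L2_inner_integrable[OF u(2) g] by (simp add: set_integral_diff)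
qed

context pathwise_snse
begin

lemma laplacian_orthogonal_gradient:
  assumes t: "t \<in> {0..T}" and \<psi>: "C1_field \<psi>" "periodic L \<psi>"
  shows "(LINT x:cell L|lborel. laplacian (v t) x \<bullet> gradient \<psi> x) = 0"
proof -
  obtain B where B: "0 \<le> B" "\<And>ds t x. length ds \<le> 4 \<Longrightarrow> t \<in> {0..T} \<Longrightarrow> norm (partials ds (v t) x) \<le> B"
    using velocity_bounds by blast
  have c: "continuous_on UNIV (partials ds (v t))" if "length ds \<le> 4" for ds
    by (rule continuous_on_slice[OF space_smooth_continuous[OF v(1) that] t])
  have 1: "L2_divergence_free L (partial_deriv i (v t))" for i
    using velocity_has_partial[of "[]" t i] velocity_has_partial[of "[i]" t i] c[of "[]"] c[of "[i]"] B(2)[of "[i, i]" t] t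
    by (intro partial_deriv_divergence_free[OF pos(3) _ velocity_divergence_free[OF t], where B=B]) auto
  have 2: "L2_divergence_free L (partial_deriv i (partial_deriv i (v t)))" for i
    using velocity_has_partial[of "[i]" t i] velocity_has_partial[of "[i, i]" t i] c[of "[i]"] c[of "[i, i]"] B(2)[of "[i, i, i]" t] t
    by (intro partial_deriv_divergence_free[OF pos(3) _ 1, where B=B]) auto
  have "L2_divergence_free L (\<lambda>x. \<Sum>i\<in>UNIV. partial_deriv i (partial_deriv i (v t)) x)"
    by (intro L2_divergence_free_sum 2) simp
  then have "L2_divergence_free L (laplacian (v t))" by (simp add: laplacian_def[abs_def])
  then show ?thesis using \<psi> by (simp add: L2_divergence_free_def)
qed

text \<open>Over a short interval before \<open>t\<close> the divergence-free increment of \<open>v\<close> is the drift at \<open>t\<close> times the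
  length, plus a divergence-free noise term, plus a remainder of higher order.\<close>

lemma drift_orthogonal_gradient:
  assumes t: "0 < t" "t \<le> T" and \<psi>: "C1_field \<psi>" "periodic L \<psi>"
  shows "(LINT x:cell L|lborel. snse_drift \<sigma> f v p t x \<bullet> gradient \<psi> x) = 0"
proof -
  define I where "I = (LINT x:cell L|lborel. snse_drift \<sigma> f v p t x \<bullet> gradient \<psi> x)"
  define G where "G = (LINT x:cell L|lborel. norm (gradient \<psi> x))"
  have tT: "t \<in> {0..T}" using t by auto
  have cg: "continuous_on UNIV (gradient \<psi>)" by (rule gradient_continuous[OF \<psi>(1)])
  have G0: "0 \<le> G" unfolding G_def set_lebesgue_integral_def by (rule integral_nonneg_AE) auto
  obtain C3 where C3: "0 \<le> C3" "\<And>s t x. 0 \<le> s \<Longrightarrow> s \<le> t \<Longrightarrow> t \<le> T \<Longrightarrow>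
     norm (\<Sum>r\<in>UNIV. integral {s..t} (\<lambda>\<tau>. (W t $ r - W \<tau> $ r) *\<^sub>R time_deriv T (\<gamma> r) \<tau> x)) \<le> C3 * (t - s) * (t - s) powr (1/3)"
    using noise_correction_bound by blast
  have cd: "continuous_on UNIV (snse_drift \<sigma> f v p t)"
    using continuous_on_slice[OF space_smooth_continuous[OF drift_smooth], of "[]" t] tT by simp
  note int = set_integrable_cell_continuous
  have cdr: "continuous_on ({0..T} \<times> UNIV) (\<lambda>(t, x). snse_drift \<sigma> f v p t x)"
    using space_smooth_continuous[OF drift_smooth, of "[]"] by simp
  have bound: "\<bar>I\<bar> \<le> e * (2 * G)" if e: "0 < e" for e
  proof -
    obtain \<delta> where \<delta>: "0 < \<delta>" "\<And>s s' x. s \<in> {0..T} \<Longrightarrow> s' \<in> {0..T} \<Longrightarrow> \<bar>s - s'\<bar> < \<delta> \<Longrightarrow>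
        norm (snse_drift \<sigma> f v p s x - snse_drift \<sigma> f v p s' x) < e"
      using periodic_uniform_modulus[OF pos(3) drift_periodic cdr e] by blast
    \<comment> \<open>so short that the drift varies by less than \<open>e\<close> and that the noise correction, of order \<open>k * k powr (1/3)\<close>, is at most \<open>e * k\<close>\<close>
    define k where "k = min (t / 2) (min (\<delta> / 2) ((e / (C3 + 1)) powr 3))"
    define s where "s = t - k"
    have k: "0 < k" "k < t" "k < \<delta>" "C3 * k powr (1/3) \<le> e"
    proof -
      show "0 < k" "k < t" "k < \<delta>" using t \<delta>(1) e C3(1) by (auto simp: k_def min_less_iff_disj)
      have "k powr (1/3) \<le> ((e / (C3 + 1)) powr 3) powr (1/3)"
        using \<open>0 < k\<close> by (intro powr_mono2) (auto simp: k_def)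
      also have "\<dots> = (e / (C3 + 1)) powr (3 * (1/3))" by (simp only: powr_powr)
      also have "\<dots> = e / (C3 + 1)" using e C3(1) by simp
      finally have "C3 * k powr (1/3) \<le> C3 * (e / (C3 + 1))" using C3(1) by (intro mult_left_mono)
      also have "\<dots> \<le> e" using e C3(1) by (simp add: field_simps)
      finally show "C3 * k powr (1/3) \<le> e" .
    qed
    have st: "0 \<le> s" "s \<le> t" "t \<le> T" and sT: "s \<in> {0..T}" and ts: "t - s = k" using k t by (auto simp: s_def)
    define r where "r x = v t x - v s x - (\<Sum>r\<in>UNIV. (W t $ r - W s $ r) *\<^sub>R \<gamma> r s x) - k *\<^sub>R snse_drift \<sigma> f v p t x" for x
    have rb: "norm (r x) \<le> 2 * e * k" for x
    proof -
      have 1: "norm (integral {s..t} (\<lambda>\<tau>. snse_drift \<sigma> f v p \<tau> x) - (t - s) *\<^sub>R snse_drift \<sigma> f v p t x) \<le> e * (t - s)"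
      proof (rule frozen_integral_error[OF st(2)])
        show "continuous_on {s..t} (\<lambda>\<tau>. snse_drift \<sigma> f v p \<tau> x)"
          using st by (intro continuous_on_subset[OF smooth_imp_continuous_time[OF drift_smooth]]) auto
        fix \<tau> assume \<tau>: "\<tau> \<in> {s..t}"
        then have "\<bar>\<tau> - t\<bar> < \<delta>" using k ts by auto
        then show "norm (snse_drift \<sigma> f v p \<tau> x - snse_drift \<sigma> f v p t x) \<le> e"
          using \<delta>(2)[of \<tau> t x] \<tau> st by (auto intro: less_imp_le)
      qed
      have 2: "norm (\<Sum>r\<in>UNIV. integral {s..t} (\<lambda>\<tau>. (W t $ r - W \<tau> $ r) *\<^sub>R time_deriv T (\<gamma> r) \<tau> x)) \<le> e * k"
      proof -
        have "C3 * k * k powr (1/3) = (C3 * k powr (1/3)) * k" by simp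
        also have "\<dots> \<le> e * k" using k by (intro mult_right_mono) auto
        finally show ?thesis using C3(2)[OF st, of x] by (simp add: ts)
      qed
      have "r x = (integral {s..t} (\<lambda>\<tau>. snse_drift \<sigma> f v p \<tau> x) - (t - s) *\<^sub>R snse_drift \<sigma> f v p t x)
          + (\<Sum>r\<in>UNIV. integral {s..t} (\<lambda>\<tau>. (W t $ r - W \<tau> $ r) *\<^sub>R time_deriv T (\<gamma> r) \<tau> x))"
        unfolding r_def velocity_increment[OF st] sum.distrib ts by (simp add: algebra_simps)
      also have "norm \<dots> \<le> e * (t - s) + e * k" by (rule norm_triangle_mono[OF 1 2])
      finally show ?thesis by (simp add: ts)
    qed
    define z where "z x = v t x - v s x - (\<Sum>r\<in>UNIV. (W t $ r - W s $ r) *\<^sub>R \<gamma> r s x)" for x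
    have dz: "L2_divergence_free L z"
      unfolding z_def[abs_def]
      by (intro L2_divergence_free_diff velocity_divergence_free tT sT L2_divergence_free_sum L2_divergence_free_scaleR
          noise_divergence_free(2)[OF sT]) simp
    have cz: "continuous_on UNIV z"
      unfolding z_def by (intro continuous_intros C1_fieldD(1)[OF velocity_C1[OF tT]] C1_fieldD(1)[OF velocity_C1[OF sT]]
          noise_divergence_free(1)[OF sT])
    have cr: "continuous_on UNIV r"
    proof -
      have "r = (\<lambda>x. z x - k *\<^sub>R snse_drift \<sigma> f v p t x)" by (simp add: r_def z_def fun_eq_iff)
      then show ?thesis by (simp add: continuous_on_diff cz continuous_on_scaleR continuous_on_const cd)
    qed
    have "(LINT x:cell L|lborel. z x \<bullet> gradient \<psi> x) = 0" using dz \<psi> by (simp add: L2_divergence_free_def)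
    also have "(\<lambda>x. z x \<bullet> gradient \<psi> x) = (\<lambda>x. k * (snse_drift \<sigma> f v p t x \<bullet> gradient \<psi> x) + r x \<bullet> gradient \<psi> x)"
      by (simp add: r_def z_def fun_eq_iff inner_diff_left)
    also have "(LINT x:cell L|lborel. k * (snse_drift \<sigma> f v p t x \<bullet> gradient \<psi> x) + r x \<bullet> gradient \<psi> x)
        = (LINT x:cell L|lborel. k * (snse_drift \<sigma> f v p t x \<bullet> gradient \<psi> x)) + (LINT x:cell L|lborel. r x \<bullet> gradient \<psi> x)"
      by (intro cell_integral_add_continuous continuous_intros cd cr cg)
    finally have "k * I = - (LINT x:cell L|lborel. r x \<bullet> gradient \<psi> x)" by (simp add: I_def)
    then have "\<bar>k * I\<bar> = \<bar>LINT x:cell L|lborel. r x \<bullet> gradient \<psi> x\<bar>" by simp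
    moreover have "\<bar>k * I\<bar> = k * \<bar>I\<bar>" using k(1) by (simp add: abs_mult)
    ultimately have "k * \<bar>I\<bar> = \<bar>LINT x:cell L|lborel. r x \<bullet> gradient \<psi> x\<bar>" by simp
    also have "\<dots> \<le> (LINT x:cell L|lborel. 2 * e * k * norm (gradient \<psi> x))"
    proof (rule set_integral_cell_abs_le)
      fix x
      have "\<bar>r x \<bullet> gradient \<psi> x\<bar> \<le> norm (r x) * norm (gradient \<psi> x)" by (rule Cauchy_Schwarz_ineq2)
      also have "\<dots> \<le> 2 * e * k * norm (gradient \<psi> x)" using rb by (intro mult_right_mono) auto
      finally show "\<bar>r x \<bullet> gradient \<psi> x\<bar> \<le> 2 * e * k * norm (gradient \<psi> x)" .
    qed (intro int continuous_intros cr cg)+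
    also have "\<dots> = 2 * e * k * G" by (simp add: G_def)
    finally have "k * \<bar>I\<bar> \<le> k * (e * (2 * G))" by (simp add: ac_simps)
    then show ?thesis using k(1) by simp
  qed
  have "\<bar>I\<bar> \<le> 0"
  proof (rule field_le_epsilon)
    fix e :: real assume e: "0 < e"
    have "e / (2 * G + 1) * (2 * G) \<le> e" using e G0 by (simp add: field_simps)
    then show "\<bar>I\<bar> \<le> 0 + e" using bound[of "e / (2 * G + 1)"] e G0 by simp
  qed
  then show ?thesis by (simp add: I_def)
qed

text \<open>Drift and Laplacian are both orthogonal to gradients, so pressure, advection and force balance.\<close>

lemma exact_pressure_weak:
  assumes t: "0 < t" "t \<le> T" and \<psi>: "C1_field \<psi>" "periodic L \<psi>"
  shows "(LINT x:cell L|lborel. gradient (p t) x \<bullet> gradient \<psi> x)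
    = (LINT x:cell L|lborel. f t x \<bullet> gradient \<psi> x) - (LINT x:cell L|lborel. advection (v t) (v t) x \<bullet> gradient \<psi> x)"
proof -
  have tT: "t \<in> {0..T}" using t by auto
  have cg: "continuous_on UNIV (gradient \<psi>)" by (rule gradient_continuous[OF \<psi>(1)])
  have slice: "continuous_on UNIV (g t)" if "space_smooth k T g" for k and g :: "real \<Rightarrow> real ^ 'n \<Rightarrow> real ^ 'n"
    using continuous_on_slice[OF space_smooth_continuous[OF that, of "[]"] tT] by simp
  have S: "space_smooth (Suc 2) T v" by (rule space_smooth_mono[OF v(1)]) simp
  have c: "continuous_on UNIV (laplacian (v t))" "continuous_on UNIV (advection (v t) (v t))" "continuous_on UNIV (gradient (p t))"
    "continuous_on UNIV (f t)"
    using slice[OF space_smooth_laplacian[of 2 T v]] slice[OF space_smooth_advection[OF S S]] slice[OF space_smooth_gradient[of 2 T p]]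
      slice[OF spacetime_smooth_space(1)[OF f(1)]] v(1) p(1) by (auto simp: numeral_eq_Suc)
  note int = set_integrable_cell_continuous
  have i: "set_integrable lborel (cell L) (\<lambda>x. laplacian (v t) x \<bullet> gradient \<psi> x)"
    "set_integrable lborel (cell L) (\<lambda>x. advection (v t) (v t) x \<bullet> gradient \<psi> x)"
    "set_integrable lborel (cell L) (\<lambda>x. gradient (p t) x \<bullet> gradient \<psi> x)"
    "set_integrable lborel (cell L) (\<lambda>x. f t x \<bullet> gradient \<psi> x)"
    by (intro int continuous_intros c cg)+
  have "(LINT x:cell L|lborel. snse_drift \<sigma> f v p t x \<bullet> gradient \<psi> x)
      = (LINT x:cell L|lborel. (\<sigma>\<^sup>2 / 2) * (laplacian (v t) x \<bullet> gradient \<psi> x) - advection (v t) (v t) x \<bullet> gradient \<psi> x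
          - gradient (p t) x \<bullet> gradient \<psi> x + f t x \<bullet> gradient \<psi> x)"
    by (simp add: snse_drift_def inner_add_left inner_diff_left)
  also have "\<dots> = (\<sigma>\<^sup>2 / 2) * (LINT x:cell L|lborel. laplacian (v t) x \<bullet> gradient \<psi> x)
      - (LINT x:cell L|lborel. advection (v t) (v t) x \<bullet> gradient \<psi> x)
      - (LINT x:cell L|lborel. gradient (p t) x \<bullet> gradient \<psi> x) + (LINT x:cell L|lborel. f t x \<bullet> gradient \<psi> x)"
    using i by (simp add: set_integral_add set_integral_diff)
  finally show ?thesis
    using drift_orthogonal_gradient[OF t \<psi>] laplacian_orthogonal_gradient[OF tT \<psi>] by simp
qed

text \<open>Against a test function the gradient of the difference of the pressures is the difference of the advection terms.
  After integration by parts this pairs \<open>A = v v\<^sup>T - V V\<^sup>T\<close> with the second derivatives of \<open>\<psi>\<close>; the norm of \<open>A\<close> is at most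
  a multiple of the velocity error, and that of the second derivatives is the norm of the Laplacian.\<close>

lemma pressure_error:
  assumes t: "0 < t" "t \<le> T" and zm: "zero_mean L (p t)"
    and pb: "layer_pressure L (f t) V pb" and V: "layer_bounds C0 V" "L2_divergence_free L V"
    and B: "C0 \<le> B" "\<And>x. norm (v t x) \<le> B"
  shows "L2_cell_norm L (\<lambda>x. pb x - p t x)
    \<le> 2 * real CARD('n) * B * sqrt (LINT x:cell L|lborel. (norm (V x - v t x))\<^sup>2)"
proof -
  define q where "q x = pb x - p t x" for x
  define n where "n = real CARD('n)"
  define E where "E = (LINT x:cell L|lborel. (norm (V x - v t x))\<^sup>2)"
  have E0: "0 \<le> E" unfolding E_def set_lebesgue_integral_def by (rule integral_nonneg_AE) auto
  have tT: "t \<in> {0..T}" using t by auto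
  have B0: "0 \<le> B" using B(2)[of 0] norm_ge_zero order_trans by blast
  have VC1: "C1_field V" and vC1: "C1_field (v t)" using V(1) velocity_C1[OF tT] by (auto simp: layer_bounds_def)
  have Vb: "norm (V x) \<le> B" for x using V(1) B(1) by (auto simp: layer_bounds_def intro: order_trans)
  obtain Ra Rf where R: "leray_complement L (advection V V) Ra" "leray_complement L (f t) Rf"
    "\<And>x. gradient pb x = - Ra x + Rf x"
    using pb by (auto simp: layer_pressure_def)
  have pbd: "pb differentiable (at x)" for x using pb by (simp add: layer_pressure_def)
  have pbp: "has_partial i pb x" for i x
  proof -
    have "(\<lambda>s. x + s *\<^sub>R axis i 1) differentiable (at (0 :: real))"
      by (intro derivative_intros)
    then have "pb \<circ> (\<lambda>s. x + s *\<^sub>R axis i 1) differentiable (at (0 :: real))"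
      using pbd[of x] by (intro differentiable_chain_at) auto
    then show ?thesis by (simp add: has_partial_def o_def)
  qed
  have cpb: "continuous_on UNIV pb"
    by (auto intro!: continuous_at_imp_continuous_on differentiable_imp_continuous_within pbd)
  have p_part: "has_partial i (p t) x" for i x
    using space_smooth_has_partial[OF p(1), of "[]" t i x] tT by simp
  have cp: "continuous_on UNIV (p t)"
    using continuous_on_slice[OF space_smooth_continuous[OF p(1), of "[]"] tT] by simp
  have cgp: "continuous_on UNIV (gradient (p t))"
    unfolding gradient_def using continuous_on_slice[OF space_smooth_continuous[OF p(1), of "[i]" for i] tT]
    by (intro continuous_on_vec_lambda) simp
  have cq: "continuous_on UNIV q" unfolding q_def by (intro continuous_intros cpb cp)
  have perq: "periodic L q"
  proof -
    have "periodic L pb" using pb by (simp add: layer_pressure_def)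
    from periodic_compose2[OF this p(2)[OF tT], of "(-)"] show ?thesis by (simp add: q_def[abs_def])
  qed
  have zq: "zero_mean L q"
    using pb zm set_integral_diff(2)[OF set_integrable_cell_continuous[OF cpb, of L] set_integrable_cell_continuous[OF cp, of L]]
    by (simp add: zero_mean_def q_def layer_pressure_def)
  have pq: "has_partial i q x" for i x unfolding q_def[abs_def] by (intro partial_diff(1) pbp p_part)
  have gq: "gradient q x = gradient pb x - gradient (p t) x" for x
    unfolding q_def[abs_def] by (simp add: gradient_def vec_eq_iff partial_diff(2)[OF pbp p_part])
  have gpb: "gradient pb = (\<lambda>x. Rf x + (-1) *\<^sub>R Ra x)" by (rule ext) (simp add: R(3))
  have L2p: "L2_periodic L (gradient (p t))" by (intro L2_periodic_continuous cgp periodic_gradient p(2)[OF tT])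
  have const: "C1_field (\<lambda>x :: real ^ 'n. 0 :: real)" "periodic L (\<lambda>x :: real ^ 'n. 0 :: real)"
    by (auto simp: C1_field_const periodic_def)
  have L2R: "L2_periodic L Ra" "L2_periodic L Rf"
    using leray_complement_test(1)[OF R(1) const] leray_complement_test(1)[OF R(2) const] by auto
  have L2pb: "L2_periodic L (gradient pb)" unfolding gpb by (intro L2_periodic_add L2_periodic_scaleR L2R)
  have L2q: "L2_periodic L (gradient q)"
    unfolding gq[abs_def] using L2_periodic_add[OF L2pb L2_periodic_scaleR[OF L2p, of "-1"]] by simp
  have "L2_cell_norm L q \<le> 2 * n * B * sqrt E"
  proof (rule L2_bound_by_duality[OF pos(3) cq perq zq])
    show "0 \<le> 2 * n * B * sqrt E" using B0 E0 by (simp add: n_def)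
    fix \<psi> :: "real ^ 'n \<Rightarrow> real" assume tr: "trig_poly L \<psi>"
    have \<psi>: "C1_field \<psi>" "periodic L \<psi>" by (rule trig_poly_C1[OF tr], rule trig_poly_periodic[OF tr])
    have tp: "trig_poly L (partial_deriv i (partial_deriv j \<psi>))" for i j
      using trig_poly_partial tr by blast
    have g: "L2_periodic L (gradient \<psi>)" by (intro L2_periodic_continuous gradient_continuous periodic_gradient \<psi>)
    have "(LINT x:cell L|lborel. gradient q x \<bullet> gradient \<psi> x)
        = (LINT x:cell L|lborel. gradient pb x \<bullet> gradient \<psi> x) - (LINT x:cell L|lborel. gradient (p t) x \<bullet> gradient \<psi> x)"
      unfolding gq inner_diff_left
      using L2_inner_integrable[OF L2pb g] L2_inner_integrable[OF L2p g] by (simp add: set_integral_diff)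
    also have "(LINT x:cell L|lborel. gradient pb x \<bullet> gradient \<psi> x)
        = (LINT x:cell L|lborel. Rf x \<bullet> gradient \<psi> x - Ra x \<bullet> gradient \<psi> x)"
      by (simp add: R(3) inner_diff_left)
    also have "\<dots> = (LINT x:cell L|lborel. f t x \<bullet> gradient \<psi> x) - (LINT x:cell L|lborel. advection V V x \<bullet> gradient \<psi> x)"
      using L2_inner_integrable[OF L2R(1) g] L2_inner_integrable[OF L2R(2) g]
        leray_complement_test(2)[OF R(1) \<psi>] leray_complement_test(2)[OF R(2) \<psi>]
      by (simp add: set_integral_diff)
    also note exact_pressure_weak[OF t \<psi>]
    finally have grad: "(LINT x:cell L|lborel. gradient q x \<bullet> gradient \<psi> x)
        = (LINT x:cell L|lborel. advection (v t) (v t) x \<bullet> gradient \<psi> x) - (LINT x:cell L|lborel. advection V V x \<bullet> gradient \<psi> x)"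
      by simp
    define A where "A x = (\<chi> i j. v t x $ i * v t x $ j - V x $ i * V x $ j)" for x
    define H where "H x = (\<chi> i j. partial_deriv i (partial_deriv j \<psi>) x)" for x
    have cA: "continuous_on UNIV A"
      unfolding A_def by (intro continuous_on_vec_lambda continuous_intros C1_fieldD(1)[OF VC1] C1_fieldD(1)[OF vC1])
    have cH: "continuous_on UNIV H"
      unfolding H_def by (intro continuous_on_vec_lambda trig_poly_continuous[OF tp])
    note int = set_integrable_cell_continuous
    have "(LINT x:cell L|lborel. q x * scalar_laplacian \<psi> x) = - (LINT x:cell L|lborel. gradient q x \<bullet> gradient \<psi> x)"
      by (rule weak_laplacian_pairing[OF pos(3) cq perq pq L2q tr])
    also have "\<dots> = (LINT x:cell L|lborel. (\<Sum>i\<in>UNIV. \<Sum>j\<in>UNIV. v t x $ i * v t x $ j * partial_deriv i (partial_deriv j \<psi>) x))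
        - (LINT x:cell L|lborel. (\<Sum>i\<in>UNIV. \<Sum>j\<in>UNIV. V x $ i * V x $ j * partial_deriv i (partial_deriv j \<psi>) x))"
      unfolding grad advection_by_parts[OF VC1 V(2) tr] advection_by_parts[OF vC1 velocity_divergence_free[OF tT] tr] by simp
    also have "\<dots> = (LINT x:cell L|lborel. (\<Sum>i\<in>UNIV. \<Sum>j\<in>UNIV. v t x $ i * v t x $ j * partial_deriv i (partial_deriv j \<psi>) x)
        - (\<Sum>i\<in>UNIV. \<Sum>j\<in>UNIV. V x $ i * V x $ j * partial_deriv i (partial_deriv j \<psi>) x))"
      by (rule set_integral_diff(2)[symmetric])
         (intro int continuous_intros C1_fieldD(1)[OF VC1] C1_fieldD(1)[OF vC1] trig_poly_continuous[OF tp])+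
    also have "\<dots> = (LINT x:cell L|lborel. A x \<bullet> H x)"
      by (simp add: A_def H_def inner_vec_def sum_subtractf left_diff_distrib)
    finally have qA: "(LINT x:cell L|lborel. q x * scalar_laplacian \<psi> x) = (LINT x:cell L|lborel. A x \<bullet> H x)" .
    have nA: "(norm (A x))\<^sup>2 \<le> (2 * n * B)\<^sup>2 * (norm (V x - v t x))\<^sup>2" for x
    proof -
      have ij: "(A x $ i $ j)\<^sup>2 \<le> (2 * B * norm (V x - v t x))\<^sup>2" for i j
      proof -
        have b: "\<bar>v t x $ i\<bar> \<le> B" "\<bar>V x $ j\<bar> \<le> B" "\<bar>v t x $ j - V x $ j\<bar> \<le> norm (V x - v t x)" "\<bar>v t x $ i - V x $ i\<bar> \<le> norm (V x - v t x)"
          using order_trans[OF component_le_norm_cart B(2)] order_trans[OF component_le_norm_cart Vb]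
            component_le_norm_cart[of "V x - v t x"] by (auto simp: abs_minus_commute)
        have "A x $ i $ j = v t x $ i * (v t x $ j - V x $ j) + (v t x $ i - V x $ i) * V x $ j"
          by (simp add: A_def algebra_simps)
        also have "\<bar>\<dots>\<bar> \<le> B * norm (V x - v t x) + norm (V x - v t x) * B"
          using b by (intro order_trans[OF abs_triangle_ineq add_mono]) (auto simp: abs_mult intro!: mult_mono B0)
        finally have "\<bar>A x $ i $ j\<bar> \<le> 2 * B * norm (V x - v t x)" by simp
        then have "\<bar>A x $ i $ j\<bar>\<^sup>2 \<le> (2 * B * norm (V x - v t x))\<^sup>2" by (intro power_mono) auto
        then show ?thesis by simp
      qed
      have "(norm (A x))\<^sup>2 = (\<Sum>i\<in>UNIV. \<Sum>j\<in>UNIV. (A x $ i $ j)\<^sup>2)"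
        unfolding power2_norm_eq_inner inner_vec_def by (simp add: power2_eq_square)
      also have "\<dots> \<le> (\<Sum>i\<in>(UNIV :: 'n set). \<Sum>j\<in>(UNIV :: 'n set). (2 * B * norm (V x - v t x))\<^sup>2)"
        by (intro sum_mono ij)
      also have "\<dots> = (2 * n * B)\<^sup>2 * (norm (V x - v t x))\<^sup>2"
        by (simp add: n_def power2_eq_square)
      finally show ?thesis .
    qed
    have "\<bar>LINT x:cell L|lborel. A x \<bullet> H x\<bar>
        \<le> sqrt (LINT x:cell L|lborel. (norm (A x))\<^sup>2) * sqrt (LINT x:cell L|lborel. (norm (H x))\<^sup>2)"
      by (intro cell_cauchy_schwarz int continuous_intros cA cH)
    also have "(LINT x:cell L|lborel. (norm (H x))\<^sup>2) = (LINT x:cell L|lborel. (scalar_laplacian \<psi> x)\<^sup>2)"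
    proof -
      have "(norm (H x))\<^sup>2 = (\<Sum>i\<in>UNIV. \<Sum>j\<in>UNIV. (partial_deriv j (partial_deriv i \<psi>) x)\<^sup>2)" for x
        unfolding power2_norm_eq_inner inner_vec_def H_def
        using trig_poly_partial_commute[OF tr] by (simp add: power2_eq_square)
      then show ?thesis using hessian_eq_laplacian_L2[OF pos(3) tr] by simp
    qed
    also have "sqrt (LINT x:cell L|lborel. (norm (A x))\<^sup>2) \<le> 2 * n * B * sqrt E"
    proof -
      have "(LINT x:cell L|lborel. (norm (A x))\<^sup>2) \<le> (LINT x:cell L|lborel. (2 * n * B)\<^sup>2 * (norm (V x - v t x))\<^sup>2)"
        by (rule set_integral_mono) (intro int continuous_intros cA nA C1_fieldD(1)[OF VC1] C1_fieldD(1)[OF vC1])+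
      also have "\<dots> = (2 * n * B)\<^sup>2 * E" by (simp add: E_def)
      finally have "sqrt (LINT x:cell L|lborel. (norm (A x))\<^sup>2) \<le> sqrt ((2 * n * B)\<^sup>2 * E)" by simp
      also have "\<dots> = 2 * n * B * sqrt E" using B0 by (simp add: real_sqrt_mult n_def)
      finally show ?thesis .
    qed
    finally show "\<bar>LINT x:cell L|lborel. q x * scalar_laplacian \<psi> x\<bar> \<le> 2 * n * B * sqrt E * sqrt (LINT x:cell L|lborel. (scalar_laplacian \<psi> x)\<^sup>2)"
      unfolding qA by (simp add: mult_right_mono set_lebesgue_integral_def integral_nonneg_AE)
  qed
  then show ?thesis by (simp add: q_def[abs_def] n_def E_def)
qed

end

section \<open>From almost sure statements to trajectories\<close>

lemma eq_on_closure:
  fixes F G :: "'a::topological_space \<Rightarrow> 'b::real_normed_vector"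
  assumes "continuous_on (closure D) F" "continuous_on (closure D) G" "\<And>x. x \<in> D \<Longrightarrow> F x = G x" "x \<in> closure D"
  shows "F x = G x"
  using continuous_constant_on_closure[of D "\<lambda>x. F x - G x" 0 x] assms by (auto intro: continuous_on_diff)

lemma integrated_equation_from_dense:
  fixes v F :: "real \<Rightarrow> real ^ 'n::finite \<Rightarrow> real ^ 'n" and g g' :: "'q::finite \<Rightarrow> real \<Rightarrow> real ^ 'n \<Rightarrow> real ^ 'n"
  assumes D1: "D1 \<subseteq> {0..T}" "{0..T} \<subseteq> closure D1" and D2: "closure D2 = UNIV"
    and cv: "continuous_on ({0..T} \<times> UNIV) (\<lambda>(t, x). v t x)" and c0: "continuous_on UNIV \<phi>"
    and cF: "continuous_on ({0..T} \<times> UNIV) (\<lambda>(t, x). F t x)"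
    and cg: "\<And>r. continuous_on ({0..T} \<times> UNIV) (\<lambda>(t, x). g r t x)"
    and cg': "\<And>r. continuous_on ({0..T} \<times> UNIV) (\<lambda>(t, x). g' r t x)"
    and cW: "\<And>r. continuous_on {0..T} (\<lambda>t. W t $ r :: real)"
    and eq: "\<And>t x. t \<in> D1 \<Longrightarrow> x \<in> D2 \<Longrightarrow> v t x = \<phi> x + integral {0..t} (\<lambda>s. F s x)
      + (\<Sum>r\<in>UNIV. W t $ r *\<^sub>R g r t x - integral {0..t} (\<lambda>s. W s $ r *\<^sub>R g' r s x))"
    and t: "t \<in> {0..T}"
  shows "v t x = \<phi> x + integral {0..t} (\<lambda>s. F s x)
      + (\<Sum>r\<in>UNIV. W t $ r *\<^sub>R g r t x - integral {0..t} (\<lambda>s. W s $ r *\<^sub>R g' r s x))"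
proof -
  define Rhs where "Rhs t x = \<phi> x + integral {0..t} (\<lambda>s. F s x)
      + (\<Sum>r\<in>UNIV. W t $ r *\<^sub>R g r t x - integral {0..t} (\<lambda>s. W s $ r *\<^sub>R g' r s x))" for t x
  have cWg: "continuous_on ({0..T} \<times> UNIV) (\<lambda>(s, x). W s $ r *\<^sub>R g' r s x)" for r
  proof -
    have "continuous_on ({0..T} \<times> (UNIV :: (real ^ 'n) set)) (\<lambda>z. W (fst z) $ r)"
      by (rule continuous_on_compose2[OF cW continuous_on_fst[OF continuous_on_id]]) auto
    then show ?thesis using cg'[of r] unfolding split_beta by (intro continuous_on_scaleR)
  qed
  have cx: "continuous_on UNIV (Rhs t)" if "t \<in> {0..T}" for t
  proof -
    have sub: "{0..t} \<times> UNIV \<subseteq> {0..T} \<times> UNIV" using that by auto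
    show ?thesis unfolding Rhs_def
      by (intro continuous_intros c0 continuous_on_time_integral continuous_on_subset[OF cF sub]
          continuous_on_subset[OF cWg sub] continuous_on_slice[OF cg that])
  qed
  have ct: "continuous_on {0..T} (\<lambda>t. Rhs t x)" for x
    unfolding Rhs_def
    by (intro continuous_intros indefinite_integral_continuous_1 integrable_continuous_interval
        continuous_on_time_slice[OF cF order_refl] continuous_on_time_slice[OF cWg order_refl]
        continuous_on_time_slice[OF cg order_refl] cW)
  have 1: "v t x = Rhs t x" if "t \<in> D1" for t x
  proof (rule eq_on_closure[of D2 "v t" "Rhs t"])
    have "t \<in> {0..T}" using that D1 by auto
    then show "continuous_on (closure D2) (v t)" "continuous_on (closure D2) (Rhs t)"
      unfolding D2 using cx continuous_on_slice[OF cv] by auto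
    show "v t y = Rhs t y" if "y \<in> D2" for y unfolding Rhs_def by (rule eq[OF \<open>t \<in> D1\<close> that])
  qed (simp add: D2)
  have cl: "closure D1 = {0..T}"
    using D1 closure_minimal[OF D1(1)] by auto
  have "v t x = Rhs t x"
  proof (rule eq_on_closure[of D1 "\<lambda>t. v t x" "\<lambda>t. Rhs t x"])
    show "continuous_on (closure D1) (\<lambda>t. v t x)" "continuous_on (closure D1) (\<lambda>t. Rhs t x)"
      unfolding cl using ct continuous_on_time_slice[OF cv order_refl] by auto
  qed (use 1 t cl in auto)
  then show ?thesis by (simp add: Rhs_def)
qed

text \<open>For fixed \<open>(t, x)\<close> the Ito integrals are replaced by pathwise expressions outside a null set; the
  union of these null sets over a countable dense set is null, and continuity does the rest.\<close>

lemma snse_integrated_equation: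
  fixes w :: "real \<Rightarrow> 'w \<Rightarrow> real ^ 'q::finite" and f :: "real \<Rightarrow> real ^ 'n::finite \<Rightarrow> real ^ 'n"
  assumes P: "prob_space M" and W: "wiener_process M w" and T: "0 < T"
    and f: "spacetime_smooth 3 T f" and \<gamma>: "\<And>r. spacetime_smooth 3 T (\<gamma> r)"
    and sol: "snse_classical_solution M w \<sigma> T L f \<gamma> \<phi> v p"
    and smooth: "AE \<omega> in M. space_smooth 4 T (\<lambda>t x. v t x \<omega>) \<and> space_smooth 3 T (\<lambda>t x. p t x \<omega>)"
  shows "AE \<omega> in M. \<forall>t\<in>{0..T}. \<forall>x. v t x \<omega> = \<phi> x
     + integral {0..t} (\<lambda>s. snse_drift \<sigma> f (\<lambda>t x. v t x \<omega>) (\<lambda>t x. p t x \<omega>) s x)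
     + (\<Sum>r\<in>UNIV. w t \<omega> $ r *\<^sub>R \<gamma> r t x - integral {0..t} (\<lambda>s. w s \<omega> $ r *\<^sub>R time_deriv T (\<gamma> r) s x))"
proof -
  note \<gamma>s = spacetime_smooth_space[OF \<gamma>]
  have c: "continuous_on {0..T} (\<lambda>s. time_deriv T (\<gamma> r) s x)" for r x
    by (rule smooth_imp_continuous_time[OF \<gamma>s(2)])
  have pt: "AE \<omega> in M. v t x \<omega> = \<phi> x
     + integral {0..t} (\<lambda>s. snse_drift \<sigma> f (\<lambda>t x. v t x \<omega>) (\<lambda>t x. p t x \<omega>) s x)
     + (\<Sum>r\<in>UNIV. w t \<omega> $ r *\<^sub>R \<gamma> r t x - integral {0..t} (\<lambda>s. w s \<omega> $ r *\<^sub>R time_deriv T (\<gamma> r) s x))"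
    if t: "t \<in> {0..T}" for t x
  proof -
    obtain J where J: "\<And>r. has_ito_integral M (generated_filtration M w) (\<lambda>s \<omega>. w s \<omega> $ r) t (\<lambda>s \<omega>. \<gamma> r s x) (J r)"
      and eq: "AE \<omega> in M. v t x \<omega> = \<phi> x
           + integral {0..t} (\<lambda>s. (\<sigma>\<^sup>2 / 2) *\<^sub>R laplacian (\<lambda>y. v s y \<omega>) x
                                   - advection (\<lambda>y. v s y \<omega>) (\<lambda>y. v s y \<omega>) x
                                   - gradient (\<lambda>y. p s y \<omega>) x + f s x) + (\<Sum>r\<in>UNIV. J r \<omega>)"
      using sol t unfolding snse_classical_solution_def by meson
    have "AE \<omega> in M. J r \<omega> = (w t \<omega> $ r) *\<^sub>R \<gamma> r t x - integral {0..t} (\<lambda>s. (w s \<omega> $ r) *\<^sub>R time_deriv T (\<gamma> r) s x)" for r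
    proof (rule wiener_integral_by_parts[OF P W _ _ _ J])
      show "0 \<le> t" using t by simp
      show "continuous_on {0..t} (\<lambda>s. time_deriv T (\<gamma> r) s x)" using t by (intro continuous_on_subset[OF c]) auto
      fix s assume s: "s \<in> {0..t}"
      then have "s \<in> {0..T}" using t by auto
      from has_vector_derivative_within_subset[OF has_time_deriv[OF \<gamma> this], of "{0..t}"] t
      show "((\<lambda>s. \<gamma> r s x) has_vector_derivative time_deriv T (\<gamma> r) s x) (at s within {0..t})" by auto
    qed
    then have "AE \<omega> in M. \<forall>r\<in>UNIV. J r \<omega> = (w t \<omega> $ r) *\<^sub>R \<gamma> r t x - integral {0..t} (\<lambda>s. (w s \<omega> $ r) *\<^sub>R time_deriv T (\<gamma> r) s x)"
      by (intro AE_finite_allI) auto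
    with eq show ?thesis by eventually_elim (simp add: snse_drift_def)
  qed
  obtain D1 :: "real set" where D1: "countable D1" "D1 \<subseteq> {0..T}" "{0..T} \<subseteq> closure D1"
    by (rule separable)
  obtain D2 :: "(real ^ 'n) set" where "countable D2" "D2 \<subseteq> UNIV" "UNIV \<subseteq> closure D2"
    by (rule separable)
  then have D2: "countable D2" "closure D2 = UNIV" by auto
  have "AE \<omega> in M. \<forall>z\<in>D1 \<times> D2. v (fst z) (snd z) \<omega> = \<phi> (snd z)
     + integral {0..fst z} (\<lambda>s. snse_drift \<sigma> f (\<lambda>t x. v t x \<omega>) (\<lambda>t x. p t x \<omega>) s (snd z))
     + (\<Sum>r\<in>UNIV. w (fst z) \<omega> $ r *\<^sub>R \<gamma> r (fst z) (snd z) - integral {0..fst z} (\<lambda>s. w s \<omega> $ r *\<^sub>R time_deriv T (\<gamma> r) s (snd z)))"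
  proof (rule AE_ball_countable')
    fix z assume "z \<in> D1 \<times> D2"
    then have "fst z \<in> {0..T}" using D1(2) by auto
    then show "AE \<omega> in M. v (fst z) (snd z) \<omega> = \<phi> (snd z)
     + integral {0..fst z} (\<lambda>s. snse_drift \<sigma> f (\<lambda>t x. v t x \<omega>) (\<lambda>t x. p t x \<omega>) s (snd z))
     + (\<Sum>r\<in>UNIV. w (fst z) \<omega> $ r *\<^sub>R \<gamma> r (fst z) (snd z) - integral {0..fst z} (\<lambda>s. w s \<omega> $ r *\<^sub>R time_deriv T (\<gamma> r) s (snd z)))"
      by (rule pt)
  qed (use D1 D2 in auto)
  moreover have "AE \<omega> in M. continuous_on {0..} (\<lambda>t. w t \<omega>)" using W by (simp add: wiener_process_def)
  moreover have "AE \<omega> in M. \<forall>x. v 0 x \<omega> = \<phi> x" using sol by (simp add: snse_classical_solution_def)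
  ultimately show ?thesis
    using smooth
  proof eventually_elim
    case (elim \<omega>)
    then have sm: "space_smooth 4 T (\<lambda>t x. v t x \<omega>)" "space_smooth 3 T (\<lambda>t x. p t x \<omega>)" by auto
    have cv: "continuous_on ({0..T} \<times> UNIV) (\<lambda>(t, x). v t x \<omega>)"
      using space_smooth_continuous[OF sm(1), of "[]"] by simp
    have "\<phi> = (\<lambda>x. v 0 x \<omega>)" using elim(3) by auto
    then have c0: "continuous_on UNIV \<phi>" using continuous_on_slice[OF cv, of 0] T by simp
    have cF: "continuous_on ({0..T} \<times> UNIV) (\<lambda>(t, x). snse_drift \<sigma> f (\<lambda>t x. v t x \<omega>) (\<lambda>t x. p t x \<omega>) t x)"
      using space_smooth_continuous[OF snse_drift_smooth[OF sm spacetime_smooth_space(1)[OF f]], of "[]"] by simp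
    have cg: "continuous_on ({0..T} \<times> UNIV) (\<lambda>(t, x). \<gamma> r t x)"
      "continuous_on ({0..T} \<times> UNIV) (\<lambda>(t, x). time_deriv T (\<gamma> r) t x)" for r
      using space_smooth_continuous[OF \<gamma>s(1), of "[]" r] space_smooth_continuous[OF \<gamma>s(2), of "[]" r] by simp_all
    have cW: "continuous_on {0..T} (\<lambda>t. w t \<omega> $ r)" for r
      by (intro continuous_intros continuous_on_subset[OF elim(2)]) auto
    show ?case
    proof (intro ballI allI)
      fix t x assume t: "t \<in> {0..T}"
      show "v t x \<omega> = \<phi> x
     + integral {0..t} (\<lambda>s. snse_drift \<sigma> f (\<lambda>t x. v t x \<omega>) (\<lambda>t x. p t x \<omega>) s x)
     + (\<Sum>r\<in>UNIV. w t \<omega> $ r *\<^sub>R \<gamma> r t x - integral {0..t} (\<lambda>s. w s \<omega> $ r *\<^sub>R time_deriv T (\<gamma> r) s x))"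
      proof (rule integrated_equation_from_dense[where W="\<lambda>t. w t \<omega>" and v="\<lambda>t x. v t x \<omega>", OF D1(2,3) D2(2) cv c0 cF cg cW _ t])
        fix t x assume "t \<in> D1" "x \<in> D2"
        then show "v t x \<omega> = \<phi> x
     + integral {0..t} (\<lambda>s. snse_drift \<sigma> f (\<lambda>t x. v t x \<omega>) (\<lambda>t x. p t x \<omega>) s x)
     + (\<Sum>r\<in>UNIV. w t \<omega> $ r *\<^sub>R \<gamma> r t x - integral {0..t} (\<lambda>s. w s \<omega> $ r *\<^sub>R time_deriv T (\<gamma> r) s x))"
          using bspec[OF elim(1), of "(t, x)"] by simp
      qed
    qed
  qed
qed

section \<open>Convergence of the pressure\<close>

text \<open>The constant combines the Gronwall constant of the velocity error with a common bound \<open>B\<close> of both velocities; both are fixed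
  by the trajectory and uniform in the step.\<close>

lemma (in pathwise_snse) pressure_convergence:
  assumes C0: "0 \<le> C0" and zm: "\<And>t. t \<in> {0..T} \<Longrightarrow> zero_mean L (p t)"
    and bounds: "\<And>N k. 1 \<le> N \<Longrightarrow> k \<le> N \<Longrightarrow> layer_bounds C0 (V N k)"
    and scheme: "\<And>N. 1 \<le> N \<Longrightarrow> layer_method \<sigma> L f \<gamma> \<phi> W N (T / real N) (V N)"
    and pressure: "\<And>N k. 1 \<le> N \<Longrightarrow> k \<in> {1..N} \<Longrightarrow> layer_pressure L (f (real k * (T / real N))) (V N k) (pb N k)"
  shows "\<exists>C\<ge>0. \<forall>N\<ge>1. \<forall>k\<in>{1..N}.
    L2_cell_norm L (\<lambda>x. pb N k x - p (real k * (T / real N)) x) \<le> C * (T / real N) powr (1/3)"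
proof -
  obtain C where C: "0 \<le> C" "\<And>N k. N \<ge> 1 \<Longrightarrow> k \<le> N \<Longrightarrow> L2_divergence_free L (V N k)"
    "\<And>N k. N \<ge> 1 \<Longrightarrow> k \<le> N \<Longrightarrow>
      (LINT x:cell L|lborel. (norm (V N k x - v (real k * (T / real N)) x))\<^sup>2) \<le> C * ((T / real N) powr (1/3))\<^sup>2"
    using velocity_error[OF C0 bounds scheme] by blast
  obtain Bv where Bv: "0 \<le> Bv" "\<And>ds t x. length ds \<le> 4 \<Longrightarrow> t \<in> {0..T} \<Longrightarrow> norm (partials ds (v t) x) \<le> Bv"
    using velocity_bounds by blast
  define B where "B = Bv + C0"
  have B: "0 \<le> B" "C0 \<le> B" using Bv C0 by (auto simp: B_def)
  show ?thesis
  proof (intro exI[of _ "2 * real CARD('n) * B * sqrt C"] conjI allI impI ballI)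
    show "0 \<le> 2 * real CARD('n) * B * sqrt C" using B C by simp
    fix N k :: nat assume N: "1 \<le> N" and k: "k \<in> {1..N}"
    define t where "t = real k * (T / real N)"
    have t: "0 < t" "t \<le> T"
    proof -
      show "0 < t" unfolding t_def using k N pos by simp
      have "real k * T \<le> real N * T" using k pos by (intro mult_right_mono) auto
      then show "t \<le> T" unfolding t_def using N by (simp add: field_simps)
    qed
    have "L2_cell_norm L (\<lambda>x. pb N k x - p t x) \<le> 2 * real CARD('n) * B * sqrt (LINT x:cell L|lborel. (norm (V N k x - v t x))\<^sup>2)"
    proof (rule pressure_error[OF t zm _ bounds[OF N] _ B(2)])
      show "norm (v t x) \<le> B" for x using Bv(2)[of "[]" t x] t C0 by (simp add: B_def)
    qed (use t k N pressure[OF N k] C(2)[OF N] in \<open>auto simp: t_def\<close>)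
    also have "\<dots> \<le> 2 * real CARD('n) * B * (sqrt C * (T / real N) powr (1/3))"
    proof (intro mult_left_mono)
      have "sqrt (LINT x:cell L|lborel. (norm (V N k x - v t x))\<^sup>2) \<le> sqrt (C * ((T / real N) powr (1/3))\<^sup>2)"
        using C(3)[OF N, of k] k by (simp add: t_def)
      then show "sqrt (LINT x:cell L|lborel. (norm (V N k x - v t x))\<^sup>2) \<le> sqrt C * (T / real N) powr (1/3)"
        by (simp add: real_sqrt_mult)
    qed (use B in auto)
    finally show "L2_cell_norm L (\<lambda>x. pb N k x - p (real k * (T / real N)) x)
        \<le> 2 * real CARD('n) * B * sqrt C * (T / real N) powr (1/3)"
      by (simp add: t_def mult.assoc)
  qed
qed

theorem proposition4p1:
  shows "\<exists>K::nat. \<forall>(M :: 'w measure) (w :: real \<Rightarrow> 'w \<Rightarrow> real ^ 'q::finite) (\<sigma>::real) (T::real) (L::real)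
      (f :: real \<Rightarrow> real ^ 'n::finite \<Rightarrow> real ^ 'n)
      (\<gamma> :: 'q \<Rightarrow> real \<Rightarrow> real ^ 'n \<Rightarrow> real ^ 'n)
      (\<phi> :: real ^ 'n \<Rightarrow> real ^ 'n)
      (v :: real \<Rightarrow> real ^ 'n \<Rightarrow> 'w \<Rightarrow> real ^ 'n)
      (p :: real \<Rightarrow> real ^ 'n \<Rightarrow> 'w \<Rightarrow> real)
      (vbar :: nat \<Rightarrow> nat \<Rightarrow> real ^ 'n \<Rightarrow> 'w \<Rightarrow> real ^ 'n)
      (pbar :: nat \<Rightarrow> nat \<Rightarrow> real ^ 'n \<Rightarrow> 'w \<Rightarrow> real).
    prob_space M \<and> wiener_process M w \<and>
    0 < \<sigma> \<and> 0 < T \<and> 0 < L \<and>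
    spacetime_smooth K T f \<and> (\<forall>t\<in>{0..T}. periodic L (f t)) \<and>
    (\<forall>r. spacetime_smooth K T (\<gamma> r) \<and>
         (\<forall>t\<in>{0..T}. periodic L (\<gamma> r t) \<and> (\<forall>x. divergence (\<gamma> r t) x = 0))) \<and>
    periodic L \<phi> \<and>
    snse_classical_solution M w \<sigma> T L f \<gamma> \<phi> v p \<and>
    snse_unique M w \<sigma> T L f \<gamma> \<phi> v p \<and>
    (AE \<omega> in M. space_smooth 4 T (\<lambda>t x. v t x \<omega>) \<and> space_smooth 3 T (\<lambda>t x. p t x \<omega>)) \<and>
    bounded_moments M T 4 v \<and> bounded_moments M T 3 p \<and>
    (AE \<omega> in M. \<forall>N\<ge>1.
       layer_method \<sigma> L f \<gamma> \<phi> (\<lambda>t. w t \<omega>) N (T / real N) (\<lambda>k x. vbar N k x \<omega>) \<and>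
       (\<forall>k\<in>{1..N}. layer_pressure L (f (real k * (T / real N)))
                     (\<lambda>x. vbar N k x \<omega>) (\<lambda>x. pbar N k x \<omega>))) \<and>
    (AE \<omega> in M. \<exists>C\<^sub>0>0. \<forall>N\<ge>1. \<forall>k\<le>N. layer_bounds C\<^sub>0 (\<lambda>x. vbar N k x \<omega>))
    \<longrightarrow>
    (AE \<omega> in M. \<forall>\<epsilon>. 0 < \<epsilon> \<and> \<epsilon> < 1/3 \<longrightarrow>
       (\<exists>C>0. \<forall>N\<ge>1. \<forall>k\<in>{1..N}.
          L2_cell_norm L (\<lambda>x. pbar N k x \<omega> - p (real k * (T / real N)) x \<omega>)
            \<le> C * (T / real N) powr (1/3 - \<epsilon>)))"
proof (rule exI[of _ 3], intro allI impI, elim conjE)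
  fix M :: "'w measure" and w :: "real \<Rightarrow> 'w \<Rightarrow> real ^ 'q::finite" and \<sigma> T L :: real
    and f :: "real \<Rightarrow> real ^ 'n::finite \<Rightarrow> real ^ 'n" and \<gamma> :: "'q \<Rightarrow> real \<Rightarrow> real ^ 'n \<Rightarrow> real ^ 'n"
    and \<phi> :: "real ^ 'n \<Rightarrow> real ^ 'n"
    and v :: "real \<Rightarrow> real ^ 'n \<Rightarrow> 'w \<Rightarrow> real ^ 'n" and p :: "real \<Rightarrow> real ^ 'n \<Rightarrow> 'w \<Rightarrow> real"
    and vbar :: "nat \<Rightarrow> nat \<Rightarrow> real ^ 'n \<Rightarrow> 'w \<Rightarrow> real ^ 'n" and pbar :: "nat \<Rightarrow> nat \<Rightarrow> real ^ 'n \<Rightarrow> 'w \<Rightarrow> real"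
  assume P: "prob_space M" and W: "wiener_process M w" and pos: "0 < \<sigma>" "0 < T" "0 < L"
    and f: "spacetime_smooth 3 T f" "\<forall>t\<in>{0..T}. periodic L (f t)"
    and \<gamma>: "\<forall>r. spacetime_smooth 3 T (\<gamma> r) \<and> (\<forall>t\<in>{0..T}. periodic L (\<gamma> r t) \<and> (\<forall>x. divergence (\<gamma> r t) x = 0))"
    and sol: "snse_classical_solution M w \<sigma> T L f \<gamma> \<phi> v p"
    and smooth: "AE \<omega> in M. space_smooth 4 T (\<lambda>t x. v t x \<omega>) \<and> space_smooth 3 T (\<lambda>t x. p t x \<omega>)"
    and scheme: "AE \<omega> in M. \<forall>N\<ge>1.
       layer_method \<sigma> L f \<gamma> \<phi> (\<lambda>t. w t \<omega>) N (T / real N) (\<lambda>k x. vbar N k x \<omega>) \<and>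
       (\<forall>k\<in>{1..N}. layer_pressure L (f (real k * (T / real N))) (\<lambda>x. vbar N k x \<omega>) (\<lambda>x. pbar N k x \<omega>))"
    and bounds: "AE \<omega> in M. \<exists>C\<^sub>0>0. \<forall>N\<ge>1. \<forall>k\<le>N. layer_bounds C\<^sub>0 (\<lambda>x. vbar N k x \<omega>)"
  have \<gamma>s: "\<And>r. spacetime_smooth 3 T (\<gamma> r)" using \<gamma> by blast
  have per: "AE \<omega> in M. \<forall>t\<in>{0..T}. periodic L (\<lambda>x. v t x \<omega>) \<and> periodic L (\<lambda>x. p t x \<omega>) \<and> zero_mean L (\<lambda>x. p t x \<omega>)"
    and div: "AE \<omega> in M. \<forall>t\<in>{0..T}. \<forall>x. divergence (\<lambda>y. v t y \<omega>) x = 0"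
    and init: "AE \<omega> in M. \<forall>x. v 0 x \<omega> = \<phi> x"
    using sol by (auto simp: snse_classical_solution_def)
  have cont: "AE \<omega> in M. continuous_on {0..} (\<lambda>t. w t \<omega>)" using W by (simp add: wiener_process_def)
  show "AE \<omega> in M. \<forall>\<epsilon>. 0 < \<epsilon> \<and> \<epsilon> < 1/3 \<longrightarrow>
       (\<exists>C>0. \<forall>N\<ge>1. \<forall>k\<in>{1..N}.
          L2_cell_norm L (\<lambda>x. pbar N k x \<omega> - p (real k * (T / real N)) x \<omega>) \<le> C * (T / real N) powr (1/3 - \<epsilon>))"
    using snse_integrated_equation[OF P W pos(2) f(1) \<gamma>s sol smooth] wiener_hoelder[OF W pos(2)]
      per div init cont smooth scheme bounds
  proof eventually_elim
    case (elim \<omega>)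
    obtain CW where CW: "0 \<le> CW" "\<And>r s t. 0 \<le> s \<Longrightarrow> s \<le> t \<Longrightarrow> t \<le> T \<Longrightarrow> \<bar>w t \<omega> $ r - w s \<omega> $ r\<bar> \<le> CW * (t - s) powr (1/3)"
      using elim(2) by blast
    obtain C0 where C0: "0 < C0" "\<And>N k. N \<ge> 1 \<Longrightarrow> k \<le> N \<Longrightarrow> layer_bounds C0 (\<lambda>x. vbar N k x \<omega>)"
      using elim(9) by blast
    interpret pathwise_snse \<sigma> T L CW f \<gamma> \<phi> "\<lambda>t x. v t x \<omega>" "\<lambda>t x. p t x \<omega>" "\<lambda>t. w t \<omega>"
    proof
      show "continuous_on {0..T} (\<lambda>t. w t \<omega> $ r)" for r
        by (intro continuous_intros continuous_on_subset[OF elim(6)]) auto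
      show "(\<lambda>x. v 0 x \<omega>) = \<phi>" using elim(5) by auto
      show "v t x \<omega> = \<phi> x + integral {0..t} (\<lambda>s. snse_drift \<sigma> f (\<lambda>t x. v t x \<omega>) (\<lambda>t x. p t x \<omega>) s x)
        + (\<Sum>r\<in>UNIV. w t \<omega> $ r *\<^sub>R \<gamma> r t x - integral {0..t} (\<lambda>s. w s \<omega> $ r *\<^sub>R time_deriv T (\<gamma> r) s x))"
        if "t \<in> {0..T}" for t x
        using elim(1) that by blast
    qed (use pos f \<gamma> CW elim in auto)
    obtain C where C: "0 \<le> C" "\<And>N k. N \<ge> 1 \<Longrightarrow> k \<in> {1..N} \<Longrightarrow>
        L2_cell_norm L (\<lambda>x. pbar N k x \<omega> - p (real k * (T / real N)) x \<omega>) \<le> C * (T / real N) powr (1/3)"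
    proof -
      have "\<exists>C\<ge>0. \<forall>N\<ge>1. \<forall>k\<in>{1..N}.
        L2_cell_norm L (\<lambda>x. pbar N k x \<omega> - p (real k * (T / real N)) x \<omega>) \<le> C * (T / real N) powr (1/3)"
        using elim(3,8) C0
        by (intro pressure_convergence[of C0 "\<lambda>N k x. vbar N k x \<omega>" "\<lambda>N k x. pbar N k x \<omega>"]) auto
      then show ?thesis using that by blast
    qed
    show ?case
    proof (intro allI impI)
      fix \<epsilon> :: real assume \<epsilon>: "0 < \<epsilon> \<and> \<epsilon> < 1/3"
      show "\<exists>C>0. \<forall>N\<ge>1. \<forall>k\<in>{1..N}.
          L2_cell_norm L (\<lambda>x. pbar N k x \<omega> - p (real k * (T / real N)) x \<omega>) \<le> C * (T / real N) powr (1/3 - \<epsilon>)"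
      proof (intro exI[of _ "C * T powr \<epsilon> + 1"] conjI allI impI ballI)
        show "0 < C * T powr \<epsilon> + 1" using C(1) by (simp add: add_nonneg_pos)
        fix N k :: nat assume N: "1 \<le> N" and k: "k \<in> {1..N}"
        \<comment> \<open>one factor \<open>h powr \<epsilon>\<close> is traded for \<open>T powr \<epsilon>\<close>\<close>
        define h where "h = T / real N"
        have h: "0 < h" "h \<le> T" using N pos by (auto simp: h_def field_simps)
        have "L2_cell_norm L (\<lambda>x. pbar N k x \<omega> - p (real k * (T / real N)) x \<omega>) \<le> C * h powr (1/3)"
          unfolding h_def by (rule C(2)[OF N k])
        also have "h powr (1/3) = h powr \<epsilon> * h powr (1/3 - \<epsilon>)" using h by (simp flip: powr_add)
        also have "\<dots> \<le> T powr \<epsilon> * h powr (1/3 - \<epsilon>)" using h \<epsilon> by (intro mult_right_mono powr_mono2) auto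
        then have "C * (h powr \<epsilon> * h powr (1/3 - \<epsilon>)) \<le> C * T powr \<epsilon> * h powr (1/3 - \<epsilon>)"
          using C(1) by (simp add: mult_left_mono mult.assoc)
        also have "\<dots> \<le> (C * T powr \<epsilon> + 1) * h powr (1/3 - \<epsilon>)" by (intro mult_right_mono) auto
        finally show "L2_cell_norm L (\<lambda>x. pbar N k x \<omega> - p (real k * (T / real N)) x \<omega>)
            \<le> (C * T powr \<epsilon> + 1) * (T / real N) powr (1/3 - \<epsilon>)" by (simp add: h_def)
      qed
    qed
  qed
qed

end
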